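(* Let $E: M\to N$ be a strongly PP (i.e. strongly finite-index) conditional expectation of a von Neumann algebra $M$ onto a $W^*$-subalgebra $N\subseteq M$, and let $\mathcal{P}$ be a $Z$-completely ideal property of $W^*$-algebras that descends along strongly PP conditional expectations. Then the central decompositions $$z_{N,\mathcal{P}}+z_{N,\mathcal{P}'_Z}=1=z_{M,\mathcal{P}}+z_{M,\mathcal{P}'_Z}$$ coincide, i.e. $z_{N,\mathcal{P}}=z_{M,\mathcal{P}}$ and $z_{N,\mathcal{P}'_Z}=z_{M,\mathcal{P}'_Z}$ as elements of $M$.
   Context: Conditional expectations: a conditional expectation $E: M\to N$ onto a $W^*$-subalgebra $N\subseteq M$ is a $\sigma$-weakly continuous norm-one idempotent linear map of $M$ onto $N$. It is PP (Pimsner–Popa; also called of finite index) if there is $\lambda>0$ such that $E-\lambda\,\mathrm{id}$ is completely positive, i.e. $(E\otimes\mathrm{id}_{M_n})(x^*x)\ge\lambda x^*x$ for all $n\in\mathbb{Z}_{>0}$ and all $x\in M\otimes M_n$. It is strongly PP (strongly of finite index) if furthermore $M$, regarded as an $M$-$N$-correspondence via the $N$-valued inner product $\langle x\mid y\rangle=E(x^*y)$, has a finite orthonormal basis: there are $x_1,\dots,x_s\in M$ such that $E(x_i^*x_j)=0$ for $i\ne j$, each $E(x_i^*x_i)$ is a projection in $N$, and $x=\sum_{i=1}^s x_iE(x_i^*x)$ for all $x\in M$. Properties: a $W^*$-algebra property $\mathcal{P}$ is an isomorphism-invariant property of von Neumann algebras. A projection $p\in N$ is said to have (or be) $\mathcal{P}$,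 or to be a $\mathcal{P}$-projection, if the von Neumann algebra $pNp$ has $\mathcal{P}$. The property $\mathcal{P}$ is ideal if for every von Neumann algebra $N$ the set of $\mathcal{P}$-projections is an ideal in the lattice of projections of $N$: it is closed under (finite) suprema and is a down-set (if $p$ has $\mathcal{P}$ and $q\le p$ is a projection, then $q$ has $\mathcal{P}$; in particular $0$ has $\mathcal{P}$). $\mathcal{P}$ is $Z$-completely (or centrally completely) ideal if it is ideal and, for every $N$, the set of $\mathcal{P}$-projections is closed under arbitrary centrally orthogonal sums, i.e. sums of families of projections whose central supports in $N$ are mutually orthogonal. For $Z$-completely ideal $\mathcal{P}$, $z_{N,\mathcal{P}}$ denotes the largest central $\mathcal{P}$-projection in $N$ (it exists). The $Z$-strong negation $\mathcal{P}'_Z$ of $\mathcal{P}$ is the property defined by: $N$ has $\mathcal{P}'_Z$ if and only if $N$ has no non-zero central $\mathcal{P}$-projections. Then $z_{N,\mathcal{P}'_Z}:=1-z_{N,\mathcal{P}}$, which is the largest $\mathcal{P}'_Z$-projection in $N$. The same notation applies to $M$. $\mathcal{P}$ descends along strongly PP conditional expectations if, whenever $F: A\to B$ is a strongly PP conditional expectation of a von Neumann algebra onto a $W^*$-subalgebra and $A$ has $\mathcal{P}$, then $B$ has $\mathcal{P}$. *)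

theory Defs
  imports "HOL-Analysis.Analysis"
begin

section \<open>Complex Hilbert spaces\<close>

text \<open>
  HOL-Analysis has real inner product spaces only.  The complex inner product is conjugate-linear in
  the first argument, and its real part is the inner product of the class \<open>real_inner\<close>, so that norm
  and topology are the library's.
\<close>

class complex_hilbert_space = real_inner + complete_space +
  fixes scaleC :: "complex \<Rightarrow> 'a \<Rightarrow> 'a" (infixr "*\<^sub>C" 75)
    and cinner :: "'a \<Rightarrow> 'a \<Rightarrow> complex"
  assumes scaleC_add_right: "c *\<^sub>C (x + y) = c *\<^sub>C x + c *\<^sub>C y"
    and scaleC_add_left: "(c + d) *\<^sub>C x = c *\<^sub>C x + d *\<^sub>C x"
    and scaleC_scaleC: "c *\<^sub>C d *\<^sub>C x = (c * d) *\<^sub>C x"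
    and scaleC_of_real: "complex_of_real r *\<^sub>C x = r *\<^sub>R x"
    and cinner_commute: "cinner x y = cnj (cinner y x)"
    and cinner_add_right: "cinner x (y + z) = cinner x y + cinner x z"
    and cinner_scaleC_right: "cinner x (c *\<^sub>C y) = c * cinner x y"
    and inner_eq_Re_cinner: "inner x y = Re (cinner x y)"

lemma cinner_scaleC_left: "cinner (c *\<^sub>C x) y = cnj c * cinner x (y::'a::complex_hilbert_space)"
  by (metis cinner_commute cinner_scaleC_right complex_cnj_mult)

lemma cinner_add_left: "cinner (x + z) y = cinner x y + cinner z (y::'a::complex_hilbert_space)"
  by (metis cinner_commute cinner_add_right complex_cnj_add)

lemma norm_scaleC: "norm (c *\<^sub>C x) = cmod c * norm (x::'a::complex_hilbert_space)"
proof -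
  have "cinner x x = complex_of_real (Re (cinner x x))"
    using cinner_commute[of x x] by (simp add: complex_eq_iff)
  then have x: "cinner x x = complex_of_real ((norm x)\<^sup>2)"
    by (simp add: power2_norm_eq_inner inner_eq_Re_cinner)
  have "(norm (c *\<^sub>C x))\<^sup>2 = Re (c * cnj c * cinner x x)"
    by (simp add: power2_norm_eq_inner inner_eq_Re_cinner cinner_scaleC_left cinner_scaleC_right ac_simps)
  also have "\<dots> = (cmod c * norm x)\<^sup>2"
    unfolding x complex_norm_square[symmetric] by (simp add: power_mult_distrib flip: of_real_mult)
  finally show ?thesis
    by (simp add: power2_eq_iff_nonneg)
qed

lemma bounded_linear_scaleC: "bounded_linear (\<lambda>x::'a::complex_hilbert_space. c *\<^sub>C x)"
proof (rule bounded_linear_intro[where K = "cmod c"])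
  show "c *\<^sub>C r *\<^sub>R x = r *\<^sub>R c *\<^sub>C x" for r and x :: 'a
    by (metis scaleC_of_real scaleC_scaleC mult.commute)
qed (simp_all add: scaleC_add_right norm_scaleC mult.commute)

lemma cinner_eqI:
  fixes x y :: "'a::complex_hilbert_space"
  assumes "\<And>z. inner x z = inner y z"
  shows "x = y"
  using assms by (metis inner_eq_zero_iff inner_diff_left right_minus_eq)

text \<open>The two halves of the complex inner product are determined by the real one.\<close>

lemma cinner_eq_inner: "cinner x y = Complex (inner x y) (- inner x (\<i> *\<^sub>C (y::'a::complex_hilbert_space)))"
  by (simp add: complex_eq_iff inner_eq_Re_cinner cinner_scaleC_right)


section \<open>Bounded operators\<close>

type_synonym 'h operator = "'h \<Rightarrow>\<^sub>L 'h"

text \<open>The type \<open>'h \<Rightarrow>\<^sub>L 'h\<close> consists of the real-linear bounded maps; \<open>bounded_operators\<close> is \<open>B(H)\<close>.\<close>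

definition bounded_operators :: "'h::complex_hilbert_space operator set" where
  "bounded_operators = {T. \<forall>c x. blinfun_apply T (c *\<^sub>C x) = c *\<^sub>C blinfun_apply T x}"

definition op_scale :: "complex \<Rightarrow> 'h::complex_hilbert_space operator \<Rightarrow> 'h operator" where
  "op_scale c T = Blinfun (\<lambda>x. c *\<^sub>C blinfun_apply T x)"

lemma op_scale_apply [simp]: "blinfun_apply (op_scale c T) x = c *\<^sub>C blinfun_apply T x"
  unfolding op_scale_def
  by (subst bounded_linear_Blinfun_apply)
     (auto intro: bounded_linear_compose[OF bounded_linear_scaleC] blinfun.bounded_linear_right)

definition adj :: "'h::complex_hilbert_space operator \<Rightarrow> 'h operator" where
  "adj T = (THE S. \<forall>x y. cinner (blinfun_apply S x) y = cinner x (blinfun_apply T y))"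

lemma riesz:
  fixes f :: "'h::complex_hilbert_space \<Rightarrow> real"
  assumes "bounded_linear f"
  shows "\<exists>y. \<forall>x. f x = inner y x"
proof -
  interpret f: bounded_linear f by fact
  obtain K where K: "\<And>x. norm (f x) \<le> norm x * K" using f.bounded by blast
  define J where "J x = (norm x)\<^sup>2 - 2 * f x" for x
  have lb: "J x \<ge> - K\<^sup>2" for x
  proof -
    have "f x \<le> norm x * K" using K[of x] by auto
    moreover have "(norm x - K)\<^sup>2 \<ge> 0" by simp
    ultimately show ?thesis unfolding J_def by (simp add: power2_eq_square algebra_simps)
  qed
  define c where "c = Inf (range J)"
  have bdd: "bdd_below (range J)" using lb by (auto intro!: bdd_belowI)
  have c_le: "c \<le> J x" for x unfolding c_def by (rule cInf_lower) (use bdd in auto)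
  have "\<exists>x. J x < c + inverse (real (Suc n))" for n
    using cInf_lessD[of "range J" "c + inverse (real (Suc n))"] unfolding c_def[symmetric] by auto
  then obtain X where X: "\<And>n. J (X n) < c + inverse (real (Suc n))" by metis
  have para: "(norm (x - y))\<^sup>2 \<le> 2 * J x + 2 * J y - 4 * c" for x y
  proof -
    have "(norm (x - y))\<^sup>2 = 2 * J x + 2 * J y - 4 * J ((1/2) *\<^sub>R (x + y))"
      unfolding J_def
      by (simp add: f.add f.scaleR power2_norm_eq_inner inner_add_left inner_add_right
          inner_diff_left inner_diff_right inner_commute[of y x] algebra_simps)
    then show ?thesis using c_le[of "(1/2) *\<^sub>R (x + y)"] by linarith
  qed
  have "Cauchy X"
  proof (rule metric_CauchyI)
    fix e :: real assume e: "e > 0"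
    obtain n0 where n0: "inverse (real (Suc n0)) < e\<^sup>2 / 4"
      using reals_Archimedean[of "e\<^sup>2 / 4"] e by auto
    have "dist (X m) (X n) < e" if "m \<ge> n0" "n \<ge> n0" for m n
    proof -
      have m: "inverse (real (Suc m)) \<le> inverse (real (Suc n0))" if "m \<ge> n0" for m
        using that by (intro le_imp_inverse_le) auto
      have "(norm (X m - X n))\<^sup>2 < e\<^sup>2"
        using para[of "X m" "X n"] X[of m] X[of n] m[OF that(1)] m[OF that(2)] n0 by linarith
      then show ?thesis using e by (simp add: dist_norm power2_less_imp_less)
    qed
    then show "\<exists>M. \<forall>m\<ge>M. \<forall>n\<ge>M. dist (X m) (X n) < e" by blast
  qed
  then obtain y where y: "X \<longlonglongrightarrow> y" using Cauchy_convergent convergent_def by blast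
  have "(\<lambda>n. J (X n)) \<longlonglongrightarrow> J y"
    unfolding J_def by (intro tendsto_intros y f.tendsto)
  moreover have "(\<lambda>n. c + inverse (real (Suc n))) \<longlonglongrightarrow> c + 0"
    by (intro tendsto_intros LIMSEQ_inverse_real_of_nat)
  ultimately have Jy: "J y \<le> c"
    by (metis (no_types, lifting) LIMSEQ_le X less_imp_le add_0_right)
  have "f x = inner y x" for x
  proof -
    define a where "a = inner y x - f x"
    define b where "b = (norm x)\<^sup>2 + 1"
    have b: "b > 0" unfolding b_def by (simp add: add_nonneg_pos)
    have "J y \<le> J (y + (- a / b) *\<^sub>R x)" using Jy c_le order_trans by blast
    also have "J (y + t *\<^sub>R x) = J y + t\<^sup>2 * (norm x)\<^sup>2 + 2 * t * a" for t
      unfolding J_def a_def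
      by (simp add: f.add f.scaleR power2_norm_eq_inner inner_add_left inner_add_right
          inner_commute[of x y] power2_eq_square[of t] algebra_simps)
    also have "J y + (- a / b)\<^sup>2 * (norm x)\<^sup>2 + 2 * (- a / b) * a
        = J y + (a / b)\<^sup>2 * (norm x)\<^sup>2 - 2 * (a / b) * a"
      by simp
    finally have "0 \<le> (a / b)\<^sup>2 * (norm x)\<^sup>2 - 2 * (a / b) * a" by simp
    also have "\<dots> = (a / b)\<^sup>2 * ((norm x)\<^sup>2 - 2 * b)"
      using b by (simp add: power2_eq_square field_simps)
    also have "\<dots> \<le> (a / b)\<^sup>2 * (- 1)"
    proof (rule mult_left_mono)
      show "(norm x)\<^sup>2 - 2 * b \<le> - 1"
        using order_trans[OF _ zero_le_power2[of "norm x"], of "- 1"] by (simp add: b_def)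
    qed simp
    finally have "a / b = 0" by simp
    then show ?thesis using b by (simp add: a_def)
  qed
  then show ?thesis by blast
qed

lemma adj_unique:
  fixes T :: "'h::complex_hilbert_space operator"
  assumes "\<And>x y. cinner (blinfun_apply S x) y = cinner x (blinfun_apply T y)"
  shows "adj T = S"
  unfolding adj_def
proof (rule the_equality)
  show "\<forall>x y. cinner (blinfun_apply S x) y = cinner x (blinfun_apply T y)" using assms by blast
  fix R assume "\<forall>x y. cinner (blinfun_apply R x) y = cinner x (blinfun_apply T y)"
  then have "inner (blinfun_apply R x) y = inner (blinfun_apply S x) y" for x y
    using assms by (simp add: inner_eq_Re_cinner)
  then show "R = S" by (metis blinfun_eqI cinner_eqI)
qed

lemma adj_exists:
  fixes T :: "'h::complex_hilbert_space operator"
  assumes "T \<in> bounded_operators"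
  shows "\<exists>S\<in>bounded_operators. \<forall>x y. cinner (blinfun_apply S x) y = cinner x (blinfun_apply T y)"
proof -
  have "\<exists>z. \<forall>x. inner y (blinfun_apply T x) = inner z x" for y
    by (intro riesz bounded_linear_compose[OF bounded_linear_inner_right] blinfun.bounded_linear_right)
  then obtain S where S: "\<And>y x. inner y (blinfun_apply T x) = inner (S y) x" by metis
  have lin: "bounded_linear S"
  proof (rule bounded_linear_intro[where K = "norm T"])
    show "S (x + y) = S x + S y" for x y
      by (rule cinner_eqI) (simp add: inner_add_left flip: S)
    show "S (r *\<^sub>R x) = r *\<^sub>R S x" for r x
      by (rule cinner_eqI) (simp flip: S)
    show "norm (S x) \<le> norm x * norm T" for x
    proof (cases "S x = 0")
      case False
      have "norm (S x) * norm (S x) = inner x (blinfun_apply T (S x))"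
        by (simp add: S flip: power2_norm_eq_inner power2_eq_square)
      also have "\<dots> \<le> norm x * norm (blinfun_apply T (S x))" by (rule norm_cauchy_schwarz)
      also have "\<dots> \<le> norm x * (norm T * norm (S x))" by (intro mult_left_mono norm_blinfun) auto
      finally show ?thesis using False by (simp add: ac_simps)
    qed auto
  qed
  have adj: "cinner (S x) y = cinner x (blinfun_apply T y)" for x y
    using assms by (simp add: cinner_eq_inner bounded_operators_def flip: S)
  have "S (c *\<^sub>C x) = c *\<^sub>C S x" for c x
    by (rule cinner_eqI) (simp add: inner_eq_Re_cinner adj cinner_scaleC_left)
  with lin adj show ?thesis
    by (intro bexI[of _ "Blinfun S"]) (auto simp: bounded_operators_def bounded_linear_Blinfun_apply)
qed

lemma adj_in: "T \<in> bounded_operators \<Longrightarrow> adj T \<in> bounded_operators"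
  using adj_exists adj_unique by metis

lemma cinner_adj:
  "T \<in> bounded_operators \<Longrightarrow> cinner (blinfun_apply (adj T) x) y = cinner x (blinfun_apply T y)"
  using adj_exists adj_unique by metis


section \<open>Operator topologies\<close>

text \<open>The topology on \<open>B(H)\<close> induced by a family of functionals.\<close>

definition functional_topology :: "('h::complex_hilbert_space operator \<Rightarrow> complex) set \<Rightarrow> 'h operator topology" where
  "functional_topology F =
     topology_generated_by {{T \<in> bounded_operators. f T \<in> U} | f U. f \<in> F \<and> open U}"

definition weak_operator_topology :: "'h::complex_hilbert_space operator topology" where
  "weak_operator_topology = functional_topology {\<lambda>T. cinner \<xi> (blinfun_apply T \<eta>) | \<xi> \<eta>. True}"

definition sigma_weak_topology :: "'h::complex_hilbert_space operator topology" where
  "sigma_weak_topology = functional_topology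
     {\<lambda>T. \<Sum>n. cinner (\<xi> n) (blinfun_apply T (\<eta> n)) | \<xi> \<eta> :: nat \<Rightarrow> 'h.
        summable (\<lambda>n. (norm (\<xi> n))\<^sup>2) \<and> summable (\<lambda>n. (norm (\<eta> n))\<^sup>2)}"


section \<open>Von Neumann algebras\<close>

definition star_subalgebra :: "'h::complex_hilbert_space operator set \<Rightarrow> bool" where
  "star_subalgebra M \<longleftrightarrow> M \<subseteq> bounded_operators \<and> 0 \<in> M \<and>
     (\<forall>x\<in>M. \<forall>y\<in>M. x + y \<in> M \<and> x o\<^sub>L y \<in> M) \<and>
     (\<forall>c. \<forall>x\<in>M. op_scale c x \<in> M) \<and> (\<forall>x\<in>M. adj x \<in> M)"

definition is_unit :: "'h::complex_hilbert_space operator set \<Rightarrow> 'h operator \<Rightarrow> bool" where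
  "is_unit M e \<longleftrightarrow> e \<in> M \<and> (\<forall>x\<in>M. e o\<^sub>L x = x \<and> x o\<^sub>L e = x)"

definition unit_of :: "'h::complex_hilbert_space operator set \<Rightarrow> 'h operator" where
  "unit_of M = (THE e. is_unit M e)"

text \<open>
  The unit \<open>e\<close> of \<open>M\<close> need not be the identity of \<open>H\<close>: \<open>M\<close> is a von Neumann algebra in the usual
  sense on the Hilbert space \<open>e H\<close>.  In this way corners \<open>p M p\<close> (including the zero algebra) live
  on the same Hilbert space as \<open>M\<close>.
\<close>

definition von_neumann_algebra :: "'h::complex_hilbert_space operator set \<Rightarrow> bool" where
  "von_neumann_algebra M \<longleftrightarrow>
     star_subalgebra M \<and> (\<exists>e. is_unit M e) \<and> closedin weak_operator_topology M"

definition wstar_subalgebra :: "'h::complex_hilbert_space operator set \<Rightarrow> 'h operator set \<Rightarrow> bool" where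
  "wstar_subalgebra N M \<longleftrightarrow>
     von_neumann_algebra M \<and> von_neumann_algebra N \<and> N \<subseteq> M \<and> unit_of N = unit_of M"

definition projections :: "'h::complex_hilbert_space operator set \<Rightarrow> 'h operator set" where
  "projections M = {p \<in> M. adj p = p \<and> p o\<^sub>L p = p}"

definition proj_le :: "'h::complex_hilbert_space operator \<Rightarrow> 'h operator \<Rightarrow> bool" where
  "proj_le q p \<longleftrightarrow> p o\<^sub>L q = q"

definition is_proj_sup ::
  "'h::complex_hilbert_space operator set \<Rightarrow> 'h operator set \<Rightarrow> 'h operator \<Rightarrow> bool" where
  "is_proj_sup N S r \<longleftrightarrow> r \<in> projections N \<and> (\<forall>p\<in>S. proj_le p r) \<and>
     (\<forall>r'\<in>projections N. (\<forall>p\<in>S. proj_le p r') \<longrightarrow> proj_le r r')"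

definition center :: "'h::complex_hilbert_space operator set \<Rightarrow> 'h operator set" where
  "center M = {z \<in> M. \<forall>x\<in>M. z o\<^sub>L x = x o\<^sub>L z}"

definition central_projections :: "'h::complex_hilbert_space operator set \<Rightarrow> 'h operator set" where
  "central_projections M = projections M \<inter> center M"

definition central_support ::
  "'h::complex_hilbert_space operator set \<Rightarrow> 'h operator \<Rightarrow> 'h operator" where
  "central_support N p = (THE z. z \<in> central_projections N \<and> proj_le p z \<and>
     (\<forall>z'\<in>central_projections N. proj_le p z' \<longrightarrow> proj_le z z'))"

definition corner :: "'h::complex_hilbert_space operator \<Rightarrow> 'h operator set \<Rightarrow> 'h operator set" where
  "corner p N = (\<lambda>x. p o\<^sub>L x o\<^sub>L p) ` N"

text \<open>*-isomorphisms of von Neumann algebras are automatically \<open>\<sigma>\<close>-weakly bicontinuous.\<close>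

definition isomorphic :: "'h::complex_hilbert_space operator set \<Rightarrow> 'h operator set \<Rightarrow> bool" where
  "isomorphic A B \<longleftrightarrow> (\<exists>\<phi>. bij_betw \<phi> A B \<and>
     (\<forall>x\<in>A. \<forall>y\<in>A. \<phi> (x + y) = \<phi> x + \<phi> y \<and> \<phi> (x o\<^sub>L y) = \<phi> x o\<^sub>L \<phi> y) \<and>
     (\<forall>c. \<forall>x\<in>A. \<phi> (op_scale c x) = op_scale c (\<phi> x)) \<and> (\<forall>x\<in>A. \<phi> (adj x) = adj (\<phi> x)))"


section \<open>Conditional expectations\<close>

text \<open>
  An idempotent linear map onto \<open>N \<noteq> {0}\<close> has norm at least one, so for these maps norm one means
  being contractive; phrased in the latter way, the zero algebra need not be treated separately.
\<close>

definition conditional_expectation ::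
  "('h::complex_hilbert_space operator \<Rightarrow> 'h operator) \<Rightarrow> 'h operator set \<Rightarrow> 'h operator set \<Rightarrow> bool" where
  "conditional_expectation E M N \<longleftrightarrow> wstar_subalgebra N M \<and>
     E ` M = N \<and> (\<forall>x\<in>M. E (E x) = E x) \<and>
     (\<forall>x\<in>M. \<forall>y\<in>M. E (x + y) = E x + E y) \<and> (\<forall>c. \<forall>x\<in>M. E (op_scale c x) = op_scale c (E x)) \<and>
     (\<forall>x\<in>M. norm (E x) \<le> norm x) \<and>
     continuous_map (subtopology sigma_weak_topology M) (subtopology sigma_weak_topology N) E"

text \<open>
  An \<open>n \<times> n\<close> matrix over \<open>M\<close> is a function on pairs of indices, of which only the entries below \<open>n\<close>
  matter.  It acts on \<open>H\<^sup>n\<close>; \<open>matrix_nonneg\<close> is positivity of that operator, and \<open>gram n x\<close> is the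
  product of the adjoint of the matrix \<open>x\<close> with \<open>x\<close>.
\<close>

definition matrix_nonneg :: "nat \<Rightarrow> (nat \<Rightarrow> nat \<Rightarrow> 'h::complex_hilbert_space operator) \<Rightarrow> bool" where
  "matrix_nonneg n a \<longleftrightarrow>
     (\<forall>\<xi>. (\<Sum>i<n. \<Sum>j<n. cinner (\<xi> i) (blinfun_apply (a i j) (\<xi> j))) \<in> \<real>\<^sub>\<ge>\<^sub>0)"

definition gram ::
  "nat \<Rightarrow> (nat \<Rightarrow> nat \<Rightarrow> 'h::complex_hilbert_space operator) \<Rightarrow> nat \<Rightarrow> nat \<Rightarrow> 'h operator" where
  "gram n x i j = (\<Sum>k<n. adj (x k i) o\<^sub>L x k j)"

definition PP_expectation ::
  "('h::complex_hilbert_space operator \<Rightarrow> 'h operator) \<Rightarrow> 'h operator set \<Rightarrow> 'h operator set \<Rightarrow> bool" where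
  "PP_expectation E M N \<longleftrightarrow> conditional_expectation E M N \<and>
     (\<exists>lam::real. lam > 0 \<and>
        (\<forall>n>0. \<forall>x. (\<forall>i<n. \<forall>j<n. x i j \<in> M) \<longrightarrow>
           matrix_nonneg n (\<lambda>i j. E (gram n x i j) - lam *\<^sub>R gram n x i j)))"

definition strongly_PP_expectation ::
  "('h::complex_hilbert_space operator \<Rightarrow> 'h operator) \<Rightarrow> 'h operator set \<Rightarrow> 'h operator set \<Rightarrow> bool" where
  "strongly_PP_expectation E M N \<longleftrightarrow> PP_expectation E M N \<and>
     (\<exists>(s::nat) (b::nat \<Rightarrow> 'h operator). (\<forall>i<s. b i \<in> M) \<and>
        (\<forall>i<s. \<forall>j<s. i \<noteq> j \<longrightarrow> E (adj (b i) o\<^sub>L b j) = 0) \<and>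
        (\<forall>i<s. E (adj (b i) o\<^sub>L b i) \<in> projections N) \<and>
        (\<forall>x\<in>M. x = (\<Sum>i<s. b i o\<^sub>L E (adj (b i) o\<^sub>L x))))"


section \<open>Properties of von Neumann algebras\<close>

text \<open>
  A property is a predicate on the von Neumann algebras acting on closed subspaces of the Hilbert
  space \<open>'h\<close>; its values on other sets of operators are never used.
\<close>

definition wstar_property :: "('h::complex_hilbert_space operator set \<Rightarrow> bool) \<Rightarrow> bool" where
  "wstar_property P \<longleftrightarrow>
     (\<forall>A B. von_neumann_algebra A \<and> von_neumann_algebra B \<and> isomorphic A B \<longrightarrow> P A = P B)"

definition property_projections ::
  "('h::complex_hilbert_space operator set \<Rightarrow> bool) \<Rightarrow> 'h operator set \<Rightarrow> 'h operator set" where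
  "property_projections P N = {p \<in> projections N. P (corner p N)}"

text \<open>The case \<open>S = {}\<close> of the first condition says that \<open>0\<close> is a \<open>P\<close>-projection.\<close>

definition ideal_property :: "('h::complex_hilbert_space operator set \<Rightarrow> bool) \<Rightarrow> bool" where
  "ideal_property P \<longleftrightarrow> wstar_property P \<and>
     (\<forall>N. von_neumann_algebra N \<longrightarrow>
        (\<forall>S r. finite S \<and> S \<subseteq> property_projections P N \<and> is_proj_sup N S r
           \<longrightarrow> r \<in> property_projections P N) \<and>
        (\<forall>p q. p \<in> property_projections P N \<and> q \<in> projections N \<and> proj_le q p
           \<longrightarrow> q \<in> property_projections P N))"

text \<open>
  A non-zero projection is not centrally orthogonal to itself and thus occurs at most once in a
  centrally orthogonal family, so sets suffice.  The sum is the limit in the strong operator topology.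
\<close>

definition Z_completely_ideal :: "('h::complex_hilbert_space operator set \<Rightarrow> bool) \<Rightarrow> bool" where
  "Z_completely_ideal P \<longleftrightarrow> ideal_property P \<and>
     (\<forall>N. von_neumann_algebra N \<longrightarrow>
        (\<forall>S r. S \<subseteq> property_projections P N \<and>
           (\<forall>p\<in>S. \<forall>q\<in>S. p \<noteq> q \<longrightarrow> central_support N p o\<^sub>L central_support N q = 0) \<and>
           r \<in> N \<and> (\<forall>\<xi>. ((\<lambda>p. blinfun_apply p \<xi>) has_sum blinfun_apply r \<xi>) S)
           \<longrightarrow> r \<in> property_projections P N))"

definition descends_strongly_PP :: "('h::complex_hilbert_space operator set \<Rightarrow> bool) \<Rightarrow> bool" where
  "descends_strongly_PP P \<longleftrightarrow> (\<forall>F A B. strongly_PP_expectation F A B \<and> P A \<longrightarrow> P B)"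

definition is_largest_in :: "'h::complex_hilbert_space operator set \<Rightarrow> 'h operator \<Rightarrow> bool" where
  "is_largest_in S z \<longleftrightarrow> z \<in> S \<and> (\<forall>p\<in>S. proj_le p z)"

definition largest_central_projection ::
  "'h::complex_hilbert_space operator set \<Rightarrow> ('h operator set \<Rightarrow> bool) \<Rightarrow> 'h operator" where
  "largest_central_projection N P =
     (THE z. is_largest_in (property_projections P N \<inter> central_projections N) z)"

definition Z_strong_negation ::
  "('h::complex_hilbert_space operator set \<Rightarrow> bool) \<Rightarrow> 'h operator set \<Rightarrow> bool" where
  "Z_strong_negation P N \<longleftrightarrow> property_projections P N \<inter> central_projections N \<subseteq> {0}"

definition negation_projection ::
  "'h::complex_hilbert_space operator set \<Rightarrow> ('h operator set \<Rightarrow> bool) \<Rightarrow> 'h operator" where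
  "negation_projection N P = unit_of N - largest_central_projection N P"

text \<open>
  As the notation suggests, \<open>negation_projection N P\<close> is the largest projection with the \<open>Z\<close>-strong
  negation of \<open>P\<close>.
\<close>

lemma is_unit_unit_of: "von_neumann_algebra N \<Longrightarrow> is_unit N (unit_of N)"
  unfolding unit_of_def von_neumann_algebra_def
  by (rule theI') (metis is_unit_def)

lemma cinner_cnj_adj:
  assumes "x \<in> bounded_operators"
  shows "cinner (blinfun_apply x \<xi>) \<eta> = cinner \<xi> (blinfun_apply (adj x) \<eta>)"
  by (metis assms cinner_adj cinner_commute)

lemma adj_compose:
  "x \<in> bounded_operators \<Longrightarrow> y \<in> bounded_operators \<Longrightarrow> adj (x o\<^sub>L y) = adj y o\<^sub>L adj x"
  by (rule adj_unique) (simp add: cinner_adj)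

lemma adj_adj: "x \<in> bounded_operators \<Longrightarrow> adj (adj x) = x"
  by (rule adj_unique) (simp add: cinner_cnj_adj)

lemma adj_diff:
  assumes "x \<in> bounded_operators" "y \<in> bounded_operators"
  shows "adj (x - y) = adj x - adj y"
proof (rule adj_unique)
  have d: "cinner a (b - c) = cinner a b - cinner a c" for a b c :: 'a
    by (metis add_diff_cancel_right' cinner_add_right diff_add_cancel)
  have d': "cinner (b - c) a = cinner b a - cinner c a" for a b c :: 'a
    by (metis add_diff_cancel_right' cinner_add_left diff_add_cancel)
  show "cinner (blinfun_apply (adj x - adj y) \<xi>) \<eta> = cinner \<xi> (blinfun_apply (x - y) \<eta>)" for \<xi> \<eta>
    using assms by (simp add: blinfun.diff_left d d' cinner_adj)
qed

lemma is_largest_negation_projection: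
  fixes N :: "'h::complex_hilbert_space operator set"
  assumes N: "von_neumann_algebra N" and P: "ideal_property P"
    and z: "is_largest_in (property_projections P N \<inter> central_projections N)
              (largest_central_projection N P)"
  shows "is_largest_in (property_projections (Z_strong_negation P) N) (negation_projection N P)"
proof -
  define z where "z = largest_central_projection N P"
  define u where "u = unit_of N"
  define w where "w = u - z"
  have w_eq: "negation_projection N P = w"
    unfolding w_def u_def z_def negation_projection_def ..
  have sub: "N \<subseteq> bounded_operators" and add: "\<And>x y. x \<in> N \<Longrightarrow> y \<in> N \<Longrightarrow> x + y \<in> N"
    and mult: "\<And>x y. x \<in> N \<Longrightarrow> y \<in> N \<Longrightarrow> x o\<^sub>L y \<in> N"
    and scale: "\<And>c x. x \<in> N \<Longrightarrow> op_scale c x \<in> N" and adj: "\<And>x. x \<in> N \<Longrightarrow> adj x \<in> N"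
    using N unfolding von_neumann_algebra_def star_subalgebra_def by blast+
  have u: "u \<in> N" "\<And>x. x \<in> N \<Longrightarrow> u o\<^sub>L x = x" "\<And>x. x \<in> N \<Longrightarrow> x o\<^sub>L u = x"
    using is_unit_unit_of[OF N] unfolding u_def is_unit_def by blast+
  have ass: "(a o\<^sub>L b) o\<^sub>L c = a o\<^sub>L (b o\<^sub>L c)" for a b c :: "'h operator"
    by (rule blinfun_eqI) simp
  have "adj u = adj u o\<^sub>L u" using u adj by simp
  then have "adj (adj u) = adj (adj u o\<^sub>L u)" by simp
  then have adj_u: "adj u = u"
    using u sub adj by (metis adj_adj adj_compose subsetD)
  have zP: "P (corner z N)" and zN: "z \<in> N" "adj z = z" "z o\<^sub>L z = z"
    and zc: "\<And>x. x \<in> N \<Longrightarrow> z o\<^sub>L x = x o\<^sub>L z"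
    and zmax: "\<And>p. p \<in> property_projections P N \<Longrightarrow> p \<in> central_projections N \<Longrightarrow> z o\<^sub>L p = p"
    using z unfolding is_largest_in_def property_projections_def central_projections_def
      projections_def center_def proj_le_def z_def[symmetric] by blast+
  have "op_scale (-1) z = - z"
    by (rule blinfun_eqI) (metis op_scale_apply blinfun.minus_left scaleC_of_real of_real_minus of_real_1 scaleR_minus1_left)
  then have w: "w \<in> N" using add[OF u(1) scale[OF zN(1), of "-1"]] by (simp add: w_def)
  have diffl: "(a - b) o\<^sub>L c = (a o\<^sub>L c) - (b o\<^sub>L c)" for a b c :: "'h operator"
    by (rule blinfun_eqI) (simp add: blinfun.diff_left)
  have diffr: "c o\<^sub>L (a - b) = (c o\<^sub>L a) - (c o\<^sub>L b)" for a b c :: "'h operator"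
    by (rule blinfun_eqI) (simp add: blinfun.diff_left blinfun.diff_right)
  have ww: "w o\<^sub>L w = w" and zw: "z o\<^sub>L w = 0" and wz: "w o\<^sub>L z = 0"
    unfolding w_def using u zN by (simp_all add: diffl diffr)
  have adj_w: "adj w = w"
    unfolding w_def using u(1) zN sub adj_u by (subst adj_diff) auto
  have wc: "w o\<^sub>L x = x o\<^sub>L w" if "x \<in> N" for x
    unfolding w_def using u(2,3)[OF that] zc[OF that] by (simp add: diffl diffr)
  have corner_corner: "corner p (corner q N) = corner p N" if "p o\<^sub>L q = p" "q o\<^sub>L p = p" for p q
  proof -
    have "p o\<^sub>L (q o\<^sub>L x o\<^sub>L q) o\<^sub>L p = p o\<^sub>L x o\<^sub>L p" for x
      using that by (metis ass)
    then show ?thesis unfolding corner_def by (simp add: image_image)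
  qed
  have neg: "Z_strong_negation P (corner w N)"
    unfolding Z_strong_negation_def
  proof
    fix p assume p: "p \<in> property_projections P (corner w N) \<inter> central_projections (corner w N)"
    then obtain x where x: "x \<in> N" "p = w o\<^sub>L x o\<^sub>L w"
      by (auto simp: property_projections_def projections_def corner_def)
    have pN: "p \<in> N" using x w mult by simp
    have "w o\<^sub>L (w o\<^sub>L y) = w o\<^sub>L y" for y :: "'h operator" by (simp add: ww flip: ass)
    then have wp: "w o\<^sub>L p = p" and pw: "p o\<^sub>L w = p" by (simp_all add: x(2) ass ww)
    have "P (corner p N)"
      using p corner_corner[OF pw wp] by (simp add: property_projections_def)
    then have pP: "p \<in> property_projections P N"
      using p pN by (simp add: property_projections_def projections_def)
    have "p o\<^sub>L y = y o\<^sub>L p" if y: "y \<in> N" for y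
    proof -
      have "w o\<^sub>L y o\<^sub>L w \<in> corner w N" using y by (auto simp: corner_def)
      then have "p o\<^sub>L (w o\<^sub>L y o\<^sub>L w) = (w o\<^sub>L y o\<^sub>L w) o\<^sub>L p"
        using p by (simp add: central_projections_def center_def)
      moreover have "p o\<^sub>L (w o\<^sub>L y o\<^sub>L w) = p o\<^sub>L y"
        using wc[OF y] by (metis ass pw ww)
      moreover have "(w o\<^sub>L y o\<^sub>L w) o\<^sub>L p = y o\<^sub>L p"
        using wc[OF y] by (metis ass wp ww)
      ultimately show ?thesis by simp
    qed
    then have "p \<in> central_projections N"
      using pP pN by (simp add: central_projections_def center_def property_projections_def)
    then have "z o\<^sub>L p = p" using zmax pP by blast
    then have "p = z o\<^sub>L w o\<^sub>L p" by (simp add: ass wp)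
    then show "p \<in> {0}" by (simp add: zw)
  qed
  have "proj_le q w" if q: "q \<in> property_projections (Z_strong_negation P) N" for q
  proof -
    have qN: "q \<in> N" "adj q = q" "q o\<^sub>L q = q" and qneg: "Z_strong_negation P (corner q N)"
      using q by (auto simp: property_projections_def projections_def)
    define p where "p = q o\<^sub>L z"
    have pz: "p = z o\<^sub>L q" using zc qN by (simp add: p_def)
    have pN: "p \<in> N" using p_def mult qN zN by blast
    have adj_p: "adj p = p"
      using qN zN sub pz by (metis adj_compose p_def subsetD)
    have pp: "p o\<^sub>L p = p" and zp: "z o\<^sub>L p = p" and qp: "q o\<^sub>L p = p" and pq: "p o\<^sub>L q = p"
      using qN zN pz p_def by (metis ass)+
    have p_corner: "p \<in> corner q N"
      unfolding corner_def using pN qp pq by (metis imageI)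
    have "p \<in> property_projections P N"
      using P N zP zN pN adj_p pp zp
      unfolding ideal_property_def property_projections_def projections_def proj_le_def
      by blast
    then have "P (corner p (corner q N))"
      using corner_corner[OF pq qp] by (simp add: property_projections_def)
    moreover have "p o\<^sub>L y = y o\<^sub>L p" if y: "y \<in> corner q N" for y
    proof -
      obtain x where x: "x \<in> N" "y = q o\<^sub>L x o\<^sub>L q" using y unfolding corner_def by blast
      have qq: "q o\<^sub>L (q o\<^sub>L v) = q o\<^sub>L v" for v :: "'h operator" by (simp add: qN(3) flip: ass)
      have "y \<in> N" using x mult qN(1) by simp
      moreover have "q o\<^sub>L y = y" "y o\<^sub>L q = y" by (simp_all add: x(2) ass qN(3) qq)
      ultimately show ?thesis using zc by (metis ass p_def pz)
    qed
    ultimately have "p \<in> {0}"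
      using qneg p_corner adj_p pp
      unfolding Z_strong_negation_def property_projections_def central_projections_def
        projections_def center_def by blast
    then show ?thesis
      using u qN by (simp add: proj_le_def w_def diffl pz[symmetric])
  qed
  with w ww adj_w neg show ?thesis
    unfolding is_largest_in_def w_eq by (simp add: property_projections_def projections_def)
qed

end

theory Submission
  imports Defs
begin

text \<open>
  Both inclusions between the central projections follow from one descent statement.  If \<open>z\<close> is a central
  \<open>P\<close>-projection of \<open>M\<close>, then the sum \<open>s\<close> of the series \<open>a (1 - a)\<^sup>n\<close>, where \<open>a = E z\<close>, is the support of \<open>a\<close>;
  \<open>a\<close> is invertible in \<open>N s\<close> by the Pimsner-Popa inequality, \<open>E\<close> followed by division by \<open>a\<close> is an expectation
  of \<open>M z\<close> onto \<open>N z\<close>, and \<open>N z\<close> is isomorphic to \<open>N s\<close>; so \<open>s\<close> is a central \<open>P\<close>-projection of \<open>N\<close> above \<open>z\<close>.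
  Applied to the dual expectation of the basic construction \<open>End\<^sub>N(M)\<close> onto \<open>M\<close>, the same argument yields
  above every central \<open>P\<close>-projection of \<open>N\<close> a central \<open>P\<close>-projection of \<open>M\<close>.

  These new expectations have a finite frame \<open>x = \<Sum> u\<^sub>i E(u\<^sub>i\<^sup>* x)\<close>, but no evident orthonormal basis.  Tensoring
  with the \<open>k \<times> k\<close> matrices repairs this: the frame, written into a single row, becomes an orthonormal basis, and
  a property that is ideal does not distinguish an algebra from its matrix algebras.
  Matrix algebras over \<open>M\<close> have to act on the Hilbert space of \<open>M\<close> again, which is possible if and only if that space is
  infinite-dimensional; on a finite-dimensional space an ideal property holds for all algebras or for \<open>0\<close> only.
\<close>

text \<open>The descent hypothesis speaks of expectations on the given Hilbert space, so each new
  one has to satisfy every clause of \<open>strongly_PP_expectation\<close>. A frame makes all but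
  one of these algebraic: expansion in it writes \<open>F (adj x \<odot> x)\<close> as a sum of
  squares of coefficients, whence positivity of matrices, a Pimsner-Popa constant that depends only
  on the norms of the frame, and contractivity of any bounded \<open>F\<close>. The remaining clause
  is topological and shapes the rest: the fixed points have to be closed in the weak operator
  topology, while an expectation is only known to be continuous in the \<sigma>-weak one. Acting on
  infinitely many copies of the space turns every \<sigma>-weakly continuous functional into a
  vector functional; the condition gained in this way survives corners, matrix algebras and the
  basic construction. The same isometries with orthogonal ranges supply the copies and the matrix
  units. The series for the support converges in norm because the Pimsner-Popa inequality makes its
  terms decay geometrically below \<open>z\<close>, and \<open>F\<close> carries this decay over to
  the subalgebra.\<close>

instance complex_hilbert_space \<subseteq> banach ..

notation blinfun_compose (infixl "\<odot>" 70)
notation op_scale (infixr "*\<^sub>O" 75)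

section \<open>Bilinearity of composition and of the complex inner product\<close>

interpretation blinfun_compose: bounded_bilinear "(\<odot>)"
  by (rule bounded_bilinear_blinfun_compose)

lemma blinfun_compose_assoc: "a \<odot> b \<odot> c = a \<odot> (b \<odot> c)"
  by (rule blinfun_eqI) simp

lemma cinner_self: "cinner x x = complex_of_real ((norm (x::'h::complex_hilbert_space))\<^sup>2)"
proof -
  have "cinner x x = complex_of_real (Re (cinner x x))"
    using cinner_commute[of x x] by (simp add: complex_eq_iff)
  then show ?thesis by (simp add: power2_norm_eq_inner inner_eq_Re_cinner)
qed

lemma scaleR_eq_scaleC: "r *\<^sub>R x = complex_of_real r *\<^sub>C (x::'h::complex_hilbert_space)"
  by (simp add: scaleC_of_real)

lemma scaleC_one [simp]: "1 *\<^sub>C x = (x::'h::complex_hilbert_space)"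
  using scaleC_of_real[of 1 x] by simp

lemma cinner_scaleR_left: "cinner (r *\<^sub>R x) y = r *\<^sub>R cinner x (y::'h::complex_hilbert_space)"
  by (simp add: scaleR_eq_scaleC cinner_scaleC_left scaleR_conv_of_real)

lemma cinner_scaleR_right: "cinner x (r *\<^sub>R y) = r *\<^sub>R cinner x (y::'h::complex_hilbert_space)"
  by (simp add: scaleR_eq_scaleC cinner_scaleC_right scaleR_conv_of_real)

lemma norm_cinner_le: "cmod (cinner x y) \<le> norm x * norm (y::'h::complex_hilbert_space)"
proof (cases "cinner x y = 0")
  case False
  \<comment> \<open>This phase turns the inner product into its modulus, where the real
    Cauchy-Schwarz inequality applies.\<close>
  define c where "c = cnj (cinner x y) / cmod (cinner x y)"
  have c: "cmod c = 1" using False by (simp add: c_def norm_divide)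
  have "cinner x (c *\<^sub>C y) = complex_of_real (cmod (cinner x y))"
    using False complex_norm_square[of "cinner x y"]
    by (simp add: c_def cinner_scaleC_right field_simps power2_eq_square)
  then have "inner x (c *\<^sub>C y) = cmod (cinner x y)" by (simp add: inner_eq_Re_cinner)
  moreover have "inner x (c *\<^sub>C y) \<le> norm x * norm (c *\<^sub>C y)" by (rule norm_cauchy_schwarz)
  ultimately show ?thesis by (simp add: norm_scaleC c)
qed simp

interpretation cinner: bounded_bilinear "cinner :: 'h::complex_hilbert_space \<Rightarrow> _"
proof
  show "\<exists>K. \<forall>a b::'h. norm (cinner a b) \<le> norm a * norm b * K"
    by (intro exI[of _ 1]) (simp add: norm_cinner_le)
qed (simp_all add: cinner_add_left cinner_add_right cinner_scaleR_left cinner_scaleR_right)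

lemma cinner_extI:
  fixes x y :: "'h::complex_hilbert_space"
  assumes "\<And>z. cinner z x = cinner z y"
  shows "x = y"
  by (rule cinner_eqI) (metis assms cinner_commute inner_eq_Re_cinner)

lemma operator_cinner_eqI:
  fixes a b :: "'h::complex_hilbert_space operator"
  assumes "\<And>x y. cinner x (a y) = cinner x (b y)"
  shows "a = b"
  by (rule blinfun_eqI) (rule cinner_extI, rule assms)

lemma scaleC_bounded_bilinear: "bounded_bilinear ((*\<^sub>C) :: complex \<Rightarrow> 'h::complex_hilbert_space \<Rightarrow> 'h)"
proof
  show "\<exists>K. \<forall>a. \<forall>b::'h. norm (a *\<^sub>C b) \<le> norm a * norm b * K"
    by (intro exI[of _ 1]) (simp add: norm_scaleC)
qed (simp_all add: scaleC_add_left scaleC_add_right scaleR_eq_scaleC scaleC_scaleC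
    scaleR_conv_of_real mult.commute)

interpretation scaleC: bounded_bilinear "(*\<^sub>C) :: complex \<Rightarrow> 'h::complex_hilbert_space \<Rightarrow> 'h"
  by (rule scaleC_bounded_bilinear)

section \<open>Algebra of bounded operators\<close>

lemma bounded_operatorsD: "T \<in> bounded_operators \<Longrightarrow> blinfun_apply T (c *\<^sub>C x) = c *\<^sub>C blinfun_apply T x"
  by (simp add: bounded_operators_def)

lemma scaleR_eq_op_scale: "r *\<^sub>R T = complex_of_real r *\<^sub>O T"
  by (rule blinfun_eqI) (simp add: blinfun.scaleR_left scaleR_eq_scaleC)

lemma op_scale_zero [simp]: "0 *\<^sub>O T = 0" "c *\<^sub>O 0 = 0"
  by (rule blinfun_eqI, simp add: scaleC.zero_left blinfun.zero_left scaleC.zero_right)+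

lemma op_scale_scale: "c *\<^sub>O d *\<^sub>O T = (c * d) *\<^sub>O T"
  by (rule blinfun_eqI) (simp add: scaleC_scaleC)

lemma op_scale_add_right: "c *\<^sub>O (S + T) = c *\<^sub>O S + c *\<^sub>O T"
  by (rule blinfun_eqI) (simp add: blinfun.add_left scaleC_add_right)

lemma op_scale_sum_right: "c *\<^sub>O (\<Sum>i\<in>I. T i) = (\<Sum>i\<in>I. c *\<^sub>O T i)"
  by (induction I rule: infinite_finite_induct) (simp_all add: op_scale_add_right)

lemma op_scale_compose_left: "(c *\<^sub>O S) \<odot> T = c *\<^sub>O (S \<odot> T)"
  by (rule blinfun_eqI) simp

lemma op_scale_compose_right:
  "S \<in> bounded_operators \<Longrightarrow> S \<odot> (c *\<^sub>O T) = c *\<^sub>O (S \<odot> T)"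
  by (rule blinfun_eqI) (simp add: bounded_operatorsD)

lemma bounded_operators_closure:
  "0 \<in> bounded_operators"
  "id_blinfun \<in> bounded_operators"
  "S \<in> bounded_operators \<Longrightarrow> T \<in> bounded_operators \<Longrightarrow> S + T \<in> bounded_operators"
  "S \<in> bounded_operators \<Longrightarrow> T \<in> bounded_operators \<Longrightarrow> S - T \<in> bounded_operators"
  "S \<in> bounded_operators \<Longrightarrow> T \<in> bounded_operators \<Longrightarrow> S \<odot> T \<in> bounded_operators"
  "S \<in> bounded_operators \<Longrightarrow> c *\<^sub>O S \<in> bounded_operators"
  by (auto simp: bounded_operators_def blinfun.add_left blinfun.diff_left blinfun.zero_left
      scaleC.zero_right scaleC.add_right scaleC.diff_right scaleC_scaleC mult.commute)

lemma bounded_operators_sum: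
  "(\<And>i. i \<in> I \<Longrightarrow> T i \<in> bounded_operators) \<Longrightarrow> (\<Sum>i\<in>I. T i) \<in> bounded_operators"
  by (induction I rule: infinite_finite_induct) (auto simp: bounded_operators_closure)

lemma closed_bounded_operators: "closed (bounded_operators :: 'h::complex_hilbert_space operator set)"
proof -
  have eq: "bounded_operators = (\<Inter>c. \<Inter>x. {T :: 'h operator. T (c *\<^sub>C x) = c *\<^sub>C T x})"
    by (auto simp: bounded_operators_def)
  have "closed {T :: 'h operator. T (c *\<^sub>C x) = c *\<^sub>C T x}" for c x
    by (intro closed_Collect_eq linear_continuous_on blinfun.bounded_linear_left
        bounded_linear_compose[OF bounded_linear_scaleC blinfun.bounded_linear_left])
  then show ?thesis unfolding eq by (intro closed_INT ballI)
qed

lemma cinner_adj': "T \<in> bounded_operators \<Longrightarrow> cinner x (adj T y) = cinner (T x) y"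
  by (simp add: cinner_cnj_adj)

lemma adj_zero [simp]: "adj 0 = 0"
  by (rule adj_unique) (simp add: blinfun.zero_left cinner.zero_left cinner.zero_right)

lemma adj_add:
  "S \<in> bounded_operators \<Longrightarrow> T \<in> bounded_operators \<Longrightarrow> adj (S + T) = adj S + adj T"
  by (rule adj_unique) (simp add: blinfun.add_left cinner_add_left cinner_add_right cinner_adj)

lemma adj_scale: "S \<in> bounded_operators \<Longrightarrow> adj (c *\<^sub>O S) = cnj c *\<^sub>O adj S"
  by (rule adj_unique) (simp add: cinner_scaleC_left cinner_scaleC_right cinner_adj)

lemma adj_sum:
  "(\<And>i. i \<in> I \<Longrightarrow> T i \<in> bounded_operators) \<Longrightarrow> adj (\<Sum>i\<in>I. T i) = (\<Sum>i\<in>I. adj (T i))"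
  by (induction I rule: infinite_finite_induct) (auto simp: adj_add bounded_operators_sum)

text \<open>The C*-identity. Cauchy-Schwarz gives \<open>*\<close>; cancelling a factor in it, for
  an operator and for its adjoint, shows that taking adjoints is isometric, and this yields the
  reverse inequality.\<close>

lemma norm_adj_compose:
  assumes "T \<in> bounded_operators"
  shows "norm (adj T \<odot> T) = (norm T)\<^sup>2" and "norm (adj T) = norm T"
proof -
  have *: "(norm S)\<^sup>2 \<le> norm (adj S \<odot> S)" if S: "S \<in> bounded_operators" for S :: "'a operator"
  proof -
    have "norm S \<le> sqrt (norm (adj S \<odot> S))"
    proof (rule norm_blinfun_bound)
      fix x
      have "(norm (S x))\<^sup>2 = cmod (cinner x (adj S (S x)))"
        using S by (simp add: cinner_adj' cinner_self norm_power)
      also have "\<dots> \<le> norm x * norm ((adj S \<odot> S) x)" by (simp add: norm_cinner_le)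
      also have "\<dots> \<le> norm x * (norm (adj S \<odot> S) * norm x)"
        by (intro mult_left_mono norm_blinfun) auto
      finally have "(norm (S x))\<^sup>2 \<le> (sqrt (norm (adj S \<odot> S)) * norm x)\<^sup>2"
        by (simp add: power_mult_distrib power2_eq_square ac_simps)
      then show "norm (S x) \<le> sqrt (norm (adj S \<odot> S)) * norm x"
        by (rule power2_le_imp_le) simp
    qed simp
    then have "(norm S)\<^sup>2 \<le> (sqrt (norm (adj S \<odot> S)))\<^sup>2" by (intro power_mono) auto
    then show ?thesis by simp
  qed
  have le: "norm S \<le> norm (adj S)" if S: "S \<in> bounded_operators" for S :: "'a operator"
  proof (cases "norm S = 0")
    case False
    have "norm S * norm S \<le> norm (adj S) * norm S"
      using *[OF S] norm_blinfun_compose[of "adj S" S] by (simp add: power2_eq_square)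
    then show ?thesis using False by (simp add: mult_le_cancel_right)
  qed simp
  show n: "norm (adj T) = norm T"
    using le[OF assms] le[OF adj_in[OF assms]] by (simp add: adj_adj assms)
  show "norm (adj T \<odot> T) = (norm T)\<^sup>2"
    using *[OF assms] norm_blinfun_compose[of "adj T" T] by (simp add: power2_eq_square n)
qed

lemma continuous_on_adj: "continuous_on bounded_operators adj"
proof (rule continuous_onI)
  fix x e assume "x \<in> bounded_operators" and e: "0 < (e::real)"
  then show "\<exists>d>0. \<forall>x'\<in>bounded_operators. dist x' x < d \<longrightarrow> dist (adj x') (adj x) \<le> e"
    by (intro exI[of _ e])
      (auto simp: dist_norm norm_adj_compose bounded_operators_closure simp flip: adj_diff)
qed

section \<open>The weak operator topology\<close>

abbreviation wot_continuous :: "'h::complex_hilbert_space operator set \<Rightarrow> ('h operator \<Rightarrow> complex) \<Rightarrow> bool" where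
  "wot_continuous A f \<equiv> continuous_map (subtopology weak_operator_topology A) euclidean f"

lemma topspace_functional_topology: "F \<noteq> {} \<Longrightarrow> topspace (functional_topology F) = bounded_operators"
  unfolding functional_topology_def topology_generated_by_topspace by blast

lemma topspace_wot [simp]: "topspace weak_operator_topology = bounded_operators"
  unfolding weak_operator_topology_def by (rule topspace_functional_topology) blast

text \<open>The generating family of \<open>sigma_weak_topology\<close>, named because continuity
  with respect to that topology is tested on its members.\<close>

definition sigma_weak_functionals :: "('h::complex_hilbert_space operator \<Rightarrow> complex) set" where
  "sigma_weak_functionals = {\<lambda>T. \<Sum>n. cinner (\<xi> n) (blinfun_apply T (\<eta> n)) | \<xi> \<eta> :: nat \<Rightarrow> 'h.
        summable (\<lambda>n. (norm (\<xi> n))\<^sup>2) \<and> summable (\<lambda>n. (norm (\<eta> n))\<^sup>2)}"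

lemma sigma_weak_functionals_nonempty:
  "sigma_weak_functionals \<noteq> ({} :: ('h::complex_hilbert_space operator \<Rightarrow> complex) set)"
proof -
  have "(\<lambda>T. \<Sum>n::nat. cinner 0 (blinfun_apply T (0::'h))) \<in> sigma_weak_functionals"
    unfolding sigma_weak_functionals_def
    by (rule CollectI, rule exI[of _ "\<lambda>_. 0"], rule exI[of _ "\<lambda>_. 0"]) simp
  then show ?thesis by blast
qed

lemma topspace_sigma_weak [simp]: "topspace sigma_weak_topology = bounded_operators"
  unfolding sigma_weak_topology_def sigma_weak_functionals_def[symmetric]
  by (rule topspace_functional_topology[OF sigma_weak_functionals_nonempty])

lemma continuous_map_functional_topology:
  assumes "f ` topspace T \<subseteq> bounded_operators"
    and "\<And>\<phi>. \<phi> \<in> F \<Longrightarrow> continuous_map T euclidean (\<lambda>x. \<phi> (f x))"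
    and "F \<noteq> {}"
  shows "continuous_map T (functional_topology F) f"
  unfolding functional_topology_def
proof (rule continuous_on_generated_topo)
  fix V assume "V \<in> {{T \<in> bounded_operators. f T \<in> U} |f U. f \<in> F \<and> open U}"
  then obtain \<phi> U where V: "V = {T \<in> bounded_operators. \<phi> T \<in> U}" "\<phi> \<in> F" "open U" by blast
  have "f -` V \<inter> topspace T = {x \<in> topspace T. \<phi> (f x) \<in> U}" using assms(1) V by auto
  then show "openin T (f -` V \<inter> topspace T)"
    using openin_continuous_map_preimage[OF assms(2)[OF V(2)], of U] V(3) by simp
next
  show "f ` topspace T \<subseteq> \<Union> {{T \<in> bounded_operators. f T \<in> U} |f U. f \<in> F \<and> open U}"
    using topspace_functional_topology[OF assms(3)] assms(1)
    unfolding functional_topology_def topology_generated_by_topspace by simp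
qed

lemma continuous_map_functional:
  assumes "\<phi> \<in> F"
  shows "continuous_map (functional_topology F) euclidean \<phi>"
  unfolding continuous_map_def
proof (intro conjI allI impI)
  fix U :: "complex set" assume "openin euclidean U"
  then have "openin (functional_topology F) {T \<in> bounded_operators. \<phi> T \<in> U}"
    unfolding functional_topology_def using assms by (intro topology_generated_by_Basis) auto
  moreover have "topspace (functional_topology F) = bounded_operators"
    using assms by (intro topspace_functional_topology) auto
  ultimately show "openin (functional_topology F) {x \<in> topspace (functional_topology F). \<phi> x \<in> U}"
    by simp
qed auto

lemma wot_continuous_vector: "wot_continuous A (\<lambda>T. cinner \<xi> (T \<eta>))"
  unfolding weak_operator_topology_def
  by (intro continuous_map_from_subtopology continuous_map_functional) blast

lemma continuous_map_wotI:
  assumes "f ` topspace T \<subseteq> bounded_operators"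
    and "\<And>\<xi> \<eta>. continuous_map T euclidean (\<lambda>x. cinner \<xi> (f x \<eta>))"
  shows "continuous_map T weak_operator_topology f"
  unfolding weak_operator_topology_def
  by (rule continuous_map_functional_topology) (use assms in auto)

lemma continuous_map_sigma_weak_wot:
  "continuous_map (subtopology sigma_weak_topology A) (subtopology weak_operator_topology A) (\<lambda>x. x)"
proof (rule continuous_map_into_subtopology)
  show "continuous_map (subtopology sigma_weak_topology A) weak_operator_topology (\<lambda>x. x)"
  proof (rule continuous_map_wotI)
    fix \<xi> \<eta> :: 'a
    \<comment> \<open>A vector functional is the \<sigma>-weak functional of two sequences
      concentrated at index 0.\<close>
    have "(\<lambda>T. \<Sum>n. cinner (if n = 0 then \<xi> else 0) (blinfun_apply T (if n = 0 then \<eta> else 0)))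
       \<in> sigma_weak_functionals"
      unfolding sigma_weak_functionals_def
      by (rule CollectI, rule exI[of _ "\<lambda>n. if n = 0 then \<xi> else 0"],
          rule exI[of _ "\<lambda>n. if n = 0 then \<eta> else 0"])
        (auto intro!: summable_finite[of "{0}"] split: if_splits)
    moreover have "(\<Sum>n. cinner (if n = 0 then \<xi> else 0) (blinfun_apply T (if n = 0 then \<eta> else 0)))
      = cinner \<xi> (T \<eta>)" for T
      by (subst suminf_finite[of "{0::nat}"]) (auto simp: cinner.zero_left)
    ultimately have "(\<lambda>T. cinner \<xi> (blinfun_apply T \<eta>)) \<in> sigma_weak_functionals" by simp
    then show "continuous_map (subtopology sigma_weak_topology A) euclidean (\<lambda>x. cinner \<xi> (blinfun_apply x \<eta>))"
      unfolding sigma_weak_topology_def sigma_weak_functionals_def[symmetric]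
      by (intro continuous_map_from_subtopology continuous_map_functional)
  qed auto
qed auto

lemma wot_continuous_sum:
  "(\<And>i. i \<in> I \<Longrightarrow> wot_continuous A (f i)) \<Longrightarrow> wot_continuous A (\<lambda>x. \<Sum>i\<in>I. f i x :: complex)"
  by (induction I rule: infinite_finite_induct) (auto intro!: continuous_map_add)

lemma wot_continuous_cong:
  assumes "wot_continuous A f" "\<And>x. x \<in> A \<Longrightarrow> f x = g x"
  shows "wot_continuous A g"
  by (rule continuous_map_eq[OF assms(1)]) (use assms(2) in auto)

lemma wot_continuous_compose:
  assumes "wot_continuous B \<phi>" and "f ` (A \<inter> bounded_operators) \<subseteq> B \<inter> bounded_operators"
    and "\<And>\<xi> \<eta>. wot_continuous A (\<lambda>x. cinner \<xi> (f x \<eta>))"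
  shows "wot_continuous A (\<lambda>x. \<phi> (f x))"
proof -
  have "continuous_map (subtopology weak_operator_topology A) (subtopology weak_operator_topology B) f"
    by (intro continuous_map_into_subtopology continuous_map_wotI) (use assms in auto)
  from continuous_map_compose[OF this assms(1)] show ?thesis by (simp add: comp_def)
qed

lemma closedin_wot_Collect:
  assumes "closedin weak_operator_topology A"
    and "\<And>i. i \<in> I \<Longrightarrow> wot_continuous A (\<phi> i)"
  shows "closedin weak_operator_topology {x \<in> A. \<forall>i\<in>I. \<phi> i x = 0}"
\<comment> \<open>The set is written as an intersection over \<open>I\<close>, which is the whole
  type instead of \<open>A\<close> if \<open>I\<close> is empty.\<close>
proof (cases "I = {}")
  case False
  have sub: "A \<subseteq> bounded_operators" using closedin_subset[OF assms(1)] by simp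
  have "closedin weak_operator_topology {x \<in> A. \<phi> i x = 0}" if "i \<in> I" for i
  proof -
    have "closedin (subtopology weak_operator_topology A)
       {x \<in> topspace (subtopology weak_operator_topology A). \<phi> i x \<in> {0}}"
      by (rule closedin_continuous_map_preimage[OF assms(2)[OF that]]) simp
    moreover have "{x \<in> topspace (subtopology weak_operator_topology A). \<phi> i x \<in> {0}}
       = {x \<in> A. \<phi> i x = 0}"
      using sub by auto
    ultimately show ?thesis by (metis assms(1) closedin_trans_full)
  qed
  then have "closedin weak_operator_topology (\<Inter>i\<in>I. {x \<in> A. \<phi> i x = 0})"
    using False by (intro closedin_INT) auto
  moreover have "(\<Inter>i\<in>I. {x \<in> A. \<phi> i x = 0}) = {x \<in> A. \<forall>i\<in>I. \<phi> i x = 0}" using False by auto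
  ultimately show ?thesis by simp
qed (use assms in simp)

text \<open>The weak operator topology is coarser than the norm topology, and the complex-linear
  operators are norm closed among the real-linear ones.\<close>

lemma closedin_wot_imp_closed:
  assumes "closedin weak_operator_topology A"
  shows "closed A"
proof -
  have "continuous_map (top_of_set bounded_operators) weak_operator_topology (\<lambda>x::'a operator. x)"
  proof (rule continuous_map_wotI)
    show "continuous_map (top_of_set bounded_operators) euclidean (\<lambda>x. cinner \<xi> (blinfun_apply x \<eta>))"
      for \<xi> \<eta> :: 'a
      by (simp add: linear_continuous_on bounded_linear_compose[OF cinner.bounded_linear_right
            blinfun.bounded_linear_left])
  qed simp
  from closedin_continuous_map_preimage[OF this assms]
  have "closedin (top_of_set bounded_operators) {x \<in> bounded_operators. x \<in> A}" by simp
  moreover have "{x \<in> bounded_operators. x \<in> A} = A"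
    using closedin_subset[OF assms] by auto
  ultimately show ?thesis using closed_bounded_operators closedin_closed_trans by fastforce
qed

text \<open>Continuity into the weak operator topology is expressed by matrix coefficients, so that
  the introduction rules carry no side condition on the values of \<open>f\<close>.\<close>

definition wot_continuous_op ::
  "'h::complex_hilbert_space operator set \<Rightarrow> ('h operator \<Rightarrow> 'h operator) \<Rightarrow> bool" where
  "wot_continuous_op A f \<longleftrightarrow> (\<forall>\<xi> \<eta>. wot_continuous A (\<lambda>x. cinner \<xi> (f x \<eta>)))"

named_theorems wot_intros

lemma wot_continuous_op_id [wot_intros]: "wot_continuous_op A (\<lambda>x. x)"
  unfolding wot_continuous_op_def by (intro allI wot_continuous_vector)

lemma wot_continuous_op_const [wot_intros]: "wot_continuous_op A (\<lambda>x. a)"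
  unfolding wot_continuous_op_def by simp

text \<open>A left factor moves to the other vector as its adjoint, whence the hypothesis on
  \<open>a\<close>; a right factor only changes the vector.\<close>

lemma wot_continuous_op_left [wot_intros]:
  assumes "a \<in> bounded_operators" "wot_continuous_op A f"
  shows "wot_continuous_op A (\<lambda>x. a \<odot> f x)"
proof -
  have "cinner \<xi> ((a \<odot> f x) \<eta>) = cinner (adj a \<xi>) (f x \<eta>)" for x \<xi> \<eta>
    using assms(1) by (simp add: cinner_adj)
  then show ?thesis using assms(2) by (simp only: wot_continuous_op_def) blast
qed

lemma wot_continuous_op_right [wot_intros]:
  "wot_continuous_op A f \<Longrightarrow> wot_continuous_op A (\<lambda>x. f x \<odot> b)"
  by (simp add: wot_continuous_op_def)

lemma wot_continuous_op_add [wot_intros]: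
  "wot_continuous_op A f \<Longrightarrow> wot_continuous_op A g \<Longrightarrow> wot_continuous_op A (\<lambda>x. f x + g x)"
  by (simp add: wot_continuous_op_def blinfun.add_left cinner_add_right continuous_map_add)

lemma wot_continuous_op_sum [wot_intros]:
  "(\<And>i. i \<in> I \<Longrightarrow> wot_continuous_op A (f i)) \<Longrightarrow> wot_continuous_op A (\<lambda>x. \<Sum>i\<in>I. f i x)"
  by (induction I rule: infinite_finite_induct) (auto intro: wot_intros)

lemma wot_continuous_op_subset:
  "wot_continuous_op B f \<Longrightarrow> A \<subseteq> B \<Longrightarrow> wot_continuous_op A f"
  unfolding wot_continuous_op_def by (blast intro: continuous_map_from_subtopology_mono)

lemma wot_continuous_functional_compose:
  assumes "wot_continuous B \<phi>" "wot_continuous_op A f" "f ` A \<subseteq> B" "B \<subseteq> bounded_operators"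
  shows "wot_continuous A (\<lambda>x. \<phi> (f x))"
  by (rule wot_continuous_compose[OF assms(1)]) (use assms in \<open>auto simp: wot_continuous_op_def\<close>)

lemma wot_continuous_op_compose:
  assumes "wot_continuous_op B g" "wot_continuous_op A f" "f ` A \<subseteq> B" "B \<subseteq> bounded_operators"
  shows "wot_continuous_op A (\<lambda>x. g (f x))"
  using assms(1) wot_continuous_functional_compose[OF _ assms(2-4)]
  by (auto simp: wot_continuous_op_def)

lemma closedin_wot_eq:
  assumes "closedin weak_operator_topology A" "wot_continuous_op A f" "wot_continuous_op A g"
  shows "closedin weak_operator_topology {x \<in> A. f x = g x}"
proof -
  have "closedin weak_operator_topology
     {x \<in> A. \<forall>(\<xi>, \<eta>)\<in>UNIV. cinner \<xi> (f x \<eta>) - cinner \<xi> (g x \<eta>) = 0}"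
    using closedin_wot_Collect[OF assms(1),
        of UNIV "\<lambda>(\<xi>, \<eta>) x. cinner \<xi> (f x \<eta>) - cinner \<xi> (g x \<eta>)"] assms(2,3)
    by (simp add: wot_continuous_op_def continuous_map_diff split_def)
  moreover have "{x \<in> A. \<forall>(\<xi>, \<eta>)\<in>UNIV. cinner \<xi> (f x \<eta>) - cinner \<xi> (g x \<eta>) = 0} = {x \<in> A. f x = g x}"
    by (auto intro: operator_cinner_eqI)
  ultimately show ?thesis by simp
qed

lemma closedin_wot_preimage:
  assumes "closedin weak_operator_topology A" "closedin weak_operator_topology B"
    "wot_continuous_op A f" "f ` A \<subseteq> bounded_operators"
  shows "closedin weak_operator_topology {x \<in> A. f x \<in> B}"
proof -
  have sub: "A \<subseteq> bounded_operators" using closedin_subset[OF assms(1)] by simp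
  have "continuous_map (subtopology weak_operator_topology A) weak_operator_topology f"
    by (rule continuous_map_wotI) (use assms in \<open>auto simp: wot_continuous_op_def\<close>)
  from closedin_continuous_map_preimage[OF this assms(2)]
  have "closedin (subtopology weak_operator_topology A) {x \<in> A. f x \<in> B}"
    using sub by (simp add: Int_absorb1)
  then show ?thesis using assms(1) by (metis closedin_trans_full)
qed

lemma closedin_wot_bounded_operators:
  "closedin weak_operator_topology (bounded_operators :: 'h::complex_hilbert_space operator set)"
  by (metis closedin_topspace topspace_wot)

section \<open>Von Neumann algebras and corners\<close>

lemma von_neumann_algebraI:
  assumes "A \<subseteq> bounded_operators" "0 \<in> A"
    "\<And>x y. x \<in> A \<Longrightarrow> y \<in> A \<Longrightarrow> x + y \<in> A"
    "\<And>x y. x \<in> A \<Longrightarrow> y \<in> A \<Longrightarrow> x \<odot> y \<in> A"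
    "\<And>c x. x \<in> A \<Longrightarrow> c *\<^sub>O x \<in> A" "\<And>x. x \<in> A \<Longrightarrow> adj x \<in> A"
    "e \<in> A" "\<And>x. x \<in> A \<Longrightarrow> e \<odot> x = x" "\<And>x. x \<in> A \<Longrightarrow> x \<odot> e = x"
    "closedin weak_operator_topology A"
  shows "von_neumann_algebra A"
  unfolding von_neumann_algebra_def star_subalgebra_def is_unit_def
  by (intro conjI ballI allI exI[of _ e]) (use assms in auto)

lemma unit_of_eqI:
  assumes "e \<in> A" "\<And>x. x \<in> A \<Longrightarrow> e \<odot> x = x" "\<And>x. x \<in> A \<Longrightarrow> x \<odot> e = x"
  shows "unit_of A = e"
  unfolding unit_of_def is_unit_def using assms by (intro the_equality) metis+

locale vN_algebra =
  fixes A :: "'h::complex_hilbert_space operator set"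
  assumes vN: "von_neumann_algebra A"
begin

definition e where "e = unit_of A"

lemma in_bounded: "x \<in> A \<Longrightarrow> x \<in> bounded_operators"
  and zero: "0 \<in> A"
  and add: "x \<in> A \<Longrightarrow> y \<in> A \<Longrightarrow> x + y \<in> A"
  and comp: "x \<in> A \<Longrightarrow> y \<in> A \<Longrightarrow> x \<odot> y \<in> A"
  and scale: "x \<in> A \<Longrightarrow> c *\<^sub>O x \<in> A"
  and adj: "x \<in> A \<Longrightarrow> adj x \<in> A"
  and wot_closed: "closedin weak_operator_topology A"
  using vN unfolding von_neumann_algebra_def star_subalgebra_def by blast+

lemma e_in: "e \<in> A" and e_left: "x \<in> A \<Longrightarrow> e \<odot> x = x" and e_right: "x \<in> A \<Longrightarrow> x \<odot> e = x"
  using is_unit_unit_of[OF vN] unfolding e_def is_unit_def by blast+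

lemma scaleR: "x \<in> A \<Longrightarrow> r *\<^sub>R x \<in> A"
  by (simp add: scaleR_eq_op_scale scale)

lemma uminus: "x \<in> A \<Longrightarrow> - x \<in> A"
  using scaleR[of x "-1"] by simp

lemma diff: "x \<in> A \<Longrightarrow> y \<in> A \<Longrightarrow> x - y \<in> A"
  using add[OF _ uminus] by simp

lemma sum: "(\<And>i. i \<in> I \<Longrightarrow> f i \<in> A) \<Longrightarrow> sum f I \<in> A"
  by (induction I rule: infinite_finite_induct) (auto simp: zero add)

lemmas closure = zero add comp scale adj scaleR uminus diff sum e_in

lemma e_left_apply: "x \<in> A \<Longrightarrow> e (x \<xi>) = x \<xi>" and e_right_apply: "x \<in> A \<Longrightarrow> x (e \<xi>) = x \<xi>"
  using e_left e_right by (metis blinfun_apply_blinfun_compose)+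

lemma adj_adj_in: "x \<in> A \<Longrightarrow> adj (adj x) = x"
  by (simp add: adj_adj in_bounded)

lemma adj_comp_in: "x \<in> A \<Longrightarrow> y \<in> A \<Longrightarrow> adj (x \<odot> y) = adj y \<odot> adj x"
  by (simp add: adj_compose in_bounded)

lemma adj_e: "adj e = e"
  by (metis adj adj_adj_in adj_comp_in e_in e_left e_right)

lemma e_projection: "e \<in> projections A"
  by (simp add: projections_def e_in adj_e e_left)

lemma e_central: "e \<in> central_projections A"
  by (simp add: central_projections_def e_projection center_def e_in e_left e_right)

lemma norm_closed: "closed A"
  by (rule closedin_wot_imp_closed[OF wot_closed])

lemma corner_eq:
  assumes "p \<in> projections A"
  shows "corner p A = {x \<in> A. p \<odot> x = x \<and> x \<odot> p = x}"
proof safe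
  fix x assume "x \<in> corner p A"
  then obtain y where y: "y \<in> A" "x = p \<odot> y \<odot> p" by (auto simp: corner_def)
  have p: "p \<in> A" "p \<odot> p = p" using assms by (auto simp: projections_def)
  show "x \<in> A" using p y by (simp add: comp)
  show "p \<odot> x = x" "x \<odot> p = x" using p y by (metis blinfun_compose_assoc)+
next
  fix x assume "x \<in> A" "p \<odot> x = x" "x \<odot> p = x"
  then show "x \<in> corner p A" unfolding corner_def by (metis imageI)
qed

lemma corner_subset: "p \<in> projections A \<Longrightarrow> corner p A \<subseteq> A"
  by (auto simp: corner_eq)

lemma corner_vN:
  assumes p: "p \<in> projections A"
  shows "von_neumann_algebra (corner p A)" and "unit_of (corner p A) = p"
proof -
  have pA: "p \<in> A" "p \<odot> p = p" "adj p = p" using p by (auto simp: projections_def)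
  have "closedin weak_operator_topology {x \<in> {x \<in> A. p \<odot> x = x}. x \<odot> p = x}"
    by (intro closedin_wot_eq wot_closed wot_intros in_bounded pA)
  then have closed: "closedin weak_operator_topology (corner p A)"
    unfolding corner_eq[OF p] by (simp add: conj_assoc)
  show "von_neumann_algebra (corner p A)"
  proof (rule von_neumann_algebraI[where e = p])
    show "x \<odot> y \<in> corner p A" if "x \<in> corner p A" "y \<in> corner p A" for x y
      using that p unfolding corner_eq[OF p]
      by (simp add: comp blinfun_compose_assoc) (simp flip: blinfun_compose_assoc)
    show "adj x \<in> corner p A" if "x \<in> corner p A" for x
      using that pA unfolding corner_eq[OF p]
      by (simp add: adj) (metis adj_comp_in)
    show "c *\<^sub>O x \<in> corner p A" if "x \<in> corner p A" for x c
      using that pA unfolding corner_eq[OF p]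
      by (simp add: scale op_scale_compose_left op_scale_compose_right in_bounded)
  qed (use pA closed in \<open>auto simp: corner_eq[OF p] zero add in_bounded
      blinfun_compose.add_left blinfun_compose.add_right\<close>)
  show "unit_of (corner p A) = p"
    by (rule unit_of_eqI) (use pA in \<open>auto simp: corner_eq[OF p]\<close>)
qed

lemma corner_e: "corner e A = A"
  by (auto simp: corner_eq[OF e_projection] e_left e_right)

lemma projections_corner:
  assumes "p \<in> projections A"
  shows "projections (corner p A) = {q \<in> projections A. proj_le q p}"
proof -
  have "q \<odot> p = q" if "q \<in> projections A" "p \<odot> q = q" for q
  proof -
    have "adj (p \<odot> q) = q \<odot> p" using assms that(1) by (simp add: projections_def adj_comp_in)
    then show ?thesis using that by (simp add: projections_def)
  qed
  then show ?thesis
    unfolding projections_def[of "corner p A"] corner_eq[OF assms] proj_le_def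
    by (auto simp: projections_def)
qed

lemma corner_corner:
  assumes p: "p \<in> projections A" and q: "q \<in> projections (corner p A)"
  shows "corner q (corner p A) = corner q A"
proof -
  interpret C: vN_algebra "corner p A" by unfold_locales (rule corner_vN[OF p])
  have q': "q \<in> projections A" "p \<odot> q = q" using q by (auto simp: projections_corner[OF p] proj_le_def)
  have qp: "q \<odot> p = q" using q by (auto simp: projections_def corner_eq[OF p])
  have "x \<in> corner p A" if "x \<in> A" "q \<odot> x = x" "x \<odot> q = x" for x
    using that q' qp unfolding corner_eq[OF p]
    by (metis (mono_tags, lifting) blinfun_compose_assoc mem_Collect_eq)
  then show ?thesis
    unfolding C.corner_eq[OF q] corner_eq[OF q'(1)] using corner_subset[OF p] by auto
qed

lemma proj_commute:
  assumes "p \<in> projections A" "q \<in> projections A" "proj_le q p"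
  shows "q \<odot> p = q"
proof -
  have "adj (p \<odot> q) = q \<odot> p" using assms by (simp add: projections_def adj_comp_in)
  then show ?thesis using assms by (simp add: projections_def proj_le_def)
qed

lemma proj_le_antisym:
  assumes "p \<in> projections A" "q \<in> projections A" "proj_le q p" "proj_le p q"
  shows "p = q"
  using proj_commute[OF assms(1,2,3)] assms(4) by (simp add: proj_le_def)

lemma norm_square_self_adjoint: "x \<in> A \<Longrightarrow> adj x = x \<Longrightarrow> norm (x \<odot> x) = (norm x)\<^sup>2"
  using norm_adj_compose(1)[OF in_bounded, of x] by simp

lemma projection_apply: 
  assumes "p \<in> projections A" shows "p (p \<xi>) = p \<xi>" "cinner (p \<xi>) \<eta> = cinner \<xi> (p \<eta>)"
proof -
  have p: "p \<in> A" "p \<odot> p = p" "adj p = p" using assms by (auto simp: projections_def)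
  show "p (p \<xi>) = p \<xi>" using p(2) by (metis blinfun_apply_blinfun_compose)
  show "cinner (p \<xi>) \<eta> = cinner \<xi> (p \<eta>)" using cinner_adj[OF in_bounded[OF p(1)]] p(3) by metis
qed

lemma norm_projection_le:
  assumes "p \<in> projections A" shows "norm (p \<xi>) \<le> norm \<xi>"
proof -
  have "complex_of_real ((norm (p \<xi>))\<^sup>2) = cinner \<xi> (p \<xi>)"
    by (metis cinner_self projection_apply[OF assms])
  then have "cmod (cinner \<xi> (p \<xi>)) = cmod (complex_of_real ((norm (p \<xi>))\<^sup>2))" by (simp only:)
  then have "(norm (p \<xi>))\<^sup>2 = cmod (cinner \<xi> (p \<xi>))" by (simp add: norm_power)
  also have "\<dots> \<le> norm \<xi> * norm (p \<xi>)" by (rule norm_cinner_le)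
  finally show ?thesis by (cases "norm (p \<xi>) = 0") (auto simp: power2_eq_square mult_le_cancel_right)
qed

end

section \<open>Ideal properties of algebras and of their corners\<close>

locale ideal_prop =
  fixes P :: "'h::complex_hilbert_space operator set \<Rightarrow> bool"
  assumes ideal: "ideal_property P"
begin

lemma wstar: "wstar_property P"
  using ideal by (simp add: ideal_property_def)

lemma iso_iff:
  assumes "von_neumann_algebra A" "von_neumann_algebra B" 
    and "bij_betw \<phi> A B"
    and "\<And>x y. x \<in> A \<Longrightarrow> y \<in> A \<Longrightarrow> \<phi> (x + y) = \<phi> x + \<phi> y"
    and "\<And>x y. x \<in> A \<Longrightarrow> y \<in> A \<Longrightarrow> \<phi> (x \<odot> y) = \<phi> x \<odot> \<phi> y"
    and "\<And>c x. x \<in> A \<Longrightarrow> \<phi> (c *\<^sub>O x) = c *\<^sub>O \<phi> x"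
    and "\<And>x. x \<in> A \<Longrightarrow> \<phi> (adj x) = adj (\<phi> x)"
  shows "P A \<longleftrightarrow> P B"
proof -
  have "isomorphic A B" unfolding isomorphic_def by (rule exI[of _ \<phi>]) (use assms in blast)
  then show ?thesis using wstar assms(1,2) unfolding wstar_property_def by blast
qed

lemma down:
  assumes "von_neumann_algebra N" "p \<in> property_projections P N" "q \<in> projections N" "proj_le q p"
  shows "q \<in> property_projections P N"
  using ideal assms unfolding ideal_property_def by blast

lemma finite_sup:
  assumes "von_neumann_algebra N" "finite S" "S \<subseteq> property_projections P N" "is_proj_sup N S r"
  shows "r \<in> property_projections P N"
  using ideal assms unfolding ideal_property_def by blast

text \<open>Ideal properties are axiomatised for projections only; an algebra enters as the corner
  at its unit.\<close>

lemma unit_property: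
  assumes "von_neumann_algebra N"
  shows "unit_of N \<in> property_projections P N \<longleftrightarrow> P N"
proof -
  interpret vN_algebra N by unfold_locales fact
  show ?thesis using corner_e e_projection by (simp add: property_projections_def e_def)
qed

lemma corner_property:
  assumes "von_neumann_algebra N" "P N" "p \<in> projections N"
  shows "P (corner p N)"
proof -
  interpret vN_algebra N by unfold_locales fact
  have "p \<in> property_projections P N"
    by (rule down[OF assms(1), of e])
      (use assms unit_property[OF assms(1)] in \<open>auto simp: proj_le_def projections_def e_left simp flip: e_def\<close>)
  then show ?thesis by (simp add: property_projections_def)
qed

end

section \<open>Norm estimates for positive operators\<close>

text \<open>Cauchy-Schwarz for the positive form of \<open>T\<close>, applied to \<open>x\<close>
  and \<open>T x\<close>, does the work of the spectral theorem.\<close>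

lemma norm_le_of_form_bound:
  fixes T :: "'h::complex_hilbert_space operator"
  assumes T: "T \<in> bounded_operators" and adj: "adj T = T"
    and pos: "\<And>\<xi>. 0 \<le> Re (cinner \<xi> (T \<xi>))" and le: "\<And>\<xi>. Re (cinner \<xi> (T \<xi>)) \<le> c * (norm \<xi>)\<^sup>2" and c: "c \<ge> 0"
  shows "norm T \<le> c"
proof (rule norm_blinfun_bound[OF c])
  fix x
  define f where "f x y = Re (cinner x (T y))" for x y
  have sym: "f x y = f y x" for x y
    unfolding f_def using cinner_adj[OF T, of y x] adj by (metis cinner_commute complex_cnj(1) complex_surj cnj.simps(1))
  \<comment> \<open>Positivity of the form at \<open>x - t y\<close> for every real
    \<open>t\<close>; Cauchy-Schwarz comes from the best choice of \<open>t\<close>.\<close>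
  have quad: "0 \<le> f x x - 2 * t * f x y + t\<^sup>2 * f y y" for x y and t :: real
  proof -
    have "f (x - t *\<^sub>R y) (x - t *\<^sub>R y) = f x x - t * f x y - t * f y x + t\<^sup>2 * f y y"
      unfolding f_def by (simp add: blinfun.diff_right blinfun.scaleR_right cinner.diff_left cinner.diff_right
          cinner_scaleR_left cinner_scaleR_right power2_eq_square algebra_simps)
    then show ?thesis using pos[of "x - t *\<^sub>R y"] sym[of y x] by (simp add: f_def)
  qed
  define y where "y = T x"
  have fxy: "f y x = (norm y)\<^sup>2" by (simp add: f_def y_def cinner_self)
  have key: "(norm y)\<^sup>2 * (norm y)\<^sup>2 \<le> (c * (norm x)\<^sup>2) * (c * (norm y)\<^sup>2)"
  proof -
    have "0 \<le> f y y - 2 * t * (norm y)\<^sup>2 + t\<^sup>2 * f x x" for t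
      using quad[of y t x] by (simp add: fxy)
    then have h: "0 \<le> c * (norm y)\<^sup>2 - 2 * t * (norm y)\<^sup>2 + t\<^sup>2 * (c * (norm x)\<^sup>2)" for t
      using le[of y] mult_left_mono[OF le[of x], of "t\<^sup>2"] unfolding f_def by (smt (verit) zero_le_power2)
    show ?thesis
    \<comment> \<open>If the coefficient of \<open>t\<^sup>2\<close> vanishes there is no minimising
      \<open>t\<close>, but then any large one, such as \<open>c + 1\<close>, forces
      \<open>y = 0\<close>.\<close>
    proof (cases "c * (norm x)\<^sup>2 = 0")
      case True
      have "(norm y)\<^sup>2 = 0"
      proof (rule ccontr)
        assume "(norm y)\<^sup>2 \<noteq> 0"
        then have "(norm y)\<^sup>2 > 0" by simp
        moreover have "0 \<le> (c - 2 * (c + 1)) * (norm y)\<^sup>2"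
          using h[of "c + 1"] True by (simp only: mult_zero_right) (simp add: algebra_simps)
        ultimately show False using c by (simp add: zero_le_mult_iff)
      qed
      then show ?thesis using c by simp
    next
      case False
      define d where "d = c * (norm x)\<^sup>2"
      have d: "d > 0" using False c unfolding d_def by (smt (verit) mult_nonneg_nonneg zero_le_power2)
      define n where "n = (norm y)\<^sup>2"
      \<comment> \<open>\<open>t = n / d\<close> minimises the quadratic polynomial in
        \<open>h\<close>.\<close>
      have "0 \<le> c * n - 2 * (n / d) * n + (n / d)\<^sup>2 * d"
        using h[of "n / d"] by (simp add: n_def d_def)
      also have "\<dots> = c * n - n * n / d" using d by (simp add: field_simps power2_eq_square)
      finally have "n * n \<le> d * (c * n)" using d by (simp add: field_simps)
      then show ?thesis by (simp add: n_def d_def ac_simps)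
    qed
  qed
  have "norm y \<le> c * norm x"
  proof (cases "norm y = 0")
    case True then show ?thesis using c by simp
  next
    case False
    then have "(norm y)\<^sup>2 * (norm y)\<^sup>2 \<le> (c * norm x)\<^sup>2 * (norm y)\<^sup>2"
      using key by (simp add: power_mult_distrib power2_eq_square ac_simps)
    moreover have "(norm y)\<^sup>2 > 0" using False by simp
    ultimately have "(norm y)\<^sup>2 \<le> (c * norm x)\<^sup>2" using mult_le_cancel_right_pos by blast
    then show ?thesis by (rule power2_le_imp_le) (use c in simp)
  qed
  then show "norm (T x) \<le> c * norm x" by (simp add: y_def)
qed

text \<open>
  Both the square root \<open>s - y\<close> of \<open>s - b\<close>, from \<open>y = (b + y\<^sup>2) / 2\<close>, and its inverse, from
  \<open>g = s + y g\<close>, are fixed points of contractions.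
\<close>

lemma sqrt_inverse_exists:
  fixes C :: "'h::complex_hilbert_space operator set"
  assumes C: "closed C" "0 \<in> C" "\<And>x y. x \<in> C \<Longrightarrow> y \<in> C \<Longrightarrow> x + y \<in> C"
    "\<And>r x. x \<in> C \<Longrightarrow> r *\<^sub>R x \<in> C" "\<And>x y. x \<in> C \<Longrightarrow> y \<in> C \<Longrightarrow> x \<odot> y \<in> C"
    and s: "s \<in> C" "\<And>x. x \<in> C \<Longrightarrow> s \<odot> x = x" "\<And>x. x \<in> C \<Longrightarrow> x \<odot> s = x"
    and b: "b \<in> C" "norm b < 1"
  obtains d d' where "d \<in> C" "d' \<in> C" "d \<odot> d = s - b" "d \<odot> d' = s"
proof -
  define r where "r = norm b"
  \<comment> \<open>The radius \<open>r = norm b\<close> serves twice: squares in this ball again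
    have norm at most \<open>r\<close>, so the ball is invariant, and \<open>r\<close> is the
    contraction constant.\<close>
  define X where "X = C \<inter> cball 0 r"
  have r: "0 \<le> r" "r < 1" using b by (auto simp: r_def)
  have "\<exists>!y\<in>X. (1/2) *\<^sub>R (b + y \<odot> y) = y"
  proof (rule Banach_fix[where S=X and c=r])
    show "complete X" unfolding X_def complete_eq_closed using C(1) by auto
    show "X \<noteq> {}" using C(2) r by (auto simp: X_def)
    show "(\<lambda>y. (1/2) *\<^sub>R (b + y \<odot> y)) ` X \<subseteq> X"
    proof safe
      fix y assume y: "y \<in> X"
      have "norm (y \<odot> y) \<le> norm y * norm y" by (rule norm_blinfun_compose)
      also have "\<dots> \<le> r * 1" using y r by (intro mult_mono) (auto simp: X_def)
      finally have "norm (b + y \<odot> y) \<le> r + r"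
        using norm_triangle_ineq[of b "y \<odot> y"] by (simp add: r_def)
      then show "(1/2) *\<^sub>R (b + y \<odot> y) \<in> X" using y C b(1) by (auto simp: X_def)
    qed
    show "dist ((1/2) *\<^sub>R (b + y \<odot> y)) ((1/2) *\<^sub>R (b + z \<odot> z)) \<le> r * dist y z"
      if yz: "y \<in> X" "z \<in> X" for y z
    proof -
      have "y \<odot> y - z \<odot> z = y \<odot> (y - z) + (y - z) \<odot> z"
        by (simp add: blinfun_compose.diff_left blinfun_compose.diff_right)
      then have "norm (y \<odot> y - z \<odot> z) \<le> norm (y \<odot> (y - z)) + norm ((y - z) \<odot> z)"
        using norm_triangle_ineq by metis
      also have "\<dots> \<le> norm y * norm (y - z) + norm (y - z) * norm z"
        by (intro add_mono norm_blinfun_compose)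
      also have "\<dots> \<le> r * norm (y - z) + norm (y - z) * r"
        using yz r by (intro add_mono mult_mono) (auto simp: X_def)
      finally have "norm (y \<odot> y - z \<odot> z) \<le> 2 * (r * norm (y - z))" by simp
      moreover have "dist ((1/2) *\<^sub>R (b + y \<odot> y)) ((1/2) *\<^sub>R (b + z \<odot> z)) = norm (y \<odot> y - z \<odot> z) / 2"
      proof -
        have "(1/2) *\<^sub>R (b + y \<odot> y) - (1/2) *\<^sub>R (b + z \<odot> z) = (1/2) *\<^sub>R (y \<odot> y - z \<odot> z)"
          by (simp add: algebra_simps)
        then show ?thesis by (simp add: dist_norm)
      qed
      ultimately show "dist ((1/2) *\<^sub>R (b + y \<odot> y)) ((1/2) *\<^sub>R (b + z \<odot> z)) \<le> r * dist y z"
        by (simp add: dist_norm)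
    qed
  qed (use r in auto)
  then obtain y where y: "y \<in> X" "(1/2) *\<^sub>R (b + y \<odot> y) = y" by blast
  have yC: "y \<in> C" "norm y \<le> r" using y by (auto simp: X_def)
  have "\<exists>!g\<in>C. s + y \<odot> g = g"
  proof (rule Banach_fix[where S=C and c=r])
    show "complete C" using C(1) by (simp add: complete_eq_closed)
    show "C \<noteq> {}" using C(2) by blast
    show "(\<lambda>g. s + y \<odot> g) ` C \<subseteq> C" using C s yC by auto
    show "dist (s + y \<odot> g) (s + y \<odot> h) \<le> r * dist g h" for g h
    proof -
      have "dist (s + y \<odot> g) (s + y \<odot> h) = norm (y \<odot> (g - h))"
        by (simp add: dist_norm blinfun_compose.diff_right)
      also have "\<dots> \<le> norm y * norm (g - h)" by (rule norm_blinfun_compose)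
      also have "\<dots> \<le> r * dist g h" using yC by (simp add: dist_norm mult_right_mono)
      finally show "dist (s + y \<odot> g) (s + y \<odot> h) \<le> r * dist g h" .
    qed
  qed (use r in auto)
  then obtain g where g: "g \<in> C" "s + y \<odot> g = g" by blast
  have yy: "y + y = b + y \<odot> y" 
    using y(2) by (metis scaleR_half_double scaleR_add_right)
  show thesis
  proof
    show "s - y \<in> C" using C(3)[OF s(1) C(4)[OF yC(1), of "-1"]] by simp
    show "g \<in> C" by fact
    have "(s - y) \<odot> (s - y) = s - (y + y) + y \<odot> y"
      using s yC by (simp add: blinfun_compose.diff_left blinfun_compose.diff_right)
    then show "(s - y) \<odot> (s - y) = s - b" unfolding yy by simp
    show "(s - y) \<odot> g = s" using s g by (simp add: blinfun_compose.diff_left algebra_simps)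
  qed
qed

lemma sum_swap3: "(\<Sum>i\<in>I. \<Sum>j\<in>J. \<Sum>l\<in>L. f i j l) = (\<Sum>l\<in>L. \<Sum>i\<in>I. \<Sum>j\<in>J. f i j l)"
proof -
  have "(\<Sum>i\<in>I. \<Sum>j\<in>J. \<Sum>l\<in>L. f i j l) = (\<Sum>i\<in>I. \<Sum>l\<in>L. \<Sum>j\<in>J. f i j l)"
    by (intro sum.cong refl, rule sum.swap)
  also have "\<dots> = (\<Sum>l\<in>L. \<Sum>i\<in>I. \<Sum>j\<in>J. f i j l)" by (rule sum.swap)
  finally show ?thesis .
qed

section \<open>Expectations with a finite frame\<close>

text \<open>The algebraic part of an expectation of finite index. Only linearity on the left over
  the fixed points and some norm bound are assumed, because these are what can be checked directly
  for the maps constructed later; linearity on the right and contractivity follow. The elements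
  \<open>u i\<close> need not be orthogonal.\<close>

locale pre_framed = vN_algebra A for A :: "'h::complex_hilbert_space operator set" +
  fixes F :: "'h operator \<Rightarrow> 'h operator" and u :: "nat \<Rightarrow> 'h operator" and k :: nat
  assumes F_in: "x \<in> A \<Longrightarrow> F x \<in> A"
    and F_add: "x \<in> A \<Longrightarrow> y \<in> A \<Longrightarrow> F (x + y) = F x + F y"
    and F_scale: "x \<in> A \<Longrightarrow> F (c *\<^sub>O x) = c *\<^sub>O F x"
    and F_adj: "x \<in> A \<Longrightarrow> F (adj x) = adj (F x)"
    and F_idem: "x \<in> A \<Longrightarrow> F (F x) = F x"
    and F_left: "x \<in> A \<Longrightarrow> y \<in> A \<Longrightarrow> F x = x \<Longrightarrow> F (x \<odot> y) = x \<odot> F y"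
    and F_e: "F (unit_of A) = unit_of A"
    and F_bounded: "\<exists>C. \<forall>x\<in>A. norm (F x) \<le> C * norm x"
    and u_in: "i < k \<Longrightarrow> u i \<in> A"
    and frame: "x \<in> A \<Longrightarrow> (\<Sum>i<k. u i \<odot> F (adj (u i) \<odot> x)) = x"
begin

definition B where "B = {x \<in> A. F x = x}"

lemma F_in_B: "x \<in> A \<Longrightarrow> F x \<in> B"
  by (simp add: B_def F_in F_idem)

lemma B_sub: "x \<in> B \<Longrightarrow> x \<in> A" and F_B: "x \<in> B \<Longrightarrow> F x = x"
  by (auto simp: B_def)

lemma F_left_B: "x \<in> B \<Longrightarrow> y \<in> A \<Longrightarrow> F (x \<odot> y) = x \<odot> F y"
  by (auto simp: B_def F_left)

lemma F_zero: "F 0 = 0"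
  using F_scale[of 0 0] zero by simp

lemma F_scaleR: "x \<in> A \<Longrightarrow> F (r *\<^sub>R x) = r *\<^sub>R F x"
  by (simp add: scaleR_eq_op_scale F_scale)

lemma F_diff: "x \<in> A \<Longrightarrow> y \<in> A \<Longrightarrow> F (x - y) = F x - F y"
  using F_add[of x "(-1) *\<^sub>R y"] F_scaleR[of y "-1"] by (simp add: uminus)

lemma F_sum: "(\<And>i. i \<in> I \<Longrightarrow> f i \<in> A) \<Longrightarrow> F (\<Sum>i\<in>I. f i) = (\<Sum>i\<in>I. F (f i))"
  by (induction I rule: infinite_finite_induct) (auto simp: F_zero F_add sum)

lemma B_closure:
  "0 \<in> B" "e \<in> B"
  "x \<in> B \<Longrightarrow> y \<in> B \<Longrightarrow> x + y \<in> B"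
  "x \<in> B \<Longrightarrow> y \<in> B \<Longrightarrow> x - y \<in> B"
  "x \<in> B \<Longrightarrow> y \<in> B \<Longrightarrow> x \<odot> y \<in> B"
  "x \<in> B \<Longrightarrow> c *\<^sub>O x \<in> B"
  "x \<in> B \<Longrightarrow> r *\<^sub>R x \<in> B"
  "x \<in> B \<Longrightarrow> adj x \<in> B"
  by (auto simp: B_def closure F_zero F_e e_def F_add F_diff F_left F_scale F_scaleR F_adj)
    (metis closure(10) e_def)

lemma F_right:
  assumes "x \<in> B" "y \<in> A"
  shows "F (y \<odot> x) = F y \<odot> x"
proof -
  have x: "x \<in> A" "adj x \<in> B" using assms B_closure by (auto simp: B_def)
  have "F (y \<odot> x) = F (adj (adj x \<odot> adj y))"
    using assms x by (simp add: adj_comp_in adj adj_adj_in)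
  also have "\<dots> = adj (adj x \<odot> adj (F y))"
    using assms x by (simp add: F_adj comp adj F_left_B)
  also have "\<dots> = F y \<odot> x"
    using assms x by (simp add: adj_comp_in adj adj_adj_in F_in)
  finally show ?thesis .
qed

text \<open>Expand \<open>y\<close> in the frame and pull the coefficients out on the right. The
  result is the inner product of two columns of coefficients, which is where complete positivity
  comes from.\<close>

lemma F_gram:
  assumes "x \<in> A" "y \<in> A"
  shows "F (adj x \<odot> y) = (\<Sum>i<k. adj (F (adj (u i) \<odot> x)) \<odot> F (adj (u i) \<odot> y))"
proof -
  have "F (adj x \<odot> y) = F (\<Sum>i<k. adj x \<odot> (u i \<odot> F (adj (u i) \<odot> y)))"
    using frame[OF assms(2)] by (simp flip: blinfun_compose.sum_right)
  also have "\<dots> = (\<Sum>i<k. F (adj x \<odot> (u i \<odot> F (adj (u i) \<odot> y))))"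
    using assms u_in by (intro F_sum) (auto intro!: comp adj F_in)
  also have "\<dots> = (\<Sum>i<k. adj (F (adj (u i) \<odot> x)) \<odot> F (adj (u i) \<odot> y))"
  proof (rule sum.cong[OF refl])
    fix i assume "i \<in> {..<k}"
    then have u: "u i \<in> A" using u_in by simp
    have "F (adj x \<odot> (u i \<odot> F (adj (u i) \<odot> y))) = F ((adj x \<odot> u i) \<odot> F (adj (u i) \<odot> y))"
      by (simp add: blinfun_compose_assoc)
    also have "\<dots> = F (adj x \<odot> u i) \<odot> F (adj (u i) \<odot> y)"
      using u assms by (intro F_right F_in_B comp adj)
    also have "adj x \<odot> u i = adj (adj (u i) \<odot> x)"
      using u assms by (simp add: adj_comp_in adj adj_adj_in)
    also have "F \<dots> = adj (F (adj (u i) \<odot> x))"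
      using u assms by (intro F_adj comp adj)
    finally show "F (adj x \<odot> (u i \<odot> F (adj (u i) \<odot> y))) = adj (F (adj (u i) \<odot> x)) \<odot> F (adj (u i) \<odot> y)" .
  qed
  finally show ?thesis .
qed

lemma F_gram_apply:
  assumes "x \<in> A" "y \<in> A"
  shows "cinner \<xi> (F (adj x \<odot> y) \<eta>) = (\<Sum>i<k. cinner (F (adj (u i) \<odot> x) \<xi>) (F (adj (u i) \<odot> y) \<eta>))"
proof -
  have "cinner \<xi> ((adj (F (adj (u i) \<odot> x)) \<odot> F (adj (u i) \<odot> y)) \<eta>)
      = cinner (F (adj (u i) \<odot> x) \<xi>) (F (adj (u i) \<odot> y) \<eta>)" if "i < k" for i
    using assms u_in[OF that] by (simp add: cinner_adj' in_bounded F_in comp adj)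
  then show ?thesis
    by (simp add: F_gram[OF assms] blinfun.sum_left cinner.sum_right)
qed

lemma F_square_apply:
  assumes "x \<in> A"
  shows "cinner \<xi> (F (adj x \<odot> x) \<xi>) = complex_of_real (\<Sum>i<k. (norm (F (adj (u i) \<odot> x) \<xi>))\<^sup>2)"
  by (simp add: F_gram_apply[OF assms assms] cinner_self)

text \<open>The Kadison-Schwarz inequality: positivity at the deviation \<open>x - F x\<close>,
  whose mixed terms collapse by the module property.\<close>

lemma schwarz: 
  assumes x: "x \<in> A"
  shows "(norm (F x \<xi>))\<^sup>2 \<le> Re (cinner \<xi> (F (adj x \<odot> x) \<xi>))"
proof -
  define y where "y = x - F x"
  have y: "y \<in> A" using x by (simp add: y_def diff F_in)
  have FxB: "F x \<in> B" "adj (F x) \<in> B" using x by (simp_all add: F_in_B B_closure)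
  have "F (adj y \<odot> y) = F (adj x \<odot> x) - F (adj x \<odot> F x) - (F (adj (F x) \<odot> x) - F (adj (F x) \<odot> F x))"
    using x unfolding y_def
    by (simp add: adj_diff in_bounded F_in blinfun_compose.diff_left blinfun_compose.diff_right
        F_diff comp diff adj)
  also have "\<dots> = F (adj x \<odot> x) - adj (F x) \<odot> F x"
    using x FxB by (simp add: F_right F_left_B adj F_in F_adj F_idem)
  finally have "F (adj x \<odot> x) = F (adj y \<odot> y) + adj (F x) \<odot> F x" by simp
  then have "cinner \<xi> (F (adj x \<odot> x) \<xi>)
     = cinner \<xi> (F (adj y \<odot> y) \<xi>) + cinner (F x \<xi>) (F x \<xi>)"
    using x by (simp add: blinfun.add_left cinner_add_right cinner_adj' in_bounded F_in)
  then show ?thesis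
    by (simp add: F_square_apply[OF y] cinner_self sum_nonneg flip: of_real_power)
qed

lemma F_norm_square: 
  assumes x: "x \<in> A" shows "(norm (F x))\<^sup>2 \<le> norm (F (adj x \<odot> x))"
proof -
  have "norm (F x) \<le> sqrt (norm (F (adj x \<odot> x)))"
  proof (rule norm_blinfun_bound)
    fix \<xi>
    have "(norm (F x \<xi>))\<^sup>2 \<le> cmod (cinner \<xi> (F (adj x \<odot> x) \<xi>))"
      using schwarz[OF x] complex_Re_le_cmod order_trans by blast
    also have "\<dots> \<le> norm \<xi> * norm (F (adj x \<odot> x) \<xi>)" by (rule norm_cinner_le)
    also have "\<dots> \<le> norm \<xi> * (norm (F (adj x \<odot> x)) * norm \<xi>)"
      by (intro mult_left_mono norm_blinfun) auto
    finally have "(norm (F x \<xi>))\<^sup>2 \<le> (sqrt (norm (F (adj x \<odot> x))) * norm \<xi>)\<^sup>2"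
      by (simp add: power_mult_distrib power2_eq_square ac_simps)
    then show "norm (F x \<xi>) \<le> sqrt (norm (F (adj x \<odot> x))) * norm \<xi>"
      by (rule power2_le_imp_le) simp
  qed simp
  then have "(norm (F x))\<^sup>2 \<le> (sqrt (norm (F (adj x \<odot> x))))\<^sup>2" by (intro power_mono) auto
  then show ?thesis by simp
qed

text \<open>Boundedness suffices for contractivity: iterating \<open>\<parallel>F x\<parallel>\<^sup>2 \<le> \<parallel>F (x\<^sup>* x)\<parallel>\<close> turns the bound \<open>C\<close> into its
  \<open>2\<^sup>n\<close>-th roots.\<close>

lemma F_contractive:
  assumes x: "x \<in> A" shows "norm (F x) \<le> norm x"
proof (cases "x = 0")
  case True then show ?thesis by (simp add: F_zero)
next
  case False
  obtain C where C: "\<And>x. x \<in> A \<Longrightarrow> norm (F x) \<le> C * norm x" using F_bounded by blast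
  have it: "norm (F y) ^ (2 ^ n) \<le> C * norm y ^ (2 ^ n)" if "y \<in> A" for y n
    using that
  proof (induction n arbitrary: y)
    case 0 then show ?case using C by simp
  next
    case (Suc n)
    have "norm (F y) ^ (2 ^ Suc n) = ((norm (F y))\<^sup>2) ^ (2 ^ n)" by (simp add: power_mult)
    also have "\<dots> \<le> norm (F (adj y \<odot> y)) ^ (2 ^ n)"
      by (intro power_mono F_norm_square Suc) simp
    also have "\<dots> \<le> C * norm (adj y \<odot> y) ^ (2 ^ n)"
      using Suc by (simp add: comp adj)
    also have "\<dots> = C * norm y ^ (2 ^ Suc n)"
      using Suc by (simp add: norm_adj_compose in_bounded power_mult)
    finally show ?case .
  qed
  show ?thesis
  proof (rule ccontr)
    define t where "t = norm (F x) / norm x"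
    assume "\<not> ?thesis"
    then have t: "t > 1" using False by (simp add: t_def field_simps)
    then obtain n where n: "C < t ^ n" using real_arch_pow by blast
    have "t ^ (2 ^ n) \<le> C" using it[OF x, of n] False by (simp add: t_def power_divide field_simps)
    moreover have "t ^ n \<le> t ^ (2 ^ n)" using t by (intro power_increasing) auto
    ultimately show False using n by simp
  qed
qed

lemma frame_norm:
  "(norm (\<Sum>i<k. u i (\<eta> i)))\<^sup>2 \<le> (\<Sum>i<k. (norm (u i))\<^sup>2) * (\<Sum>i<k. (norm (\<eta> i))\<^sup>2)"
proof -
  have "norm (\<Sum>i<k. u i (\<eta> i)) \<le> (\<Sum>i<k. norm (u i) * norm (\<eta> i))"
    by (intro order_trans[OF norm_sum] sum_mono norm_blinfun)
  then have "(norm (\<Sum>i<k. u i (\<eta> i)))\<^sup>2 \<le> (\<Sum>i<k. norm (u i) * norm (\<eta> i))\<^sup>2"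
    by (intro power_mono) auto
  also have "\<dots> \<le> (\<Sum>i<k. (norm (u i))\<^sup>2) * (\<Sum>i<k. (norm (\<eta> i))\<^sup>2)"
    by (rule Cauchy_Schwarz_ineq_sum)
  finally show ?thesis .
qed

text \<open>The reciprocal of the constant in \<open>frame_norm\<close>. The summand 1 keeps the
  denominator positive for a vanishing frame and gives \<open>lam \<le> 1\<close>, so that
  \<open>1 - lam\<close> can serve as a decay rate.\<close>

definition lam :: real where "lam = 1 / (1 + (\<Sum>i<k. (norm (u i))\<^sup>2))"

lemma lam_pos: "lam > 0" and lam_le_1: "lam \<le> 1"
  by (simp_all add: lam_def add_pos_nonneg sum_nonneg field_simps)

lemma lam_frame: "lam * (norm (\<Sum>i<k. u i (\<eta> i)))\<^sup>2 \<le> (\<Sum>i<k. (norm (\<eta> i))\<^sup>2)"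
proof -
  have "(\<Sum>i<k. (norm (u i))\<^sup>2) * (\<Sum>i<k. (norm (\<eta> i))\<^sup>2)
     \<le> (1 + (\<Sum>i<k. (norm (u i))\<^sup>2)) * (\<Sum>i<k. (norm (\<eta> i))\<^sup>2)"
    by (intro mult_right_mono sum_nonneg) auto
  with frame_norm[of \<eta>] have "(norm (\<Sum>i<k. u i (\<eta> i)))\<^sup>2
     \<le> (1 + (\<Sum>i<k. (norm (u i))\<^sup>2)) * (\<Sum>i<k. (norm (\<eta> i))\<^sup>2)" by linarith
  moreover have "1 + (\<Sum>i<k. (norm (u i))\<^sup>2) > 0" by (simp add: add_pos_nonneg sum_nonneg)
  ultimately show ?thesis by (simp add: lam_def field_simps)
qed

text \<open>Row \<open>l\<close> of the matrix, applied to the vector, is \<open>v l\<close>, and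
  its frame coefficients are \<open>w l m\<close>. The quadratic form splits into one term for each
  \<open>l\<close>, namely the sum of the squared norms of the coefficients minus \<open>lam\<close>
  times the squared norm of \<open>v l\<close>; this is nonnegative by
  \<open>lam_frame\<close>.\<close>

lemma pimsner_popa:
  assumes x: "\<And>i j. i < n \<Longrightarrow> j < n \<Longrightarrow> x i j \<in> A"
  shows "matrix_nonneg n (\<lambda>i j. F (gram n x i j) - lam *\<^sub>R gram n x i j)"
  unfolding matrix_nonneg_def
proof
  fix \<xi> :: "nat \<Rightarrow> 'h"
  define v where "v l = (\<Sum>j<n. x l j (\<xi> j))" for l
  define w where "w l m = (\<Sum>j<n. F (adj (u m) \<odot> x l j) (\<xi> j))" for l m
  have vw: "v l = (\<Sum>m<k. u m (w l m))" if l: "l < n" for l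
  proof -
    have "v l = (\<Sum>j<n. \<Sum>m<k. u m (F (adj (u m) \<odot> x l j) (\<xi> j)))"
      unfolding v_def
    proof (rule sum.cong[OF refl])
      fix j assume "j \<in> {..<n}"
      then have "x l j (\<xi> j) = (\<Sum>m<k. u m \<odot> F (adj (u m) \<odot> x l j)) (\<xi> j)"
        using frame[OF x[OF l]] by simp
      then show "x l j (\<xi> j) = (\<Sum>m<k. u m (F (adj (u m) \<odot> x l j) (\<xi> j)))"
        by (simp add: blinfun.sum_left)
    qed
    then show ?thesis unfolding w_def by (subst (asm) sum.swap) (simp add: blinfun.sum_right)
  qed
  have *: "cinner (\<xi> i) ((F (gram n x i j) - lam *\<^sub>R gram n x i j) (\<xi> j))
      = (\<Sum>l<n. (\<Sum>m<k. cinner (F (adj (u m) \<odot> x l i) (\<xi> i)) (F (adj (u m) \<odot> x l j) (\<xi> j)))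
            - lam *\<^sub>R cinner (x l i (\<xi> i)) (x l j (\<xi> j)))" if "i < n" "j < n" for i j
  proof -
    have "F (gram n x i j) = (\<Sum>l<n. F (adj (x l i) \<odot> x l j))"
      unfolding gram_def using that x by (intro F_sum) (auto intro!: comp adj)
    then have "cinner (\<xi> i) (F (gram n x i j) (\<xi> j))
        = (\<Sum>l<n. \<Sum>m<k. cinner (F (adj (u m) \<odot> x l i) (\<xi> i)) (F (adj (u m) \<odot> x l j) (\<xi> j)))"
      using that x by (simp add: blinfun.sum_left cinner.sum_right F_gram_apply)
    moreover have "cinner (\<xi> i) (gram n x i j (\<xi> j)) = (\<Sum>l<n. cinner (x l i (\<xi> i)) (x l j (\<xi> j)))"
      unfolding gram_def using that x by (simp add: blinfun.sum_left cinner.sum_right cinner_adj' in_bounded)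
    ultimately show ?thesis
      by (simp add: blinfun.diff_left blinfun.scaleR_left cinner.diff_right cinner_scaleR_right
          sum_subtractf scaleR_sum_right)
  qed
  have "(\<Sum>i<n. \<Sum>j<n. cinner (\<xi> i) ((F (gram n x i j) - lam *\<^sub>R gram n x i j) (\<xi> j)))
     = (\<Sum>i<n. \<Sum>j<n. \<Sum>l<n. (\<Sum>m<k. cinner (F (adj (u m) \<odot> x l i) (\<xi> i)) (F (adj (u m) \<odot> x l j) (\<xi> j)))
            - lam *\<^sub>R cinner (x l i (\<xi> i)) (x l j (\<xi> j)))"
    by (intro sum.cong refl) (simp add: *)
  also have "\<dots> = (\<Sum>l<n. \<Sum>i<n. \<Sum>j<n. (\<Sum>m<k. cinner (F (adj (u m) \<odot> x l i) (\<xi> i)) (F (adj (u m) \<odot> x l j) (\<xi> j)))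
            - lam *\<^sub>R cinner (x l i (\<xi> i)) (x l j (\<xi> j)))"
    by (rule sum_swap3)
  also have "\<dots> = (\<Sum>l<n. (\<Sum>m<k. cinner (w l m) (w l m)) - lam *\<^sub>R cinner (v l) (v l))"
  proof (rule sum.cong[OF refl])
    fix l
    have "(\<Sum>m<k. cinner (w l m) (w l m))
        = (\<Sum>m<k. \<Sum>i<n. \<Sum>j<n. cinner (F (adj (u m) \<odot> x l i) (\<xi> i)) (F (adj (u m) \<odot> x l j) (\<xi> j)))"
      unfolding w_def by (intro sum.cong refl) (simp add: cinner.sum_left cinner.sum_right, rule sum.swap)
    also have "\<dots> = (\<Sum>i<n. \<Sum>j<n. \<Sum>m<k. cinner (F (adj (u m) \<odot> x l i) (\<xi> i)) (F (adj (u m) \<odot> x l j) (\<xi> j)))"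
      by (rule sum_swap3[symmetric])
    finally have w: "(\<Sum>m<k. cinner (w l m) (w l m)) = \<dots>" .
    have v: "cinner (v l) (v l) = (\<Sum>i<n. \<Sum>j<n. cinner (x l i (\<xi> i)) (x l j (\<xi> j)))"
      unfolding v_def by (simp add: cinner.sum_left cinner.sum_right, rule sum.swap)
    show "(\<Sum>i<n. \<Sum>j<n. (\<Sum>m<k. cinner (F (adj (u m) \<odot> x l i) (\<xi> i)) (F (adj (u m) \<odot> x l j) (\<xi> j)))
            - lam *\<^sub>R cinner (x l i (\<xi> i)) (x l j (\<xi> j)))
        = (\<Sum>m<k. cinner (w l m) (w l m)) - lam *\<^sub>R cinner (v l) (v l)"
      unfolding w v by (simp add: sum_subtractf scaleR_sum_right)
  qed
  also have "\<dots> = complex_of_real (\<Sum>l<n. (\<Sum>m<k. (norm (w l m))\<^sup>2) - lam * (norm (v l))\<^sup>2)"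
    by (simp add: cinner_self scaleR_conv_of_real)
  also have "\<dots> \<in> \<real>\<^sub>\<ge>\<^sub>0"
    by (simp only: nonneg_Reals_of_real_iff) (auto simp: vw lam_frame intro!: sum_nonneg)
  finally show "(\<Sum>i<n. \<Sum>j<n. cinner (\<xi> i) ((F (gram n x i j) - lam *\<^sub>R gram n x i j) (\<xi> j))) \<in> \<real>\<^sub>\<ge>\<^sub>0" .
qed

lemma lam_bound:
  assumes "x \<in> A"
  shows "lam * (norm (x \<xi>))\<^sup>2 \<le> Re (cinner \<xi> (F (adj x \<odot> x) \<xi>))"
proof -
  have "x \<xi> = (\<Sum>i<k. u i \<odot> F (adj (u i) \<odot> x)) \<xi>" using frame[OF assms] by simp
  then have "x \<xi> = (\<Sum>i<k. u i (F (adj (u i) \<odot> x) \<xi>))" by (simp add: blinfun.sum_left)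
  then show ?thesis using lam_frame by (simp add: F_square_apply[OF assms])
qed

text \<open>The reproducing identity of the frame. It makes the Gram matrix with entries
  \<open>F (adj (u i) \<odot> u j)\<close> idempotent and the coefficient matrices of left
  multiplications multiplicative.\<close>

lemma frame_product:
  assumes "x \<in> A" "y \<in> A"
  shows "(\<Sum>i<k. F (x \<odot> u i) \<odot> F (adj (u i) \<odot> y)) = F (x \<odot> y)"
proof -
  have "F (x \<odot> y) = (\<Sum>i<k. adj (F (adj (u i) \<odot> adj x)) \<odot> F (adj (u i) \<odot> y))"
    using F_gram[of "adj x" y] assms by (simp add: adj adj_adj_in)
  also have "\<dots> = (\<Sum>i<k. F (x \<odot> u i) \<odot> F (adj (u i) \<odot> y))"
    using assms u_in
    by (intro sum.cong refl) (simp add: comp adj adj_comp_in adj_adj_in flip: F_adj)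
  finally show ?thesis by simp
qed

end

text \<open>By the first assumption, \<open>\<sigma>\<close>-weakly continuous maps on \<open>A\<close> are continuous for the weak operator
  topology, so that the algebra \<open>B\<close> of fixed points is closed in the latter.  It holds after an infinite
  amplification.\<close>

locale framed = pre_framed +
  assumes sigma_weak: "\<phi> \<in> sigma_weak_functionals \<Longrightarrow> wot_continuous A \<phi>"
    and F_wot: "wot_continuous_op A F"
begin

lemma B_vN: "von_neumann_algebra B" and B_unit: "unit_of B = e"
proof -
  have "closedin weak_operator_topology B"
    unfolding B_def by (intro closedin_wot_eq wot_closed F_wot wot_intros)
  then show "von_neumann_algebra B"
    by (intro von_neumann_algebraI[where e = e])
       (auto simp: B_closure B_sub in_bounded e_left e_right)
  show "unit_of B = e" by (rule unit_of_eqI) (auto simp: B_closure B_sub e_left e_right)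
qed

text \<open>A \<sigma>-weak functional after \<open>F\<close> is continuous for the weak operator
  topology by the two assumptions of the locale, hence for the finer \<sigma>-weak topology on the
  source.\<close>

lemma F_sigma_weak:
  "continuous_map (subtopology sigma_weak_topology A) (subtopology sigma_weak_topology B) F"
proof (rule continuous_map_into_subtopology)
  show "continuous_map (subtopology sigma_weak_topology A) sigma_weak_topology F"
    unfolding sigma_weak_topology_def sigma_weak_functionals_def[symmetric]
  proof (rule continuous_map_functional_topology[OF _ _ sigma_weak_functionals_nonempty])
    fix \<phi> :: "'a operator \<Rightarrow> complex" assume "\<phi> \<in> sigma_weak_functionals"
    then have "wot_continuous A (\<lambda>x. \<phi> (F x))"
      by (intro wot_continuous_functional_compose[OF sigma_weak F_wot]) (auto simp: F_in in_bounded)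
    from continuous_map_compose[OF continuous_map_sigma_weak_wot this]
    show "continuous_map (subtopology (functional_topology sigma_weak_functionals) A) euclidean (\<lambda>x. \<phi> (F x))"
      by (simp add: comp_def sigma_weak_topology_def sigma_weak_functionals_def[symmetric])
  qed (auto simp: F_in in_bounded)
qed (auto simp: F_in_B)

theorem strongly_PP:
  assumes "\<And>i j. i < k \<Longrightarrow> j < k \<Longrightarrow> i \<noteq> j \<Longrightarrow> F (adj (u i) \<odot> u j) = 0"
    and "\<And>i. i < k \<Longrightarrow> F (adj (u i) \<odot> u i) \<in> projections B"
  shows "strongly_PP_expectation F A B"
proof -
  have "F ` A = B" using F_in_B F_B B_sub by (auto intro!: image_eqI)
  then have "conditional_expectation F A B"
    unfolding conditional_expectation_def wstar_subalgebra_def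
    using B_vN B_unit vN F_sigma_weak
    by (auto simp: e_def B_sub F_idem F_add F_scale F_contractive)
  then have "PP_expectation F A B"
    unfolding PP_expectation_def
    by (intro conjI exI[of _ lam] allI impI lam_pos pimsner_popa) auto
  then show ?thesis
    unfolding strongly_PP_expectation_def using assms u_in frame
    by (intro conjI exI[of _ k] exI[of _ u]) auto
qed

end

text \<open>Tomiyama's theorem, by Choi's multiplicative domain argument: the positivity of the
  2 by 2 matrices is contained in the Pimsner-Popa condition.\<close>

lemma strongly_PP_pre_framed:
  assumes "strongly_PP_expectation E M N"
  obtains u k where "pre_framed M E u k" "N = {x \<in> M. E x = x}"
proof -
  have PP: "PP_expectation E M N" and CE: "conditional_expectation E M N"
    using assms by (auto simp: strongly_PP_expectation_def PP_expectation_def)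
  obtain lam :: real where lam: "lam > 0" "\<forall>n>0. \<forall>x. (\<forall>i<n. \<forall>j<n. x i j \<in> M) \<longrightarrow>
           matrix_nonneg n (\<lambda>i j. E (gram n x i j) - lam *\<^sub>R gram n x i j)"
    using PP unfolding PP_expectation_def by (elim conjE exE) (rule that)
  obtain u k where u: "\<And>i. i < (k::nat) \<Longrightarrow> u i \<in> M"
      "\<And>x. x \<in> M \<Longrightarrow> x = (\<Sum>i<k. u i \<odot> E (adj (u i) \<odot> x))"
    using assms unfolding strongly_PP_expectation_def by blast
  have "von_neumann_algebra M" "von_neumann_algebra N" and NM: "N \<subseteq> M" and unit: "unit_of N = unit_of M"
    using CE by (auto simp: conditional_expectation_def wstar_subalgebra_def)
  then interpret M: vN_algebra M + N: vN_algebra N by unfold_locales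
  have im: "E ` M = N" and idem: "\<And>x. x \<in> M \<Longrightarrow> E (E x) = E x"
    using CE unfolding conditional_expectation_def by blast+
  have "E x = x" if "x \<in> N" for x using that im idem by auto
  moreover have "x \<in> N" if "x \<in> M" "E x = x" for x using that im by (metis imageI)
  ultimately have N: "N = {x \<in> M. E x = x}" using NM by auto
  have EN: "\<And>x. x \<in> M \<Longrightarrow> E x \<in> N"
    and E_add: "\<And>x y. x \<in> M \<Longrightarrow> y \<in> M \<Longrightarrow> E (x + y) = E x + E y"
    and E_scale: "\<And>c x. x \<in> M \<Longrightarrow> E (c *\<^sub>O x) = c *\<^sub>O E x"
    and E_norm: "\<And>x. x \<in> M \<Longrightarrow> norm (E x) \<le> norm x"
    using CE unfolding conditional_expectation_def by blast+
  have EM: "\<And>x. x \<in> M \<Longrightarrow> E x \<in> M" using EN NM by blast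
  have Ee: "E M.e = M.e" 
    unfolding M.e_def unit[symmetric] using N.e_in[unfolded N.e_def] N by blast
  have E_zero: "E 0 = 0" using E_scale[of 0 0] M.zero by simp
  have pos: "cinner \<xi> (E (adj x \<odot> x) \<xi>) + cinner \<xi> (E (adj x \<odot> y) \<eta>)
      + (cinner \<eta> (E (adj y \<odot> x) \<xi>) + cinner \<eta> (E (adj y \<odot> y) \<eta>)) \<in> \<real>\<^sub>\<ge>\<^sub>0"
    if "x \<in> M" "y \<in> M" for x y \<xi> \<eta>
  proof -
    \<comment> \<open>With first row \<open>(x, y)\<close> and second row zero, the Gram matrix
      consists of the four products in question. Its \<open>lam\<close> term is a nonnegative
      multiple of the squared norm of \<open>q\<close> and is moved to the other side.\<close>
    define X where "X i j = (if i = (0::nat) then (if j = (0::nat) then x else y) else 0)" for i j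
    have gram: "gram 2 X i j = adj (X 0 i) \<odot> X 0 j" for i j
      by (simp add: gram_def X_def numeral_2_eq_2)
    define Z where "Z i = (if i = (0::nat) then \<xi> else \<eta>)" for i
    have "matrix_nonneg 2 (\<lambda>i j. E (gram 2 X i j) - lam *\<^sub>R gram 2 X i j)"
      using lam(2)[rule_format, of 2 X] that M.zero by (simp add: X_def)
    then have nn: "(\<Sum>i<2. \<Sum>j<2. cinner (Z i) ((E (gram 2 X i j) - lam *\<^sub>R gram 2 X i j) (Z j))) \<in> \<real>\<^sub>\<ge>\<^sub>0"
      unfolding matrix_nonneg_def by blast
    define q where "q = x \<xi> + y \<eta>"
    define R where "R = cinner \<xi> (E (adj x \<odot> x) \<xi>) + cinner \<xi> (E (adj x \<odot> y) \<eta>)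
      + (cinner \<eta> (E (adj y \<odot> x) \<xi>) + cinner \<eta> (E (adj y \<odot> y) \<eta>))"
    have "(\<Sum>i<2. \<Sum>j<2. cinner (Z i) ((E (gram 2 X i j) - lam *\<^sub>R gram 2 X i j) (Z j)))
      = R - lam *\<^sub>R cinner q q"
      using that unfolding gram
      by (simp add: numeral_2_eq_2 Z_def X_def R_def q_def blinfun.diff_left blinfun.scaleR_left
          cinner.diff_right cinner_scaleR_right cinner_add_left cinner_add_right cinner_adj' M.in_bounded
          algebra_simps scaleR_add_right)
    then have "R = (\<Sum>i<2. \<Sum>j<2. cinner (Z i) ((E (gram 2 X i j) - lam *\<^sub>R gram 2 X i j) (Z j)))
       + complex_of_real (lam * (norm q)\<^sup>2)"
      by (simp add: cinner_self scaleR_conv_of_real)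
    moreover have "complex_of_real (lam * (norm q)\<^sup>2) \<in> \<real>\<^sub>\<ge>\<^sub>0"
      using lam(1) by (simp only: nonneg_Reals_of_real_iff) simp
    ultimately have "R \<in> \<real>\<^sub>\<ge>\<^sub>0" using nn nonneg_Reals_add_I by simp
    then show ?thesis by (simp add: R_def)
  qed
  have pos1: "cinner \<xi> (E (adj x \<odot> x) \<xi>) \<in> \<real>\<^sub>\<ge>\<^sub>0" if "x \<in> M" for x \<xi>
    using pos[OF that that, of \<xi> 0] by (simp add: blinfun.zero_right cinner.zero_left cinner.zero_right)
  have E_adj: "E (adj x) = adj (E x)" if x: "x \<in> M" for x
  proof -
    \<comment> \<open>Positivity with the unit in place of \<open>y\<close> makes the sum of the two
      off-diagonal terms real. Doing this for \<eta> and for its multiple by the imaginary unit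
      shows that the two terms are conjugate.\<close>
    define f where "f \<xi> \<eta> = cinner \<xi> (E (adj x) \<eta>) + cinner \<eta> (E x \<xi>)" for \<xi> \<eta>
    have "Im (f \<xi> \<eta>) = 0" for \<xi> \<eta>
    proof -
      have "Im (cinner \<xi> (E (adj x \<odot> x) \<xi>) + cinner \<xi> (E (adj x \<odot> M.e) \<eta>)
        + (cinner \<eta> (E (adj M.e \<odot> x) \<xi>) + cinner \<eta> (E (adj M.e \<odot> M.e) \<eta>))) = 0"
        using pos[OF x M.e_in, of \<xi> \<eta>] nonneg_Reals_subset_Reals complex_is_Real_iff by blast
      moreover have "Im (cinner \<xi> (E (adj x \<odot> x) \<xi>)) = 0"  "Im (cinner \<eta> (E (adj M.e \<odot> M.e) \<eta>)) = 0"
        using pos1[OF x, of \<xi>] pos1[OF M.e_in, of \<eta>] nonneg_Reals_subset_Reals complex_is_Real_iff by blast+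
      ultimately show ?thesis using x by (simp add: f_def M.e_left M.e_right M.adj_e M.adj)
    qed
    then have im: "Im (f \<xi> \<eta>) = 0" "Im (f \<xi> (\<i> *\<^sub>C \<eta>)) = 0" for \<xi> \<eta> by auto
    have "cinner \<eta> (E x \<xi>) = cnj (cinner \<xi> (E (adj x) \<eta>))" for \<xi> \<eta>
    proof -
      have "E (adj x) \<in> bounded_operators" using x by (simp add: EM M.adj M.in_bounded)
      then show ?thesis using im[of \<xi> \<eta>]
        by (simp add: f_def bounded_operatorsD cinner_scaleC_left cinner_scaleC_right complex_eq_iff)
    qed
    then have "adj (E x) = E (adj x)"
      by (intro adj_unique) (metis cinner_commute)
    then show ?thesis by simp
  qed
  \<comment> \<open>The defect in the Schwarz inequality. It is positive on the diagonal by
    \<open>pos\<close> with the unit and the vector \<open>- E x \<xi>\<close>.\<close>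
  define D where "D x y \<xi> = cinner \<xi> (E (adj x \<odot> y) \<xi>) - cinner (E x \<xi>) (E y \<xi>)" for x y \<xi>
  have Dpos: "D x x \<xi> \<in> \<real>\<^sub>\<ge>\<^sub>0" if x: "x \<in> M" for x \<xi>
  proof -
    have e1: "M.e (E x \<xi>) = E x \<xi>" using M.e_left_apply[OF EM[OF x]] .
    have e2: "cinner \<xi> (E (adj x) (E x \<xi>)) = cinner (E x \<xi>) (E x \<xi>)"
      by (simp add: E_adj[OF x] cinner_adj' M.in_bounded EM x)
    show ?thesis
      using pos[OF x M.e_in, of \<xi> "- E x \<xi>"] x
      by (simp add: D_def M.e_in M.e_left M.e_right M.adj_e M.adj Ee e1 e2 blinfun.minus_right
          cinner.minus_right cinner.minus_left)
  qed
  have E_mod: "E (x \<odot> y) = E x \<odot> y" if xy: "x \<in> M" "y \<in> M" "E y = y" for x y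
  proof (rule operator_cinner_eqI)
    define d where "d \<xi> \<eta> = cinner \<xi> (E (x \<odot> y) \<eta>) - cinner \<xi> (E x (y \<eta>))" for \<xi> \<eta>
    have ax: "adj x \<in> M" "adj (adj x) = x" using xy by (simp_all add: M.adj M.adj_adj_in)
    have dD: "d \<xi> \<xi> = D (adj x) y \<xi>" for \<xi>
      using xy ax by (simp add: d_def D_def E_adj cinner_adj M.in_bounded EM)
    \<comment> \<open>For a fixed point \<open>y\<close> the defect of \<open>y\<close> itself
      vanishes. So the defect of \<open>adj x + c y\<close> has no quadratic term in
      \<open>c\<close>, and a nonnegative affine function of \<open>c\<close> has no linear
      term.\<close>
    have sum: "D (adj x) (adj x) \<xi> + (2 * Re (c * d \<xi> \<xi>)) \<in> \<real>\<^sub>\<ge>\<^sub>0" for \<xi> and c :: complex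
    proof -
      define a where "a = adj x"
      have a: "a \<in> M" using ax by (simp add: a_def)
      have cy: "c *\<^sub>O y \<in> M" using xy M.scale by simp
      have "D (a + c *\<^sub>O y) (a + c *\<^sub>O y) \<xi> = D a a \<xi> + c * D a y \<xi> + cnj c * D y a \<xi> + cnj c * c * D y y \<xi>"
        using a xy cy unfolding D_def
        by (simp add: adj_add adj_scale M.in_bounded blinfun_compose.add_left blinfun_compose.add_right
            E_add M.add M.comp M.adj M.scale op_scale_compose_left op_scale_compose_right E_scale op_scale_add_right
            blinfun.add_left cinner_add_left cinner_add_right cinner_scaleC_left cinner_scaleC_right
            op_scale_scale algebra_simps)
      moreover have "D y y \<xi> = 0"
      proof -
        have "adj y \<odot> y \<in> N" using xy N by (intro N.comp N.adj) auto
        then show ?thesis using xy N by (simp add: D_def cinner_adj' M.in_bounded)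
      qed
      moreover have "D y a \<xi> = cnj (D a y \<xi>)"
      proof -
        have "cinner \<xi> (E (adj y \<odot> a) \<xi>) = cnj (cinner \<xi> (E (adj a \<odot> y) \<xi>))"
        proof -
          have "adj y \<odot> a = adj (adj a \<odot> y)" using a xy by (simp add: M.adj_comp_in M.adj M.adj_adj_in)
          then have *: "E (adj y \<odot> a) = adj (E (adj a \<odot> y))" using a xy by (simp add: E_adj M.comp M.adj)
          have "E (adj a \<odot> y) \<in> bounded_operators" using a xy by (intro M.in_bounded EM M.comp M.adj)
          from cinner_adj'[OF this] show ?thesis unfolding * using cinner_commute by simp
        qed
        then show ?thesis unfolding D_def using cinner_commute[of "E y \<xi>" "E a \<xi>"] by simp
      qed
      moreover have "a + c *\<^sub>O y \<in> M" using a cy M.add by blast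
      ultimately have "D a a \<xi> + (c * D a y \<xi> + cnj (c * D a y \<xi>)) \<in> \<real>\<^sub>\<ge>\<^sub>0"
        using Dpos[of "a + c *\<^sub>O y" \<xi>] by (simp add: add.assoc)
      then show ?thesis unfolding complex_add_cnj dD a_def[symmetric] by simp
    qed
    have d0: "d \<xi> \<xi> = 0" for \<xi>
    proof (rule ccontr)
      assume nz: "d \<xi> \<xi> \<noteq> 0"
      define r where "r = Re (D (adj x) (adj x) \<xi>)"
      \<comment> \<open>Chosen so that the linear term is \<open>- 2 (r + 1)\<close>, which
        outweighs the constant term \<open>r\<close>.\<close>
      define c where "c = complex_of_real (- (r + 1)) / d \<xi> \<xi>"
      have "r \<ge> 0" using Dpos[OF ax(1), of \<xi>] by (simp add: r_def complex_nonneg_Reals_iff)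
      moreover have "c * d \<xi> \<xi> = complex_of_real (- (r + 1))" using nz by (simp add: c_def)
      then have "0 \<le> r + 2 * (- (r + 1))"
        using sum[of \<xi> c] by (simp add: complex_nonneg_Reals_iff r_def)
      ultimately show False by simp
    qed
    fix \<xi> \<eta>
    have bd: "E (x \<odot> y) \<in> bounded_operators" "E x \<in> bounded_operators" "y \<in> bounded_operators"
      using xy by (simp_all add: EM M.comp M.in_bounded)
    \<comment> \<open>Polarisation: \<open>c = 1\<close> and \<open>c = \<i>\<close> recover the
      form from its vanishing diagonal.\<close>
    have "d (\<xi> + c *\<^sub>C \<eta>) (\<xi> + c *\<^sub>C \<eta>) = d \<xi> \<xi> + c * d \<xi> \<eta> + cnj c * d \<eta> \<xi> + cnj c * c * d \<eta> \<eta>" for c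
      unfolding d_def using bd
      by (simp add: blinfun.add_right cinner_add_left cinner_add_right bounded_operatorsD
          cinner_scaleC_left cinner_scaleC_right algebra_simps)
    then have "c * d \<xi> \<eta> + cnj c * d \<eta> \<xi> = 0" for c using d0 by simp
    from this[of 1] this[of \<i>] have "d \<xi> \<eta> + d \<eta> \<xi> = 0" "d \<xi> \<eta> - d \<eta> \<xi> = 0"
      by (simp_all add: right_diff_distrib[symmetric])
    then have "d \<xi> \<eta> = 0" by (simp add: add_eq_0_iff)
    then show "cinner \<xi> (E (x \<odot> y) \<eta>) = cinner \<xi> ((E x \<odot> y) \<eta>)" by (simp add: d_def)
  qed
  have E_mod': "E (y \<odot> x) = y \<odot> E x" if xy: "x \<in> M" "y \<in> M" "E y = y" for x y
  proof -
    have "E (y \<odot> x) = E (adj (adj x \<odot> adj y))"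
      using xy by (simp add: M.adj_comp_in M.adj M.adj_adj_in)
    also have "\<dots> = adj (E (adj x \<odot> adj y))" using xy by (intro E_adj M.comp M.adj)
    also have "E (adj x \<odot> adj y) = E (adj x) \<odot> adj y"
      using xy by (intro E_mod M.adj) (auto simp: E_adj)
    also have "adj \<dots> = y \<odot> E x" using xy by (simp add: E_adj M.adj_comp_in M.adj EM M.adj_adj_in)
    finally show ?thesis .
  qed
  have "pre_framed M E u k"
  proof unfold_locales
    show "\<exists>C. \<forall>x\<in>M. norm (E x) \<le> C * norm x" using E_norm by (intro exI[of _ 1]) simp
    show "E (unit_of M) = unit_of M" using Ee by (simp add: M.e_def)
    show "E (E x) = E x" if "x \<in> M" for x using EN[OF that] N by simp
  qed (use u in \<open>simp_all add: EM E_add E_scale E_adj E_mod' flip: u(2)\<close>)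
  then show thesis using N that by blast
qed

lemma sigma_weak_summable:
  fixes \<xi> \<eta> :: "nat \<Rightarrow> 'h::complex_hilbert_space"
  assumes "summable (\<lambda>n. (norm (\<xi> n))\<^sup>2)" "summable (\<lambda>n. (norm (\<eta> n))\<^sup>2)"
  shows "summable (\<lambda>n. cinner (\<xi> n) (blinfun_apply T (\<eta> n)))"
proof (rule summable_comparison_test')
  show "summable (\<lambda>n. norm T * ((norm (\<xi> n))\<^sup>2 + (norm (\<eta> n))\<^sup>2))"
    by (intro summable_mult summable_add assms)
  fix n
  have "cmod (cinner (\<xi> n) (T (\<eta> n))) \<le> norm (\<xi> n) * norm (T (\<eta> n))" by (rule norm_cinner_le)
  also have "\<dots> \<le> norm (\<xi> n) * (norm T * norm (\<eta> n))" by (intro mult_left_mono norm_blinfun) auto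
  also have "\<dots> = norm T * (norm (\<xi> n) * norm (\<eta> n))" by simp
  also have "\<dots> \<le> norm T * ((norm (\<xi> n))\<^sup>2 + (norm (\<eta> n))\<^sup>2)"
  proof (rule mult_left_mono)
    have "0 \<le> (norm (\<xi> n))\<^sup>2 + (norm (\<eta> n))\<^sup>2" "2 * norm (\<xi> n) * norm (\<eta> n) \<le> (norm (\<xi> n))\<^sup>2 + (norm (\<eta> n))\<^sup>2"
      using sum_squares_bound by auto
    then show "norm (\<xi> n) * norm (\<eta> n) \<le> (norm (\<xi> n))\<^sup>2 + (norm (\<eta> n))\<^sup>2" by linarith
  qed simp
  finally show "cmod (cinner (\<xi> n) (T (\<eta> n))) \<le> norm T * ((norm (\<xi> n))\<^sup>2 + (norm (\<eta> n))\<^sup>2)" .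
qed

lemma blinfun_compose_id [simp]: "x \<odot> id_blinfun = x" "id_blinfun \<odot> x = x"
  by (rule blinfun_eqI, simp)+

lemma op_if_zero:
  "(if c then x else 0) \<odot> y = (if c then x \<odot> y else 0)"
  "y \<odot> (if c then x else 0) = (if c then y \<odot> x else 0)"
  "adj (if c then x else 0) = (if c then adj x else 0)"
  by auto

section \<open>Matrix algebras acting on the original Hilbert space\<close>

locale isometries =
  fixes S :: "nat \<Rightarrow> 'h::complex_hilbert_space operator"
  assumes S_bounded: "S i \<in> bounded_operators"
    and S_orthogonal: "adj (S i) \<odot> S j = (if i = j then id_blinfun else 0)"
begin

lemma S_adj_bounded: "adj (S i) \<in> bounded_operators"
  by (simp add: adj_in S_bounded)

lemma S_orthogonal': "adj (S i) \<odot> (S j \<odot> x) = (if i = j then x else 0)"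
proof -
  have "adj (S i) \<odot> (S j \<odot> x) = (adj (S i) \<odot> S j) \<odot> x" by (simp add: blinfun_compose_assoc)
  also have "\<dots> = (if i = j then x else 0)" by (auto simp: S_orthogonal intro: blinfun_eqI)
  finally show ?thesis .
qed

lemma norm_S: "norm (S i) \<le> 1" "norm (adj (S i)) \<le> 1"
proof -
  have "(norm (S i))\<^sup>2 = norm (id_blinfun :: 'h operator)"
    using norm_adj_compose(1)[OF S_bounded, of i] by (simp add: S_orthogonal)
  also have "\<dots> \<le> 1" by (rule norm_blinfun_bound) auto
  finally have "(norm (S i))\<^sup>2 \<le> 1\<^sup>2" by simp
  then show "norm (S i) \<le> 1" by (rule power2_le_imp_le) simp
  then show "norm (adj (S i)) \<le> 1" by (simp add: norm_adj_compose S_bounded)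
qed

definition entry :: "'h operator \<Rightarrow> nat \<Rightarrow> nat \<Rightarrow> 'h operator" where
  "entry x i j = adj (S i) \<odot> (x \<odot> S j)"

definition mat :: "nat \<Rightarrow> (nat \<Rightarrow> nat \<Rightarrow> 'h operator) \<Rightarrow> 'h operator" where
  "mat k a = (\<Sum>i<k. \<Sum>j<k. S i \<odot> (a i j \<odot> adj (S j)))"

definition pr :: "nat \<Rightarrow> 'h operator" where
  "pr k = (\<Sum>i<k. S i \<odot> adj (S i))"

text \<open>The \<open>k\<close> by \<open>k\<close> matrices over \<open>A\<close>, placed on the
  ranges of the first \<open>k\<close> isometries. The compression is by \<open>pr k\<close> and not
  by the unit of the matrix algebra: the unit of \<open>A\<close> may be smaller than the identity,
  and in this form the same condition applies to every set of entries.\<close>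

definition amp :: "nat \<Rightarrow> 'h operator set \<Rightarrow> 'h operator set" where
  "amp k A = {x \<in> bounded_operators. pr k \<odot> x = x \<and> x \<odot> pr k = x \<and> (\<forall>i<k. \<forall>j<k. entry x i j \<in> A)}"

lemma pr_bounded: "pr k \<in> bounded_operators"
  unfolding pr_def by (intro bounded_operators_sum bounded_operators_closure S_bounded S_adj_bounded)

lemma mat_bounded:
  "(\<And>i j. i < k \<Longrightarrow> j < k \<Longrightarrow> a i j \<in> bounded_operators) \<Longrightarrow> mat k a \<in> bounded_operators"
  unfolding mat_def
  by (intro bounded_operators_sum bounded_operators_closure S_bounded S_adj_bounded) auto

lemma entry_bounded: "x \<in> bounded_operators \<Longrightarrow> entry x i j \<in> bounded_operators"
  unfolding entry_def by (intro bounded_operators_closure S_bounded S_adj_bounded)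

lemma mat_cong: "(\<And>i j. i < k \<Longrightarrow> j < k \<Longrightarrow> a i j = b i j) \<Longrightarrow> mat k a = mat k b"
  unfolding mat_def by (intro sum.cong) auto

lemma entry_mat: 
  assumes "i < k" "j < k" shows "entry (mat k a) i j = a i j"
proof -
  have "adj (S i) \<odot> (S l \<odot> (a l m \<odot> adj (S m)) \<odot> S j) = (if i = l then (if m = j then a l m else 0) else 0)" for l m
    by (auto simp: blinfun_compose_assoc S_orthogonal S_orthogonal')
  then have "entry (mat k a) i j = (\<Sum>l<k. \<Sum>m<k. if i = l then (if m = j then a l m else 0) else 0)"
    unfolding entry_def mat_def by (simp only: blinfun_compose.sum_left blinfun_compose.sum_right)
  also have "\<dots> = a i j"
  proof -
    have "(\<Sum>m<k. if i = l then (if m = j then a l m else 0) else 0) = (if i = l then a l j else 0)" for l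
      using assms by simp
    then show ?thesis using assms by simp
  qed
  finally show ?thesis .
qed

lemma pr_mat: "pr k \<odot> mat k a = mat k a" 
proof -
  have "pr k \<odot> S i = S i" if "i < k" for i
    using that unfolding pr_def
    by (simp add: blinfun_compose.sum_left blinfun_compose_assoc S_orthogonal op_if_zero)
  then have "pr k \<odot> (S i \<odot> x) = S i \<odot> x" if "i < k" for i x
    using that by (metis blinfun_compose_assoc)
  then show ?thesis
    unfolding mat_def blinfun_compose.sum_right by (intro sum.cong refl) auto
qed

lemma mat_pr: "mat k a \<odot> pr k = mat k a"
proof -
  have "adj (S i) \<odot> pr k = adj (S i)" if "i < k" for i
    using that unfolding pr_def
    by (simp add: blinfun_compose.sum_right S_orthogonal')
  then show ?thesis
    unfolding mat_def blinfun_compose.sum_left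
    by (intro sum.cong refl) (auto simp: blinfun_compose_assoc)
qed

lemma mat_entry: "pr k \<odot> x = x \<Longrightarrow> x \<odot> pr k = x \<Longrightarrow> mat k (entry x) = x"
proof -
  assume x: "pr k \<odot> x = x" "x \<odot> pr k = x"
  have "mat k (entry x) = pr k \<odot> (x \<odot> pr k)"
    unfolding mat_def entry_def pr_def
    by (simp add: blinfun_compose.sum_left blinfun_compose.sum_right blinfun_compose_assoc)
      (rule sum.swap)
  then show ?thesis using x by simp
qed

lemma mat_entry_amp: "x \<in> amp k A \<Longrightarrow> mat k (entry x) = x"
  by (simp add: amp_def mat_entry)

lemma mat_in_amp:
  "A \<subseteq> bounded_operators \<Longrightarrow> (\<And>i j. i < k \<Longrightarrow> j < k \<Longrightarrow> a i j \<in> A) \<Longrightarrow> mat k a \<in> amp k A"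
  unfolding amp_def by (auto simp: pr_mat mat_pr entry_mat intro!: mat_bounded)

lemma entry_in: "x \<in> amp k A \<Longrightarrow> i < k \<Longrightarrow> j < k \<Longrightarrow> entry x i j \<in> A"
  by (simp add: amp_def)

lemma amp_bounded: "amp k A \<subseteq> bounded_operators"
  by (auto simp: amp_def)

lemma amp_eqI:
  assumes "x \<in> amp k A" "y \<in> amp k B" "\<And>i j. i < k \<Longrightarrow> j < k \<Longrightarrow> entry x i j = entry y i j"
  shows "x = y"
  using mat_cong[of k "entry x" "entry y"] assms by (simp add: mat_entry_amp)

lemma entry_add: "entry (x + y) i j = entry x i j + entry y i j"
  by (simp add: entry_def blinfun_compose.add_left blinfun_compose.add_right)

lemma entry_sum: "entry (\<Sum>l\<in>I. x l) i j = (\<Sum>l\<in>I. entry (x l) i j)"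
  by (simp add: entry_def blinfun_compose.sum_left blinfun_compose.sum_right)

lemma entry_scale: "entry (c *\<^sub>O x) i j = c *\<^sub>O entry x i j"
  by (simp add: entry_def op_scale_compose_left op_scale_compose_right S_adj_bounded)

lemma entry_adj: "x \<in> bounded_operators \<Longrightarrow> entry (adj x) i j = adj (entry x j i)"
  by (simp add: entry_def adj_compose adj_adj bounded_operators_closure S_bounded S_adj_bounded
      blinfun_compose_assoc)

lemma entry_comp: 
  assumes "x \<in> amp k A"
  shows "entry (x \<odot> y) i j = (\<Sum>l<k. entry x i l \<odot> entry y l j)"
proof -
  have "x \<odot> y = (x \<odot> pr k) \<odot> y" using assms by (simp add: amp_def)
  then have "entry (x \<odot> y) i j = adj (S i) \<odot> (((x \<odot> pr k) \<odot> y) \<odot> S j)" by (simp only: entry_def)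
  also have "\<dots> = (\<Sum>l<k. entry x i l \<odot> entry y l j)"
    unfolding pr_def entry_def
    by (simp add: blinfun_compose.sum_left blinfun_compose.sum_right blinfun_compose_assoc)
  finally show ?thesis .
qed

lemma entry_wot [wot_intros]: "wot_continuous_op A (\<lambda>x. entry x i j)"
  unfolding entry_def by (intro wot_intros S_adj_bounded)

lemma norm_entry: "norm (entry x i j) \<le> norm x"
proof -
  have "norm (entry x i j) \<le> norm (adj (S i)) * norm (x \<odot> S j)"
    unfolding entry_def by (rule norm_blinfun_compose)
  also have "\<dots> \<le> 1 * (norm x * 1)"
    by (intro mult_mono norm_S order_trans[OF norm_blinfun_compose]) auto
  finally show ?thesis by simp
qed

lemma norm_mat: "norm (mat k a) \<le> (\<Sum>i<k. \<Sum>j<k. norm (a i j))"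
  unfolding mat_def
proof (intro order_trans[OF norm_sum] sum_mono)
  fix i j
  have "norm (S i \<odot> (a i j \<odot> adj (S j))) \<le> norm (S i) * norm (a i j \<odot> adj (S j))"
    by (rule norm_blinfun_compose)
  also have "\<dots> \<le> 1 * (norm (a i j) * 1)"
    by (intro mult_mono norm_S order_trans[OF norm_blinfun_compose]) auto
  finally show "norm (S i \<odot> (a i j \<odot> adj (S j))) \<le> norm (a i j)" by simp
qed

context
  fixes A :: "'h operator set"
  assumes vA: "von_neumann_algebra A"
begin

interpretation vN_algebra A by unfold_locales (rule vA)

lemma amp_closure:
  "0 \<in> amp k A"
  "x \<in> amp k A \<Longrightarrow> y \<in> amp k A \<Longrightarrow> x + y \<in> amp k A"
  "x \<in> amp k A \<Longrightarrow> y \<in> amp k A \<Longrightarrow> x \<odot> y \<in> amp k A"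
  "x \<in> amp k A \<Longrightarrow> c *\<^sub>O x \<in> amp k A"
  "x \<in> amp k A \<Longrightarrow> adj x \<in> amp k A"
proof -
  have adj_pr: "adj (pr k) = pr k"
    by (simp add: pr_def adj_sum adj_compose adj_adj bounded_operators_closure S_bounded S_adj_bounded)
  show "0 \<in> amp k A" by (simp add: amp_def entry_def bounded_operators_closure zero)
  show "x + y \<in> amp k A" if "x \<in> amp k A" "y \<in> amp k A"
    using that by (auto simp: amp_def bounded_operators_closure blinfun_compose.add_left
        blinfun_compose.add_right entry_add add)
  show "c *\<^sub>O x \<in> amp k A" if "x \<in> amp k A"
    using that by (auto simp: amp_def bounded_operators_closure op_scale_compose_left
        op_scale_compose_right pr_bounded entry_scale scale)
  show "adj x \<in> amp k A" if x: "x \<in> amp k A"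
  proof -
    have "x \<in> bounded_operators" "pr k \<odot> x = x" "x \<odot> pr k = x" using x by (auto simp: amp_def)
    then have "pr k \<odot> adj x = adj x" "adj x \<odot> pr k = adj x"
      using adj_compose[of x "pr k"] adj_compose[of "pr k" x] by (auto simp: pr_bounded adj_pr)
    then show ?thesis using x by (auto simp: amp_def adj_in entry_adj adj)
  qed
  show "x \<odot> y \<in> amp k A" if x: "x \<in> amp k A" and y: "y \<in> amp k A"
  proof -
    have "entry (x \<odot> y) i j \<in> A" if "i < k" "j < k" for i j
      using x y that unfolding entry_comp[OF x] by (intro sum comp) (auto intro: entry_in)
    moreover have "pr k \<odot> (x \<odot> y) = x \<odot> y" "x \<odot> y \<odot> pr k = x \<odot> y"
      using x y by (auto simp: amp_def blinfun_compose_assoc) (metis blinfun_compose_assoc)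
    ultimately show ?thesis using x y by (auto simp: amp_def bounded_operators_closure)
  qed
qed

definition unit_mat :: "nat \<Rightarrow> 'h operator" where
  "unit_mat k = mat k (\<lambda>i j. if i = j then unit_of A else 0)"

lemma unit_mat_in: "unit_mat k \<in> amp k A"
  unfolding unit_mat_def using e_in zero
  by (intro mat_in_amp) (auto simp: e_def in_bounded)

lemma unit_mat_left: 
  assumes x: "x \<in> amp k A" shows "unit_mat k \<odot> x = x"
proof (rule amp_eqI[OF _ x])
  show "unit_mat k \<odot> x \<in> amp k A" by (intro amp_closure unit_mat_in x)
  fix i j assume ij: "i < k" "j < k"
  have "entry (unit_mat k \<odot> x) i j = (\<Sum>l<k. entry (unit_mat k) i l \<odot> entry x l j)"
    by (rule entry_comp[OF unit_mat_in])
  also have "\<dots> = (\<Sum>l<k. if i = l then e \<odot> entry x l j else 0)"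
    using ij by (intro sum.cong) (auto simp: unit_mat_def entry_mat e_def)
  also have "\<dots> = entry x i j" using ij entry_in[OF x] by (simp add: e_left)
  finally show "entry (unit_mat k \<odot> x) i j = entry x i j" .
qed

lemma unit_mat_right: 
  assumes x: "x \<in> amp k A" shows "x \<odot> unit_mat k = x"
proof (rule amp_eqI[OF _ x])
  show "x \<odot> unit_mat k \<in> amp k A" by (intro amp_closure unit_mat_in x)
  fix i j assume ij: "i < k" "j < k"
  have "entry (x \<odot> unit_mat k) i j = (\<Sum>l<k. entry x i l \<odot> entry (unit_mat k) l j)"
    by (rule entry_comp[OF x])
  also have "\<dots> = (\<Sum>l<k. if l = j then entry x i l \<odot> e else 0)"
    using ij by (intro sum.cong) (auto simp: unit_mat_def entry_mat e_def)
  also have "\<dots> = entry x i j" using ij entry_in[OF x] by (simp add: e_right)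
  finally show "entry (x \<odot> unit_mat k) i j = entry x i j" .
qed

lemma amp_vN: "von_neumann_algebra (amp k A)"
proof (rule von_neumann_algebraI[where e = "unit_mat k"])
  have "closedin weak_operator_topology
    ({x \<in> {x \<in> bounded_operators. pr k \<odot> x = x}. x \<odot> pr k = x} \<inter>
      (\<Inter>(i, j)\<in>{..<k} \<times> {..<k} \<union> {}. {x \<in> bounded_operators. entry x i j \<in> A}))"
  \<comment> \<open>For \<open>k = 0\<close> there are no entry conditions, and the intersection
    over the index pairs is empty.\<close>
  proof (cases "k = 0")
    case True
    have "closedin weak_operator_topology {x \<in> {x \<in> bounded_operators. pr k \<odot> x = x}. x \<odot> pr k = x}"
      by (intro closedin_wot_eq closedin_wot_bounded_operators wot_intros pr_bounded)
    then show ?thesis using True by simp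
  next
    case False
    then show ?thesis
      by (intro closedin_Int closedin_wot_eq closedin_wot_bounded_operators wot_intros pr_bounded closedin_INT)
        (auto intro!: closedin_wot_preimage closedin_wot_bounded_operators wot_closed wot_intros entry_bounded)
  qed
  moreover have "{x \<in> {x \<in> bounded_operators. pr k \<odot> x = x}. x \<odot> pr k = x} \<inter>
      (\<Inter>(i, j)\<in>{..<k} \<times> {..<k} \<union> {}. {x \<in> bounded_operators. entry x i j \<in> A}) = amp k A"
    by (auto simp: amp_def)
  ultimately show "closedin weak_operator_topology (amp k A)" by simp
qed (use amp_bounded in \<open>auto simp: amp_closure unit_mat_in unit_mat_left unit_mat_right\<close>)

lemma amp_unit: "unit_of (amp k A) = unit_mat k"
  by (rule unit_of_eqI) (auto simp: unit_mat_in unit_mat_left unit_mat_right)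

definition diag_unit :: "nat \<Rightarrow> 'h operator" where
  "diag_unit i = S i \<odot> (unit_of A \<odot> adj (S i))"

lemma diag_unit_mat: "i < k \<Longrightarrow> diag_unit i = mat k (\<lambda>a b. if a = i \<and> b = i then unit_of A else 0)"
proof -
  assume i: "i < k"
  have "mat k (\<lambda>a b. if a = i \<and> b = i then unit_of A else 0)
     = (\<Sum>a<k. if a = i then (\<Sum>b<k. if b = i then S a \<odot> (unit_of A \<odot> adj (S b)) else 0) else 0)"
    unfolding mat_def by (intro sum.cong) (auto simp: op_if_zero intro!: sum.neutral sum.cong)
  then show ?thesis using i by (simp add: diag_unit_def)
qed

lemma diag_unit_projection:
  assumes "i < k" shows "diag_unit i \<in> projections (amp k A)"
proof -
  have e: "unit_of A \<in> A" "adj (unit_of A) = unit_of A" "unit_of A \<odot> (unit_of A \<odot> x) = unit_of A \<odot> x" for x :: "'h operator"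
    using e_in adj_e e_left[OF e_in] by (auto simp: e_def simp flip: blinfun_compose_assoc)
  have "diag_unit i \<in> amp k A"
    unfolding diag_unit_mat[OF assms] using e zero in_bounded by (intro mat_in_amp) auto
  moreover have "adj (diag_unit i) = diag_unit i"
    unfolding diag_unit_def using in_bounded[OF e(1)] e
    by (simp add: adj_compose adj_adj bounded_operators_closure S_bounded S_adj_bounded
      blinfun_compose_assoc)
  moreover have "diag_unit i \<odot> diag_unit i = diag_unit i"
    unfolding diag_unit_def using e by (simp add: blinfun_compose_assoc S_orthogonal')
  ultimately show ?thesis by (simp add: projections_def)
qed

lemma sum_diag_unit: "(\<Sum>i<k. diag_unit i) = unit_mat k"
proof -
  have "(\<Sum>j<k. S i \<odot> ((if i = j then unit_of A else 0) \<odot> adj (S j)))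
      = (\<Sum>j<k. if i = j then S i \<odot> (unit_of A \<odot> adj (S j)) else 0)" for i
    by (intro sum.cong) auto
  then show ?thesis by (simp add: diag_unit_def unit_mat_def mat_def)
qed

text \<open>Sandwiching between \<open>S i\<close> and its adjoint is an isomorphism of
  \<open>A\<close> onto this corner; its inverse reads off the diagonal entry.\<close>

lemma P_diag_corner:
  assumes P: "ideal_prop P" and i: "i < k"
  shows "P (corner (diag_unit i) (amp k A)) \<longleftrightarrow> P A"
proof -
  interpret P: ideal_prop P by fact
  interpret C: vN_algebra "amp k A" by unfold_locales (rule amp_vN)
  note pr = diag_unit_projection[OF i]
  have e: "e = unit_of A" by (simp add: e_def)
  have in_c: "S i \<odot> (x \<odot> adj (S i)) \<in> corner (diag_unit i) (amp k A)" if x: "x \<in> A" for x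
  proof -
    have *: "S i \<odot> (x \<odot> adj (S i)) = mat k (\<lambda>a b. if a = i \<and> b = i then x else 0)"
    proof -
      have "mat k (\<lambda>a b. if a = i \<and> b = i then x else 0)
         = (\<Sum>a<k. if a = i then (\<Sum>b<k. if b = i then S a \<odot> (x \<odot> adj (S b)) else 0) else 0)"
        unfolding mat_def by (intro sum.cong) (auto simp: op_if_zero intro!: sum.neutral sum.cong)
      then show ?thesis using i by simp
    qed
    have "S i \<odot> (x \<odot> adj (S i)) \<in> amp k A"
      unfolding * using x zero in_bounded by (intro mat_in_amp) auto
    moreover have "unit_of A \<odot> (x \<odot> y) = x \<odot> y" "x \<odot> (unit_of A \<odot> y) = x \<odot> y" for y :: "'h operator"
      using e_left[OF x] e_right[OF x] unfolding e by (simp_all flip: blinfun_compose_assoc)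
    ultimately show ?thesis
      by (simp add: C.corner_eq[OF pr]) (simp add: diag_unit_def blinfun_compose_assoc S_orthogonal')
  qed
  have "P A \<longleftrightarrow> P (corner (diag_unit i) (amp k A))"
  proof (rule P.iso_iff[OF vA C.corner_vN(1)[OF pr], where \<phi> = "\<lambda>x. S i \<odot> (x \<odot> adj (S i))"])
    show "bij_betw (\<lambda>x. S i \<odot> (x \<odot> adj (S i))) A (corner (diag_unit i) (amp k A))"
    proof (rule bij_betw_byWitness[where f' = "\<lambda>y. entry y i i"])
      show "\<forall>x\<in>A. entry (S i \<odot> (x \<odot> adj (S i))) i i = x"
        by (auto simp: entry_def blinfun_compose_assoc S_orthogonal S_orthogonal' intro!: blinfun_eqI)
      show "(\<lambda>x. S i \<odot> (x \<odot> adj (S i))) ` A \<subseteq> corner (diag_unit i) (amp k A)" using in_c by auto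
      show "(\<lambda>y. entry y i i) ` corner (diag_unit i) (amp k A) \<subseteq> A"
        using C.corner_subset[OF pr] entry_in i by blast
      show "\<forall>y\<in>corner (diag_unit i) (amp k A). S i \<odot> (entry y i i \<odot> adj (S i)) = y"
      proof
        fix y assume y: "y \<in> corner (diag_unit i) (amp k A)"
        then have yA: "y \<in> amp k A" and y2: "diag_unit i \<odot> y = y" "y \<odot> diag_unit i = y"
          by (auto simp: C.corner_eq[OF pr])
        have "y = diag_unit i \<odot> (y \<odot> diag_unit i)" using y2 by simp
        also have "\<dots> = S i \<odot> ((unit_of A \<odot> entry y i i \<odot> unit_of A) \<odot> adj (S i))"
          by (simp add: diag_unit_def entry_def blinfun_compose_assoc)
        also have "unit_of A \<odot> entry y i i \<odot> unit_of A = entry y i i"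
          using e_left e_right entry_in[OF yA i i] by (simp add: e)
        finally show "S i \<odot> (entry y i i \<odot> adj (S i)) = y" by simp
      qed
    qed
  qed (auto simp: blinfun_compose.add_left blinfun_compose.add_right blinfun_compose_assoc S_orthogonal'
      op_scale_compose_left op_scale_compose_right S_bounded adj_compose adj_adj bounded_operators_closure
      S_adj_bounded in_bounded)
  then show ?thesis by simp
qed

text \<open>The unit of the matrix algebra is the supremum of \<open>k\<close> diagonal units whose
  corners are copies of \<open>A\<close>. This is where closure under finite suprema is used; the
  converse below uses closure under smaller projections.\<close>

lemma P_amp:
  assumes P: "ideal_prop P" and PA: "P A"
  shows "P (amp k A)"
proof -
  interpret P: ideal_prop P by fact
  interpret C: vN_algebra "amp k A" by unfold_locales (rule amp_vN)
  have "unit_mat k \<in> property_projections P (amp k A)"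
  proof (rule P.finite_sup[OF amp_vN])
    show "finite (diag_unit ` {..<k})" by simp
    show "diag_unit ` {..<k} \<subseteq> property_projections P (amp k A)"
      using P_diag_corner[OF P] PA diag_unit_projection by (auto simp: property_projections_def)
    show "is_proj_sup (amp k A) (diag_unit ` {..<k}) (unit_mat k)"
      unfolding is_proj_sup_def
    proof (intro conjI ballI impI)
      show "unit_mat k \<in> projections (amp k A)" using C.e_projection by (simp add: C.e_def amp_unit)
      show "proj_le p (unit_mat k)" if "p \<in> diag_unit ` {..<k}" for p
        using that diag_unit_projection unit_mat_left by (auto simp: proj_le_def projections_def)
      fix r assume "\<forall>p\<in>diag_unit ` {..<k}. proj_le p r"
      then have "(\<Sum>i<k. r \<odot> diag_unit i) = (\<Sum>i<k. diag_unit i)" by (simp add: proj_le_def)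
      then show "proj_le (unit_mat k) r"
        unfolding proj_le_def sum_diag_unit[symmetric] by (simp add: blinfun_compose.sum_right)
    qed
  qed
  then show ?thesis using P.unit_property[OF amp_vN] by (simp add: amp_unit)
qed

lemma P_unamp:
  assumes P: "ideal_prop P" and PA: "P (amp k A)" and k: "k > 0"
  shows "P A"
  using P_diag_corner[OF P k] ideal_prop.corner_property[OF P amp_vN PA diag_unit_projection[OF k]]
  by simp

end

end

section \<open>Descent along expectations with a frame\<close>

locale framed_isometries = framed A F u k + isometries S
  for A :: "'h::complex_hilbert_space operator set" and F u k and S :: "nat \<Rightarrow> 'h operator"
begin

definition amp_F :: "nat \<Rightarrow> 'h operator \<Rightarrow> 'h operator" where
  "amp_F m x = mat m (\<lambda>i j. F (entry x i j))"

definition amp_u :: "nat \<Rightarrow> 'h operator" where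
  "amp_u r = mat k (\<lambda>a b. if a = r then u b else 0)"

lemma A_bounded: "A \<subseteq> bounded_operators"
  using in_bounded by blast

lemma amp_F_in: "x \<in> amp m A \<Longrightarrow> amp_F m x \<in> amp m A"
  unfolding amp_F_def by (intro mat_in_amp A_bounded F_in entry_in)

lemma entry_amp_F: "i < m \<Longrightarrow> j < m \<Longrightarrow> entry (amp_F m x) i j = F (entry x i j)"
  unfolding amp_F_def by (rule entry_mat)

lemma amp_u_in: "r < k \<Longrightarrow> amp_u r \<in> amp k A"
  unfolding amp_u_def using u_in zero by (intro mat_in_amp A_bounded) auto

lemma entry_amp_u: "i < k \<Longrightarrow> j < k \<Longrightarrow> entry (amp_u r) i j = (if i = r then u j else 0)"
  by (simp add: amp_u_def entry_mat)

lemma entry_adj_amp_u: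
  assumes r: "r < k" and ij: "i < k" "j < k"
  shows "entry (adj (amp_u r) \<odot> x) i j = adj (u i) \<odot> entry x r j"
proof -
  have "entry (adj (amp_u r) \<odot> x) i j = (\<Sum>l<k. entry (adj (amp_u r)) i l \<odot> entry x l j)"
    by (intro entry_comp[where A = A] amp_closure[OF vN] amp_u_in r)
  also have "\<dots> = (\<Sum>l<k. if l = r then adj (u i) \<odot> entry x l j else 0)"
    using ij amp_u_in[OF r] amp_bounded
    by (intro sum.cong refl) (subst entry_adj, auto simp: amp_u_def entry_mat)
  finally show ?thesis using r by simp
qed

text \<open>A \<sigma>-weak functional of a matrix is a finite sum of \<sigma>-weak functionals of
  its entries, taken at the sequences moved by the adjoints of the isometries. These sequences stay
  square summable because the adjoints are contractions.\<close>

lemma amp_sigma_weak: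
  assumes "\<phi> \<in> sigma_weak_functionals"
  shows "wot_continuous (amp m A) \<phi>"
proof -
  obtain \<xi> \<eta> where \<phi>: "\<phi> = (\<lambda>T. \<Sum>n. cinner (\<xi> n) (T (\<eta> n)))"
    and s: "summable (\<lambda>n. (norm (\<xi> n))\<^sup>2)" "summable (\<lambda>n. (norm (\<eta> n))\<^sup>2)"
    using assms by (auto simp: sigma_weak_functionals_def)
  have le: "(norm (adj (S i) v))\<^sup>2 \<le> (norm v)\<^sup>2" for i v
  proof (rule power_mono)
    have "norm (adj (S i) v) \<le> norm (adj (S i)) * norm v" by (rule norm_blinfun)
    also have "\<dots> \<le> 1 * norm v" by (intro mult_right_mono norm_S) auto
    finally show "norm (adj (S i) v) \<le> norm v" by simp
  qed simp
  have s': "summable (\<lambda>n. (norm (adj (S i) (\<xi> n)))\<^sup>2)" "summable (\<lambda>n. (norm (adj (S i) (\<eta> n)))\<^sup>2)" for i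
    by (rule summable_comparison_test'[OF s(1)], simp add: le,
        rule summable_comparison_test'[OF s(2)], simp add: le)
  define \<psi> where "\<psi> i j = (\<lambda>T. \<Sum>n. cinner (adj (S i) (\<xi> n)) (blinfun_apply T (adj (S j) (\<eta> n))))" for i j
  have \<psi>: "\<psi> i j \<in> sigma_weak_functionals" for i j
    unfolding \<psi>_def sigma_weak_functionals_def
    by (rule CollectI, rule exI[of _ "\<lambda>n. adj (S i) (\<xi> n)"], rule exI[of _ "\<lambda>n. adj (S j) (\<eta> n)"])
      (simp add: s')
  have "wot_continuous (amp m A) (\<lambda>x. \<Sum>i<m. \<Sum>j<m. \<psi> i j (entry x i j))"
    by (intro wot_continuous_sum wot_continuous_functional_compose[OF sigma_weak[OF \<psi>]] wot_intros A_bounded)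
      (auto intro: entry_in)
  moreover have "(\<Sum>i<m. \<Sum>j<m. \<psi> i j (entry x i j)) = \<phi> x" if x: "x \<in> amp m A" for x
  proof -
    have "\<phi> x = (\<Sum>n. cinner (\<xi> n) (mat m (entry x) (\<eta> n)))" using x by (simp add: \<phi> mat_entry_amp)
    also have "\<dots> = (\<Sum>n. \<Sum>i<m. \<Sum>j<m. cinner (adj (S i) (\<xi> n)) (entry x i j (adj (S j) (\<eta> n))))"
      by (simp add: mat_def blinfun.sum_left cinner.sum_right cinner_adj S_bounded)
    also have "\<dots> = (\<Sum>i<m. \<Sum>n. \<Sum>j<m. cinner (adj (S i) (\<xi> n)) (entry x i j (adj (S j) (\<eta> n))))"
      by (intro suminf_sum summable_sum sigma_weak_summable s')
    also have "\<dots> = (\<Sum>i<m. \<Sum>j<m. \<psi> i j (entry x i j))"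
      unfolding \<psi>_def by (intro sum.cong refl suminf_sum sigma_weak_summable s')
    finally show ?thesis by simp
  qed
  ultimately show ?thesis by (rule wot_continuous_cong)
qed

text \<open>The frame in row \<open>r\<close> of a matrix, for \<open>r < k\<close>, gives an orthonormal basis of the matrix algebra.\<close>

lemma amp_framed: "framed (amp k A) (amp_F k) amp_u k"
proof -
  note [simp] = entry_amp_F
  interpret C: vN_algebra "amp k A" by unfold_locales (rule amp_vN[OF vN])
  have cl: "x \<in> bounded_operators" if "x \<in> amp k A" for x using that by (simp add: amp_def)
  show ?thesis
  proof unfold_locales
    fix x y assume x: "x \<in> amp k A" and y: "y \<in> amp k A"
    show "amp_F k (x + y) = amp_F k x + amp_F k y"
      by (rule amp_eqI[of _ k A _ A]) (auto simp: entry_add F_add entry_in[OF x] entry_in[OF y] intro!: amp_F_in C.add x y)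
    assume fixed: "amp_F k x = x"
    have Fx: "F (entry x i j) = entry x i j" if "i < k" "j < k" for i j
      using entry_amp_F[OF that, of x] by (simp add: fixed)
    show "amp_F k (x \<odot> y) = x \<odot> amp_F k y"
    proof (rule amp_eqI[of _ k A _ A])
      fix i j assume ij: "i < k" "j < k"
      have "entry (amp_F k (x \<odot> y)) i j = F (\<Sum>l<k. entry x i l \<odot> entry y l j)"
        using ij by (simp add: entry_comp[OF x])
      also have "\<dots> = (\<Sum>l<k. F (entry x i l \<odot> entry y l j))"
        using ij x y by (intro F_sum) (auto intro!: comp entry_in)
      also have "\<dots> = (\<Sum>l<k. entry x i l \<odot> entry (amp_F k y) l j)"
        using ij x y by (intro sum.cong refl) (auto simp: F_left Fx entry_in)
      also have "\<dots> = entry (x \<odot> amp_F k y) i j" by (simp add: entry_comp[OF x])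
      finally show "entry (amp_F k (x \<odot> y)) i j = entry (x \<odot> amp_F k y) i j" .
    qed (intro amp_F_in C.comp x y)+
  next
    fix x c assume x: "x \<in> amp k A"
    show "amp_F k x \<in> amp k A" by (rule amp_F_in[OF x])
    show "amp_F k (c *\<^sub>O x) = c *\<^sub>O amp_F k x"
      by (rule amp_eqI[of _ k A _ A]) (auto simp: entry_scale F_scale entry_in[OF x] intro!: amp_F_in C.scale x)
    show "amp_F k (adj x) = adj (amp_F k x)"
      by (rule amp_eqI[of _ k A _ A])
        (auto simp: entry_adj cl F_adj entry_in[OF x] amp_F_in x intro!: amp_F_in C.adj x)
    show "amp_F k (amp_F k x) = amp_F k x"
      by (rule amp_eqI[of _ k A _ A]) (auto simp: F_idem entry_in[OF x] intro!: amp_F_in x)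
    show "(\<Sum>i<k. amp_u i \<odot> amp_F k (adj (amp_u i) \<odot> x)) = x"
    proof (rule amp_eqI[OF _ x])
      show "(\<Sum>i<k. amp_u i \<odot> amp_F k (adj (amp_u i) \<odot> x)) \<in> amp k A"
        by (intro C.sum C.comp amp_F_in C.adj x amp_u_in) auto
      fix i j assume ij: "i < k" "j < k"
      have "entry (\<Sum>r<k. amp_u r \<odot> amp_F k (adj (amp_u r) \<odot> x)) i j
        = (\<Sum>r<k. \<Sum>l<k. entry (amp_u r) i l \<odot> F (entry (adj (amp_u r) \<odot> x) l j))"
        unfolding entry_sum
        by (intro sum.cong refl, subst entry_comp[OF amp_u_in]) (use ij in auto)
      also have "\<dots> = (\<Sum>r<k. \<Sum>l<k. if i = r then u l \<odot> F (adj (u l) \<odot> entry x r j) else 0)"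
        using ij by (intro sum.cong refl) (auto simp: entry_adj_amp_u entry_amp_u)
      also have "\<dots> = (\<Sum>r<k. if i = r then (\<Sum>l<k. u l \<odot> F (adj (u l) \<odot> entry x r j)) else 0)"
        by (intro sum.cong refl) auto
      also have "\<dots> = entry x i j" using ij by (simp add: frame entry_in[OF x])
      finally show "entry (\<Sum>r<k. amp_u r \<odot> amp_F k (adj (amp_u r) \<odot> x)) i j = entry x i j" .
    qed
  next
    show "amp_F k (unit_of (amp k A)) = unit_of (amp k A)"
      unfolding amp_unit[OF vN] by (rule amp_eqI[of _ k A _ A])
        (auto simp: unit_mat_def[OF vN] entry_mat F_e F_zero intro!: amp_F_in unit_mat_in[OF vN, unfolded unit_mat_def[OF vN]])
    show "\<exists>C. \<forall>x\<in>amp k A. norm (amp_F k x) \<le> C * norm x"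
    proof (intro exI ballI)
      fix x assume x: "x \<in> amp k A"
      have "norm (amp_F k x) \<le> (\<Sum>i<k. \<Sum>j<k. norm (F (entry x i j)))"
        unfolding amp_F_def by (rule norm_mat)
      also have "\<dots> \<le> (\<Sum>i<k. \<Sum>j<k. norm x)"
        using x by (intro sum_mono order_trans[OF F_contractive norm_entry]) (auto intro: entry_in)
      finally show "norm (amp_F k x) \<le> (real k * real k) * norm x" by simp
    qed
    show "amp_u i \<in> amp k A" if "i < k" for i by (rule amp_u_in[OF that])
    show "wot_continuous (amp k A) \<phi>" if "\<phi> \<in> sigma_weak_functionals" for \<phi>
      by (rule amp_sigma_weak[OF that])
    show "wot_continuous_op (amp k A) (amp_F k)"
      unfolding amp_F_def mat_def
      by (intro wot_intros S_bounded wot_continuous_op_compose[OF F_wot] A_bounded) (auto intro: entry_in)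
  qed
qed

text \<open>The descent hypothesis is invoked for matrices, where the frame has become a basis;
  \<open>P_amp\<close> and \<open>P_unamp\<close> carry the property there and back.\<close>

theorem property_descends:
  assumes P: "ideal_prop P" and desc: "descends_strongly_PP P" and PA: "P A"
  shows "P B"
\<comment> \<open>Matrices of size zero remember nothing of \<open>B\<close>, but an empty frame
  leaves only the zero algebra.\<close>
proof (cases "k = 0")
  case True
  then have "x = 0" if "x \<in> A" for x using frame[OF that] by simp
  then have "A = {0}" using zero by auto
  moreover from this have "B = {0}" using B_closure(1) B_sub by auto
  ultimately show ?thesis using PA by simp
next
  case False
  interpret C: framed "amp k A" "amp_F k" amp_u k by (rule amp_framed)
  have CB: "C.B = amp k B"
  proof safe
    fix x assume "x \<in> C.B"
    then have x: "x \<in> amp k A" "amp_F k x = x" by (auto simp: C.B_def)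
    then show "x \<in> amp k B"
      using entry_amp_F[of _ k _ x] by (auto simp: amp_def B_def)
  next
    fix x assume x: "x \<in> amp k B"
    then have xA: "x \<in> amp k A" by (auto simp: amp_def B_def)
    moreover have "amp_F k x = x"
      by (rule amp_eqI[OF amp_F_in[OF xA] xA]) (auto simp: entry_amp_F F_B entry_in[OF x])
    ultimately show "x \<in> C.B" by (simp add: C.B_def)
  qed
  have gram: "entry (adj (amp_u r) \<odot> amp_u t) i j = (if r = t then adj (u i) \<odot> u j else 0)"
    if "r < k" "t < k" "i < k" "j < k" for r t i j
    using that by (simp add: entry_adj_amp_u) (simp add: amp_u_def entry_mat)
  have "strongly_PP_expectation (amp_F k) (amp k A) C.B"
  proof (rule C.strongly_PP)
    fix r t assume rt: "r < k" "t < k" "r \<noteq> t"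
    show "amp_F k (adj (amp_u r) \<odot> amp_u t) = 0"
      by (rule amp_eqI[of _ k A _ A])
        (use rt in \<open>auto intro!: amp_F_in C.comp C.adj amp_u_in C.zero simp: entry_amp_F gram F_zero\<close>, simp add: entry_def)
  next
    fix r assume r: "r < k"
    \<comment> \<open>\<open>G\<close> is the Gram matrix of the frame, the same for every row
      \<open>r\<close>; that it is idempotent is \<open>frame_product\<close>.\<close>
    define G where "G = amp_F k (adj (amp_u r) \<odot> amp_u r)"
    have GB: "G \<in> C.B" unfolding G_def by (intro C.F_in_B C.comp C.adj amp_u_in r)
    have GA: "G \<in> amp k A" using GB by (rule C.B_sub)
    have G: "entry G i j = F (adj (u i) \<odot> u j)" if "i < k" "j < k" for i j
      using that r by (simp add: G_def entry_amp_F gram)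
    have "adj G = G"
    proof (rule amp_eqI[OF C.adj[OF GA] GA])
      fix i j assume ij: "i < k" "j < k"
      then show "entry (adj G) i j = entry G i j"
        using GA by (simp add: entry_adj amp_def[of k A] G adj_comp_in u_in adj adj_adj_in comp flip: F_adj)
    qed
    moreover have "G \<odot> G = G"
    proof (rule amp_eqI[OF C.comp[OF GA GA] GA])
      fix i j assume ij: "i < k" "j < k"
      have "entry (G \<odot> G) i j = (\<Sum>l<k. F (adj (u i) \<odot> u l) \<odot> F (adj (u l) \<odot> u j))"
        using ij by (simp add: entry_comp[OF GA] G)
      also have "\<dots> = entry G i j" using ij by (simp add: frame_product u_in adj G)
      finally show "entry (G \<odot> G) i j = entry G i j" .
    qed
    ultimately show "amp_F k (adj (amp_u r) \<odot> amp_u r) \<in> projections C.B"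
      using GB by (simp add: projections_def G_def)
  qed
  moreover have "P (amp k A)" by (rule P_amp[OF vN P PA])
  ultimately have "P (amp k B)" using desc unfolding descends_strongly_PP_def CB by blast
  then show ?thesis using P_unamp[OF B_vN P] False by simp
qed

end

section \<open>The support of the expectation of a central projection\<close>

context vN_algebra
begin

text \<open>Restricting to self-adjoint central elements gives a commutative real algebra closed in
  norm, so that limits, products and square roots formed in it are again self-adjoint and
  central.\<close>

definition real_center :: "'h operator set" where
  "real_center = {x \<in> A. adj x = x \<and> (\<forall>b\<in>A. x \<odot> b = b \<odot> x)}"

lemma real_center_A: "x \<in> real_center \<Longrightarrow> x \<in> A"
  and real_center_adj: "x \<in> real_center \<Longrightarrow> adj x = x"
  and real_center_commute: "x \<in> real_center \<Longrightarrow> b \<in> A \<Longrightarrow> x \<odot> b = b \<odot> x"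
  by (auto simp: real_center_def)

lemma real_center_closure:
  "0 \<in> real_center" "e \<in> real_center"
  "x \<in> real_center \<Longrightarrow> y \<in> real_center \<Longrightarrow> x + y \<in> real_center"
  "x \<in> real_center \<Longrightarrow> y \<in> real_center \<Longrightarrow> x - y \<in> real_center"
  "x \<in> real_center \<Longrightarrow> r *\<^sub>R x \<in> real_center"
proof -
  show "0 \<in> real_center" "e \<in> real_center"
    by (auto simp: real_center_def zero e_in adj_e e_left e_right)
  show "x + y \<in> real_center" "x - y \<in> real_center" if "x \<in> real_center" "y \<in> real_center"
    using that by (auto simp: real_center_def add diff adj_add adj_diff in_bounded
      blinfun_compose.add_left blinfun_compose.add_right blinfun_compose.diff_left blinfun_compose.diff_right)
  show "r *\<^sub>R x \<in> real_center" if "x \<in> real_center"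
    using that by (auto simp: real_center_def scaleR blinfun_compose.scaleR_left blinfun_compose.scaleR_right)
      (simp add: scaleR_eq_op_scale adj_scale in_bounded)
qed

lemma real_center_comp:
  assumes "x \<in> real_center" "y \<in> real_center"
  shows "x \<odot> y \<in> real_center"
proof -
  have xy: "x \<in> A" "y \<in> A" using assms by (auto simp: real_center_def)
  have "adj (x \<odot> y) = x \<odot> y"
    using assms xy by (simp add: adj_comp_in real_center_adj real_center_commute)
  moreover have "x \<odot> y \<odot> b = b \<odot> (x \<odot> y)" if "b \<in> A" for b
    using real_center_commute[OF assms(1) that] real_center_commute[OF assms(2) that]
    by (metis blinfun_compose_assoc)
  ultimately show ?thesis using xy by (auto simp: real_center_def comp)
qed

lemma real_center_closed: "closed real_center"
proof -
  have "closed {x \<in> A. adj x = x}"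
  proof (rule continuous_closed_preimage_constant[of _ "\<lambda>x. adj x - x" 0, simplified])
    show "continuous_on A (\<lambda>x. adj x - x)"
      using in_bounded by (intro continuous_intros continuous_on_subset[OF continuous_on_adj]) auto
  qed (rule norm_closed)
  moreover have "closed {x. x \<odot> b = b \<odot> x}" for b
    by (intro closed_Collect_eq linear_continuous_on blinfun_compose.bounded_linear_left
        blinfun_compose.bounded_linear_right)
  then have "closed (\<Inter>b\<in>A. {x. x \<odot> b = b \<odot> x})" by (intro closed_INT ballI)
  moreover have "real_center = {x \<in> A. adj x = x} \<inter> (\<Inter>b\<in>A. {x. x \<odot> b = b \<odot> x})"
    by (auto simp: real_center_def)
  ultimately show ?thesis by (simp add: closed_Int)
qed

lemma central_projections_real_center:
  "p \<in> central_projections A \<longleftrightarrow> p \<in> real_center \<and> p \<odot> p = p"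
  by (auto simp: central_projections_def projections_def center_def real_center_def)

text \<open>The elements carried by \<open>s\<close> form a closed algebra with unit
  \<open>s\<close>, inside which the two contractions are iterated.\<close>

lemma real_center_sqrt:
  assumes s: "s \<in> real_center" "s \<odot> s = s" and b: "b \<in> real_center" "s \<odot> b = b" "norm b < 1"
  obtains d d' where "d \<in> real_center" "d' \<in> real_center" "s \<odot> d = d" "s \<odot> d' = d'"
    "d \<odot> d = s - b" "d \<odot> d' = s"
proof -
  define C where "C = {x \<in> real_center. s \<odot> x = x}"
  have comm: "x \<odot> s = x" if "x \<in> C" for x
    using that real_center_commute[OF s(1), of x] by (auto simp: C_def real_center_A)
  have "C = real_center \<inter> {x. s \<odot> x = x}" by (auto simp: C_def)
  moreover have "closed {x :: 'h operator. s \<odot> x = x}"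
    by (intro closed_Collect_eq linear_continuous_on blinfun_compose.bounded_linear_right bounded_linear_ident)
  ultimately have closed: "closed C" by (simp add: closed_Int real_center_closed)
  obtain d d' where "d \<in> C" "d' \<in> C" "d \<odot> d = s - b" "d \<odot> d' = s"
  proof (rule sqrt_inverse_exists[of C s b])
    show "closed C" by (rule closed)
    show "x \<odot> y \<in> C" if "x \<in> C" "y \<in> C" for x y
      using that by (auto simp: C_def real_center_comp simp flip: blinfun_compose_assoc)
    show "0 \<in> C" "s \<in> C" "b \<in> C" using s b by (auto simp: C_def real_center_closure)
    show "x + y \<in> C" if "x \<in> C" "y \<in> C" for x y
      using that by (auto simp: C_def real_center_closure blinfun_compose.add_right)
    show "r *\<^sub>R x \<in> C" if "x \<in> C" for x r
      using that by (auto simp: C_def real_center_closure blinfun_compose.scaleR_right)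
    show "s \<odot> x = x" "x \<odot> s = x" if "x \<in> C" for x
      using that comm by (auto simp: C_def)
  qed (use b(3) in auto)
  then show thesis using that by (auto simp: C_def)
qed

end

context framed_isometries
begin

interpretation BA: vN_algebra B
  by unfold_locales (rule B_vN)

lemma property_down:
  assumes P: "ideal_prop P" and desc: "descends_strongly_PP P"
    and z: "z \<in> central_projections A" and Pz: "P (corner z A)"
  obtains s where "s \<in> central_projections B" "P (corner s B)" "s \<odot> z = z"
proof -
  interpret P: ideal_prop P by fact
  have zpr: "z \<in> projections A" using z by (simp add: central_projections_def)
  have zA: "z \<in> A" and zz: "z \<odot> z = z" and adj_z: "adj z = z" and zc: "\<And>x. x \<in> A \<Longrightarrow> z \<odot> x = x \<odot> z"
    using z by (auto simp: central_projections_def projections_def center_def)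
  have zmz: "z \<odot> (m \<odot> z) = m \<odot> z" if "m \<in> A" for m
  proof -
    have "z \<odot> (m \<odot> z) = (z \<odot> m) \<odot> z" by (simp add: blinfun_compose_assoc)
    then show ?thesis by (simp add: zc[OF that] zz blinfun_compose_assoc)
  qed
  have Be: "BA.e = e" by (simp add: BA.e_def B_unit)
  define a where "a = F z"
  have aB: "a \<in> B" by (simp add: a_def F_in_B zA)
  have Fbz: "F (b \<odot> z) = b \<odot> a" and Fzb: "F (z \<odot> b) = a \<odot> b" if "b \<in> B" for b
    using that zA by (simp_all add: a_def F_left_B F_right)
  have aC: "a \<in> BA.real_center"
  proof -
    have "adj a = a" using F_adj[OF zA] by (simp add: a_def adj_z)
    moreover have "a \<odot> b = b \<odot> a" if "b \<in> B" for b
      using Fbz[OF that] Fzb[OF that] zc[OF B_sub[OF that]] by simp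
    ultimately show ?thesis using aB by (auto simp: BA.real_center_def)
  qed
  define y where "y = e - a"
  have yC: "y \<in> BA.real_center"
    unfolding y_def using BA.real_center_closure(2) aC by (simp add: BA.real_center_closure Be)
  have yB: "y \<in> B" and yA: "y \<in> A" using BA.real_center_A[OF yC] B_sub by auto
  \<comment> \<open>Below \<open>z\<close>, the Pimsner-Popa inequality bounds \<open>a\<close> from
    below by \<open>lam\<close> and hence \<open>y\<close> from above by \<open>r\<close>.\<close>
  define r where "r = 1 - lam"
  have r: "0 \<le> r" "r < 1" using lam_pos lam_le_1 by (auto simp: r_def)
  have norm_z: "norm z \<le> 1"
    by (rule norm_blinfun_bound) (auto simp: norm_projection_le[OF zpr])
  have zy: "norm (z \<odot> y) \<le> r"
  proof (rule norm_le_of_form_bound)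
    show "z \<odot> y \<in> bounded_operators" using zA yA by (simp add: comp in_bounded)
    show "adj (z \<odot> y) = z \<odot> y"
      using zA yA zc[OF yA] by (simp add: adj_comp_in adj_z BA.real_center_adj[OF yC])
    fix \<xi>
    define v where "v = z \<xi>"
    have ev: "e v = v" "z v = v" using e_left_apply[OF zA] projection_apply(1)[OF zpr] by (simp_all add: v_def)
    have "z \<odot> y = z \<odot> (y \<odot> z)" using zc[OF yA] zz by (metis blinfun_compose_assoc)
    then have "cinner \<xi> ((z \<odot> y) \<xi>) = cinner \<xi> (z (y v))" by (simp add: v_def)
    also have "\<dots> = cinner v (y v)" by (simp add: v_def projection_apply(2)[OF zpr])
    finally have eq: "Re (cinner \<xi> ((z \<odot> y) \<xi>)) = (norm v)\<^sup>2 - Re (cinner v (a v))"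
      by (simp add: y_def blinfun.diff_left cinner.diff_right ev cinner_self)
    have "lam * (norm v)\<^sup>2 \<le> Re (cinner v (a v))"
      using lam_bound[OF zA, of v] by (simp add: adj_z zz a_def ev)
    then have "Re (cinner \<xi> ((z \<odot> y) \<xi>)) \<le> r * (norm v)\<^sup>2" unfolding eq by (simp add: r_def algebra_simps)
    also have "\<dots> \<le> r * (norm \<xi>)\<^sup>2"
      unfolding v_def by (intro mult_left_mono power_mono norm_projection_le[OF zpr] r) auto
    finally show "Re (cinner \<xi> ((z \<odot> y) \<xi>)) \<le> r * (norm \<xi>)\<^sup>2" .
    have "Re (cinner v (a v)) \<le> cmod (cinner v (a v))" by (rule complex_Re_le_cmod)
    also have "\<dots> \<le> norm v * norm (a v)" by (rule norm_cinner_le)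
    also have "\<dots> \<le> norm v * (norm a * norm v)" by (intro mult_left_mono norm_blinfun) auto
    also have "\<dots> \<le> norm v * (1 * norm v)"
      using F_contractive[OF zA] norm_z by (intro mult_left_mono mult_right_mono) (auto simp: a_def)
    finally show "0 \<le> Re (cinner \<xi> ((z \<odot> y) \<xi>))" unfolding eq by (simp add: power2_eq_square)
  qed (rule r)
  define c where "c n = (((\<odot>) y) ^^ n) e" for n :: nat
  have c0: "c 0 = e" and cS: "c (Suc n) = y \<odot> c n" for n by (simp_all add: c_def)
  have cC: "c n \<in> BA.real_center" for n
    by (induction n) (use BA.real_center_closure(2) in \<open>auto simp: c0 cS Be intro!: BA.real_center_comp yC\<close>)
  have cB: "c n \<in> B" and cA: "c n \<in> A" for n using BA.real_center_A[OF cC] B_sub by auto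
  have zcn: "norm (z \<odot> c n) \<le> r ^ n" for n
  proof (induction n)
    case 0 then show ?case using norm_z by (simp add: c0 e_right zA)
  next
    case (Suc n)
    have "z \<odot> c (Suc n) = (z \<odot> y) \<odot> (z \<odot> c n)"
      unfolding cS using zc[OF yA] zz by (metis blinfun_compose_assoc)
    then have "norm (z \<odot> c (Suc n)) \<le> norm (z \<odot> y) * norm (z \<odot> c n)" by (simp add: norm_blinfun_compose)
    also have "\<dots> \<le> r * r ^ n" using zy Suc r by (intro mult_mono) auto
    finally show ?case by simp
  qed
  \<comment> \<open>\<open>a \<odot> c n\<close> is the image of \<open>z \<odot> c n\<close> under
    the contraction \<open>F\<close>. In this way the decay reaches \<open>B\<close>, although the
    powers \<open>c n\<close> themselves need not tend to zero there.\<close>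
  have acn: "norm (a \<odot> c n) \<le> r ^ n" for n
    using F_contractive[of "z \<odot> c n"] zcn[of n] zA cA by (simp add: Fzb[OF cB] comp)
  have rn: "(\<lambda>n. r ^ n) \<longlonglongrightarrow> 0" using r by (intro LIMSEQ_power_zero) simp
  have summ: "summable (\<lambda>n. a \<odot> c n)"
    by (rule summable_comparison_test'[OF summable_geometric[of r]]) (use r acn in auto)
  define s where "s = (\<Sum>n. a \<odot> c n)"
  \<comment> \<open>As \<open>a = e - y\<close>, the series telescopes; its sum is the complement of
    \<open>f\<close>, the limit of the powers of \<open>y\<close>.\<close>
  have part: "(\<Sum>m<n. a \<odot> c m) = e - c n" for n
  proof (induction n)
    case (Suc n)
    have "a \<odot> c n = c n - y \<odot> c n"
      using e_left[OF cA] by (simp add: y_def blinfun_compose.diff_left)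
    then show ?case using Suc by (simp add: cS)
  qed (simp add: c0)
  have "(\<lambda>n. e - c n) \<longlonglongrightarrow> s" using summable_LIMSEQ[OF summ] by (simp add: s_def part)
  from tendsto_diff[OF tendsto_const[of e] this] have cf: "c \<longlonglongrightarrow> e - s" by simp
  define f where "f = e - s"
  have sC: "s \<in> BA.real_center"
  proof (rule closed_sequentially[OF BA.real_center_closed])
    show "e - c n \<in> BA.real_center" for n
      using BA.real_center_closure(2) cC by (simp add: BA.real_center_closure Be)
  qed fact
  have sB: "s \<in> B" and sA: "s \<in> A" using BA.real_center_A[OF sC] B_sub by auto
  have fA: "f \<in> A" by (simp add: f_def diff sA e_in)
  have lim: "(\<lambda>n. x \<odot> c n) \<longlonglongrightarrow> x \<odot> f" "(\<lambda>n. c n \<odot> x) \<longlonglongrightarrow> f \<odot> x" for x :: "'h operator"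
    unfolding f_def by (intro tendsto_intros cf)+
  have zero_lim: "x \<odot> f = 0" if "\<And>n. norm (x \<odot> c n) \<le> r ^ n" for x :: "'h operator"
  proof -
    have "(\<lambda>n. x \<odot> c n) \<longlonglongrightarrow> 0"
      by (rule Lim_null_comparison[OF _ rn]) (simp add: that)
    then show ?thesis using LIMSEQ_unique[OF lim(1)] by blast
  qed
  have af: "a \<odot> f = 0" and zf: "z \<odot> f = 0" using zero_lim acn zcn by auto
  have s_f: "s = e - f" by (simp add: f_def)
  have as: "a \<odot> s = a"
    using af e_right[OF B_sub[OF aB]] by (simp add: s_f blinfun_compose.diff_right)
  have zs: "z \<odot> s = z" using zf e_right[OF zA] by (simp add: s_f blinfun_compose.diff_right)
  have yf: "y \<odot> f = f" using af e_left[OF fA] by (simp add: y_def blinfun_compose.diff_left)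
  have cnf: "c n \<odot> f = f" for n
    by (induction n) (simp_all add: c0 cS e_left fA blinfun_compose_assoc yf)
  have ff: "f \<odot> f = f" using LIMSEQ_unique[OF lim(2)[of f]] by (simp add: cnf)
  have fcn: "f \<odot> c n = f" for n
    using cnf[of n] BA.real_center_commute[OF cC, of f n] BA.e_in sB
    by (simp add: f_def Be BA.diff)
  have ss: "s \<odot> s = s"
    unfolding s_f using ff fA by (simp add: blinfun_compose.diff_left blinfun_compose.diff_right e_left e_right e_in)
  define b where "b = s - a"
  have bC: "b \<in> BA.real_center" by (simp add: b_def BA.real_center_closure sC aC)
  have sa: "s \<odot> a = a" using as BA.real_center_commute[OF sC aB] by simp
  have sb: "s \<odot> b = b" by (simp add: b_def blinfun_compose.diff_right ss sa)
  \<comment> \<open>Since \<open>b = y - f\<close>, its powers are \<open>c n - f\<close> and tend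
    to zero. For a self-adjoint element, however, a norm of at least 1 persists under repeated
    squaring. The strict bound says that \<open>a\<close> is invertible below
    \<open>s\<close>.\<close>
  have norm_b: "norm b < 1"
  proof (rule ccontr)
    assume "\<not> norm b < 1"
    then have ge: "norm b \<ge> 1" by simp
    have cadd: "c (m + n) = c m \<odot> c n" for m n
      by (induction m) (simp_all add: c0 cS e_left cA blinfun_compose_assoc)
    have "norm (c (2 ^ n) - f) \<ge> 1" for n
    proof (induction n)
      case 0
      have "c (Suc 0) = y" by (simp add: cS c0 e_right yA)
      then have "c (2 ^ 0) - f = b" by (simp add: y_def f_def b_def)
      then show ?case using ge by simp
    next
      case (Suc n)
      define q where "q = c (2 ^ n) - f"
      have "q \<odot> q = c (2 ^ Suc n) - f"
        by (simp add: q_def blinfun_compose.diff_left blinfun_compose.diff_right cnf fcn ff mult_2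
          flip: cadd)
      moreover have "norm (q \<odot> q) = (norm q)\<^sup>2"
      proof (rule BA.norm_square_self_adjoint)
        have "q \<in> BA.real_center"
          unfolding q_def f_def using BA.real_center_closure(2) cC sC by (simp add: BA.real_center_closure Be)
        then show "q \<in> B" "adj q = q" by (auto simp: BA.real_center_def)
      qed
      ultimately show ?case using Suc by (simp add: q_def)
    qed
    moreover have "\<exists>n0. \<forall>n\<ge>n0. norm (c n - f) < 1"
      using LIMSEQ_D[OF cf, of 1] by (simp add: f_def)
    then obtain n0 where "\<And>n. n \<ge> n0 \<Longrightarrow> norm (c n - f) < 1" by blast
    then have "norm (c (2 ^ n0) - f) < 1" by simp
    ultimately show False by (meson not_less)
  qed
  obtain d d' where d: "d \<in> BA.real_center" "d' \<in> BA.real_center" "s \<odot> d = d" "s \<odot> d' = d'"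
    "d \<odot> d = s - b" "d \<odot> d' = s"
    using BA.real_center_sqrt[OF sC ss bC sb norm_b] .
  have dd: "d \<odot> d = a" using d by (simp add: b_def)
  \<comment> \<open>The inverse of \<open>a\<close> in the algebra cut down by \<open>s\<close>;
    \<open>d\<close> is a square root of \<open>a\<close> there.\<close>
  define g where "g = d' \<odot> d'"
  have gC: "g \<in> BA.real_center" by (simp add: g_def BA.real_center_comp d)
  have gB: "g \<in> B" and gA: "g \<in> A" using BA.real_center_A[OF gC] B_sub by auto
  have dB: "d \<in> B" and dA: "d \<in> A" using BA.real_center_A[OF d(1)] B_sub by auto
  have sg: "s \<odot> g = g" using d(4) by (simp add: g_def flip: blinfun_compose_assoc)
  have ag: "a \<odot> g = s"
  proof -
    have "a \<odot> g = d \<odot> ((d \<odot> d') \<odot> d')" by (simp add: dd[symmetric] g_def blinfun_compose_assoc)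
    also have "\<dots> = s" using d by simp
    finally show ?thesis .
  qed
  have ga: "g \<odot> a = s" using ag BA.real_center_commute[OF gC aB] by simp
  have gx: "g \<odot> x = x \<odot> g" and sx: "s \<odot> x = x \<odot> s" and dx: "d \<odot> x = x \<odot> d" if "x \<in> B" for x
    using that BA.real_center_commute gC sC d by blast+
  have sz: "s \<odot> z = z" using zs zc[OF sA] by simp
  have spr: "s \<in> central_projections B" using sC ss by (simp add: BA.central_projections_real_center)
  \<comment> \<open>\<open>F'\<close> divides by \<open>a\<close>, so the frame has to supply a
    factor \<open>a\<close>, half on each side: \<open>v i\<close> contributes one \<open>d\<close>,
    its adjoint another, and \<open>d \<odot> d \<odot> g = s\<close> acts as the identity on
    \<open>z\<close>.\<close>
  define F' where "F' x = F x \<odot> (g \<odot> z)" for x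
  define v where "v i = u i \<odot> (d \<odot> z)" for i
  have corner: "corner z A = {x \<in> A. z \<odot> x = x \<and> x \<odot> z = x}" by (rule corner_eq[OF zpr])
  have in_corner: "x \<odot> z \<in> corner z A" if "x \<in> A" for x
    using that zA zz zc[OF that] by (auto simp: corner comp blinfun_compose_assoc) (metis blinfun_compose_assoc)
  have F'_in: "F' x \<in> corner z A" if "x \<in> A" for x
    using in_corner[of "F x \<odot> g"] that gA by (simp add: F'_def comp F_in blinfun_compose_assoc)
  have FF': "F (F' x) = F x \<odot> s" if x: "x \<in> A" for x
  proof -
    have "F (F' x) = F ((F x \<odot> g) \<odot> z)" by (simp add: F'_def blinfun_compose_assoc)
    also have "\<dots> = (F x \<odot> g) \<odot> a" using x gB by (intro Fbz B_closure F_in_B)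
    finally show ?thesis by (simp add: blinfun_compose_assoc ga)
  qed
  have F'z: "F' (m \<odot> z) = (m \<odot> s) \<odot> z" if m: "m \<in> B" for m
  proof -
    have "F' (m \<odot> z) = m \<odot> ((a \<odot> g) \<odot> z)" using m by (simp add: F'_def Fbz blinfun_compose_assoc)
    then show ?thesis by (simp add: ag blinfun_compose_assoc)
  qed
  have fr: "framed (corner z A) F' v k"
  proof unfold_locales
    show "von_neumann_algebra (corner z A)" by (rule corner_vN[OF zpr])
    show "F' (unit_of (corner z A)) = unit_of (corner z A)"
      unfolding corner_vN(2)[OF zpr] using ag sz by (simp add: F'_def a_def[symmetric] flip: blinfun_compose_assoc)
    show "\<exists>C. \<forall>x\<in>corner z A. norm (F' x) \<le> C * norm x"
    proof (intro exI ballI)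
      fix x assume "x \<in> corner z A"
      then have x: "x \<in> A" by (simp add: corner)
      have "norm (F' x) \<le> norm (F x) * norm (g \<odot> z)" unfolding F'_def by (rule norm_blinfun_compose)
      also have "\<dots> \<le> norm x * norm (g \<odot> z)" by (intro mult_right_mono F_contractive x) simp
      finally show "norm (F' x) \<le> norm (g \<odot> z) * norm x" by (simp add: mult.commute)
    qed
    show "v i \<in> corner z A" if "i < k" for i
      using in_corner[of "u i \<odot> d"] u_in[OF that] dA by (simp add: v_def blinfun_compose_assoc comp)
    show "wot_continuous (corner z A) \<phi>" if "\<phi> \<in> sigma_weak_functionals" for \<phi>
      by (rule continuous_map_from_subtopology_mono[OF sigma_weak[OF that]]) (auto simp: corner)
    show "wot_continuous_op (corner z A) F'"
      unfolding F'_def by (intro wot_intros wot_continuous_op_subset[OF F_wot]) (auto simp: corner)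
  next
    fix x y assume xy: "x \<in> corner z A" "y \<in> corner z A"
    then have x: "x \<in> A" "z \<odot> x = x" "x \<odot> z = x" and y: "y \<in> A" "z \<odot> y = y" "y \<odot> z = y"
      by (auto simp: corner)
    show "F' (x + y) = F' x + F' y" using x y by (simp add: F'_def F_add blinfun_compose.add_left)
    assume fixed: "F' x = x"
    define m where "m = F x \<odot> g"
    have mB: "m \<in> B" using x gB by (simp add: m_def B_closure F_in_B)
    have xm: "x = m \<odot> z" using fixed by (simp add: F'_def m_def blinfun_compose_assoc)
    have "F (x \<odot> y) = F (m \<odot> y)" unfolding xm by (simp add: blinfun_compose_assoc y)
    then have "F' (x \<odot> y) = m \<odot> F' y" using mB y by (simp add: F'_def F_left_B blinfun_compose_assoc)
    also have "F' y = z \<odot> F' y" using F'_in[OF y(1)] by (simp add: corner)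
    also have "m \<odot> (z \<odot> F' y) = x \<odot> F' y" by (simp add: xm blinfun_compose_assoc)
    finally show "F' (x \<odot> y) = x \<odot> F' y" .
  next
    fix x l assume "x \<in> corner z A"
    then have x: "x \<in> A" "z \<odot> x = x" "x \<odot> z = x" by (auto simp: corner)
    show "F' x \<in> corner z A" by (rule F'_in[OF x(1)])
    show "F' (l *\<^sub>O x) = l *\<^sub>O F' x" using x by (simp add: F'_def F_scale op_scale_compose_left)
    show "F' (adj x) = adj (F' x)"
    proof -
      have "adj (F' x) = (z \<odot> g) \<odot> adj (F x)"
        unfolding F'_def using x gA zA
        by (simp add: adj_comp_in comp F_in adj_z BA.real_center_adj[OF gC])
      also have "\<dots> = z \<odot> (F (adj x) \<odot> g)"
        using gx[of "F (adj x)"] x by (simp add: F_adj F_in_B B_closure blinfun_compose_assoc)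
      also have "\<dots> = F' (adj x)"
        using zc[of "F (adj x) \<odot> g"] x gA by (simp add: F'_def F_in comp adj blinfun_compose_assoc)
      finally show ?thesis by simp
    qed
    have "F' (F' x) = F x \<odot> ((s \<odot> g) \<odot> z)" by (simp add: F'_def[of "F' x"] FF'[OF x(1)] blinfun_compose_assoc)
    then show "F' (F' x) = F' x" by (simp add: sg F'_def)
    have "v i \<odot> F' (adj (v i) \<odot> x) = (u i \<odot> F (adj (u i) \<odot> x)) \<odot> z" if i: "i < k" for i
    proof -
      have ui: "u i \<in> A" "adj (u i) \<in> A" using u_in[OF i] adj by auto
      define w where "w = F (adj (u i) \<odot> x)"
      have wB: "w \<in> B" using x ui by (simp add: w_def F_in_B comp)
      have "adj (v i) \<odot> x = z \<odot> (d \<odot> (adj (u i) \<odot> x))"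
        unfolding v_def using ui zA dA
        by (simp add: adj_comp_in comp adj_z BA.real_center_adj[OF d(1)] blinfun_compose_assoc)
      also have "\<dots> = d \<odot> (adj (u i) \<odot> x)"
        using zc[of "d \<odot> (adj (u i) \<odot> x)"] x ui dA by (simp add: comp blinfun_compose_assoc)
      finally have "F (adj (v i) \<odot> x) = d \<odot> w"
        using dB x ui by (simp add: w_def F_left_B comp)
      then have "v i \<odot> F' (adj (v i) \<odot> x) = u i \<odot> (d \<odot> (z \<odot> (d \<odot> (w \<odot> (g \<odot> z)))))"
        by (simp add: F'_def v_def blinfun_compose_assoc)
      also have "z \<odot> (d \<odot> (w \<odot> (g \<odot> z))) = d \<odot> (w \<odot> (g \<odot> z))"
        using zmz[of "d \<odot> (w \<odot> g)"] B_sub[OF wB] gA dA by (simp add: comp blinfun_compose_assoc)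
      also have "d \<odot> (d \<odot> (w \<odot> (g \<odot> z))) = a \<odot> (w \<odot> (g \<odot> z))"
        by (simp add: dd[symmetric] blinfun_compose_assoc)
      also have "\<dots> = w \<odot> ((a \<odot> g) \<odot> z)"
        by (simp add: BA.real_center_commute[OF aC wB] flip: blinfun_compose_assoc)
      also have "\<dots> = w \<odot> z" by (simp add: ag sz)
      finally show ?thesis by (simp add: w_def blinfun_compose_assoc)
    qed
    then have "(\<Sum>i<k. v i \<odot> F' (adj (v i) \<odot> x)) = (\<Sum>i<k. u i \<odot> F (adj (u i) \<odot> x)) \<odot> z"
      by (simp add: blinfun_compose.sum_left)
    then show "(\<Sum>i<k. v i \<odot> F' (adj (v i) \<odot> x)) = x" using x by (simp add: frame)
  qed
  then interpret C: framed_isometries "corner z A" F' v k S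
    by (simp add: framed_isometries_def isometries_axioms)
  have "P C.B" by (rule C.property_descends[OF P desc Pz])
  moreover have spr': "s \<in> projections B" using spr by (simp add: central_projections_def)
  \<comment> \<open>Multiplication with \<open>z\<close> loses nothing of the corner at
    \<open>s\<close>: \<open>F (m \<odot> z) \<odot> g = m \<odot> s\<close> recovers
    \<open>m\<close>.\<close>
  have "P (corner s B) \<longleftrightarrow> P C.B"
  proof (rule P.iso_iff[where \<phi> = "\<lambda>m. m \<odot> z"])
    show "bij_betw (\<lambda>m. m \<odot> z) (corner s B) C.B"
    proof (rule bij_betw_byWitness[where f' = "\<lambda>x. F x \<odot> g"])
      show "\<forall>m\<in>corner s B. F (m \<odot> z) \<odot> g = m"
        using spr' by (auto simp: BA.corner_eq Fbz blinfun_compose_assoc ag)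
      show "\<forall>x\<in>C.B. F x \<odot> g \<odot> z = x"
        by (auto simp: C.B_def F'_def blinfun_compose_assoc)
      show "(\<lambda>m. m \<odot> z) ` corner s B \<subseteq> C.B"
      proof safe
        fix m assume "m \<in> corner s B"
        then have "m \<in> B" "m \<odot> s = m" using spr' by (auto simp: BA.corner_eq)
        then show "m \<odot> z \<in> C.B" using in_corner[OF B_sub] by (simp add: C.B_def F'z)
      qed
      show "(\<lambda>x. F x \<odot> g) ` C.B \<subseteq> corner s B"
      proof safe
        fix x assume "x \<in> C.B"
        then have "x \<in> A" using C.B_sub corner_subset[OF zpr] by blast
        then have FB: "F x \<in> B" by (rule F_in_B)
        then show "F x \<odot> g \<in> corner s B"
          using spr' gB sx[OF FB] sx[OF gB] sg
          by (auto simp: BA.corner_eq B_closure blinfun_compose_assoc) (metis blinfun_compose_assoc)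
      qed
    qed
    show "von_neumann_algebra (corner s B)" by (rule BA.corner_vN[OF spr'])
    show "von_neumann_algebra C.B" by (rule C.B_vN)
    fix x y assume "x \<in> corner s B" "y \<in> corner s B"
    then have xy: "x \<in> A" "y \<in> A" using spr' B_sub by (auto simp: BA.corner_eq)
    show "(x + y) \<odot> z = x \<odot> z + y \<odot> z" by (simp add: blinfun_compose.add_left)
    show "x \<odot> y \<odot> z = x \<odot> z \<odot> (y \<odot> z)" using zc[OF xy(2)] zz by (metis blinfun_compose_assoc)
  next
    fix x l assume "x \<in> corner s B"
    then have x: "x \<in> A" using spr' B_sub by (auto simp: BA.corner_eq)
    show "l *\<^sub>O x \<odot> z = l *\<^sub>O (x \<odot> z)" by (simp add: op_scale_compose_left)
    show "adj x \<odot> z = adj (x \<odot> z)" using x zA zc[OF adj[OF x]] by (simp add: adj_comp_in adj_z)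
  qed
  ultimately show thesis using that spr sz by blast
qed

end

section \<open>The basic construction\<close>

context pre_framed
begin

lemma frame_adj: 
  assumes x: "x \<in> A"
  shows "(\<Sum>i<k. F (x \<odot> u i) \<odot> adj (u i)) = x"
proof -
  have "adj x = (\<Sum>i<k. u i \<odot> F (adj (u i) \<odot> adj x))" using frame[OF adj[OF x]] by simp
  then have "adj (adj x) = adj (\<Sum>i<k. u i \<odot> F (adj (u i) \<odot> adj x))" by (simp only:)
  also have "\<dots> = (\<Sum>i<k. adj (u i \<odot> F (adj (u i) \<odot> adj x)))"
    using u_in x by (intro adj_sum in_bounded) (auto intro!: comp F_in adj)
  also have "\<dots> = (\<Sum>i<k. F (x \<odot> u i) \<odot> adj (u i))"
    using u_in x by (intro sum.cong refl) (simp add: adj_comp_in comp adj F_in adj_adj_in flip: F_adj)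
  finally show ?thesis using x by (simp add: adj_adj_in)
qed

text \<open>The Watatani index of \<open>F\<close>. Being central and bounded below, it can be
  divided out of the dual expectation.\<close>

definition frame_op :: "'h operator" where
  "frame_op = (\<Sum>i<k. u i \<odot> adj (u i))"

lemma frame_op_in: "frame_op \<in> A"
  unfolding frame_op_def by (intro sum comp adj u_in) auto

text \<open>Expand \<open>x \<odot> u i\<close> in the frame, exchange the sums, and recollect
  \<open>adj (u j) \<odot> x\<close> by \<open>frame_adj\<close>.\<close>

lemma frame_op_commute:
  assumes x: "x \<in> A"
  shows "frame_op \<odot> x = x \<odot> frame_op"
proof -
  have "x \<odot> frame_op = (\<Sum>i<k. (\<Sum>j<k. u j \<odot> F (adj (u j) \<odot> (x \<odot> u i))) \<odot> adj (u i))"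
    unfolding frame_op_def blinfun_compose.sum_right
    by (intro sum.cong refl, subst frame) (use u_in x in \<open>auto simp: comp blinfun_compose_assoc\<close>)
  also have "\<dots> = (\<Sum>j<k. u j \<odot> (\<Sum>i<k. F ((adj (u j) \<odot> x) \<odot> u i) \<odot> adj (u i)))"
    by (simp add: blinfun_compose.sum_left blinfun_compose.sum_right blinfun_compose_assoc)
      (rule sum.swap)
  also have "\<dots> = frame_op \<odot> x"
    unfolding frame_op_def blinfun_compose.sum_left
    by (intro sum.cong refl, subst frame_adj) (use u_in x in \<open>auto simp: comp adj blinfun_compose_assoc\<close>)
  finally show ?thesis by simp
qed

lemma frame_op_real_center: "frame_op \<in> real_center"
proof -
  have "adj frame_op = frame_op"
    unfolding frame_op_def using u_in
    by (subst adj_sum) (auto simp: adj_comp_in adj adj_adj_in comp intro!: in_bounded sum.cong)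
  then show ?thesis by (simp add: real_center_def frame_op_in frame_op_commute)
qed

lemma frame_op_apply: "Re (cinner \<xi> (frame_op \<xi>)) = (\<Sum>i<k. (norm (adj (u i) \<xi>))\<^sup>2)"
proof -
  have "cinner \<xi> (frame_op \<xi>) = (\<Sum>i<k. cinner (adj (u i) \<xi>) (adj (u i) \<xi>))"
    unfolding frame_op_def using u_in
    by (simp add: blinfun.sum_left cinner.sum_right cinner_adj in_bounded)
  then show ?thesis by (simp add: cinner_self flip: of_real_power)
qed

text \<open>Expand the unit as the sum of the products \<open>F (u i) \<odot> adj (u i)\<close> and
  apply Cauchy-Schwarz. The first factors contribute the square sum of the coefficients of the unit,
  which is the squared norm of \<open>e \<xi>\<close> again and cancels against one power on the
  left.\<close>

lemma frame_op_ge: "(norm (e \<xi>))\<^sup>2 \<le> Re (cinner \<xi> (frame_op \<xi>))"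
proof -
  have ee: "adj e \<odot> e = e" by (simp add: adj_e e_left e_in)
  have Fe: "F e = e" using F_e by (simp add: e_def)
  have "cinner \<xi> (e \<xi>) = complex_of_real (\<Sum>i<k. (norm (F (adj (u i)) \<xi>))\<^sup>2)"
    using F_square_apply[OF e_in, of \<xi>] u_in by (simp add: ee Fe e_right adj)
  moreover have "cinner \<xi> (e \<xi>) = cinner (e \<xi>) (e \<xi>)"
    by (metis projection_apply[OF e_projection])
  ultimately have n1: "(norm (e \<xi>))\<^sup>2 = (\<Sum>i<k. (norm (F (adj (u i)) \<xi>))\<^sup>2)"
    unfolding cinner_self by (simp only: of_real_eq_iff)
  have "e = (\<Sum>i<k. F (u i) \<odot> adj (u i))" using frame_adj[OF e_in] u_in by (simp add: e_left)
  then have "cinner \<xi> (e \<xi>) = cinner \<xi> ((\<Sum>i<k. F (u i) \<odot> adj (u i)) \<xi>)" by (simp only:)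
  then have "cinner \<xi> (e \<xi>) = (\<Sum>i<k. cinner \<xi> (F (u i) (adj (u i) \<xi>)))"
    by (simp add: blinfun.sum_left cinner.sum_right)
  also have "\<dots> = (\<Sum>i<k. cinner (F (adj (u i)) \<xi>) (adj (u i) \<xi>))"
    using u_in by (intro sum.cong refl) (simp add: F_adj cinner_adj in_bounded F_in)
  finally have "cinner (e \<xi>) (e \<xi>) = (\<Sum>i<k. cinner (F (adj (u i)) \<xi>) (adj (u i) \<xi>))"
    using \<open>cinner \<xi> (e \<xi>) = cinner (e \<xi>) (e \<xi>)\<close> by simp
  then have "(norm (e \<xi>))\<^sup>2 = cmod (\<Sum>i<k. cinner (F (adj (u i)) \<xi>) (adj (u i) \<xi>))"
    unfolding cinner_self by (metis norm_of_real abs_of_nonneg zero_le_power2)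
  also have "\<dots> \<le> (\<Sum>i<k. norm (F (adj (u i)) \<xi>) * norm (adj (u i) \<xi>))"
    by (intro order_trans[OF norm_sum] sum_mono norm_cinner_le)
  finally have "((norm (e \<xi>))\<^sup>2)\<^sup>2 \<le> (\<Sum>i<k. norm (F (adj (u i)) \<xi>) * norm (adj (u i) \<xi>))\<^sup>2"
    by (intro power_mono) auto
  also have "\<dots> \<le> (norm (e \<xi>))\<^sup>2 * Re (cinner \<xi> (frame_op \<xi>))"
    unfolding n1 frame_op_apply by (rule Cauchy_Schwarz_ineq_sum)
  finally have "(norm (e \<xi>))\<^sup>2 * (norm (e \<xi>))\<^sup>2 \<le> (norm (e \<xi>))\<^sup>2 * Re (cinner \<xi> (frame_op \<xi>))"
    by (simp add: power2_eq_square)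
  then show ?thesis
  proof (cases "norm (e \<xi>) = 0")
    case True then show ?thesis unfolding frame_op_apply by (simp add: sum_nonneg)
  next
    case False
    then have "(norm (e \<xi>))\<^sup>2 > 0" by simp
    then show ?thesis
      using \<open>(norm (e \<xi>))\<^sup>2 * (norm (e \<xi>))\<^sup>2 \<le> (norm (e \<xi>))\<^sup>2 * Re (cinner \<xi> (frame_op \<xi>))\<close>
        mult_le_cancel_left_pos by blast
  qed
qed

lemma frame_op_sqrt:
  obtains h h' where "h \<in> real_center" "h' \<in> real_center" "h \<odot> h = frame_op" "h \<odot> h' = e"
proof -
  \<comment> \<open>Division by \<open>t\<close> brings the index between \<open>e / t\<close> and
    \<open>e\<close>, so that its distance from the unit is at most
    \<open>1 - 1 / t\<close>.\<close>
  define t where "t = norm frame_op + 1"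
  have t: "t \<ge> 1" by (simp add: t_def)
  define b where "b = e - (1/t) *\<^sub>R frame_op"
  have bC: "b \<in> real_center"
    unfolding b_def by (intro real_center_closure frame_op_real_center)
  have bA: "b \<in> A" using bC by (rule real_center_A)
  have "norm b \<le> 1 - 1 / t"
  proof (rule norm_le_of_form_bound[OF in_bounded[OF bA] real_center_adj[OF bC]])
    fix \<xi>
    define v where "v = e \<xi>"
    have eq: "Re (cinner \<xi> (b \<xi>)) = (norm v)\<^sup>2 - Re (cinner \<xi> (frame_op \<xi>)) / t"
    proof -
      have "cinner \<xi> (e \<xi>) = cinner v v" unfolding v_def by (metis projection_apply[OF e_projection])
      then show ?thesis
        by (simp add: b_def blinfun.diff_left blinfun.scaleR_left cinner.diff_right cinner_scaleR_right cinner_self)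
    qed
    have "(norm v)\<^sup>2 / t \<le> Re (cinner \<xi> (frame_op \<xi>)) / t"
      using frame_op_ge[of \<xi>] t by (intro divide_right_mono) (auto simp: v_def)
    then have "Re (cinner \<xi> (b \<xi>)) \<le> (1 - 1 / t) * (norm v)\<^sup>2"
      unfolding eq by (simp add: algebra_simps)
    also have "\<dots> \<le> (1 - 1 / t) * (norm \<xi>)\<^sup>2"
      unfolding v_def using t
      by (intro mult_left_mono power_mono norm_projection_le e_projection) auto
    finally show "Re (cinner \<xi> (b \<xi>)) \<le> (1 - 1 / t) * (norm \<xi>)\<^sup>2" .
    have "cinner \<xi> (frame_op \<xi>) = cinner \<xi> (e (frame_op (e \<xi>)))"
      using e_left_apply[OF frame_op_in] e_right_apply[OF frame_op_in] by simp
    also have "\<dots> = cinner v (frame_op v)" by (simp add: v_def projection_apply[OF e_projection])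
    finally have "Re (cinner \<xi> (frame_op \<xi>)) \<le> cmod (cinner v (frame_op v))"
      by (simp add: complex_Re_le_cmod)
    also have "\<dots> \<le> norm v * norm (frame_op v)" by (rule norm_cinner_le)
    also have "\<dots> \<le> norm v * (norm frame_op * norm v)" by (intro mult_left_mono norm_blinfun) auto
    also have "\<dots> \<le> norm v * (t * norm v)" by (intro mult_left_mono mult_right_mono) (auto simp: t_def)
    finally have "Re (cinner \<xi> (frame_op \<xi>)) / t \<le> (norm v)\<^sup>2"
      using t by (simp add: field_simps power2_eq_square)
    then show "0 \<le> Re (cinner \<xi> (b \<xi>))" unfolding eq by simp
  qed (use t in simp)
  also have "\<dots> < 1" using t by simp
  finally have nb: "norm b < 1" .
  obtain d d' where d: "d \<in> real_center" "d' \<in> real_center" "d \<odot> d = e - b" "d \<odot> d' = e"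
    using real_center_sqrt[OF real_center_closure(2) e_left[OF e_in] bC e_left[OF bA] nb] by metis
  show thesis
  proof
    show "sqrt t *\<^sub>R d \<in> real_center" "(1 / sqrt t) *\<^sub>R d' \<in> real_center"
      using d by (simp_all add: real_center_closure)
    show "(sqrt t *\<^sub>R d) \<odot> (sqrt t *\<^sub>R d) = frame_op"
      using t d(3) by (simp add: blinfun_compose.scaleR_left blinfun_compose.scaleR_right b_def)
    show "(sqrt t *\<^sub>R d) \<odot> ((1 / sqrt t) *\<^sub>R d') = e"
      using t d(4) by (simp add: blinfun_compose.scaleR_left blinfun_compose.scaleR_right)
  qed
qed

end

context framed_isometries
begin

interpretation BA: vN_algebra B
  by unfold_locales (rule B_vN)

abbreviation mB :: "'h operator set" where "mB \<equiv> amp k B"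

interpretation MB: vN_algebra mB
  by unfold_locales (rule amp_vN[OF B_vN])

lemma B_bounded: "B \<subseteq> bounded_operators"
  using B_sub A_bounded by blast

text \<open>\<open>A1\<close> is the algebra \<open>End\<^sub>B(A)\<close> of the right \<open>B\<close>-module \<open>A\<close>, written as matrices in the frame \<open>u\<close>;
  \<open>contract\<close> is, up to division by the index \<open>frame_op\<close>, the dual expectation onto \<open>A\<close>.\<close>

definition left_mult :: "'h operator \<Rightarrow> 'h operator" where
  "left_mult x = mat k (\<lambda>i j. F (adj (u i) \<odot> (x \<odot> u j)))"

text \<open>The Gram matrix of the frame. It is the projection onto the columns that occur as
  coefficients of elements of \<open>A\<close>, which is how endomorphisms of the module become a
  corner of a matrix algebra.\<close>

definition G :: "'h operator" where "G = left_mult e"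

abbreviation A1 :: "'h operator set" where "A1 \<equiv> corner G mB"

definition contract :: "'h operator \<Rightarrow> 'h operator" where
  "contract T = (\<Sum>i<k. \<Sum>j<k. u i \<odot> (entry T i j \<odot> adj (u j)))"

lemma u_adj_in: "i < k \<Longrightarrow> adj (u i) \<in> A"
  by (simp add: u_in adj)

lemma left_mult_in: "x \<in> A \<Longrightarrow> left_mult x \<in> mB"
  unfolding left_mult_def by (intro mat_in_amp B_bounded F_in_B comp u_in u_adj_in)

lemma entry_left_mult: "i < k \<Longrightarrow> j < k \<Longrightarrow> entry (left_mult x) i j = F (adj (u i) \<odot> (x \<odot> u j))"
  unfolding left_mult_def by (rule entry_mat)

lemma entry_G: "i < k \<Longrightarrow> j < k \<Longrightarrow> entry G i j = F (adj (u i) \<odot> u j)"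
  unfolding G_def by (simp add: entry_left_mult e_left u_in)

lemma frame_product': "x \<in> A \<Longrightarrow> y \<in> A \<Longrightarrow> (\<Sum>i<k. F (x \<odot> u i) \<odot> (F (adj (u i) \<odot> y) \<odot> w)) = F (x \<odot> y) \<odot> w"
  using frame_product[of x y] by (simp flip: blinfun_compose_assoc blinfun_compose.sum_left)

lemma left_mult_comp:
  assumes x: "x \<in> A" and y: "y \<in> A"
  shows "left_mult (x \<odot> y) = left_mult x \<odot> left_mult y"
proof (rule amp_eqI[OF left_mult_in])
  show "x \<odot> y \<in> A" by (simp add: comp x y)
  show "left_mult x \<odot> left_mult y \<in> mB" by (intro MB.comp left_mult_in x y)
  fix i j assume ij: "i < k" "j < k"
  have "entry (left_mult x \<odot> left_mult y) i j = (\<Sum>l<k. F ((adj (u i) \<odot> x) \<odot> u l) \<odot> F (adj (u l) \<odot> (y \<odot> u j)))"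
    using ij by (simp add: entry_comp[OF left_mult_in[OF x]] entry_left_mult blinfun_compose_assoc)
  also have "\<dots> = F ((adj (u i) \<odot> x) \<odot> (y \<odot> u j))"
    using ij x y by (intro frame_product comp u_in u_adj_in)
  finally show "entry (left_mult (x \<odot> y)) i j = entry (left_mult x \<odot> left_mult y) i j"
    using ij by (simp add: entry_left_mult blinfun_compose_assoc)
qed

lemma left_mult_adj:
  assumes x: "x \<in> A" shows "left_mult (adj x) = adj (left_mult x)"
proof (rule amp_eqI[OF left_mult_in MB.adj[OF left_mult_in]])
  fix i j assume ij: "i < k" "j < k"
  have "left_mult x \<in> bounded_operators" using left_mult_in[OF x] amp_bounded by blast
  then have "entry (adj (left_mult x)) i j = adj (F (adj (u j) \<odot> (x \<odot> u i)))"
    using ij by (simp add: entry_adj entry_left_mult)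
  also have "\<dots> = F (adj (adj (u j) \<odot> (x \<odot> u i)))"
    using ij x by (intro F_adj[symmetric] comp u_in u_adj_in)
  also have "\<dots> = entry (left_mult (adj x)) i j"
    using ij x by (simp add: entry_left_mult adj_comp_in u_in u_adj_in comp adj_adj_in blinfun_compose_assoc)
  finally show "entry (left_mult (adj x)) i j = entry (adj (left_mult x)) i j" by simp
qed (auto simp: x adj)

lemma left_mult_add: "x \<in> A \<Longrightarrow> y \<in> A \<Longrightarrow> left_mult (x + y) = left_mult x + left_mult y"
  by (rule amp_eqI[OF left_mult_in MB.add[OF left_mult_in left_mult_in]])
    (auto simp: add entry_add entry_left_mult F_add comp u_in u_adj_in blinfun_compose.add_left blinfun_compose.add_right)

lemma left_mult_scale: "x \<in> A \<Longrightarrow> left_mult (c *\<^sub>O x) = c *\<^sub>O left_mult x"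
  by (rule amp_eqI[OF left_mult_in MB.scale[OF left_mult_in]])
    (auto simp: scale entry_scale entry_left_mult F_scale[symmetric] comp u_in u_adj_in in_bounded
      op_scale_compose_left op_scale_compose_right)

lemma left_mult_bound: "\<exists>C. \<forall>x\<in>A. norm (left_mult x) \<le> C * norm x"
proof (intro exI ballI)
  fix x assume x: "x \<in> A"
  have "norm (left_mult x) \<le> (\<Sum>i<k. \<Sum>j<k. norm (F (adj (u i) \<odot> (x \<odot> u j))))"
    unfolding left_mult_def by (rule norm_mat)
  also have "\<dots> \<le> (\<Sum>i<k. \<Sum>j<k. norm (u i) * (norm x * norm (u j)))"
  proof (intro sum_mono)
    fix i j assume "i \<in> {..<k}" "j \<in> {..<k}"
    then have ij: "i < k" "j < k" by auto
    have "norm (F (adj (u i) \<odot> (x \<odot> u j))) \<le> norm (adj (u i) \<odot> (x \<odot> u j))"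
      using ij x by (intro F_contractive comp u_in u_adj_in)
    also have "\<dots> \<le> norm (adj (u i)) * norm (x \<odot> u j)" by (rule norm_blinfun_compose)
    also have "\<dots> \<le> norm (adj (u i)) * (norm x * norm (u j))"
      by (intro mult_left_mono norm_blinfun_compose) simp
    also have "norm (adj (u i)) = norm (u i)" using ij by (simp add: norm_adj_compose in_bounded u_in)
    finally show "norm (F (adj (u i) \<odot> (x \<odot> u j))) \<le> norm (u i) * (norm x * norm (u j))" .
  qed
  also have "\<dots> = (\<Sum>i<k. \<Sum>j<k. norm (u i) * norm (u j)) * norm x"
    by (simp add: sum_distrib_left sum_distrib_right mult_ac)
  finally show "norm (left_mult x) \<le> (\<Sum>i<k. \<Sum>j<k. norm (u i) * norm (u j)) * norm x" .
qed

text \<open>Column \<open>j\<close> of the matrix contains the coefficients of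
  \<open>x \<odot> u j\<close>, and the expansion of the unit in the frame recovers \<open>x\<close>
  from these products.\<close>

lemma left_mult_inj: 
  assumes x: "x \<in> A" and y: "y \<in> A" and eq: "left_mult x = left_mult y"
  shows "x = y"
proof -
  have inv: "(\<Sum>j<k. (\<Sum>i<k. u i \<odot> entry (left_mult x) i j) \<odot> F (adj (u j))) = x" if x: "x \<in> A" for x
  proof -
    have "(\<Sum>i<k. u i \<odot> entry (left_mult x) i j) = x \<odot> u j" if j: "j < k" for j
      using frame[of "x \<odot> u j"] j x by (simp add: entry_left_mult comp u_in)
    then have "(\<Sum>j<k. (\<Sum>i<k. u i \<odot> entry (left_mult x) i j) \<odot> F (adj (u j))) = (\<Sum>j<k. (x \<odot> u j) \<odot> F (adj (u j)))"
      by simp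
    also have "\<dots> = x \<odot> (\<Sum>j<k. u j \<odot> F (adj (u j) \<odot> e))"
      by (simp add: blinfun_compose.sum_right blinfun_compose_assoc e_right u_adj_in)
    also have "\<dots> = x" using frame[OF e_in] x by (simp add: e_right)
    finally show ?thesis .
  qed
  show ?thesis using inv[OF x] inv[OF y] unfolding eq by simp
qed

lemma left_mult_wot: "wot_continuous_op A left_mult"
  unfolding left_mult_def mat_def
proof (intro wot_intros S_bounded)
  fix i j assume "i \<in> {..<k}" "j \<in> {..<k}"
  then have ij: "i < k" "j < k" by auto
  show "wot_continuous_op A (\<lambda>x. F (adj (u i) \<odot> (x \<odot> u j)))"
    by (rule wot_continuous_op_compose[OF F_wot])
      (use ij A_bounded in \<open>auto intro!: wot_intros in_bounded comp u_in u_adj_in\<close>)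
qed

lemma G_projection: "G \<in> projections mB"
  unfolding projections_def G_def
  using left_mult_in[OF e_in] left_mult_adj[OF e_in] left_mult_comp[OF e_in e_in] by (simp add: adj_e e_left e_in)

lemma A1_eq: "A1 = {T \<in> mB. G \<odot> T = T \<and> T \<odot> G = T}"
  by (rule MB.corner_eq[OF G_projection])

interpretation A1: vN_algebra A1
  by unfold_locales (rule MB.corner_vN[OF G_projection])

lemma left_mult_in_A1: "x \<in> A \<Longrightarrow> left_mult x \<in> A1"
proof -
  assume "x \<in> A"
  then have "left_mult x \<in> mB \<and> G \<odot> left_mult x = left_mult x \<and> left_mult x \<odot> G = left_mult x"
    using left_mult_comp[of e x] left_mult_comp[of x e] by (simp add: G_def left_mult_in e_in e_left e_right)
  then show "left_mult x \<in> A1" by (simp add: A1_eq)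
qed

lemma entry_B: "T \<in> mB \<Longrightarrow> i < k \<Longrightarrow> j < k \<Longrightarrow> entry T i j \<in> B"
  and entry_A: "T \<in> mB \<Longrightarrow> i < k \<Longrightarrow> j < k \<Longrightarrow> entry T i j \<in> A"
  using entry_in B_sub by blast+

lemma contract_in: "T \<in> mB \<Longrightarrow> contract T \<in> A"
  unfolding contract_def by (intro sum comp u_in u_adj_in entry_A) auto

lemma contract_add: "contract (T + T') = contract T + contract T'"
  by (simp add: contract_def entry_add blinfun_compose.add_left blinfun_compose.add_right sum.distrib)

lemma contract_scale: "contract (c *\<^sub>O T) = c *\<^sub>O contract T"
  unfolding contract_def entry_scale
  using u_in in_bounded by (simp add: op_scale_compose_left op_scale_compose_right op_scale_sum_right)

lemma contract_adj:
  assumes T: "T \<in> mB" shows "contract (adj T) = adj (contract T)"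
proof -
  have "T \<in> bounded_operators" using T amp_bounded by blast
  then have "contract (adj T) = (\<Sum>i<k. \<Sum>j<k. u i \<odot> (adj (entry T j i) \<odot> adj (u j)))"
    by (simp add: contract_def entry_adj)
  also have "\<dots> = (\<Sum>j<k. \<Sum>i<k. u i \<odot> (adj (entry T j i) \<odot> adj (u j)))" by (rule sum.swap)
  also have "\<dots> = (\<Sum>j<k. \<Sum>i<k. adj (u j \<odot> (entry T j i \<odot> adj (u i))))"
    by (intro sum.cong refl) (simp add: adj_comp_in comp u_in u_adj_in entry_A[OF T] adj_adj_in blinfun_compose_assoc)
  also have "\<dots> = (\<Sum>j<k. adj (\<Sum>i<k. u j \<odot> (entry T j i \<odot> adj (u i))))"
    by (intro sum.cong refl adj_sum[symmetric] in_bounded comp u_in u_adj_in entry_A[OF T]) auto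
  also have "\<dots> = adj (contract T)"
    unfolding contract_def by (intro adj_sum[symmetric] in_bounded sum comp u_in u_adj_in entry_A[OF T]) auto
  finally show ?thesis .
qed

lemma contract_left_mult_comp:
  assumes x: "x \<in> A" and T: "T \<in> mB"
  shows "contract (left_mult x \<odot> T) = x \<odot> contract T"
proof -
  have "contract (left_mult x \<odot> T) = (\<Sum>i<k. \<Sum>j<k. \<Sum>l<k. u i \<odot> (F (adj (u i) \<odot> (x \<odot> u l)) \<odot> (entry T l j \<odot> adj (u j))))"
    by (simp add: contract_def entry_comp[OF left_mult_in[OF x]] entry_left_mult blinfun_compose.sum_left blinfun_compose.sum_right
        blinfun_compose_assoc)
  also have "\<dots> = (\<Sum>l<k. \<Sum>i<k. \<Sum>j<k. u i \<odot> (F (adj (u i) \<odot> (x \<odot> u l)) \<odot> (entry T l j \<odot> adj (u j))))"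
    by (rule sum_swap3)
  also have "\<dots> = (\<Sum>l<k. \<Sum>j<k. \<Sum>i<k. u i \<odot> (F (adj (u i) \<odot> (x \<odot> u l)) \<odot> (entry T l j \<odot> adj (u j))))"
    by (rule sum.cong[OF refl], rule sum.swap)
  also have "\<dots> = (\<Sum>l<k. \<Sum>j<k. (\<Sum>i<k. u i \<odot> F (adj (u i) \<odot> (x \<odot> u l))) \<odot> (entry T l j \<odot> adj (u j)))"
    by (simp add: blinfun_compose.sum_left blinfun_compose_assoc)
  also have "\<dots> = (\<Sum>l<k. \<Sum>j<k. (x \<odot> u l) \<odot> (entry T l j \<odot> adj (u j)))"
    using x by (intro sum.cong refl) (simp add: frame comp u_in)
  also have "\<dots> = x \<odot> contract T"
    by (simp add: contract_def blinfun_compose.sum_right blinfun_compose_assoc)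
  finally show ?thesis .
qed

lemma contract_left_mult: 
  assumes x: "x \<in> A" shows "contract (left_mult x) = x \<odot> frame_op"
proof -
  have "contract (left_mult x) = (\<Sum>j<k. \<Sum>i<k. u i \<odot> (F (adj (u i) \<odot> (x \<odot> u j)) \<odot> adj (u j)))"
    unfolding contract_def by (subst sum.swap) (simp add: entry_left_mult)
  also have "\<dots> = (\<Sum>j<k. (\<Sum>i<k. u i \<odot> F (adj (u i) \<odot> (x \<odot> u j))) \<odot> adj (u j))"
    by (simp add: blinfun_compose.sum_left blinfun_compose_assoc)
  also have "\<dots> = (\<Sum>j<k. (x \<odot> u j) \<odot> adj (u j))"
    using x by (intro sum.cong refl) (simp add: frame comp u_in)
  also have "\<dots> = x \<odot> frame_op"
    by (simp add: frame_op_def blinfun_compose.sum_right blinfun_compose_assoc)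
  finally show ?thesis .
qed

lemma contract_bound: "\<exists>C. \<forall>T. norm (contract T) \<le> C * norm T"
proof (intro exI allI)
  fix T
  have "norm (contract T) \<le> (\<Sum>i<k. \<Sum>j<k. norm (u i) * (norm T * norm (adj (u j))))"
    unfolding contract_def
  proof (intro order_trans[OF norm_sum] sum_mono)
    fix i j
    have "norm (u i \<odot> (entry T i j \<odot> adj (u j))) \<le> norm (u i) * norm (entry T i j \<odot> adj (u j))"
      by (rule norm_blinfun_compose)
    also have "\<dots> \<le> norm (u i) * (norm (entry T i j) * norm (adj (u j)))"
      by (intro mult_left_mono norm_blinfun_compose) simp
    also have "\<dots> \<le> norm (u i) * (norm T * norm (adj (u j)))"
      by (intro mult_left_mono mult_right_mono norm_entry) auto
    finally show "norm (u i \<odot> (entry T i j \<odot> adj (u j))) \<le> norm (u i) * (norm T * norm (adj (u j)))" .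
  qed
  also have "\<dots> = (\<Sum>i<k. \<Sum>j<k. norm (u i) * norm (adj (u j))) * norm T"
    by (simp add: sum_distrib_left sum_distrib_right mult_ac)
  finally show "norm (contract T) \<le> (\<Sum>i<k. \<Sum>j<k. norm (u i) * norm (adj (u j))) * norm T" .
qed

lemma contract_wot: "wot_continuous_op X contract"
  unfolding contract_def by (intro wot_intros in_bounded u_in) auto

text \<open>From the rank-one map that sends \<open>y\<close> to \<open>a F(b y)\<close>,
  \<open>contract\<close> makes the product \<open>a b\<close>; this is the defining formula of the
  dual expectation up to the index. On \<open>left_mult x\<close> it produces
  \<open>x \<odot> frame_op\<close>, so division by the index makes the composite with
  \<open>left_mult\<close> idempotent.\<close>

lemma basic_construction:
  obtains F1 U where "framed A1 F1 U k" "{T \<in> A1. F1 T = T} = left_mult ` A"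
proof -
  obtain h h' where h: "h \<in> real_center" "h' \<in> real_center" "h \<odot> h = frame_op" "h \<odot> h' = e"
    by (rule frame_op_sqrt)
  have hA: "h \<in> A" "h' \<in> A" using h real_center_A by auto
  have hc: "h \<odot> x = x \<odot> h" "h' \<odot> x = x \<odot> h'" if "x \<in> A" for x using that real_center_commute h by auto
  define g where "g = h' \<odot> h'"
  have gC: "g \<in> real_center" by (simp add: g_def real_center_comp h)
  have gA: "g \<in> A" and gc: "\<And>x. x \<in> A \<Longrightarrow> g \<odot> x = x \<odot> g"
    using gC real_center_A real_center_commute by auto
  have gh: "g \<odot> h = h'"
  proof -
    have "g \<odot> h = h' \<odot> (h \<odot> h')" using hc(1)[OF hA(2)] by (simp add: g_def blinfun_compose_assoc)
    then show ?thesis using h(4) e_right[OF hA(2)] by simp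
  qed
  have gD: "g \<odot> frame_op = e"
    using gh h(4) hc(2)[OF hA(1)] by (simp add: h(3)[symmetric] flip: blinfun_compose_assoc)
  define F1 where "F1 T = left_mult (g \<odot> contract T)" for T
  \<comment> \<open>The matrix of the module map that sends \<open>y\<close> to
    \<open>u\<^sub>r F(h y)\<close>: the frame element, the Jones projection and the square root
    \<open>h\<close> of the index. The two roots from \<open>U r\<close> and its adjoint cancel the
    division by the index in \<open>F1\<close>.\<close>
  define U where "U r = mat k (\<lambda>a b. F (adj (u a) \<odot> u r) \<odot> F (h \<odot> u b))" for r
  have F1_in: "F1 T \<in> A1" if "T \<in> mB" for T
    using that by (simp add: F1_def left_mult_in_A1 comp contract_in gA)
  have A1_mB: "T \<in> mB" "G \<odot> T = T" "T \<odot> G = T" if "T \<in> A1" for T using that A1_eq by auto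
  have F1_left_mult: "F1 (left_mult x) = left_mult x" if x: "x \<in> A" for x
  proof -
    have "g \<odot> contract (left_mult x) = x" using gc[OF x] gD e_right[OF x] by (simp add: contract_left_mult[OF x]) (metis blinfun_compose_assoc)
    then show ?thesis by (simp add: F1_def)
  qed
  have U_mB: "U r \<in> mB" if "r < k" for r
    unfolding U_def using that by (intro mat_in_amp B_bounded B_closure F_in_B comp u_in u_adj_in hA)
  have entry_U: "entry (U r) a b = F (adj (u a) \<odot> u r) \<odot> F (h \<odot> u b)" if "a < k" "b < k" for r a b
    unfolding U_def using that by (simp add: entry_mat)
  have U_A1: "U r \<in> A1" if r: "r < k" for r
  proof -
    have "G \<odot> U r = U r"
    proof (rule amp_eqI[OF MB.comp U_mB[OF r]])
      fix i j assume ij: "i < k" "j < k"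
      have "entry (G \<odot> U r) i j = (\<Sum>l<k. F (adj (u i) \<odot> u l) \<odot> (F (adj (u l) \<odot> u r) \<odot> F (h \<odot> u j)))"
        using ij G_projection by (subst entry_comp[of _ k B]) (auto simp: projections_def entry_G entry_U)
      also have "\<dots> = entry (U r) i j" using ij r by (simp add: frame_product' u_in u_adj_in entry_U)
      finally show "entry (G \<odot> U r) i j = entry (U r) i j" .
    qed (use G_projection U_mB r in \<open>auto simp: projections_def\<close>)
    moreover have "U r \<odot> G = U r"
    proof (rule amp_eqI[OF MB.comp U_mB[OF r]])
      fix i j assume ij: "i < k" "j < k"
      have "entry (U r \<odot> G) i j = F (adj (u i) \<odot> u r) \<odot> (\<Sum>l<k. F (h \<odot> u l) \<odot> F (adj (u l) \<odot> u j))"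
        using ij by (subst entry_comp[OF U_mB[OF r]]) (simp add: entry_G entry_U blinfun_compose.sum_right blinfun_compose_assoc)
      also have "\<dots> = entry (U r) i j" using ij r by (simp add: frame_product u_in hA entry_U)
      finally show "entry (U r \<odot> G) i j = entry (U r) i j" .
    qed (use G_projection U_mB r in \<open>auto simp: projections_def\<close>)
    ultimately show ?thesis using U_mB[OF r] by (simp add: A1_eq)
  qed
  have fr: "framed A1 F1 U k"
  proof unfold_locales
    show "F1 (unit_of A1) = unit_of A1"
      unfolding MB.corner_vN(2)[OF G_projection] using F1_left_mult[OF e_in] by (simp add: G_def)
    show "\<exists>C. \<forall>x\<in>A1. norm (F1 x) \<le> C * norm x"
    proof -
      obtain C1 where C1: "\<And>x. x \<in> A \<Longrightarrow> norm (left_mult x) \<le> C1 * norm x" using left_mult_bound by blast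
      obtain C2 where C2: "\<And>T. norm (contract T) \<le> C2 * norm T" using contract_bound by blast
      have "norm (F1 T) \<le> (\<bar>C1\<bar> * norm g * C2) * norm T" if "T \<in> A1" for T
      proof -
        have "norm (F1 T) \<le> C1 * norm (g \<odot> contract T)"
          unfolding F1_def using that A1_mB by (intro C1 comp gA contract_in) auto
        also have "\<dots> \<le> \<bar>C1\<bar> * norm (g \<odot> contract T)" by (intro mult_right_mono) auto
        also have "\<dots> \<le> \<bar>C1\<bar> * (norm g * norm (contract T))" by (intro mult_left_mono norm_blinfun_compose) auto
        also have "\<dots> \<le> \<bar>C1\<bar> * (norm g * (C2 * norm T))" by (intro mult_left_mono C2) auto
        finally show ?thesis by (simp add: mult_ac)
      qed
      then show ?thesis by blast
    qed
    show "U i \<in> A1" if "i < k" for i by (rule U_A1[OF that])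
    show "wot_continuous A1 \<phi>" if "\<phi> \<in> sigma_weak_functionals" for \<phi>
    proof (rule continuous_map_from_subtopology_mono[OF amp_sigma_weak[OF that]])
      have "mB \<subseteq> amp k A" by (auto simp: amp_def B_def)
      then show "A1 \<subseteq> amp k A" using MB.corner_subset[OF G_projection] by blast
    qed
    show "wot_continuous_op A1 F1"
      unfolding F1_def using A1_mB
      by (intro wot_continuous_op_compose[OF left_mult_wot] wot_intros contract_wot in_bounded gA A_bounded)
        (auto intro!: comp gA contract_in)
  next
    fix x y assume xy: "x \<in> A1" "y \<in> A1"
    note x = A1_mB[OF xy(1)] and y = A1_mB[OF xy(2)]
    show "F1 (x + y) = F1 x + F1 y"
      using x y by (simp add: F1_def contract_add blinfun_compose.add_right left_mult_add comp contract_in gA)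
    assume fixed: "F1 x = x"
    define m where "m = g \<odot> contract x"
    have m: "m \<in> A" "x = left_mult m" using x fixed by (auto simp: m_def comp gA contract_in F1_def)
    have "F1 (x \<odot> y) = left_mult (g \<odot> (m \<odot> contract y))" using y m by (simp add: F1_def contract_left_mult_comp)
    also have "g \<odot> (m \<odot> contract y) = m \<odot> (g \<odot> contract y)" using gc[OF m(1)] by (metis blinfun_compose_assoc)
    also have "left_mult \<dots> = x \<odot> F1 y" using y m by (simp add: F1_def left_mult_comp comp gA contract_in)
    finally show "F1 (x \<odot> y) = x \<odot> F1 y" .
  next
    fix x c assume "x \<in> A1"
    note x = A1_mB[OF this]
    show "F1 x \<in> A1" by (rule F1_in[OF x(1)])
    show "F1 (c *\<^sub>O x) = c *\<^sub>O F1 x"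
      using x by (simp add: F1_def contract_scale left_mult_scale op_scale_compose_right in_bounded gA comp contract_in)
    show "F1 (F1 x) = F1 x"
      using F1_left_mult[of "g \<odot> contract x"] x by (simp add: F1_def[of x] comp gA contract_in)
    show "F1 (adj x) = adj (F1 x)"
    proof -
      have "adj (F1 x) = left_mult (adj (g \<odot> contract x))"
        unfolding F1_def using x by (intro left_mult_adj[symmetric] comp gA contract_in)
      also have "adj (g \<odot> contract x) = g \<odot> contract (adj x)"
        using x gc[of "adj (contract x)"] by (simp add: adj_comp_in gA contract_in adj real_center_adj[OF gC] contract_adj)
      finally show ?thesis by (simp add: F1_def)
    qed
    show "(\<Sum>r<k. U r \<odot> F1 (adj (U r) \<odot> x)) = x"
    proof (rule amp_eqI[OF MB.sum x(1)])
      show "U r \<odot> F1 (adj (U r) \<odot> x) \<in> mB" if "r \<in> {..<k}" for r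
        using that x U_mB[of r] by (intro MB.comp) (auto simp: F1_def intro!: left_mult_in comp gA contract_in MB.comp MB.adj)
      fix i j assume ij: "i < k" "j < k"
      have Gx: "(\<Sum>l<k. F (adj (u a) \<odot> u l) \<odot> entry x l b) = entry x a b" if "a < k" "b < k" for a b
      proof -
        have "entry (G \<odot> x) a b = (\<Sum>l<k. entry G a l \<odot> entry x l b)"
          using G_projection by (intro entry_comp[where A = B]) (simp add: projections_def)
        then show ?thesis using that x by (simp add: entry_G)
      qed
      have xG: "(\<Sum>l<k. entry x a l \<odot> F (adj (u l) \<odot> u b)) = entry x a b" if "a < k" "b < k" for a b
        using that x entry_comp[OF x(1), of G a b] by (simp add: entry_G)
      \<comment> \<open>Row \<open>r\<close> of \<open>x\<close>, assembled to an element of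
        \<open>A\<close>; by \<open>xG\<close> its entries come back as
        \<open>F (y r \<odot> u j)\<close>.\<close>
      define y where "y r = (\<Sum>b<k. entry x r b \<odot> adj (u b))" for r
      have yA: "y r \<in> A" if "r < k" for r
        unfolding y_def using that x by (intro sum comp entry_A u_adj_in) auto
      have "entry (U r \<odot> F1 (adj (U r) \<odot> x)) i j = F (adj (u i) \<odot> u r) \<odot> entry x r j" if r: "r < k" for r
      proof -
        have entU: "entry (adj (U r) \<odot> x) a b = F (adj (u a) \<odot> h) \<odot> entry x r b" if ab: "a < k" "b < k" for a b
        proof -
          have "entry (adj (U r) \<odot> x) a b = (\<Sum>l<k. entry (adj (U r)) a l \<odot> entry x l b)"
            by (intro entry_comp[where A = B] MB.adj U_mB r)
          also have "\<dots> = (\<Sum>l<k. F (adj (u a) \<odot> h) \<odot> (F (adj (u r) \<odot> u l) \<odot> entry x l b))"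
          proof (intro sum.cong refl)
            fix l assume "l \<in> {..<k}"
            then have l: "l < k" by simp
            have "entry (adj (U r)) a l = adj (F (adj (u l) \<odot> u r) \<odot> F (h \<odot> u a))"
              using ab l U_mB[OF r] MB.in_bounded by (simp add: entry_adj entry_U)
            also have "\<dots> = F (adj (u a) \<odot> h) \<odot> F (adj (u r) \<odot> u l)"
              using ab l r hA by (simp add: adj_comp_in F_in comp u_in u_adj_in adj_adj_in
                  real_center_adj[OF h(1)] flip: F_adj)
            finally show "entry (adj (U r)) a l \<odot> entry x l b = F (adj (u a) \<odot> h) \<odot> (F (adj (u r) \<odot> u l) \<odot> entry x l b)"
              by (simp add: blinfun_compose_assoc)
          qed
          also have "\<dots> = F (adj (u a) \<odot> h) \<odot> entry x r b"
            using Gx[OF r ab(2)] by (simp flip: blinfun_compose.sum_right)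
          finally show ?thesis .
        qed
        have "contract (adj (U r) \<odot> x) = (\<Sum>a<k. u a \<odot> F (adj (u a) \<odot> h)) \<odot> y r"
          unfolding contract_def y_def
          by (simp add: entU blinfun_compose.sum_left blinfun_compose.sum_right blinfun_compose_assoc)
             (rule sum.swap)
        also have "\<dots> = h \<odot> y r" by (simp add: frame hA)
        finally have "F1 (adj (U r) \<odot> x) = left_mult (h' \<odot> y r)"
          by (simp add: F1_def gh flip: blinfun_compose_assoc)
        then have "entry (U r \<odot> F1 (adj (U r) \<odot> x)) i j
          = F (adj (u i) \<odot> u r) \<odot> (\<Sum>l<k. F (h \<odot> u l) \<odot> F (adj (u l) \<odot> ((h' \<odot> y r) \<odot> u j)))"
          using ij by (simp add: entry_comp[OF U_mB[OF r]] entry_U entry_left_mult blinfun_compose.sum_right blinfun_compose_assoc)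
        also have "(\<Sum>l<k. F (h \<odot> u l) \<odot> F (adj (u l) \<odot> ((h' \<odot> y r) \<odot> u j))) = F (h \<odot> ((h' \<odot> y r) \<odot> u j))"
          using ij r by (intro frame_product comp hA yA u_in)
        also have "h \<odot> ((h' \<odot> y r) \<odot> u j) = y r \<odot> u j"
          using h(4) e_left[OF yA[OF r]] by (metis blinfun_compose_assoc)
        also have "F (y r \<odot> u j) = (\<Sum>b<k. F (entry x r b \<odot> (adj (u b) \<odot> u j)))"
          unfolding y_def blinfun_compose.sum_left blinfun_compose_assoc
          using ij r x by (intro F_sum comp entry_A u_in u_adj_in) auto
        also have "\<dots> = (\<Sum>b<k. entry x r b \<odot> F (adj (u b) \<odot> u j))"
          using ij r x by (intro sum.cong refl F_left_B entry_B comp u_in u_adj_in) auto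
        also have "\<dots> = entry x r j" by (rule xG[OF r ij(2)])
        finally show ?thesis .
      qed
      then have "entry (\<Sum>r<k. U r \<odot> F1 (adj (U r) \<odot> x)) i j = (\<Sum>r<k. F (adj (u i) \<odot> u r) \<odot> entry x r j)"
        by (simp add: entry_sum)
      also have "\<dots> = entry x i j" by (rule Gx[OF ij])
      finally show "entry (\<Sum>r<k. U r \<odot> F1 (adj (U r) \<odot> x)) i j = entry x i j" .
    qed
  qed
  moreover have "{T \<in> A1. F1 T = T} = left_mult ` A"
  proof safe
    fix T assume "T \<in> A1" "F1 T = T"
    then show "T \<in> left_mult ` A"
      by (intro image_eqI[of _ _ "g \<odot> contract T"]) (auto simp: F1_def comp gA contract_in A1_mB)
  qed (auto simp: left_mult_in_A1 F1_left_mult)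
  ultimately show thesis by (rule that)
qed

text \<open>\<open>property_down\<close> is applied to the projection \<open>w\<close> of \<open>A1\<close> given by right multiplication with \<open>q\<close>.\<close>

lemma property_up:
  assumes P: "ideal_prop P" and desc: "descends_strongly_PP P"
    and q: "q \<in> central_projections B" and Pq: "P (corner q B)"
  obtains c where "c \<in> central_projections A" "P (corner c A)" "c \<odot> q = q"
proof -
  interpret P: ideal_prop P by fact
  have qpr: "q \<in> projections B" using q by (simp add: central_projections_def)
  have qB: "q \<in> B" and qq: "q \<odot> q = q" and adj_q: "adj q = q" and qc: "\<And>x. x \<in> B \<Longrightarrow> q \<odot> x = x \<odot> q"
    using q by (auto simp: central_projections_def projections_def center_def)
  have qA: "q \<in> A" using qB B_sub by blast
  define w where "w = mat k (\<lambda>i j. F (adj (u i) \<odot> u j) \<odot> q)"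
  have w_mB: "w \<in> mB"
    unfolding w_def by (intro mat_in_amp B_bounded B_closure F_in_B comp u_in u_adj_in qB)
  have entry_w: "entry w i j = F (adj (u i) \<odot> u j) \<odot> q" if "i < k" "j < k" for i j
    unfolding w_def using that by (simp add: entry_mat)
  have FB: "F (adj (u i) \<odot> u j) \<in> B" if "i < k" "j < k" for i j
    using that by (intro F_in_B comp u_in u_adj_in)
  have wT: "entry (w \<odot> T) i j = entry (G \<odot> T) i j \<odot> q" if T: "T \<in> mB" and ij: "i < k" "j < k" for T i j
  proof -
    have "entry (w \<odot> T) i j = (\<Sum>l<k. entry w i l \<odot> entry T l j)" by (rule entry_comp[OF w_mB])
    also have "\<dots> = (\<Sum>l<k. (entry G i l \<odot> entry T l j) \<odot> q)"
      using ij T qc by (intro sum.cong refl) (simp add: entry_w entry_G entry_B blinfun_compose_assoc)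
    also have "\<dots> = entry (G \<odot> T) i j \<odot> q"
      using G_projection by (subst entry_comp[of G k B]) (auto simp: projections_def blinfun_compose.sum_left)
    finally show ?thesis .
  qed
  have Tw: "entry (T \<odot> w) i j = entry (T \<odot> G) i j \<odot> q" if T: "T \<in> mB" and ij: "i < k" "j < k" for T i j
  proof -
    have "entry (T \<odot> w) i j = (\<Sum>l<k. entry T i l \<odot> entry w l j)" by (rule entry_comp[OF T])
    also have "\<dots> = (\<Sum>l<k. entry T i l \<odot> entry G l j) \<odot> q"
      using ij by (simp add: entry_w entry_G blinfun_compose.sum_left blinfun_compose_assoc)
    also have "\<dots> = entry (T \<odot> G) i j \<odot> q" by (simp add: entry_comp[OF T])
    finally show ?thesis .
  qed
  have GG: "G \<in> mB" "G \<odot> G = G" "adj G = G" using G_projection by (auto simp: projections_def)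
  have w_entry: "entry w i j = entry G i j \<odot> q" if "i < k" "j < k" for i j using that by (simp add: entry_w entry_G)
  have Gw: "G \<odot> w = w" "w \<odot> G = w"
    by (rule amp_eqI[OF MB.comp[OF GG(1) w_mB] w_mB], simp add: Tw GG w_entry)
      (rule amp_eqI[OF MB.comp[OF w_mB GG(1)] w_mB], simp add: wT GG w_entry)
  have wA1: "w \<in> A1" using w_mB Gw by (simp add: A1_eq)
  have adj_w: "adj w = w"
  proof (rule amp_eqI[OF MB.adj[OF w_mB] w_mB])
    fix i j assume ij: "i < k" "j < k"
    have "entry (adj w) i j = adj (entry G j i \<odot> q)" using ij MB.in_bounded[OF w_mB] by (simp add: entry_adj w_entry)
    also have "\<dots> = q \<odot> adj (entry G j i)"
      using ij entry_A[OF GG(1)] by (simp add: adj_comp_in qA adj_q)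
    also have "adj (entry G j i) = entry G i j"
      using ij GG MB.in_bounded[OF GG(1)] by (metis entry_adj)
    also have "q \<odot> entry G i j = entry w i j" using ij entry_B[OF GG(1)] by (simp add: qc w_entry)
    finally show "entry (adj w) i j = entry w i j" .
  qed
  have ww: "w \<odot> w = w"
    by (rule amp_eqI[OF MB.comp[OF w_mB w_mB] w_mB]) (simp add: wT w_mB Gw w_entry blinfun_compose_assoc qq)
  have w_mpr: "w \<in> projections mB" using w_mB adj_w ww by (simp add: projections_def)
  have wpr: "w \<in> projections A1" using wA1 adj_w ww by (simp add: projections_def)
  have "w \<odot> T = T \<odot> w" if "T \<in> A1" for T
  proof (rule amp_eqI[OF MB.comp MB.comp])
    show "T \<in> mB" "w \<in> mB" "w \<in> mB" "T \<in> mB" using that w_mB by (auto simp: A1_eq)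
    then show "entry (w \<odot> T) i j = entry (T \<odot> w) i j" if "i < k" "j < k" for i j
      using that \<open>T \<in> A1\<close> by (simp add: wT Tw A1_eq)
  qed
  then have w_central: "w \<in> central_projections A1"
    using wpr by (simp add: central_projections_def center_def wA1)
  \<comment> \<open>Operators below \<open>w\<close> have their entries in the corner of
    \<open>B\<close> at \<open>q\<close>. So the corner at \<open>w\<close> is also a corner of the
    matrices over \<open>corner q B\<close>, and these have the property by
    \<open>P_amp\<close>.\<close>
  have "P (corner w A1)"
  proof -
    have cq: "corner q B = {x \<in> B. q \<odot> x = x \<and> x \<odot> q = x}" by (rule BA.corner_eq[OF qpr])
    have vq: "von_neumann_algebra (corner q B)" by (rule BA.corner_vN[OF qpr])
    have Q: "P (amp k (corner q B))" by (rule P_amp[OF vq P Pq])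
    interpret MQ: vN_algebra "amp k (corner q B)" by unfold_locales (rule amp_vN[OF vq])
    have sub: "amp k (corner q B) \<subseteq> mB" by (auto simp: amp_def cq)
    have wQ: "T \<in> amp k (corner q B)" if T: "T \<in> mB" "w \<odot> T = T" for T
    proof -
      have "entry T i j \<in> corner q B" if ij: "i < k" "j < k" for i j
      proof -
        have eq: "entry T i j = entry (G \<odot> T) i j \<odot> q" using wT[OF T(1) ij] T(2) by simp
        have "entry T i j \<odot> q = entry T i j" by (subst (1 2) eq) (simp add: blinfun_compose_assoc qq)
        then show ?thesis using entry_B[OF T(1) ij] qc by (simp add: cq)
      qed
      then show ?thesis using T by (simp add: amp_def)
    qed
    have w_qpr: "w \<in> projections (amp k (corner q B))"
      using wQ[OF w_mB ww] adj_w ww by (simp add: projections_def)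
    have "corner w (amp k (corner q B)) = corner w mB"
      unfolding MQ.corner_eq[OF w_qpr] MB.corner_eq[OF w_mpr] using sub wQ by auto
    moreover have "corner w A1 = corner w mB"
      by (rule MB.corner_corner[OF G_projection wpr])
    ultimately show ?thesis using P.corner_property[OF MQ.vN Q w_qpr] by simp
  qed
  obtain F1 U where fr: "framed A1 F1 U k" and fixpts: "{T \<in> A1. F1 T = T} = left_mult ` A"
    by (rule basic_construction)
  interpret C: framed_isometries A1 F1 U k S
    by (simp add: framed_isometries_def isometries_axioms fr)
  have CB: "C.B = left_mult ` A" by (simp add: C.B_def fixpts)
  interpret CBA: vN_algebra C.B by unfold_locales (rule C.B_vN)
  obtain s where s: "s \<in> central_projections C.B" "P (corner s C.B)" "s \<odot> w = w"
    by (rule C.property_down[OF P desc w_central \<open>P (corner w A1)\<close>])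
  then have spr: "s \<in> projections C.B" by (simp add: central_projections_def)
  have sB: "s \<in> left_mult ` A" and ss: "s \<odot> s = s" and adj_s: "adj s = s"
    and sc: "\<And>x. x \<in> A \<Longrightarrow> s \<odot> left_mult x = left_mult x \<odot> s"
    using s(1) unfolding CB by (auto simp: central_projections_def projections_def center_def)
  obtain c where cA: "c \<in> A" and s_c: "s = left_mult c" using sB by blast
  have adj_c: "adj c = c" by (rule left_mult_inj) (use cA adj_s s_c in \<open>auto simp: adj left_mult_adj\<close>)
  have cc: "c \<odot> c = c" by (rule left_mult_inj) (use cA ss s_c in \<open>auto simp: comp left_mult_comp\<close>)
  have comm: "c \<odot> x = x \<odot> c" if "x \<in> A" for x
    by (rule left_mult_inj) (use cA sc[OF that] s_c that in \<open>auto simp: comp left_mult_comp\<close>)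
  have cpr: "c \<in> projections A" using cA adj_c cc by (simp add: projections_def)
  have c: "c \<in> central_projections A"
    using cpr comm by (simp add: central_projections_def center_def cA)
  have "P (corner c A) \<longleftrightarrow> P (corner s C.B)"
  proof (rule P.iso_iff[where \<phi> = left_mult])
    show "von_neumann_algebra (corner c A)" by (rule corner_vN[OF cpr])
    show "von_neumann_algebra (corner s C.B)" by (rule CBA.corner_vN[OF spr])
    have sub: "corner c A \<subseteq> A" by (rule corner_subset[OF cpr])
    show "bij_betw left_mult (corner c A) (corner s C.B)"
    proof (rule bij_betw_imageI)
      show "inj_on left_mult (corner c A)" using sub left_mult_inj by (intro inj_onI) blast
      show "left_mult ` corner c A = corner s C.B"
      proof safe
        fix x assume "x \<in> corner c A"
        then have "x \<in> A" "c \<odot> x = x" "x \<odot> c = x" by (auto simp: corner_eq[OF cpr])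
        then have "left_mult x \<in> C.B \<and> s \<odot> left_mult x = left_mult x \<and> left_mult x \<odot> s = left_mult x"
          unfolding CB s_c using cA by (simp flip: left_mult_comp)
        then show "left_mult x \<in> corner s C.B" by (simp add: CBA.corner_eq[OF spr])
      next
        fix T assume "T \<in> corner s C.B"
        then have T: "T \<in> left_mult ` A" "s \<odot> T = T" "T \<odot> s = T"
          by (auto simp: CBA.corner_eq[OF spr] simp flip: CB)
        then obtain x where x: "x \<in> A" "T = left_mult x" by blast
        have "c \<odot> x = x" by (rule left_mult_inj) (use T x cA s_c in \<open>auto simp: comp left_mult_comp\<close>)
        moreover have "x \<odot> c = x" by (rule left_mult_inj) (use T x cA s_c in \<open>auto simp: comp left_mult_comp\<close>)
        ultimately have "x \<in> corner c A" using x cpr by (simp add: corner_eq)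
        then show "T \<in> left_mult ` corner c A" using x by blast
      qed
    qed
  qed (use corner_subset[OF cpr] in \<open>auto simp: left_mult_scale left_mult_adj subset_iff intro!: left_mult_add left_mult_comp\<close>)
  then have Pc: "P (corner c A)" using s by simp
  \<comment> \<open>The relation \<open>s \<odot> w = w\<close> read off entry by entry.\<close>
  have entc: "F (adj (u i) \<odot> (c \<odot> u j)) \<odot> q = F (adj (u i) \<odot> u j) \<odot> q" if ij: "i < k" "j < k" for i j
  proof -
    have "entry (s \<odot> w) i j = entry (s \<odot> G) i j \<odot> q" by (rule Tw[OF _ ij]) (simp add: s_c left_mult_in cA)
    also have "s \<odot> G = s" unfolding s_c G_def using cA e_right[OF cA] by (simp add: e_in flip: left_mult_comp)
    finally show ?thesis using ij s(3) by (simp add: s_c entry_left_mult entry_w)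
  qed
  \<comment> \<open>Expanding the factor \<open>q\<close> in the frame turns the entrywise relation
    into equality of all frame coefficients of \<open>c \<odot> q\<close> and
    \<open>q\<close>.\<close>
  have "F (adj (u i) \<odot> (c \<odot> q)) = F (adj (u i) \<odot> q)" if i: "i < k" for i
  proof -
    have *: "F (adj (u i) \<odot> (x \<odot> q)) = (\<Sum>j<k. F (adj (u i) \<odot> (x \<odot> u j)) \<odot> q \<odot> F (adj (u j)))"
      if x: "x \<in> A" for x
    proof -
      have "F (adj (u i) \<odot> (x \<odot> q)) = F ((adj (u i) \<odot> x) \<odot> q)" by (simp add: blinfun_compose_assoc)
      also have "\<dots> = (\<Sum>j<k. F ((adj (u i) \<odot> x) \<odot> u j) \<odot> F (adj (u j) \<odot> q))"
        using i x qA by (intro frame_product[symmetric] comp u_adj_in)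
      also have "\<dots> = (\<Sum>j<k. F (adj (u i) \<odot> (x \<odot> u j)) \<odot> q \<odot> F (adj (u j)))"
      proof (intro sum.cong refl)
        fix j assume "j \<in> {..<k}"
        then have j: "j < k" by simp
        have "F (adj (u j) \<odot> q) = q \<odot> F (adj (u j))"
          using j qB qc[of "F (adj (u j))"] by (simp add: F_right u_adj_in F_in_B)
        then show "F ((adj (u i) \<odot> x) \<odot> u j) \<odot> F (adj (u j) \<odot> q)
          = F (adj (u i) \<odot> (x \<odot> u j)) \<odot> q \<odot> F (adj (u j))" by (simp add: blinfun_compose_assoc)
      qed
      finally show ?thesis .
    qed
    have "F (adj (u i) \<odot> (c \<odot> q)) = F (adj (u i) \<odot> (e \<odot> q))"
      unfolding *[OF cA] *[OF e_in] using i entc by (intro sum.cong refl) (simp add: e_left u_in)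
    then show ?thesis by (simp add: e_left qA)
  qed
  then have "(\<Sum>i<k. u i \<odot> F (adj (u i) \<odot> (c \<odot> q))) = (\<Sum>i<k. u i \<odot> F (adj (u i) \<odot> q))" by simp
  then have "c \<odot> q = q" using cA qA by (simp add: frame comp)
  then show thesis using that c Pc by blast
qed

end

section \<open>Isometries with orthogonal ranges\<close>

lemma operator_of_form:
  fixes \<beta> :: "'h::complex_hilbert_space \<Rightarrow> 'h \<Rightarrow> complex"
  assumes add: "\<And>x y z. \<beta> (x + y) z = \<beta> x z + \<beta> y z" "\<And>x y z. \<beta> z (x + y) = \<beta> z x + \<beta> z y"
    and scale: "\<And>c x y. \<beta> (c *\<^sub>C x) y = cnj c * \<beta> x y" "\<And>c x y. \<beta> x (c *\<^sub>C y) = c * \<beta> x y"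
    and bound: "\<And>x y. cmod (\<beta> x y) \<le> K * norm x * norm y" and K: "0 \<le> K"
  obtains T where "T \<in> bounded_operators" "\<And>x y. cinner x (blinfun_apply T y) = \<beta> x y" "norm T \<le> K"
proof -
  have "\<exists>t. \<forall>x. Re (\<beta> x y) = inner t x" for y
  proof (rule riesz, rule bounded_linear_intro[where K = "K * norm y"])
    fix x z r
    show "Re (\<beta> (x + z) y) = Re (\<beta> x y) + Re (\<beta> z y)" by (simp add: add)
    show "Re (\<beta> (r *\<^sub>R x) y) = r *\<^sub>R Re (\<beta> x y)" by (simp add: scaleR_eq_scaleC scale)
    show "norm (Re (\<beta> x y)) \<le> norm x * (K * norm y)"
      using abs_Re_le_cmod[of "\<beta> x y"] bound[of x y] by (simp add: mult_ac)
  qed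
  then obtain t where t: "\<And>y x. Re (\<beta> x y) = inner (t y) x" by metis
  have re: "Re (cinner x (t y)) = Re (\<beta> x y)" for x y
    by (simp add: t inner_commute flip: inner_eq_Re_cinner)
  \<comment> \<open>The real parts at \<open>x\<close> and at \<open>\<i> *\<^sub>C x\<close>
    determine the complex values.\<close>
  have eq: "cinner x (t y) = \<beta> x y" for x y
    using re[of x y] re[of "\<i> *\<^sub>C x" y] by (simp add: scale cinner_scaleC_left complex_eq_iff)
  have lin: "t (x + y) = t x + t y" "t (c *\<^sub>C x) = c *\<^sub>C t x" for x y c
    by (rule cinner_extI, simp add: eq add scale cinner_add_right cinner_scaleC_right)+
  have le: "norm (t y) \<le> K * norm y" for y
  proof (cases "norm (t y) = 0")
    case False
    have "(norm (t y))\<^sup>2 = cmod (\<beta> (t y) y)" using cinner_self[of "t y"] by (simp add: eq norm_power)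
    also have "\<dots> \<le> K * norm (t y) * norm y" by (rule bound)
    finally have "norm (t y) * norm (t y) \<le> norm (t y) * (K * norm y)" by (simp add: power2_eq_square mult_ac)
    moreover have "norm (t y) > 0" using False by simp
    ultimately show ?thesis using mult_le_cancel_left_pos by blast
  qed (simp add: K)
  have bl: "bounded_linear t"
    by (rule bounded_linear_intro[where K = K]) (auto simp: lin scaleR_eq_scaleC mult.commute[of _ K] le)
  show thesis
  proof
    show "Blinfun t \<in> bounded_operators"
      by (simp add: bounded_operators_def bounded_linear_Blinfun_apply[OF bl] lin)
    show "cinner x (blinfun_apply (Blinfun t) y) = \<beta> x y" for x y
      by (simp add: bounded_linear_Blinfun_apply[OF bl] eq)
    show "norm (Blinfun t) \<le> K"
      by (rule norm_blinfun_bound) (auto simp: bounded_linear_Blinfun_apply[OF bl] le K)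
  qed
qed

text \<open>The common source of the isometries, the ampliations, the vectors with prescribed
  components and the sums of projections: the operator is the sum of the products of the adjoint of
  \<alpha> with \<gamma>, built from its sesquilinear form since the series need not converge in
  norm.\<close>

lemma operator_of_sum:
  fixes \<alpha> \<gamma> :: "'i \<Rightarrow> 'h::complex_hilbert_space \<Rightarrow> 'h"
  assumes \<alpha>: "\<And>i x y. \<alpha> i (x + y) = \<alpha> i x + \<alpha> i y" "\<And>i c x. \<alpha> i (c *\<^sub>C x) = c *\<^sub>C \<alpha> i x"
    and \<gamma>: "\<And>i x y. \<gamma> i (x + y) = \<gamma> i x + \<gamma> i y" "\<And>i c x. \<gamma> i (c *\<^sub>C x) = c *\<^sub>C \<gamma> i x"
    and bessel: "\<And>J x. finite J \<Longrightarrow> J \<subseteq> I \<Longrightarrow> (\<Sum>i\<in>J. (norm (\<alpha> i x))\<^sup>2) \<le> (norm x)\<^sup>2"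
      "\<And>J x. finite J \<Longrightarrow> J \<subseteq> I \<Longrightarrow> (\<Sum>i\<in>J. (norm (\<gamma> i x))\<^sup>2) \<le> (C * norm x)\<^sup>2"
    and C: "0 \<le> C"
  obtains T where "T \<in> bounded_operators"
    "\<And>x y. ((\<lambda>i. cinner (\<alpha> i x) (\<gamma> i y)) has_sum cinner x (blinfun_apply T y)) I" "norm T \<le> C"
proof -
  have fin: "(\<Sum>i\<in>J. cmod (cinner (\<alpha> i x) (\<gamma> i y))) \<le> C * norm x * norm y"
    if J: "finite J" "J \<subseteq> I" for J x y
  proof -
    have "(\<Sum>i\<in>J. norm (\<alpha> i x) * norm (\<gamma> i y))\<^sup>2 \<le> (\<Sum>i\<in>J. (norm (\<alpha> i x))\<^sup>2) * (\<Sum>i\<in>J. (norm (\<gamma> i y))\<^sup>2)"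
      by (rule Cauchy_Schwarz_ineq_sum)
    also have "\<dots> \<le> (norm x)\<^sup>2 * (C * norm y)\<^sup>2"
      by (intro mult_mono bessel J sum_nonneg) auto
    also have "\<dots> = (C * norm x * norm y)\<^sup>2" by (simp add: power_mult_distrib)
    finally have "(\<Sum>i\<in>J. norm (\<alpha> i x) * norm (\<gamma> i y)) \<le> C * norm x * norm y"
      by (rule power2_le_imp_le) (simp add: C)
    moreover have "(\<Sum>i\<in>J. cmod (cinner (\<alpha> i x) (\<gamma> i y))) \<le> (\<Sum>i\<in>J. norm (\<alpha> i x) * norm (\<gamma> i y))"
      by (intro sum_mono norm_cinner_le)
    ultimately show ?thesis by linarith
  qed
  have abs: "(\<lambda>i. cmod (cinner (\<alpha> i x) (\<gamma> i y))) summable_on I" for x y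
    by (rule nonneg_bdd_above_summable_on) (auto intro!: bdd_aboveI[of _ "C * norm x * norm y"] fin)
  note summ = abs_summable_summable[OF abs]
  define \<beta> where "\<beta> x y = infsum (\<lambda>i. cinner (\<alpha> i x) (\<gamma> i y)) I" for x y
  have "cmod (\<beta> x y) \<le> C * norm x * norm y" for x y
  proof -
    have "cmod (\<beta> x y) \<le> infsum (\<lambda>i. cmod (cinner (\<alpha> i x) (\<gamma> i y))) I"
      unfolding \<beta>_def by (rule norm_infsum_bound[OF abs])
    also have "\<dots> \<le> C * norm x * norm y"
      by (rule infsum_le_finite_sums[OF abs]) (rule fin)
    finally show ?thesis .
  qed
  moreover have "\<beta> (x + y) z = \<beta> x z + \<beta> y z" "\<beta> z (x + y) = \<beta> z x + \<beta> z y" for x y z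
    unfolding \<beta>_def by (simp_all add: \<alpha> \<gamma> cinner_add_left cinner_add_right infsum_add summ)
  moreover have "\<beta> (c *\<^sub>C x) y = cnj c * \<beta> x y" "\<beta> x (c *\<^sub>C y) = c * \<beta> x y" for c x y
    unfolding \<beta>_def by (simp_all add: \<alpha> \<gamma> cinner_scaleC_left cinner_scaleC_right infsum_cmult_right')
  ultimately obtain T where T: "T \<in> bounded_operators" "\<And>x y. cinner x (blinfun_apply T y) = \<beta> x y" "norm T \<le> C"
    using operator_of_form[of \<beta> C] C by metis
  have "((\<lambda>i. cinner (\<alpha> i x) (\<gamma> i y)) has_sum cinner x (blinfun_apply T y)) I" for x y
    unfolding T(2) \<beta>_def by (rule has_sum_infsum[OF summ])
  then show thesis using that T by blast
qed

definition orthonormal :: "'h::complex_hilbert_space set \<Rightarrow> bool" where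
  "orthonormal B \<longleftrightarrow> (\<forall>x\<in>B. \<forall>y\<in>B. cinner x y = (if x = y then 1 else 0))"

text \<open>The condition on \<open>x\<close> makes \<open>x\<close> minus the sum orthogonal to
  every \<open>v i\<close>. Formulated for components instead of an orthonormal set, the inequality
  covers ranges of isometries and of projections as well.\<close>

lemma orthogonal_bessel:
  fixes x :: "'h::complex_hilbert_space"
  assumes "finite J" and orth: "\<And>i j. i \<in> J \<Longrightarrow> j \<in> J \<Longrightarrow> i \<noteq> j \<Longrightarrow> cinner (v i) (v j) = 0"
    and x: "\<And>i. i \<in> J \<Longrightarrow> cinner x (v i) = cinner (v i) (v i)"
  shows "(\<Sum>i\<in>J. (norm (v i))\<^sup>2) \<le> (norm x)\<^sup>2"
proof -
  define N where "N = (\<Sum>i\<in>J. (norm (v i))\<^sup>2)"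
  define y where "y = (\<Sum>i\<in>J. v i)"
  have N: "(\<Sum>i\<in>J. cinner (v i) (v i)) = complex_of_real N" by (simp add: N_def cinner_self)
  have "cinner x y = complex_of_real N" unfolding y_def cinner.sum_right N[symmetric] by (simp add: x)
  moreover have "cinner y x = cnj (cinner x y)" by (rule cinner_commute)
  moreover have "cinner y y = complex_of_real N"
  proof -
    have "cinner y y = (\<Sum>j\<in>J. \<Sum>i\<in>J. if i = j then cinner (v i) (v i) else 0)"
      unfolding y_def cinner.sum_left cinner.sum_right by (intro sum.cong refl) (auto simp: orth)
    then show ?thesis using assms(1) by (simp add: N)
  qed
  moreover have "cinner (x - y) (x - y) = cinner x x - cinner x y - (cinner y x - cinner y y)"
    by (simp only: cinner.diff_left cinner.diff_right) simp
  ultimately have "cinner (x - y) (x - y) = complex_of_real ((norm x)\<^sup>2 - N)"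
    by (simp add: cinner_self[of x])
  then have "(norm (x - y))\<^sup>2 = (norm x)\<^sup>2 - N" unfolding cinner_self by (simp only: of_real_eq_iff)
  then show ?thesis using zero_le_power2[of "norm (x - y)"] by (simp add: N_def)
qed

lemma orthonormal_norm:
  assumes "orthonormal B" "b \<in> B"
  shows "norm b = 1"
proof -
  have "complex_of_real ((norm b)\<^sup>2) = complex_of_real 1"
    using assms unfolding cinner_self[symmetric] by (simp add: orthonormal_def)
  then have "(norm b)\<^sup>2 = 1" by (simp only: of_real_eq_iff)
  then show ?thesis using norm_ge_zero[of b] by (auto simp: power2_eq_1_iff)
qed

lemma orthonormal_bessel:
  assumes "orthonormal B" "finite J" "J \<subseteq> B"
  shows "(\<Sum>b\<in>J. (cmod (cinner b x))\<^sup>2) \<le> (norm x)\<^sup>2"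
proof -
  have on: "cinner a b = (if a = b then 1 else 0)" if "a \<in> J" "b \<in> J" for a b
    using assms that by (auto simp: orthonormal_def subset_iff)
  have "(\<Sum>b\<in>J. (norm (cinner b x *\<^sub>C b))\<^sup>2) \<le> (norm x)\<^sup>2"
  proof (rule orthogonal_bessel[OF assms(2)])
    show "cinner x (cinner b x *\<^sub>C b) = cinner (cinner b x *\<^sub>C b) (cinner b x *\<^sub>C b)" if "b \<in> J" for b
      using on[OF that that] cinner_commute[of x b]
      by (simp add: cinner_scaleC_left cinner_scaleC_right)
  qed (simp add: cinner_scaleC_left cinner_scaleC_right on)
  moreover have "norm (cinner b x *\<^sub>C b) = cmod (cinner b x)" if "b \<in> J" for b
    using orthonormal_norm[OF assms(1)] assms(3) that by (auto simp: norm_scaleC)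
  ultimately show ?thesis by simp
qed

text \<open>Zorn's lemma: a nonzero vector orthogonal to a maximal orthonormal set could be
  normalised and added.\<close>

lemma orthonormal_extend:
  assumes "orthonormal (B0 :: 'h::complex_hilbert_space set)"
  obtains B where "orthonormal B" "B0 \<subseteq> B" "\<And>x. (\<And>b. b \<in> B \<Longrightarrow> cinner b x = 0) \<Longrightarrow> x = 0"
proof -
  define \<A> where "\<A> = {B. orthonormal B \<and> B0 \<subseteq> B}"
  have "\<exists>M\<in>\<A>. \<forall>X\<in>\<A>. M \<subseteq> X \<longrightarrow> X = M"
  proof (rule subset_Zorn_nonempty)
    show "\<A> \<noteq> {}" using assms by (auto simp: \<A>_def)
    fix C assume C: "C \<noteq> {}" "subset.chain \<A> C"
    have "orthonormal (\<Union>C)"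
      unfolding orthonormal_def
    proof (intro ballI)
      fix x y assume "x \<in> \<Union>C" "y \<in> \<Union>C"
      then obtain X Y where XY: "X \<in> C" "Y \<in> C" "x \<in> X" "y \<in> Y" by blast
      moreover have "C \<subseteq> \<A>" and ch: "\<forall>X\<in>C. \<forall>Y\<in>C. X \<subseteq> Y \<or> Y \<subseteq> X"
        using C(2) by (auto simp: subset_chain_def)
      ultimately have "X \<subseteq> Y \<or> Y \<subseteq> X" by blast
      then obtain Z where "Z \<in> C" "x \<in> Z" "y \<in> Z" using XY by blast
      moreover have "orthonormal Z" using C \<open>Z \<in> C\<close> unfolding subset_chain_def \<A>_def by blast
      ultimately show "cinner x y = (if x = y then 1 else 0)" by (simp add: orthonormal_def)
    qed
    moreover have "B0 \<subseteq> \<Union>C" using C unfolding subset_chain_def \<A>_def by blast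
    ultimately show "\<Union>C \<in> \<A>" by (simp add: \<A>_def)
  qed
  then obtain B where B_in: "B \<in> \<A>" and B_max: "\<forall>X\<in>\<A>. B \<subseteq> X \<longrightarrow> X = B" by (elim bexE)
  then have B: "orthonormal B" "B0 \<subseteq> B" by (auto simp: \<A>_def)
  have max: "X = B" if "orthonormal X" "B \<subseteq> X" for X
    using B_max that B(2) by (auto simp: \<A>_def)
  have "x = 0" if x: "\<And>b. b \<in> B \<Longrightarrow> cinner b x = 0" for x
  proof (rule ccontr)
    assume nz: "x \<noteq> 0"
    define v where "v = complex_of_real (1 / norm x) *\<^sub>C x"
    have "norm v = 1" using nz by (simp add: v_def norm_scaleC norm_divide)
    then have vv: "cinner v v = 1" by (simp add: cinner_self)
    have bv: "cinner b v = 0" "cinner v b = 0" if "b \<in> B" for b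
    proof -
      show "cinner b v = 0" using x[OF that] by (simp add: v_def cinner_scaleC_right)
      then show "cinner v b = 0" by (subst cinner_commute) simp
    qed
    have "orthonormal (insert v B)"
      using B(1) vv bv unfolding orthonormal_def by (auto split: if_splits)
    then have "v \<in> B" using max[of "insert v B"] by blast
    then show False using bv vv by force
  qed
  then show thesis using that B by blast
qed

text \<open>Totality of \<open>B\<close> concerns vectors orthogonal to it, and the values of the
  adjoint of \<open>R\<close> are such vectors.\<close>

lemma operator_zero_on_basis:
  fixes R :: "'h::complex_hilbert_space operator"
  assumes R: "R \<in> bounded_operators" and B: "\<And>x. (\<And>b. b \<in> B \<Longrightarrow> cinner b x = 0) \<Longrightarrow> x = 0"
    and zero: "\<And>b. b \<in> B \<Longrightarrow> R b = 0"
  shows "R = 0"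
proof -
  have "adj R y = 0" for y
    by (rule B) (simp add: cinner_adj' R zero cinner.zero_left)
  then have "adj R = 0" by (intro blinfun_eqI) simp
  then have "norm R = 0" using norm_adj_compose(2)[OF R] by simp
  then show ?thesis by simp
qed

text \<open>An infinite basis \<open>B\<close> has as many elements as its product with the natural
  numbers, so it contains countably many disjoint copies of itself; \<open>S n\<close> maps the
  basis onto the copy with number \<open>n\<close>.\<close>

lemma isometries_exist:
  fixes B0 :: "'h::complex_hilbert_space set"
  assumes inf: "infinite B0" and on: "orthonormal B0"
  obtains S :: "nat \<Rightarrow> 'h operator" where "isometries S"
proof -
  obtain B where B: "orthonormal B" "B0 \<subseteq> B" and tot: "\<And>x. (\<And>b. b \<in> B \<Longrightarrow> cinner b x = 0) \<Longrightarrow> x = 0"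
    using orthonormal_extend[OF on] by metis
  have infB: "infinite B" using inf B finite_subset by blast
  then have "(card_of (UNIV :: nat set), card_of B) \<in> ordLeq"
    by (simp add: infinite_iff_card_of_nat)
  from card_of_Times_infinite[OF infB _ this]
  have "(card_of (B \<times> (UNIV :: nat set)), card_of B) \<in> ordIso" by simp
  then have "(card_of (B \<times> (UNIV :: nat set)), card_of B) \<in> ordLeq" by (rule ordIso_imp_ordLeq)
  then obtain h where h: "inj_on h (B \<times> (UNIV :: nat set))" "h ` (B \<times> UNIV) \<subseteq> B"
    unfolding card_of_ordLeq[symmetric] by blast
  have hB: "h (b, n) \<in> B" if "b \<in> B" for b n using h that by blast
  have h_inj: "h (b, m) = h (b', n) \<longleftrightarrow> b = b' \<and> m = n" if "b \<in> B" "b' \<in> B" for b b' m n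
    using inj_on_eq_iff[OF h(1), of "(b, m)" "(b', n)"] that by auto
  \<comment> \<open>The unit vector \<open>v\<close> only turns scalar coefficients into the
    vector-valued families that \<open>operator_of_sum\<close> takes.\<close>
  obtain v where v: "v \<in> B" using infB by fastforce
  have on_B: "cinner x y = (if x = y then 1 else 0)" if "x \<in> B" "y \<in> B" for x y
    using B(1) that by (simp add: orthonormal_def)
  have nv: "norm v = 1" by (rule orthonormal_norm[OF B(1) v])
  have ex: "\<exists>T. T \<in> bounded_operators \<and>
    (\<forall>x y. ((\<lambda>b. cinner (cinner (h (b, n)) x *\<^sub>C v) (cinner b y *\<^sub>C v)) has_sum cinner x (blinfun_apply T y)) B)" for n
  proof (rule operator_of_sum[of "\<lambda>b x. cinner (h (b, n)) x *\<^sub>C v" "\<lambda>b y. cinner b y *\<^sub>C v" B 1])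
    show "(\<Sum>b\<in>J. (norm (cinner (h (b, n)) x *\<^sub>C v))\<^sup>2) \<le> (norm x)\<^sup>2" if J: "finite J" "J \<subseteq> B" for J x
    proof -
      have "inj_on (\<lambda>b. h (b, n)) J" using J(2) h_inj by (meson inj_onI subsetD)
      then have "(\<Sum>b\<in>J. (norm (cinner (h (b, n)) x *\<^sub>C v))\<^sup>2) = (\<Sum>b\<in>(\<lambda>b. h (b, n)) ` J. (cmod (cinner b x))\<^sup>2)"
        by (simp add: sum.reindex norm_scaleC nv)
      also have "\<dots> \<le> (norm x)\<^sup>2"
        by (rule orthonormal_bessel[OF B(1)]) (use J hB in auto)
      finally show ?thesis .
    qed
    show "(\<Sum>b\<in>J. (norm (cinner b x *\<^sub>C v))\<^sup>2) \<le> (1 * norm x)\<^sup>2" if "finite J" "J \<subseteq> B" for J x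
      using orthonormal_bessel[OF B(1) that] by (simp add: norm_scaleC nv)
  qed (auto simp: cinner_add_right scaleC_add_left cinner_scaleC_right scaleC_scaleC)
  have "\<forall>n. \<exists>T. T \<in> bounded_operators \<and>
    (\<forall>x y. ((\<lambda>b. cinner (cinner (h (b, n)) x *\<^sub>C v) (cinner b y *\<^sub>C v)) has_sum cinner x (blinfun_apply T y)) B)"
    by (intro allI ex)
  from choice[OF this] obtain S where S': "\<forall>n. S n \<in> bounded_operators \<and>
    (\<forall>x y. ((\<lambda>b. cinner (cinner (h (b, n)) x *\<^sub>C v) (cinner b y *\<^sub>C v)) has_sum cinner x (blinfun_apply (S n) y)) B)"
    by (elim exE)
  then have S: "S n \<in> bounded_operators"
    "((\<lambda>b. cinner (cinner (h (b, n)) x *\<^sub>C v) (cinner b y *\<^sub>C v)) has_sum cinner x (blinfun_apply (S n) y)) B" for n x y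
    by (blast dest: spec)+
  have form: "((\<lambda>b. cinner x (h (b, n)) * cinner b y) has_sum cinner x (S n y)) B" for n x y
  proof -
    have "cinner (cinner (h (b, n)) x *\<^sub>C v) (cinner b y *\<^sub>C v) = cinner x (h (b, n)) * cinner b y" for b
      using on_B[OF v v] cinner_commute[of x "h (b, n)"] by (simp add: cinner_scaleC_left cinner_scaleC_right mult.commute)
    then show ?thesis using S(2)[of n x y] by simp
  qed
  have Sb: "S n b = h (b, n)" if b: "b \<in> B" for n b
  proof (rule cinner_extI)
    fix x
    have "((\<lambda>a. cinner x (h (a, n)) * cinner a b) has_sum cinner x (h (b, n))) B"
      using b on_B by (intro has_sum_finite_neutralI[of "{b}"]) auto
    then show "cinner x (S n b) = cinner x (h (b, n))" using form has_sum_unique by blast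
  qed
  have Sadj: "adj (S m) (h (b, n)) = (if m = n then b else 0)" if b: "b \<in> B" for m n b
  proof (rule cinner_extI)
    fix x
    have eq: "cinner (h (b, n)) (h (a, m)) * cinner a x = (if m = n then (if a = b then cinner b x else 0) else 0)"
      if "a \<in> B" for a
      using on_B[OF hB[OF b] hB[OF that], of n m] h_inj[OF b that] by auto
    have "((\<lambda>a. cinner (h (b, n)) (h (a, m)) * cinner a x) has_sum (if m = n then cinner b x else 0)) B"
      using b eq by (intro has_sum_finite_neutralI[of "{b}"]) auto
    then have "cinner (h (b, n)) (S m x) = (if m = n then cinner b x else 0)"
      using form has_sum_unique by blast
    then have "cinner (adj (S m) (h (b, n))) x = (if m = n then cinner b x else 0)"
      by (simp add: cinner_adj S)
    then show "cinner x (adj (S m) (h (b, n))) = cinner x (if m = n then b else 0)"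
      by (subst (1 2) cinner_commute) (simp add: cinner.zero_left)
  qed
  have "isometries S"
  proof
    show "S i \<in> bounded_operators" for i by (rule S)
    show "adj (S i) \<odot> S j = (if i = j then id_blinfun else 0)" for i j
    proof -
      have "adj (S i) \<odot> S j - (if i = j then id_blinfun else 0) = 0"
        by (rule operator_zero_on_basis[OF _ tot])
          (auto simp: bounded_operators_closure S adj_in blinfun.diff_left Sb Sadj blinfun.zero_left)
      then show ?thesis by simp
    qed
  qed
  then show thesis by (rule that)
qed

section \<open>Infinite amplification\<close>

context isometries
begin

lemma S_adj_apply: "adj (S i) (S j z) = (if i = j then z else 0)"
  using S_orthogonal[of i j] by (metis blinfun_apply_blinfun_compose blinfun_apply_id_blinfun id_apply blinfun.zero_left)

lemma norm_S_apply: "norm (S i z) = norm z"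
proof -
  have "cinner (S i z) (S i z) = cinner z z"
    by (simp add: S_adj_apply flip: cinner_adj[OF S_bounded])
  then show ?thesis by (simp add: cinner_self of_real_eq_iff flip: of_real_power)
qed

lemma isometries_bessel:
  assumes "finite J"
  shows "(\<Sum>i\<in>J. (norm (adj (S i) x))\<^sup>2) \<le> (norm x)\<^sup>2"
proof -
  have "(\<Sum>i\<in>J. (norm (S i (adj (S i) x)))\<^sup>2) \<le> (norm x)\<^sup>2"
    by (rule orthogonal_bessel[OF assms])
      (auto simp: S_adj_apply cinner.zero_left cinner.zero_right simp flip: cinner_adj[OF S_bounded])
  then show ?thesis by (simp add: norm_S_apply)
qed

text \<open>The operator \<open>x\<close> acting diagonally on the ranges of all isometries at once.
  The sum of the blocks does not converge in norm, so the operator is described by its form; the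
  norm bound is stored with it.\<close>

definition ampliate :: "'h operator \<Rightarrow> 'h operator" where
  "ampliate x = (SOME T. T \<in> bounded_operators \<and> norm T \<le> norm x \<and>
     (\<forall>\<xi> \<eta>. ((\<lambda>i. cinner (adj (S i) \<xi>) (x (adj (S i) \<eta>))) has_sum cinner \<xi> (T \<eta>)) UNIV))"

lemma ampliate:
  assumes x: "x \<in> bounded_operators"
  shows "ampliate x \<in> bounded_operators" "norm (ampliate x) \<le> norm x"
    "((\<lambda>i. cinner (adj (S i) \<xi>) (x (adj (S i) \<eta>))) has_sum cinner \<xi> (ampliate x \<eta>)) UNIV"
proof -
  have "\<exists>T. T \<in> bounded_operators \<and> norm T \<le> norm x \<and>
     (\<forall>\<xi> \<eta>. ((\<lambda>i. cinner (adj (S i) \<xi>) (x (adj (S i) \<eta>))) has_sum cinner \<xi> (blinfun_apply T \<eta>)) UNIV)"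
  proof (rule operator_of_sum[of "\<lambda>i. adj (S i)" "\<lambda>i \<eta>. x (adj (S i) \<eta>)" UNIV "norm x"])
    show "(\<Sum>i\<in>J. (norm (x (adj (S i) \<eta>)))\<^sup>2) \<le> (norm x * norm \<eta>)\<^sup>2" if "finite J" for J \<eta>
    proof -
      have "(\<Sum>i\<in>J. (norm (x (adj (S i) \<eta>)))\<^sup>2) \<le> (\<Sum>i\<in>J. (norm x * norm (adj (S i) \<eta>))\<^sup>2)"
        by (intro sum_mono power_mono norm_blinfun) auto
      also have "\<dots> = (norm x)\<^sup>2 * (\<Sum>i\<in>J. (norm (adj (S i) \<eta>))\<^sup>2)"
        by (simp add: power_mult_distrib sum_distrib_left)
      also have "\<dots> \<le> (norm x)\<^sup>2 * (norm \<eta>)\<^sup>2"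
        by (intro mult_left_mono isometries_bessel that) simp
      finally show ?thesis by (simp add: power_mult_distrib)
    qed
  qed (use x S_adj_bounded isometries_bessel in \<open>auto simp: blinfun.add_right bounded_operatorsD\<close>)
  from someI_ex[OF this] show "ampliate x \<in> bounded_operators" "norm (ampliate x) \<le> norm x"
    "((\<lambda>i. cinner (adj (S i) \<xi>) (x (adj (S i) \<eta>))) has_sum cinner \<xi> (ampliate x \<eta>)) UNIV"
    unfolding ampliate_def by blast+
qed

lemma ampliate_unique:
  assumes "T \<in> bounded_operators" "x \<in> bounded_operators"
    "\<And>\<xi> \<eta>. ((\<lambda>i. cinner (adj (S i) \<xi>) (x (adj (S i) \<eta>))) has_sum cinner \<xi> (blinfun_apply T \<eta>)) UNIV"
  shows "ampliate x = T"
  by (rule operator_cinner_eqI) (rule has_sum_unique[OF ampliate(3)[OF assms(2)] assms(3)])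

lemma S_adj_ampliate:
  assumes x: "x \<in> bounded_operators"
  shows "adj (S l) (ampliate x \<eta>) = x (adj (S l) \<eta>)"
proof (rule cinner_extI)
  fix \<zeta>
  have "((\<lambda>i. cinner (adj (S i) (S l \<zeta>)) (x (adj (S i) \<eta>))) has_sum cinner \<zeta> (x (adj (S l) \<eta>))) UNIV"
    by (intro has_sum_finite_neutralI[of "{l}"]) (auto simp: S_adj_apply cinner.zero_left)
  then have "cinner (S l \<zeta>) (ampliate x \<eta>) = cinner \<zeta> (x (adj (S l) \<eta>))"
    using has_sum_unique ampliate(3)[OF x] by blast
  then show "cinner \<zeta> (adj (S l) (ampliate x \<eta>)) = cinner \<zeta> (x (adj (S l) \<eta>))"
    by (simp add: cinner_adj' S_bounded)
qed

lemma ampliate_comp: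
  assumes "x \<in> bounded_operators" "y \<in> bounded_operators"
  shows "ampliate (x \<odot> y) = ampliate x \<odot> ampliate y"
proof (rule ampliate_unique)
  show "((\<lambda>i. cinner (adj (S i) \<xi>) ((x \<odot> y) (adj (S i) \<eta>))) has_sum cinner \<xi> ((ampliate x \<odot> ampliate y) \<eta>)) UNIV" for \<xi> \<eta>
    using ampliate(3)[OF assms(1), of \<xi> "ampliate y \<eta>"] by (simp add: S_adj_ampliate assms(2))
qed (use assms ampliate in \<open>auto simp: bounded_operators_closure\<close>)

lemma ampliate_add:
  assumes "x \<in> bounded_operators" "y \<in> bounded_operators"
  shows "ampliate (x + y) = ampliate x + ampliate y"
proof (rule ampliate_unique)
  show "((\<lambda>i. cinner (adj (S i) \<xi>) ((x + y) (adj (S i) \<eta>))) has_sum cinner \<xi> ((ampliate x + ampliate y) \<eta>)) UNIV" for \<xi> \<eta>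
    using has_sum_add[OF ampliate(3)[OF assms(1), of \<xi> \<eta>] ampliate(3)[OF assms(2), of \<xi> \<eta>]]
    by (simp add: blinfun.add_left cinner_add_right)
qed (use assms ampliate in \<open>auto simp: bounded_operators_closure\<close>)

lemma ampliate_scale:
  assumes "x \<in> bounded_operators"
  shows "ampliate (c *\<^sub>O x) = c *\<^sub>O ampliate x"
proof (rule ampliate_unique)
  show "((\<lambda>i. cinner (adj (S i) \<xi>) ((c *\<^sub>O x) (adj (S i) \<eta>))) has_sum cinner \<xi> ((c *\<^sub>O ampliate x) \<eta>)) UNIV" for \<xi> \<eta>
    using has_sum_cmult_right[OF ampliate(3)[OF assms(1), of \<xi> \<eta>], of c]
    by (simp add: cinner_scaleC_right)
qed (use assms ampliate in \<open>auto simp: bounded_operators_closure\<close>)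

lemma ampliate_adj:
  assumes x: "x \<in> bounded_operators"
  shows "ampliate (adj x) = adj (ampliate x)"
proof (rule ampliate_unique)
  fix \<xi> \<eta>
  have "((\<lambda>i. cnj (cinner (adj (S i) \<eta>) (x (adj (S i) \<xi>)))) has_sum cnj (cinner \<eta> (ampliate x \<xi>))) UNIV"
    using ampliate(3)[OF x] by (simp only: has_sum_cnj_iff)
  then show "((\<lambda>i. cinner (adj (S i) \<xi>) (adj x (adj (S i) \<eta>))) has_sum cinner \<xi> (adj (ampliate x) \<eta>)) UNIV"
    by (simp add: cinner_adj' x ampliate flip: cinner_commute)
qed (use assms ampliate in \<open>auto simp: adj_in\<close>)

lemma entry_ampliate:
  assumes "x \<in> bounded_operators"
  shows "entry (ampliate x) i j = (if i = j then x else 0)"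
  by (rule blinfun_eqI) (auto simp: entry_def S_adj_ampliate assms S_adj_apply blinfun.zero_left blinfun.zero_right)

lemma ampliate_inj: "x \<in> bounded_operators \<Longrightarrow> y \<in> bounded_operators \<Longrightarrow> ampliate x = ampliate y \<Longrightarrow> x = y"
proof -
  assume xy: "x \<in> bounded_operators" "y \<in> bounded_operators" and eq: "ampliate x = ampliate y"
  have "entry (ampliate x) 0 0 = x" and y: "entry (ampliate y) 0 0 = y" using xy by (simp_all add: entry_ampliate)
  then have "entry (ampliate y) 0 0 = x" unfolding eq by blast
  from trans[OF sym[OF this] y] show "x = y" .
qed

lemma ampliate_zero: "ampliate 0 = 0"
  by (rule ampliate_unique) (auto simp: bounded_operators_closure blinfun.zero_left cinner.zero_right)

lemma ampliate_sum: "(\<And>i. i \<in> I \<Longrightarrow> f i \<in> bounded_operators) \<Longrightarrow> ampliate (\<Sum>i\<in>I. f i) = (\<Sum>i\<in>I. ampliate (f i))"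
  by (induction I rule: infinite_finite_induct) (auto simp: ampliate_zero ampliate_add bounded_operators_sum)

text \<open>Describes ampliations by conditions that are closed in the weak operator topology, so
  that the ampliation of a von Neumann algebra is seen to be closed.\<close>

lemma ampliate_characterization:
  assumes y: "y \<in> bounded_operators" "ampliate id_blinfun \<odot> y = y" "y \<odot> ampliate id_blinfun = y"
    and entry: "\<And>i j. entry y i j = (if i = j then entry y 0 0 else 0)"
  shows "y = ampliate (entry y 0 0)"
proof (rule ampliate_unique[symmetric])
  define x where "x = entry y 0 0"
  show x: "entry y 0 0 \<in> bounded_operators" by (rule entry_bounded[OF y(1)])
  have idb: "id_blinfun \<in> bounded_operators" by (simp add: bounded_operators_closure)
  have *: "adj (S l) (y \<eta>) = x (adj (S l) \<eta>)" for l \<eta>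
  proof (rule cinner_extI)
    fix \<zeta>
    \<comment> \<open>The ampliated identity projects onto the closed span of all ranges; inserting
      it expands \<open>y\<close> along the copies.\<close>
    have "((\<lambda>i. cinner (adj (S i) (adj y (S l \<zeta>))) (id_blinfun (adj (S i) \<eta>))) has_sum
        cinner (adj y (S l \<zeta>)) (ampliate id_blinfun \<eta>)) UNIV"
      by (rule ampliate(3)[OF idb])
    moreover have "cinner (adj (S i) (adj y (S l \<zeta>))) (id_blinfun (adj (S i) \<eta>)) = cinner \<zeta> (entry y l i (adj (S i) \<eta>))" for i
    proof -
      have "cinner (adj (S i) (adj y (S l \<zeta>))) w = cinner (S l \<zeta>) (y (S i w))" for w
        by (simp add: cinner_adj y(1) S_bounded)
      moreover have "cinner \<zeta> (entry y l i w) = cinner (S l \<zeta>) (y (S i w))" for w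
        by (simp add: entry_def cinner_adj' S_bounded)
      ultimately show ?thesis by simp
    qed
    moreover have "cinner (adj y (S l \<zeta>)) (ampliate id_blinfun \<eta>) = cinner \<zeta> (adj (S l) (y \<eta>))"
    proof -
      have "y (ampliate id_blinfun \<eta>) = y \<eta>" using y(3) by (metis blinfun_apply_blinfun_compose)
      moreover have "cinner (adj y (S l \<zeta>)) w = cinner (S l \<zeta>) (y w)" for w by (rule cinner_adj[OF y(1)])
      ultimately show ?thesis by (simp add: cinner_adj' S_bounded)
    qed
    ultimately have "((\<lambda>i. cinner \<zeta> (entry y l i (adj (S i) \<eta>))) has_sum cinner \<zeta> (adj (S l) (y \<eta>))) UNIV"
      by simp
    moreover have "((\<lambda>i. cinner \<zeta> (entry y l i (adj (S i) \<eta>))) has_sum cinner \<zeta> (x (adj (S l) \<eta>))) UNIV"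
      by (rule has_sum_finite_neutralI[of "{l}"])
        (auto simp: entry[of l] x_def blinfun.zero_left cinner.zero_right)
    ultimately show "cinner \<zeta> (adj (S l) (y \<eta>)) = cinner \<zeta> (x (adj (S l) \<eta>))" by (rule has_sum_unique)
  qed
  fix \<xi> \<eta>
  show "((\<lambda>i. cinner (adj (S i) \<xi>) (entry y 0 0 (adj (S i) \<eta>))) has_sum cinner \<xi> (y \<eta>)) UNIV"
  proof -
    have "ampliate id_blinfun (y \<eta>) = y \<eta>" using y(2) by (metis blinfun_apply_blinfun_compose)
    then show ?thesis using ampliate(3)[OF idb, of \<xi> "y \<eta>"] by (simp add: * x_def)
  qed
qed (rule y(1))

lemma ampliate_vN:
  assumes "von_neumann_algebra A"
  shows "von_neumann_algebra (ampliate ` A)" "unit_of (ampliate ` A) = ampliate (unit_of A)"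
proof -
  interpret vN_algebra A by unfold_locales fact
  have idb: "id_blinfun \<in> bounded_operators" by (simp add: bounded_operators_closure)
  have tb: "ampliate x \<in> bounded_operators" if "x \<in> bounded_operators" for x using ampliate(1)[OF that] .
  have eq: "ampliate ` A = {y \<in> bounded_operators. entry y 0 0 \<in> A} \<inter>
      {y \<in> {y \<in> bounded_operators. ampliate id_blinfun \<odot> y = y}. y \<odot> ampliate id_blinfun = y} \<inter>
      (\<Inter>p. {y \<in> bounded_operators. entry y (fst p) (snd p) = (if fst p = snd p then entry y 0 0 else 0)})"
  proof safe
    fix y
    assume int: "y \<in> (\<Inter>p. {y \<in> bounded_operators. entry y (fst p) (snd p) = (if fst p = snd p then entry y 0 0 else 0)})"
      and y: "y \<in> bounded_operators" "entry y 0 0 \<in> A" "ampliate id_blinfun \<odot> y = y" "y \<odot> ampliate id_blinfun = y"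
    have "entry y i j = (if i = j then entry y 0 0 else 0)" for i j
      using INT_D[OF int, of "(i, j)"] by simp
    from ampliate_characterization[OF y(1,3,4) this] show "y \<in> ampliate ` A" using y(2) by blast
  next
    fix x and p :: "nat \<times> nat" assume "x \<in> A"
    then have x: "x \<in> bounded_operators" by (rule in_bounded)
    show "ampliate x \<in> bounded_operators" by (rule tb[OF x])
    show "entry (ampliate x) (fst p) (snd p) = (if fst p = snd p then entry (ampliate x) 0 0 else 0)" by (simp add: entry_ampliate x)
    show "ampliate id_blinfun \<odot> ampliate x = ampliate x" "ampliate x \<odot> ampliate id_blinfun = ampliate x"
      by (simp_all add: ampliate_comp[symmetric] x idb)
  qed (auto simp: entry_ampliate in_bounded tb)
  have wot_if: "wot_continuous_op bounded_operators (\<lambda>y. if i = j then entry y 0 0 else 0)" for i j :: nat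
    by (cases "i = j") (auto intro: wot_intros)
  have closed: "closedin weak_operator_topology (ampliate ` A)"
    unfolding eq
    by (intro closedin_Int closedin_INT closedin_wot_eq closedin_wot_preimage closedin_wot_bounded_operators
        wot_if wot_intros tb idb wot_closed) (auto intro: entry_bounded)
  show "von_neumann_algebra (ampliate ` A)"
  proof (rule von_neumann_algebraI[where e = "ampliate e"])
    show "0 \<in> ampliate ` A" using ampliate_zero zero by (metis imageI)
    show "x + y \<in> ampliate ` A" "x \<odot> y \<in> ampliate ` A" if "x \<in> ampliate ` A" "y \<in> ampliate ` A" for x y
      using that by (auto simp: ampliate_add[symmetric] ampliate_comp[symmetric] in_bounded add comp)
    show "c *\<^sub>O x \<in> ampliate ` A" "adj x \<in> ampliate ` A" if "x \<in> ampliate ` A" for c x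
      using that by (auto simp: ampliate_scale[symmetric] ampliate_adj[symmetric] in_bounded scale adj)
  qed (use closed in \<open>auto simp: tb in_bounded e_in e_left e_right simp flip: ampliate_comp\<close>)
  show "unit_of (ampliate ` A) = ampliate (unit_of A)"
    by (rule unit_of_eqI) (use e_in in \<open>auto simp: in_bounded e_left e_right e_def[symmetric] simp flip: ampliate_comp\<close>)
qed

lemma P_ampliate:
  assumes P: "ideal_prop P" and A: "von_neumann_algebra A"
  shows "P A \<longleftrightarrow> P (ampliate ` A)"
proof -
  interpret vN_algebra A by unfold_locales fact
  show ?thesis
    by (rule ideal_prop.iso_iff[OF P A ampliate_vN(1)[OF A], where \<phi> = ampliate])
      (auto simp: bij_betw_def ampliate_add ampliate_comp ampliate_scale ampliate_adj in_bounded intro!: inj_onI ampliate_inj)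
qed

lemma corner_ampliate:
  assumes "A \<subseteq> bounded_operators" "q \<in> bounded_operators"
  shows "corner (ampliate q) (ampliate ` A) = ampliate ` corner q A"
proof -
  have "ampliate q \<odot> ampliate x \<odot> ampliate q = ampliate (q \<odot> x \<odot> q)" if "x \<in> A" for x
    using assms that by (auto simp: ampliate_comp bounded_operators_closure)
  then show ?thesis unfolding corner_def image_image by (intro image_cong) auto
qed

lemma P_corner_ampliate:
  assumes P: "ideal_prop P" and A: "von_neumann_algebra A" and q: "q \<in> projections A"
  shows "P (corner (ampliate q) (ampliate ` A)) \<longleftrightarrow> P (corner q A)"
proof -
  interpret vN_algebra A by unfold_locales fact
  have "q \<in> A" using q by (simp add: projections_def)
  then have "corner (ampliate q) (ampliate ` A) = ampliate ` corner q A"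
    using in_bounded by (intro corner_ampliate) auto
  then show ?thesis using P_ampliate[OF P corner_vN(1)[OF q]] by simp
qed

lemma central_projections_ampliate:
  assumes A: "von_neumann_algebra A" and q: "q \<in> A"
  shows "ampliate q \<in> central_projections (ampliate ` A) \<longleftrightarrow> q \<in> central_projections A"
proof -
  interpret vN_algebra A by unfold_locales fact
  have "ampliate x = ampliate y \<longleftrightarrow> x = y" if "x \<in> A" "y \<in> A" for x y
    using ampliate_inj that in_bounded by blast
  then show ?thesis
    using q by (auto simp: central_projections_def projections_def center_def in_bounded adj comp
        simp flip: ampliate_comp ampliate_adj)
qed

text \<open>Square-summable sequences become vectors, so that \<open>\<sigma>\<close>-weakly continuous functionals
  become vector functionals.\<close>

lemma vector_of_sequence:
  assumes "summable (\<lambda>n. (norm (\<xi> n))\<^sup>2)"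
  obtains \<xi>' where "\<And>n. adj (S n) \<xi>' = \<xi> n"
proof (cases "\<exists>v::'h. norm v = 1")
  case False
  have "(x::'h) = 0" for x
  proof (rule ccontr)
    assume "x \<noteq> 0"
    then have "norm ((1 / norm x) *\<^sub>R x) = 1" by simp
    then show False using False by blast
  qed
  then have "adj (S n) 0 = \<xi> n" for n by metis
  then show thesis by (rule that)
next
  case True
  then obtain v :: 'h where v: "norm v = 1" by blast
  define K where "K = sqrt (\<Sum>n. (norm (\<xi> n))\<^sup>2)"
  have K2: "K\<^sup>2 = (\<Sum>n. (norm (\<xi> n))\<^sup>2)" unfolding K_def using assms by (simp add: suminf_nonneg)
  have K0: "0 \<le> K" by (simp add: K_def suminf_nonneg assms)
  have "(\<Sum>i\<in>J. (norm (cinner v x *\<^sub>C \<xi> i))\<^sup>2) \<le> (K * norm x)\<^sup>2" if "finite J" for J x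
  proof -
    have "(\<Sum>i\<in>J. (norm (cinner v x *\<^sub>C \<xi> i))\<^sup>2) = (cmod (cinner v x))\<^sup>2 * (\<Sum>i\<in>J. (norm (\<xi> i))\<^sup>2)"
      by (simp add: norm_scaleC power_mult_distrib sum_distrib_left)
    also have "\<dots> \<le> (norm x)\<^sup>2 * K\<^sup>2"
      unfolding K2 using norm_cinner_le[of v x] v
      by (intro mult_mono power_mono sum_le_suminf assms that sum_nonneg) auto
    finally show ?thesis by (simp add: power_mult_distrib mult.commute)
  qed
  note bound = this
  \<comment> \<open>The wanted vector, the sum of the images of \<open>\<xi> i\<close> under
    \<open>S i\<close>, is obtained as the value at \<open>v\<close> of a rank-one operator.\<close>
  have "\<exists>T. T \<in> bounded_operators \<and>
    (\<forall>x y. ((\<lambda>i. cinner (adj (S i) x) (cinner v y *\<^sub>C \<xi> i)) has_sum cinner x (blinfun_apply T y)) UNIV)"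
    by (rule operator_of_sum[of "\<lambda>i. adj (S i)" "\<lambda>i y. cinner v y *\<^sub>C \<xi> i" UNIV K])
      (use isometries_bessel bound K0 S_adj_bounded in \<open>auto simp: blinfun.add_right bounded_operatorsD
        cinner_add_right scaleC_add_left cinner_scaleC_right scaleC_scaleC\<close>)
  then obtain T where T: "T \<in> bounded_operators"
    "\<And>x y. ((\<lambda>i. cinner (adj (S i) x) (cinner v y *\<^sub>C \<xi> i)) has_sum cinner x (blinfun_apply T y)) UNIV"
    by (elim exE conjE) (rule that, assumption, elim allE)
  have "adj (S l) (T v) = \<xi> l" for l
  proof (rule cinner_extI)
    fix \<zeta>
    have "((\<lambda>i. cinner (adj (S i) (S l \<zeta>)) (cinner v v *\<^sub>C \<xi> i)) has_sum cinner \<zeta> (\<xi> l)) UNIV"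
      by (intro has_sum_finite_neutralI[of "{l}"]) (auto simp: S_adj_apply cinner.zero_left cinner_self v)
    then have "cinner (S l \<zeta>) (T v) = cinner \<zeta> (\<xi> l)" using T(2) has_sum_unique by blast
    then show "cinner \<zeta> (adj (S l) (T v)) = cinner \<zeta> (\<xi> l)" by (simp add: cinner_adj' S_bounded)
  qed
  then show thesis by (rule that)
qed

lemma sigma_weak_eq_vector:
  assumes "\<phi> \<in> sigma_weak_functionals"
  shows "\<exists>\<xi> \<eta>. \<forall>x\<in>bounded_operators. \<phi> x = cinner \<xi> (ampliate x \<eta>)"
proof -
  obtain a b where \<phi>: "\<phi> = (\<lambda>T. \<Sum>n. cinner (a n) (blinfun_apply T (b n)))"
    and s: "summable (\<lambda>n. (norm (a n))\<^sup>2)" "summable (\<lambda>n. (norm (b n))\<^sup>2)"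
    using assms by (auto simp: sigma_weak_functionals_def)
  obtain \<xi> where \<xi>: "\<And>n. adj (S n) \<xi> = a n" using vector_of_sequence[OF s(1)] by metis
  obtain \<eta> where \<eta>: "\<And>n. adj (S n) \<eta> = b n" using vector_of_sequence[OF s(2)] by metis
  have "\<phi> x = cinner \<xi> (ampliate x \<eta>)" if "x \<in> bounded_operators" for x
  proof -
    have "(\<lambda>n. cinner (a n) (x (b n))) sums cinner \<xi> (ampliate x \<eta>)"
      using has_sum_imp_sums[OF ampliate(3)[OF that, of \<xi> \<eta>]] by (simp add: \<xi> \<eta>)
    then show ?thesis by (simp add: \<phi> sums_iff)
  qed
  then show ?thesis by (intro exI ballI)
qed

lemma vector_ampliate_sigma_weak:
  "\<exists>\<phi>\<in>sigma_weak_functionals. \<forall>x\<in>bounded_operators. \<phi> x = cinner \<xi> (ampliate x \<eta>)"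
proof -
  have s: "summable (\<lambda>n. (norm (adj (S n) \<zeta>))\<^sup>2)" for \<zeta>
    by (rule summableI_nonneg_bounded[of _ "(norm \<zeta>)\<^sup>2"]) (auto intro: isometries_bessel)
  have mem: "(\<lambda>T. \<Sum>n. cinner (adj (S n) \<xi>) (blinfun_apply T (adj (S n) \<eta>))) \<in> sigma_weak_functionals"
    unfolding sigma_weak_functionals_def
    by (rule CollectI, rule exI[of _ "\<lambda>n. adj (S n) \<xi>"], rule exI[of _ "\<lambda>n. adj (S n) \<eta>"]) (simp add: s)
  have val: "(\<Sum>n. cinner (adj (S n) \<xi>) (x (adj (S n) \<eta>))) = cinner \<xi> (ampliate x \<eta>)" if "x \<in> bounded_operators" for x
    using has_sum_imp_sums[OF ampliate(3)[OF that, of \<xi> \<eta>]] by (simp add: sums_iff)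
  show ?thesis by (rule bexI[OF _ mem]) (simp add: val)
qed

text \<open>The entry at \<open>(0, 0)\<close> undoes the ampliation, and a \<sigma>-weak functional
  of an operator is a vector functional of its ampliation.\<close>

lemma entry_sigma_weak_wot:
  assumes "A \<subseteq> bounded_operators" "\<phi> \<in> sigma_weak_functionals"
  shows "wot_continuous (ampliate ` A) (\<lambda>y. \<phi> (entry y 0 0))"
proof -
  obtain \<xi> \<eta> where \<xi>\<eta>: "\<forall>x\<in>bounded_operators. \<phi> x = cinner \<xi> (ampliate x \<eta>)"
    using sigma_weak_eq_vector[OF assms(2)] by (elim exE)
  show ?thesis
    by (rule wot_continuous_cong[OF wot_continuous_vector[of _ \<xi> \<eta>]])
      (use assms(1) \<xi>\<eta> in \<open>auto simp: entry_ampliate subset_iff\<close>)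
qed

text \<open>Ampliation replaces each term of the series by a series over the copies. Enumerating the
  pairs of indices merges them into one sequence, which is square summable by Bessel's inequality in
  each copy.\<close>

lemma ampliate_sigma_weak_pullback:
  assumes "\<phi> \<in> sigma_weak_functionals"
  shows "\<exists>\<psi>\<in>sigma_weak_functionals. \<forall>x\<in>bounded_operators. \<phi> (ampliate x) = \<psi> x"
proof -
  obtain a b where \<phi>: "\<phi> = (\<lambda>T. \<Sum>n. cinner (a n) (blinfun_apply T (b n)))"
    and s: "summable (\<lambda>n. (norm (a n))\<^sup>2)" "summable (\<lambda>n. (norm (b n))\<^sup>2)"
    using assms by (auto simp: sigma_weak_functionals_def)
  define c where "c a m = (case prod_decode m of (n, i) \<Rightarrow> adj (S i) (a n))" for a :: "nat \<Rightarrow> 'h" and m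
  have sq: "(\<lambda>(n, i). (norm (adj (S i) (a n)))\<^sup>2) summable_on UNIV" 
    if "summable (\<lambda>n. (norm (a n))\<^sup>2)" for a :: "nat \<Rightarrow> 'h"
  proof -
    have 1: "((\<lambda>i. (norm (adj (S i) z))\<^sup>2) has_sum infsum (\<lambda>i. (norm (adj (S i) z))\<^sup>2) UNIV) UNIV"
      and 2: "infsum (\<lambda>i. (norm (adj (S i) z))\<^sup>2) UNIV \<le> (norm z)\<^sup>2" for z
    proof -
      have "(\<lambda>i. (norm (adj (S i) z))\<^sup>2) summable_on UNIV"
        by (rule nonneg_bdd_above_summable_on) (auto intro!: bdd_aboveI[of _ "(norm z)\<^sup>2"] isometries_bessel)
      then show "((\<lambda>i. (norm (adj (S i) z))\<^sup>2) has_sum infsum (\<lambda>i. (norm (adj (S i) z))\<^sup>2) UNIV) UNIV"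
        "infsum (\<lambda>i. (norm (adj (S i) z))\<^sup>2) UNIV \<le> (norm z)\<^sup>2"
        by (auto intro!: infsum_le_finite_sums isometries_bessel)
    qed
    have "(\<lambda>n. infsum (\<lambda>i. (norm (adj (S i) (a n)))\<^sup>2) UNIV) summable_on UNIV"
    proof (rule summable_on_comparison_test)
      show "(\<lambda>n. (norm (a n))\<^sup>2) summable_on UNIV"
        using that by (simp add: summable_on_UNIV_nonneg_real_iff)
    qed (use 2 in \<open>auto intro: infsum_nonneg\<close>)
    then have "(\<lambda>(n, i). (norm (adj (S i) (a n)))\<^sup>2) summable_on (SIGMA n:UNIV. UNIV)"
      using 1 by (intro summable_on_SigmaI[where g = "\<lambda>n. infsum (\<lambda>i. (norm (adj (S i) (a n)))\<^sup>2) UNIV"]) auto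
    then show ?thesis by simp
  qed
  have csq: "summable (\<lambda>m. (norm (c a m))\<^sup>2)" if "summable (\<lambda>n. (norm (a n))\<^sup>2)" for a
  proof -
    have "(\<lambda>m. (\<lambda>(n, i). (norm (adj (S i) (a n)))\<^sup>2) (prod_decode m)) summable_on UNIV"
      using sq[OF that] summable_on_reindex_bij_betw[OF bij_prod_decode] by blast
    then have "(\<lambda>m. (norm (c a m))\<^sup>2) summable_on UNIV" by (simp add: c_def split_def)
    then show ?thesis by (simp add: summable_on_UNIV_nonneg_real_iff)
  qed
  define \<psi> where "\<psi> = (\<lambda>T. \<Sum>m. cinner (c a m) (blinfun_apply T (c b m)))"
  have mem: "\<psi> \<in> sigma_weak_functionals"
    unfolding \<psi>_def sigma_weak_functionals_def
    by (rule CollectI, rule exI[of _ "c a"], rule exI[of _ "c b"]) (simp add: csq s)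
  have val: "\<phi> (ampliate x) = \<psi> x" if x: "x \<in> bounded_operators" for x
  proof -
    define f where "f = (\<lambda>(n, i). cinner (adj (S i) (a n)) (x (adj (S i) (b n))))"
    have abs: "(\<lambda>p. norm (f p)) summable_on UNIV"
    proof (rule Infinite_Sum.abs_summable_on_comparison_test')
      show "(\<lambda>(n, i). norm x * ((norm (adj (S i) (a n)))\<^sup>2 + (norm (adj (S i) (b n)))\<^sup>2)) summable_on UNIV"
        using summable_on_cmult_right[OF summable_on_add[OF sq[OF s(1)] sq[OF s(2)]], of "norm x"]
        by (simp add: split_def)
      fix p :: "nat \<times> nat"
      obtain n i where p: "p = (n, i)" by (cases p)
      define v w where "v = adj (S i) (a n)" and "w = adj (S i) (b n)"
      have "norm (f p) \<le> norm v * (norm x * norm w)"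
        unfolding f_def p v_def w_def
        by (auto intro!: order_trans[OF norm_cinner_le] mult_left_mono norm_blinfun)
      also have "\<dots> \<le> norm x * ((norm v)\<^sup>2 + (norm w)\<^sup>2)"
      proof -
        have "0 \<le> (norm v)\<^sup>2 + (norm w)\<^sup>2" "2 * norm v * norm w \<le> (norm v)\<^sup>2 + (norm w)\<^sup>2"
          using sum_squares_bound by auto
        then have "norm v * norm w \<le> (norm v)\<^sup>2 + (norm w)\<^sup>2" by linarith
        from mult_left_mono[OF this, of "norm x"] show ?thesis by (simp add: mult_ac)
      qed
      finally show "norm (f p) \<le> (case p of (n, i) \<Rightarrow> norm x * ((norm (adj (S i) (a n)))\<^sup>2 + (norm (adj (S i) (b n)))\<^sup>2))"
        by (simp add: p v_def w_def)
    qed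
    note fs = abs_summable_summable[OF abs]
    have "(f has_sum infsum f UNIV) UNIV" by (rule has_sum_infsum[OF fs])
    then have "((\<lambda>m. f (prod_decode m)) has_sum infsum f UNIV) UNIV"
      using has_sum_reindex_bij_betw[OF bij_prod_decode] by blast
    from has_sum_imp_sums[OF this] have "\<psi> x = infsum f UNIV"
      by (simp add: \<psi>_def c_def f_def split_def sums_iff)
    moreover have "\<phi> (ampliate x) = infsum f UNIV"
    proof -
      have "((\<lambda>n. cinner (a n) (ampliate x (b n))) has_sum infsum f UNIV) UNIV"
      proof (rule has_sum_SigmaD[where f = f and B = "\<lambda>_. UNIV"])
        show "(f has_sum infsum f UNIV) (SIGMA n:UNIV. UNIV)" using has_sum_infsum[OF fs] by simp
        show "((\<lambda>i. f (n, i)) has_sum cinner (a n) (ampliate x (b n))) UNIV" for n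
          using ampliate(3)[OF x, of "a n" "b n"] by (simp add: f_def)
      qed
      from has_sum_imp_sums[OF this] show ?thesis by (simp add: \<phi> sums_iff)
    qed
    ultimately show ?thesis by simp
  qed
  show ?thesis by (rule bexI[OF _ mem]) (simp add: val)
qed

end

text \<open>A vector functional of an ampliated value is a \<sigma>-weak functional of the value, to
  which \<open>cont\<close> applies; and passing back from the ampliation to \<open>A\<close> is
  continuous from the weak operator topology to the \<sigma>-weak one. Thus the \<sigma>-weak
  continuity of \<open>F\<close> becomes the continuity demanded by \<open>framed\<close>.\<close>

lemma (in isometries) ampliate_framed:
  assumes fr: "pre_framed A F u k"
    and cont: "\<And>\<phi>. \<phi> \<in> sigma_weak_functionals \<Longrightarrow>
      continuous_map (subtopology sigma_weak_topology A) euclidean (\<lambda>x. \<phi> (F x))"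
  shows "framed (ampliate ` A) (\<lambda>y. ampliate (F (entry y 0 0))) (\<lambda>i. ampliate (u i)) k"
proof -
  interpret pre_framed A F u k by fact
  have A_b: "A \<subseteq> bounded_operators" using in_bounded by blast
  note [simp] = entry_ampliate in_bounded
  have sw: "wot_continuous (ampliate ` A) \<phi>" if \<phi>: "\<phi> \<in> sigma_weak_functionals" for \<phi>
  proof -
    obtain \<psi> where \<psi>: "\<psi> \<in> sigma_weak_functionals" "\<And>x. x \<in> bounded_operators \<Longrightarrow> \<phi> (ampliate x) = \<psi> x"
      using ampliate_sigma_weak_pullback[OF \<phi>] by blast
    show ?thesis
      by (rule wot_continuous_cong[OF entry_sigma_weak_wot[OF A_b \<psi>(1)]]) (auto simp: \<psi>(2))
  qed
  show ?thesis
  proof unfold_locales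
    show "von_neumann_algebra (ampliate ` A)" by (rule ampliate_vN(1)[OF vN])
    show "ampliate (F (entry (unit_of (ampliate ` A)) 0 0)) = unit_of (ampliate ` A)"
      unfolding ampliate_vN(2)[OF vN] using e_in by (simp add: F_e e_def)
    show "\<exists>C. \<forall>x\<in>ampliate ` A. norm (ampliate (F (entry x 0 0))) \<le> C * norm x"
    proof (intro exI[of _ 1] ballI)
      fix y assume "y \<in> ampliate ` A"
      then obtain x where x: "x \<in> A" "y = ampliate x" by blast
      have "norm (ampliate (F (entry y 0 0))) \<le> norm (F (entry y 0 0))"
        using x by (intro ampliate(2)) (simp add: F_in)
      also have "\<dots> \<le> norm (entry y 0 0)" using x by (intro F_contractive) simp
      also have "\<dots> \<le> norm y" by (rule norm_entry)
      finally show "norm (ampliate (F (entry y 0 0))) \<le> 1 * norm y" by simp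
    qed
    show "wot_continuous (ampliate ` A) \<phi>" if "\<phi> \<in> sigma_weak_functionals" for \<phi> by (rule sw[OF that])
    show "wot_continuous_op (ampliate ` A) (\<lambda>y. ampliate (F (entry y 0 0)))"
      unfolding wot_continuous_op_def
    proof (intro allI)
      fix \<xi> \<eta>
      obtain \<phi> where \<phi>: "\<phi> \<in> sigma_weak_functionals" "\<And>x. x \<in> bounded_operators \<Longrightarrow> \<phi> x = cinner \<xi> (ampliate x \<eta>)"
        using vector_ampliate_sigma_weak by metis
      have "continuous_map (subtopology weak_operator_topology (ampliate ` A)) (subtopology sigma_weak_topology A) (\<lambda>y. entry y 0 0)"
      proof (rule continuous_map_into_subtopology)
        show "continuous_map (subtopology weak_operator_topology (ampliate ` A)) sigma_weak_topology (\<lambda>y. entry y 0 0)"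
          unfolding sigma_weak_topology_def sigma_weak_functionals_def[symmetric]
          by (rule continuous_map_functional_topology[OF _ _ sigma_weak_functionals_nonempty])
            (auto intro!: entry_sigma_weak_wot A_b entry_bounded)
      qed auto
      from continuous_map_compose[OF this cont[OF \<phi>(1)]]
      have "wot_continuous (ampliate ` A) (\<lambda>y. \<phi> (F (entry y 0 0)))" by (simp add: comp_def)
      then show "wot_continuous (ampliate ` A) (\<lambda>y. cinner \<xi> (ampliate (F (entry y 0 0)) \<eta>))"
        by (rule wot_continuous_cong) (auto simp: \<phi>(2) F_in)
    qed
  next
    fix x assume "x \<in> ampliate ` A"
    then obtain a where a: "a \<in> A" "x = ampliate a" by blast
    have "ampliate (\<Sum>i<k. u i \<odot> F (adj (u i) \<odot> a)) = (\<Sum>i<k. ampliate (u i \<odot> F (adj (u i) \<odot> a)))"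
      by (rule ampliate_sum) (use a u_in in \<open>auto intro!: in_bounded comp F_in adj\<close>)
    also have "\<dots> = (\<Sum>i<k. ampliate (u i) \<odot> ampliate (F (entry (adj (ampliate (u i)) \<odot> x) 0 0)))"
      by (intro sum.cong refl) (simp add: a u_in comp adj F_in ampliate_comp flip: ampliate_adj, simp add: a u_in comp adj flip: ampliate_comp)
    finally show "(\<Sum>i<k. ampliate (u i) \<odot> ampliate (F (entry (adj (ampliate (u i)) \<odot> x) 0 0))) = x"
      by (simp add: frame a)
  qed (auto simp: F_in u_in F_idem F_add F_scale F_adj add scale adj comp F_left
      simp flip: ampliate_add ampliate_scale ampliate_adj ampliate_comp dest!: ampliate_inj[rotated 2])
qed

section \<open>Transfer of the descent statements to the given inclusion\<close>

lemma ampliate_expectation: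
  fixes M N :: "'h::complex_hilbert_space operator set" and S :: "nat \<Rightarrow> 'h operator"
  assumes S: "isometries S" and E: "strongly_PP_expectation E M N"
  obtains F u k where "framed_isometries (isometries.ampliate S ` M) F u k S"
    "{y \<in> isometries.ampliate S ` M. F y = y} = isometries.ampliate S ` N"
proof -
  interpret isometries S by fact
  obtain u k where fr: "pre_framed M E u k" and N: "N = {x \<in> M. E x = x}"
    by (rule strongly_PP_pre_framed[OF E])
  interpret pre_framed M E u k by fact
  have cE: "continuous_map (subtopology sigma_weak_topology M) (subtopology sigma_weak_topology N) E"
    using E by (simp add: strongly_PP_expectation_def PP_expectation_def conditional_expectation_def)
  have "continuous_map (subtopology sigma_weak_topology M) euclidean (\<lambda>x. \<phi> (E x))"
    if "\<phi> \<in> sigma_weak_functionals" for \<phi>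
  proof -
    have "continuous_map (subtopology sigma_weak_topology N) euclidean \<phi>"
      unfolding sigma_weak_topology_def sigma_weak_functionals_def[symmetric]
      by (intro continuous_map_from_subtopology continuous_map_functional that)
    from continuous_map_compose[OF cE this] show ?thesis by (simp add: comp_def)
  qed
  from ampliate_framed[OF fr this]
  have "framed_isometries (ampliate ` M) (\<lambda>y. ampliate (E (entry y 0 0))) (\<lambda>i. ampliate (u i)) k S"
    by (simp add: framed_isometries_def isometries_axioms)
  moreover have "{y \<in> ampliate ` M. ampliate (E (entry y 0 0)) = y} = ampliate ` N"
  proof safe
    fix x assume x: "x \<in> M" and eq: "ampliate (E (entry (ampliate x) 0 0)) = ampliate x"
    have "E x = x"
      by (rule ampliate_inj) (use x eq in \<open>auto simp: entry_ampliate in_bounded F_in\<close>)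
    then show "ampliate x \<in> ampliate ` N" using x by (auto simp: N)
  qed (auto simp: N entry_ampliate in_bounded)
  ultimately show thesis by (rule that)
qed

text \<open>Ampliation identifies central projections, and corners up to isomorphism, so the
  statement for the ampliated inclusion can be read back.\<close>

lemma property_projection_down:
  fixes M N :: "'h::complex_hilbert_space operator set" and S :: "nat \<Rightarrow> 'h operator"
  assumes S: "isometries S" and E: "strongly_PP_expectation E M N"
    and P: "ideal_prop P" "descends_strongly_PP P"
    and z: "z \<in> central_projections M" "P (corner z M)"
  obtains s where "s \<in> central_projections N" "P (corner s N)" "s \<odot> z = z"
proof -
  interpret isometries S by fact
  obtain F u k where fr: "framed_isometries (ampliate ` M) F u k S" and fixpts: "{y \<in> ampliate ` M. F y = y} = ampliate ` N"
    by (rule ampliate_expectation[OF S E])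
  interpret T: framed_isometries "ampliate ` M" F u k S by fact
  have vN: "von_neumann_algebra M" "von_neumann_algebra N"
    using E by (auto simp: strongly_PP_expectation_def PP_expectation_def
        conditional_expectation_def wstar_subalgebra_def)
  interpret M: vN_algebra M by unfold_locales (rule vN)
  interpret N: vN_algebra N by unfold_locales (rule vN)
  have TB: "T.B = ampliate ` N" by (simp add: T.B_def fixpts)
  have zM: "z \<in> projections M" "z \<in> M" using z by (auto simp: central_projections_def projections_def)
  obtain s' where s': "s' \<in> central_projections T.B" "P (corner s' T.B)" "s' \<odot> ampliate z = ampliate z"
    by (rule T.property_down[OF P, of "ampliate z"])
      (use z zM vN P in \<open>auto simp: central_projections_ampliate P_corner_ampliate\<close>)
  then obtain s where s: "s \<in> N" "s' = ampliate s"
    unfolding TB by (auto simp: central_projections_def projections_def)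
  have sc: "s \<in> central_projections N" using s' s vN central_projections_ampliate by (simp add: TB)
  show thesis
  proof
    show "P (corner s N)"
      using s' s sc P_corner_ampliate[OF P(1) vN(2), of s] by (simp add: TB central_projections_def)
    show "s \<odot> z = z"
      by (rule ampliate_inj) (use s' s zM in \<open>auto simp: bounded_operators_closure M.in_bounded N.in_bounded ampliate_comp\<close>)
  qed (rule sc)
qed

lemma property_projection_up:
  fixes M N :: "'h::complex_hilbert_space operator set" and S :: "nat \<Rightarrow> 'h operator"
  assumes S: "isometries S" and E: "strongly_PP_expectation E M N"
    and P: "ideal_prop P" "descends_strongly_PP P"
    and q: "q \<in> central_projections N" "P (corner q N)"
  obtains c where "c \<in> central_projections M" "P (corner c M)" "c \<odot> q = q"
proof -
  interpret isometries S by fact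
  obtain F u k where fr: "framed_isometries (ampliate ` M) F u k S" and fixpts: "{y \<in> ampliate ` M. F y = y} = ampliate ` N"
    by (rule ampliate_expectation[OF S E])
  interpret T: framed_isometries "ampliate ` M" F u k S by fact
  have vN: "von_neumann_algebra M" "von_neumann_algebra N"
    using E by (auto simp: strongly_PP_expectation_def PP_expectation_def
        conditional_expectation_def wstar_subalgebra_def)
  interpret M: vN_algebra M by unfold_locales (rule vN)
  interpret N: vN_algebra N by unfold_locales (rule vN)
  have TB: "T.B = ampliate ` N" by (simp add: T.B_def fixpts)
  have qN: "q \<in> projections N" "q \<in> N" using q by (auto simp: central_projections_def projections_def)
  obtain c' where c': "c' \<in> central_projections (ampliate ` M)" "P (corner c' (ampliate ` M))" "c' \<odot> ampliate q = ampliate q"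
    by (rule T.property_up[OF P, of "ampliate q"])
      (use q qN vN P in \<open>auto simp: central_projections_ampliate P_corner_ampliate TB\<close>)
  then obtain c where c: "c \<in> M" "c' = ampliate c" by (auto simp: central_projections_def projections_def)
  have cc: "c \<in> central_projections M" using c' c vN central_projections_ampliate by simp
  show thesis
  proof
    show "P (corner c M)"
      using c' c cc P_corner_ampliate[OF P(1) vN(1), of c] by (simp add: central_projections_def)
    show "c \<odot> q = q"
      by (rule ampliate_inj) (use c' c qN in \<open>auto simp: bounded_operators_closure M.in_bounded N.in_bounded ampliate_comp\<close>)
  qed (rule cc)
qed

section \<open>Finite-dimensional Hilbert spaces\<close>

text \<open>Unit vectors chosen in the ranges of the successive differences
  \<open>p n - p (Suc n)\<close> are orthonormal.\<close>

lemma proj_chain_orthonormal: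
  fixes p :: "nat \<Rightarrow> 'h::complex_hilbert_space operator"
  assumes p: "\<And>n. p n \<in> projections bounded_operators"
    and le: "\<And>n. proj_le (p (Suc n)) (p n)" and neq: "\<And>n. p (Suc n) \<noteq> p n"
  shows "\<exists>B0::'h set. infinite B0 \<and> orthonormal B0"
proof -
  have pb: "p n \<in> bounded_operators" and pp: "p n (p n x) = p n x"
    and pa: "cinner (p n x) y = cinner x (p n y)" for n x y
  proof -
    show "p n \<in> bounded_operators" using p[of n] by (simp add: projections_def)
    then show "cinner (p n x) y = cinner x (p n y)" using p[of n] cinner_adj[of "p n" x y] by (simp add: projections_def)
    have "p n \<odot> p n = p n" using p[of n] by (simp add: projections_def)
    then show "p n (p n x) = p n x" by (metis blinfun_apply_blinfun_compose)
  qed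
  have le1: "p n (p (Suc n) x) = p (Suc n) x" for n x
    using le[of n] unfolding proj_le_def by (metis blinfun_apply_blinfun_compose)
  have le2: "p (Suc n) (p n x) = p (Suc n) x" for n x
    by (rule cinner_extI) (metis le1 pa)
  have mono: "p n (p m x) = p m x" if "n \<le> m" for n m x
    using that
  proof (induction m arbitrary: x rule: dec_induct)
    case (step m)
    then show ?case by (metis le1)
  qed (rule pp)
  have "\<exists>w. p n w - p (Suc n) w \<noteq> 0" for n
    using neq[of n] by (metis blinfun_eqI eq_iff_diff_eq_0)
  then obtain w where w: "\<And>n. p n (w n) - p (Suc n) (w n) \<noteq> 0" by metis
  define d where "d n = p n (w n) - p (Suc n) (w n)" for n
  have d: "p n (d n) = d n" "p (Suc n) (d n) = 0" "d n \<noteq> 0" for n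
    using w[of n] by (simp_all add: d_def blinfun.diff_right pp le1 le2)
  define v where "v n = complex_of_real (1 / norm (d n)) *\<^sub>C d n" for n
  have nv: "cinner (v n) (v n) = 1" for n
    using d(3)[of n] by (simp add: cinner_self v_def norm_scaleC norm_divide)
  have vp: "p n (v n) = v n" "p (Suc n) (v n) = 0" for n
    unfolding v_def by (simp_all add: bounded_operatorsD[OF pb] d scaleC.zero_right)
  have lt: "cinner (v n) (v m) = 0" if "n < m" for n m
  proof -
    have "p (Suc n) (v m) = v m" using mono[of "Suc n" m "v m"] that vp(1) by simp
    then have "cinner (v n) (v m) = cinner (p (Suc n) (v n)) (v m)" by (simp add: pa)
    then show ?thesis by (simp add: vp(2) cinner.zero_left)
  qed
  have orth: "cinner (v n) (v m) = (if n = m then 1 else 0)" for n m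
    using lt[of n m] lt[of m n] nv[of n] cinner_commute[of "v n" "v m"] by (cases n m rule: linorder_cases) auto
  have "inj v"
  proof (rule injI)
    fix n m assume "v n = v m"
    then show "n = m" using orth[of n m] orth[of n n] by (cases "n = m") auto
  qed
  then have "infinite (range v)" using finite_imageD infinite_UNIV_nat by blast
  moreover have "orthonormal (range v)"
    unfolding orthonormal_def using orth \<open>inj v\<close> by (auto simp: inj_eq)
  ultimately show ?thesis by blast
qed

text \<open>Formed in the algebra of all bounded operators, so that one well-foundedness statement
  serves the projections of every algebra.\<close>

definition proj_less :: "('h::complex_hilbert_space operator \<times> 'h operator) set" where
  "proj_less = {(q, p). q \<in> projections bounded_operators \<and> p \<in> projections bounded_operators
      \<and> proj_le q p \<and> q \<noteq> p}"

lemma wf_proj_less: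
  assumes "\<And>B0::'h::complex_hilbert_space set. orthonormal B0 \<Longrightarrow> finite B0"
  shows "wf (proj_less :: ('h operator \<times> 'h operator) set)"
  unfolding wf_iff_no_infinite_down_chain
proof
  assume "\<exists>f. \<forall>i. (f (Suc i), f i) \<in> (proj_less :: ('h operator \<times> 'h operator) set)"
  then obtain f where f: "\<And>i. (f (Suc i), f i) \<in> (proj_less :: ('h operator \<times> 'h operator) set)" by blast
  then have "\<exists>B0::'h set. infinite B0 \<and> orthonormal B0"
    by (intro proj_chain_orthonormal[of f]) (auto simp: proj_less_def)
  then show False using assms by blast
qed

lemma projections_subset_bounded:
  "von_neumann_algebra A \<Longrightarrow> projections A \<subseteq> projections bounded_operators"
  unfolding projections_def von_neumann_algebra_def star_subalgebra_def by blast

definition minimal_projection :: "'h::complex_hilbert_space operator set \<Rightarrow> 'h operator \<Rightarrow> bool" where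
  "minimal_projection A p \<longleftrightarrow> p \<in> projections A \<and> p \<noteq> 0 \<and>
     (\<forall>q\<in>projections A. proj_le q p \<longrightarrow> q = 0 \<or> q = p)"

text \<open>Finite dimension as the exact negation of what \<open>isometries_exist\<close> requires,
  so that the two cases of the final argument are exhaustive. The parameter \<open>ty\<close> only
  fixes the type.\<close>

locale finite_dim = 
  fixes ty :: "'h::complex_hilbert_space itself"
  assumes fin: "\<And>B0::'h set. orthonormal B0 \<Longrightarrow> finite B0"
begin

text \<open>Stated as the estimate by which pointwise convergence of operators becomes convergence
  in norm.\<close>

lemma basis:
  obtains B :: "'h set" where "finite B"
    "\<And>T. T \<in> bounded_operators \<Longrightarrow> norm T \<le> (\<Sum>b\<in>B. norm (blinfun_apply T b))"
proof -
  obtain B :: "'h set" where B: "orthonormal B" "\<And>x. (\<And>b. b \<in> B \<Longrightarrow> cinner b x = 0) \<Longrightarrow> x = 0"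
    using orthonormal_extend[of "{}"] by (auto simp: orthonormal_def)
  have fB: "finite B" by (rule fin[OF B(1)])
  have expand: "x = (\<Sum>b\<in>B. cinner b x *\<^sub>C b)" for x
  proof -
    have "cinner a (x - (\<Sum>b\<in>B. cinner b x *\<^sub>C b)) = 0" if a: "a \<in> B" for a
    proof -
      have "cinner a (\<Sum>b\<in>B. cinner b x *\<^sub>C b) = (\<Sum>b\<in>B. if b = a then cinner b x else 0)"
        unfolding cinner.sum_right cinner_scaleC_right
        using B(1) a by (intro sum.cong refl) (auto simp: orthonormal_def)
      then show ?thesis using a fB by (simp add: cinner.diff_right)
    qed
    from B(2)[OF this] show ?thesis by simp
  qed
  have nb: "norm b = 1" if "b \<in> B" for b by (rule orthonormal_norm[OF B(1) that])
  show thesis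
  proof (rule that[OF fB])
    fix T :: "'h operator" assume T: "T \<in> bounded_operators"
    show "norm T \<le> (\<Sum>b\<in>B. norm (T b))"
    proof (rule norm_blinfun_bound)
      fix x
      have "T x = T (\<Sum>b\<in>B. cinner b x *\<^sub>C b)" using expand[of x] by simp
      also have "\<dots> = (\<Sum>b\<in>B. cinner b x *\<^sub>C T b)" by (simp add: blinfun.sum_right bounded_operatorsD[OF T])
      also have "norm \<dots> \<le> (\<Sum>b\<in>B. norm x * norm (T b))"
        using norm_cinner_le[of _ x] nb
        by (intro order_trans[OF norm_sum] sum_mono) (auto simp: norm_scaleC intro!: mult_right_mono, metis mult_1)
      finally show "norm (T x) \<le> (\<Sum>b\<in>B. norm (T b)) * norm x"
        by (simp add: sum_distrib_left mult.commute)
    qed (simp add: sum_nonneg)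
  qed
qed

text \<open>The powers of \<open>y\<^sup>2\<close> converge strongly, hence in norm, to the projection onto the fixed vectors of \<open>y\<^sup>2\<close>.\<close>

lemma spectral_projection:
  assumes A: "von_neumann_algebra (A :: 'h operator set)"
    and y: "y \<in> A" "adj y = y" "norm y = 1"
  obtains f where "f \<in> projections A" "f \<noteq> 0" "f \<odot> (y \<odot> y) = f"
    "\<And>p. p \<odot> y = y \<Longrightarrow> y \<odot> p = y \<Longrightarrow> p \<odot> f = f"
proof -
  interpret vN_algebra A by unfold_locales fact
  have yb: "y \<in> bounded_operators" by (rule in_bounded[OF y(1)])
  define c where "c n = (((\<odot>) y) ^^ n) e" for n :: nat
  have c0: "c 0 = e" and cS: "c (Suc n) = y \<odot> c n" for n by (simp_all add: c_def)
  have cA: "c n \<in> A" for n by (induction n) (auto simp: c0 cS e_in comp y)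
  have cadd: "c m \<odot> c n = c (m + n)" for m n
    by (induction m) (simp_all add: c0 cS e_left cA blinfun_compose_assoc)
  have c1: "c 1 = y" using cS[of 0] by (simp add: c0 e_right y)
  have adj_c: "adj (c n) = c n" for n
  proof (induction n)
    case (Suc n)
    have "adj (c (Suc n)) = c n \<odot> y" by (simp add: cS adj_comp_in y cA Suc)
    also have "\<dots> = c (n + 1)" unfolding c1[symmetric] by (rule cadd)
    finally show ?case by simp
  qed (simp add: c0 adj_e)
  have form: "cinner (c m \<eta>) (c n \<eta>) = cinner \<eta> (c (m + n) \<eta>)" for m n \<eta>
    using cinner_adj[OF in_bounded[OF cA], of m \<eta> "c n \<eta>"] by (simp add: adj_c flip: cadd)
  define t where "t \<eta> n = (norm (c n \<eta>))\<^sup>2" for \<eta> n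
  have form2: "cinner (c m \<eta>) (c n \<eta>) = complex_of_real (t \<eta> l)" if "m + n = 2 * l" for m n l \<eta>
    using form[of m \<eta> n] form[of l \<eta> l] that by (simp add: t_def cinner_self mult_2)
  have t_dec: "decseq (t \<eta>)" for \<eta>
  proof (rule decseq_SucI)
    fix n
    have "norm (c (Suc n) \<eta>) \<le> norm y * norm (c n \<eta>)" by (simp add: cS norm_blinfun)
    then show "t \<eta> (Suc n) \<le> t \<eta> n" unfolding t_def by (intro power_mono) (simp_all add: y)
  qed
  have t_lim: "\<exists>L. t \<eta> \<longlonglongrightarrow> L" for \<eta>
    using decseq_convergent[OF t_dec, of 0 \<eta>] by (metis t_def zero_le_power2)
  \<comment> \<open>Even exponents, since an eigenvalue -1 makes the powers of \<open>y\<close>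
    oscillate. Any two of them have an integral midpoint, so their inner product is a value of the
    convergent sequence \<open>t\<close>.\<close>
  have Cauchy_pt: "Cauchy (\<lambda>n. c (2 * n) \<eta>)" for \<eta>
  proof (rule metric_CauchyI)
    fix \<epsilon> :: real assume \<epsilon>: "\<epsilon> > 0"
    obtain L where L: "t \<eta> \<longlonglongrightarrow> L" using t_lim by blast
    obtain n0 where n0: "\<And>n. n \<ge> n0 \<Longrightarrow> \<bar>t \<eta> n - L\<bar> < \<epsilon>\<^sup>2 / 4"
      using LIMSEQ_D[OF L, of "\<epsilon>\<^sup>2 / 4"] \<epsilon> by (auto simp: real_norm_def)
    have "dist (c (2 * m) \<eta>) (c (2 * n) \<eta>) < \<epsilon>" if mn: "m \<ge> n0" "n \<ge> n0" for m n
    proof -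
      define v w where "v = c (2 * m) \<eta>" and "w = c (2 * n) \<eta>"
      have "cinner (v - w) (v - w) = cinner v v - cinner v w - (cinner w v - cinner w w)"
        by (simp only: cinner.diff_left cinner.diff_right) simp
      also have "\<dots> = complex_of_real (t \<eta> (2 * m) - 2 * t \<eta> (m + n) + t \<eta> (2 * n))"
        unfolding v_def w_def
        by (simp add: form2[where l = "2 * m"] form2[where l = "2 * n"] form2[where l = "m + n"])
      finally have "(norm (v - w))\<^sup>2 = t \<eta> (2 * m) - 2 * t \<eta> (m + n) + t \<eta> (2 * n)"
        unfolding cinner_self by (simp only: of_real_eq_iff)
      also have "\<dots> < \<epsilon>\<^sup>2"
        using n0[of "2 * m"] n0[of "2 * n"] n0[of "m + n"] mn by linarith
      finally have "norm (v - w) < \<epsilon>" using \<epsilon> by (simp add: power2_less_imp_less)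
      then show ?thesis by (simp add: dist_norm v_def w_def)
    qed
    then show "\<exists>M. \<forall>m\<ge>M. \<forall>n\<ge>M. dist (c (2 * m) \<eta>) (c (2 * n) \<eta>) < \<epsilon>" by blast
  qed
  obtain B :: "'h set" where B: "finite B"
    "\<And>T. T \<in> bounded_operators \<Longrightarrow> norm T \<le> (\<Sum>b\<in>B. norm (blinfun_apply T b))"
    by (rule basis) blast
  have "\<exists>x. (\<lambda>n. c (2 * n) b) \<longlonglongrightarrow> x" for b
    using Cauchy_pt Cauchy_convergent_iff convergent_def by blast
  then obtain l where l: "\<And>b. (\<lambda>n. c (2 * n) b) \<longlonglongrightarrow> l b" by metis
  have "Cauchy (\<lambda>n. c (2 * n))"
  proof (rule metric_CauchyI)
    fix \<epsilon> :: real assume \<epsilon>: "\<epsilon> > 0"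
    define s where "s n = (\<Sum>b\<in>B. norm (c (2 * n) b - l b))" for n
    have "s \<longlonglongrightarrow> (\<Sum>b\<in>B. norm (l b - l b))"
      unfolding s_def by (intro tendsto_intros l)
    then have "s \<longlonglongrightarrow> 0" by simp
    then obtain n0 where n0: "\<And>n. n \<ge> n0 \<Longrightarrow> \<bar>s n\<bar> < \<epsilon> / 2"
      using LIMSEQ_D[of s 0 "\<epsilon> / 2"] \<epsilon> by (auto simp: real_norm_def)
    have "dist (c (2 * m)) (c (2 * n)) < \<epsilon>" if mn: "m \<ge> n0" "n \<ge> n0" for m n
    proof -
      have "norm (c (2 * m) - c (2 * n)) \<le> (\<Sum>b\<in>B. norm ((c (2 * m) - c (2 * n)) b))"
        by (rule B(2)) (simp add: bounded_operators_closure in_bounded cA)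
      also have "\<dots> \<le> (\<Sum>b\<in>B. norm (c (2 * m) b - l b) + norm (c (2 * n) b - l b))"
        using dist_triangle2[of "c (2 * m) b" "c (2 * n) b" "l b" for b]
        by (intro sum_mono) (simp add: dist_norm blinfun.diff_left)
      also have "\<dots> = s m + s n" by (simp add: s_def sum.distrib)
      also have "\<dots> < \<epsilon>" using n0[OF mn(1)] n0[OF mn(2)] by linarith
      finally show ?thesis by (simp add: dist_norm)
    qed
    then show "\<exists>M. \<forall>m\<ge>M. \<forall>n\<ge>M. dist (c (2 * m)) (c (2 * n)) < \<epsilon>" by blast
  qed
  then obtain f where f: "(\<lambda>n. c (2 * n)) \<longlonglongrightarrow> f"
    using Cauchy_convergent_iff convergent_def by blast
  have fA: "f \<in> A" by (rule closed_sequentially[OF norm_closed _ f]) (rule cA)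
  have f_sub: "(\<lambda>n. c (2 * r n)) \<longlonglongrightarrow> f" if "filterlim r at_top sequentially" for r
    using filterlim_compose[OF f that] .
  have "(\<lambda>n. adj (c (2 * n))) \<longlonglongrightarrow> adj f"
    by (rule continuous_on_tendsto_compose[OF continuous_on_adj f]) (auto intro!: in_bounded fA cA always_eventually)
  then have adj_f: "adj f = f" using LIMSEQ_unique f by (simp add: adj_c)
  have ff: "f \<odot> f = f"
  proof -
    have "(\<lambda>n. c (2 * n) \<odot> c (2 * n)) \<longlonglongrightarrow> f \<odot> f" by (intro tendsto_intros f)
    moreover have "(\<lambda>n. c (2 * (2 * n))) \<longlonglongrightarrow> f"
      by (rule f_sub) (auto intro!: filterlim_subseq simp: strict_mono_def)
    ultimately show ?thesis using LIMSEQ_unique by (simp add: cadd mult_2)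
  qed
  have fy: "f \<odot> (y \<odot> y) = f"
  proof -
    have "(\<lambda>n. c (2 * n) \<odot> (y \<odot> y)) \<longlonglongrightarrow> f \<odot> (y \<odot> y)" by (intro tendsto_intros f)
    moreover have "c (2 * n) \<odot> (y \<odot> y) = c (2 * Suc n)" for n
    proof -
      have "c (2 * n) \<odot> (c 1 \<odot> c 1) = c (2 * n + (1 + 1))" by (simp only: cadd)
      then show ?thesis unfolding c1 by simp
    qed
    moreover have "(\<lambda>n. c (2 * Suc n)) \<longlonglongrightarrow> f" by (rule f_sub) (rule filterlim_Suc)
    ultimately show ?thesis using LIMSEQ_unique by simp
  qed
  \<comment> \<open>Squaring preserves norm 1 for self-adjoint elements; along the exponents
    \<open>2 ^ n\<close> this keeps the limit away from zero.\<close>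
  have norm_c: "norm (c (2 ^ n)) = 1" for n
  proof (induction n)
    case 0 then show ?case using c1 y by simp
  next
    case (Suc n)
    have "norm (c (2 ^ n) \<odot> c (2 ^ n)) = (norm (c (2 ^ n)))\<^sup>2"
      by (rule norm_square_self_adjoint) (rule cA, rule adj_c)
    then show ?case using Suc by (simp add: cadd mult_2)
  qed
  have "(\<lambda>n. c (2 * 2 ^ n)) \<longlonglongrightarrow> f"
    by (rule f_sub) (auto intro!: filterlim_subseq simp: strict_mono_def)
  from tendsto_norm[OF this] have "(\<lambda>n. 1) \<longlonglongrightarrow> norm f"
    using norm_c[of "Suc _"] by simp
  then have "norm f = 1" using LIMSEQ_unique tendsto_const by blast
  then have f0: "f \<noteq> 0" by auto
  have "p \<odot> f = f" if p: "p \<odot> y = y" "y \<odot> p = y" for p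
  proof -
    have "p \<odot> c (Suc n) = c (Suc n)" for n
      using p by (simp add: cS flip: blinfun_compose_assoc)
    from this[of "Suc (2 * _)"] have eq: "p \<odot> c (2 * Suc n) = c (2 * Suc n)" for n by simp
    have lim: "(\<lambda>n. c (2 * Suc n)) \<longlonglongrightarrow> f" by (rule f_sub) (rule filterlim_Suc)
    have "(\<lambda>n. p \<odot> c (2 * Suc n)) \<longlonglongrightarrow> p \<odot> f"
      by (rule blinfun_compose.tendsto[OF tendsto_const lim])
    then show ?thesis unfolding eq by (rule LIMSEQ_unique[OF _ lim])
  qed
  then show thesis using that[of f] fA adj_f ff f0 fy by (simp add: projections_def)
qed

text \<open>For a self-adjoint \<open>y\<close> of norm 1 in the corner, the projection onto the
  fixed vectors of \<open>y \<odot> y\<close> is nonzero and below \<open>p\<close>, hence equal to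
  \<open>p\<close>, and \<open>y \<odot> y = p\<close>. So squares of self-adjoint elements are
  multiples of \<open>p\<close>; general elements are reached through real and imaginary
  parts.\<close>

lemma corner_minimal_projection:
  assumes A: "von_neumann_algebra (A :: 'h operator set)" and p: "minimal_projection A p"
  shows "corner p A = range (\<lambda>c. c *\<^sub>O p)"
proof
  interpret vN_algebra A by unfold_locales fact
  have ppr: "p \<in> projections A" and p0: "p \<noteq> 0"
    and pmin: "\<And>q. q \<in> projections A \<Longrightarrow> proj_le q p \<Longrightarrow> q = 0 \<or> q = p"
    using p by (auto simp: minimal_projection_def)
  have pA: "p \<in> A" "p \<odot> p = p" "adj p = p" using ppr by (auto simp: projections_def)
  interpret C: vN_algebra "corner p A" by unfold_locales (rule corner_vN[OF ppr])
  have C_eq: "corner p A = {x \<in> A. p \<odot> x = x \<and> x \<odot> p = x}" by (rule corner_eq[OF ppr])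
  have sq1: "y \<odot> y = p" if y: "y \<in> corner p A" "adj y = y" "norm y = 1" for y
  proof -
    have y': "y \<in> A" "p \<odot> y = y" "y \<odot> p = y" using y by (auto simp: C_eq)
    obtain f where f: "f \<in> projections A" "f \<noteq> 0" "f \<odot> (y \<odot> y) = f"
      "\<And>q. q \<odot> y = y \<Longrightarrow> y \<odot> q = y \<Longrightarrow> q \<odot> f = f"
      by (rule spectral_projection[OF A y'(1) y(2,3)]) blast
    have "f = p" using pmin[OF f(1)] f(2) f(4)[OF y'(2,3)] by (auto simp: proj_le_def)
    then show ?thesis using f(3) y' by (simp flip: blinfun_compose_assoc)
  qed
  have sq: "x \<odot> x = ((norm x)\<^sup>2) *\<^sub>R p" if x: "x \<in> corner p A" "adj x = x" for x
  proof (cases "x = 0")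
    case False
    define y where "y = (1 / norm x) *\<^sub>R x"
    have "adj y = y" using x by (simp add: y_def scaleR_eq_op_scale adj_scale C.in_bounded)
    then have "y \<odot> y = p" using x False by (intro sq1) (auto simp: y_def C.scaleR)
    moreover have "x = norm x *\<^sub>R y" using False by (simp add: y_def)
    moreover have "(norm x *\<^sub>R y) \<odot> (norm x *\<^sub>R y) = ((norm x)\<^sup>2) *\<^sub>R (y \<odot> y)"
      by (simp add: blinfun_compose.scaleR_left blinfun_compose.scaleR_right power2_eq_square)
    ultimately show ?thesis by simp
  qed simp
  have sa: "\<exists>r. x = complex_of_real r *\<^sub>O p" if x: "x \<in> corner p A" "adj x = x" for x
  proof -
    have pC: "p \<in> corner p A" using pA by (simp add: C_eq)
    \<comment> \<open>The square of \<open>x\<close> equals the square of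
      \<open>norm x *\<^sub>R p\<close>, so the product of \<open>w'\<close> and \<open>w\<close>
      vanishes. As \<open>w \<odot> w\<close> is a multiple of \<open>p\<close>, one of the two
      factors is zero, and \<open>x\<close> is plus or minus its norm times
      \<open>p\<close>.\<close>
    define w where "w = x - norm x *\<^sub>R p"
    define w' where "w' = x + norm x *\<^sub>R p"
    have xp: "x \<odot> p = x" "p \<odot> x = x" using x by (auto simp: C_eq)
    have ww: "w' \<odot> w = 0"
      by (simp add: w_def w'_def blinfun_compose.add_left blinfun_compose.diff_right blinfun_compose.scaleR_left
          blinfun_compose.scaleR_right xp pA sq[OF x] power2_eq_square scaleR_add_right)
    have wC: "w \<in> corner p A" unfolding w_def by (intro C.diff C.scaleR x pC)
    have "adj w = w"
      unfolding w_def using x pA pC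
      by (subst adj_diff) (auto simp: C.in_bounded C.scaleR scaleR_eq_op_scale[of _ p] adj_scale C.scale)
    then have "w \<odot> w = ((norm w)\<^sup>2) *\<^sub>R p" by (rule sq[OF wC])
    then have "w' \<odot> (((norm w)\<^sup>2) *\<^sub>R p) = 0" using ww by (metis blinfun_compose_assoc blinfun_compose_zero(1))
    then have "((norm w)\<^sup>2) *\<^sub>R w' = 0"
      by (simp add: w'_def blinfun_compose.scaleR_right blinfun_compose.add_left blinfun_compose.scaleR_left xp pA)
    then have "w = 0 \<or> w' = 0" by simp
    then have "x = norm x *\<^sub>R p \<or> x = (- norm x) *\<^sub>R p" by (auto simp: w_def w'_def add_eq_0_iff)
    then show ?thesis unfolding scaleR_eq_op_scale by blast
  qed
  show "corner p A \<subseteq> range (\<lambda>c. c *\<^sub>O p)"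
  proof
    fix x assume x: "x \<in> corner p A"
    define a where "a = x + adj x"
    define b where "b = \<i> *\<^sub>O (x - adj x)"
    have ax: "adj x \<in> corner p A" using x by (rule C.adj)
    have ab: "a \<in> corner p A" "b \<in> corner p A" unfolding a_def b_def by (intro C.add C.scale C.diff x ax)+
    have "adj a = a" unfolding a_def using x ax by (simp add: adj_add C.in_bounded C.adj_adj_in add.commute)
    then obtain r where r: "a = complex_of_real r *\<^sub>O p" using sa[OF ab(1)] by blast
    have "adj b = (- \<i>) *\<^sub>O (adj x - x)"
      unfolding b_def using x ax by (simp add: adj_scale adj_diff C.in_bounded C.adj_adj_in bounded_operators_closure)
    also have "\<dots> = b" unfolding b_def by (rule blinfun_eqI) (simp add: blinfun.diff_left scaleC.diff_right scaleC.minus_left)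
    finally obtain r' where r': "b = complex_of_real r' *\<^sub>O p" using sa[OF ab(2)] by blast
    have "x = (1/2) *\<^sub>O a + (- \<i> / 2) *\<^sub>O b"
    proof (rule blinfun_eqI)
      fix \<xi>
      have "((1/2) *\<^sub>O a + (- \<i> / 2) *\<^sub>O b) \<xi> = (1/2) *\<^sub>C (x \<xi> + adj x \<xi>) + (1/2) *\<^sub>C (x \<xi> - adj x \<xi>)"
        by (simp add: a_def b_def blinfun.add_left blinfun.diff_left scaleC_scaleC)
      also have "\<dots> = (1/2 + 1/2) *\<^sub>C x \<xi>"
        by (simp only: scaleC_add_left scaleC_add_right scaleC.diff_right) simp
      finally show "x \<xi> = ((1/2) *\<^sub>O a + (- \<i> / 2) *\<^sub>O b) \<xi>" by simp
    qed
    also have "\<dots> = ((1/2) * complex_of_real r + (- \<i> / 2) * complex_of_real r') *\<^sub>O p"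
      unfolding r r' op_scale_scale
      by (rule blinfun_eqI) (simp only: blinfun.add_left op_scale_apply scaleC_add_left)
    finally show "x \<in> range (\<lambda>c. c *\<^sub>O p)" by blast
  qed
  show "range (\<lambda>c. c *\<^sub>O p) \<subseteq> corner p A"
    using pA by (auto simp: C_eq scale op_scale_compose_left op_scale_compose_right in_bounded)
qed

lemma minimal_projection_below:
  assumes A: "von_neumann_algebra (A :: 'h operator set)" and q: "q \<in> projections A" "q \<noteq> 0"
  obtains p where "minimal_projection A p" "proj_le p q"
proof -
  interpret vN_algebra A by unfold_locales fact
  define Q where "Q = {p \<in> projections A. p \<noteq> 0 \<and> proj_le p q}"
  have "q \<in> Q" using q by (simp add: Q_def proj_le_def projections_def)
  then obtain p where p: "p \<in> Q" "\<And>r. (r, p) \<in> proj_less \<Longrightarrow> r \<notin> Q"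
    using wfE_min[OF wf_proj_less[OF fin], of q Q] by blast
  have "minimal_projection A p"
    unfolding minimal_projection_def
  proof (intro conjI ballI impI)
    show "p \<in> projections A" "p \<noteq> 0" using p by (auto simp: Q_def)
    fix r assume r: "r \<in> projections A" "proj_le r p"
    show "r = 0 \<or> r = p"
    proof (rule ccontr)
      assume n: "\<not> (r = 0 \<or> r = p)"
      have pr: "p \<odot> r = r" "q \<odot> p = p" using r p(1) by (auto simp: Q_def proj_le_def)
      have "q \<odot> r = q \<odot> (p \<odot> r)" by (simp only: pr)
      also have "\<dots> = (q \<odot> p) \<odot> r" by (simp only: blinfun_compose_assoc)
      finally have "proj_le r q" by (simp add: pr proj_le_def)
      then have "r \<in> Q" using n r by (simp add: Q_def)
      moreover have "(r, p) \<in> proj_less"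
        using n r p projections_subset_bounded[OF A] by (auto simp: proj_less_def Q_def)
      ultimately show False using p by blast
    qed
  qed
  then show thesis using that p by (simp add: Q_def)
qed

text \<open>Both corners are copies of the complex numbers, and the isomorphism matches the
  scalars.\<close>

lemma P_minimal:
  assumes P: "ideal_prop P" and A: "von_neumann_algebra (A :: 'h operator set)"
    and N: "von_neumann_algebra N"
    and p: "minimal_projection A p" and r: "minimal_projection N r" and PA: "P (corner p A)"
  shows "P (corner r N)"
proof -
  interpret A: vN_algebra A by unfold_locales fact
  interpret N: vN_algebra N by unfold_locales fact
  have pr: "p \<in> projections A" "p \<noteq> 0" "r \<in> projections N" "r \<noteq> 0"
    using p r by (auto simp: minimal_projection_def)
  then have pp: "p \<in> A" "p \<odot> p = p" "adj p = p" "r \<in> N" "r \<odot> r = r" "adj r = r" by (auto simp: projections_def)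
  have cp: "corner p A = range (\<lambda>c. c *\<^sub>O p)" and cr: "corner r N = range (\<lambda>c. c *\<^sub>O r)"
    using corner_minimal_projection A N p r by blast+
  have inj: "c *\<^sub>O q = d *\<^sub>O q \<longleftrightarrow> c = d" if q: "q \<noteq> 0" for c d and q :: "'h operator"
  proof
    assume eq: "c *\<^sub>O q = d *\<^sub>O q"
    obtain \<xi> where "q \<xi> \<noteq> 0" using q by (metis blinfun_eqI blinfun.zero_left)
    moreover have "c *\<^sub>C q \<xi> = d *\<^sub>C q \<xi>" using eq by (metis op_scale_apply)
    then have "(c - d) *\<^sub>C q \<xi> = 0" by (simp add: scaleC.diff_left)
    then have "cmod (c - d) * norm (q \<xi>) = 0" by (metis norm_scaleC norm_zero)
    ultimately show "c = d" by simp
  qed simp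
  define \<phi> where "\<phi> x = (THE c. x = c *\<^sub>O p) *\<^sub>O r" for x
  have \<phi>: "\<phi> (c *\<^sub>O p) = c *\<^sub>O r" for c by (simp add: \<phi>_def inj[OF pr(2)] eq_commute)
  have comb: "c *\<^sub>O q + d *\<^sub>O q = (c + d) *\<^sub>O q" for c d and q :: "'h operator"
    by (rule blinfun_eqI) (simp add: blinfun.add_left scaleC_add_left)
  have mult: "(c *\<^sub>O q) \<odot> (d *\<^sub>O q) = (c * d) *\<^sub>O q" if "q \<in> bounded_operators" "q \<odot> q = q" for c d and q :: "'h operator"
    using that by (simp add: op_scale_compose_left op_scale_compose_right op_scale_scale)
  have "P (corner p A) \<longleftrightarrow> P (corner r N)"
  proof (rule ideal_prop.iso_iff[OF P, where \<phi> = \<phi>])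
    show "von_neumann_algebra (corner p A)" "von_neumann_algebra (corner r N)"
      using A.corner_vN N.corner_vN pr by blast+
    show "bij_betw \<phi> (corner p A) (corner r N)"
      unfolding cp cr bij_betw_def by (auto simp: inj_on_def \<phi> inj pr image_image)
  qed (auto simp: cp \<phi> comb mult pp A.in_bounded N.in_bounded op_scale_scale adj_scale)
  then show ?thesis using PA by simp
qed

text \<open>One minimal corner with the property gives it to every minimal corner of every algebra.
  A largest possible projection with the property in \<open>N\<close> is then the unit, since
  otherwise a minimal projection below its complement could be joined to it.\<close>

lemma P_all:
  assumes P: "ideal_prop P" and A: "von_neumann_algebra (A :: 'h operator set)" and PA: "P A"
    and nz: "A \<noteq> {0}" and N: "von_neumann_algebra N"
  shows "P N"
proof -
  interpret P: ideal_prop P by fact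
  interpret A: vN_algebra A by (unfold_locales; fact)
  interpret N: vN_algebra N by (unfold_locales; fact)
  have "A.e \<noteq> 0"
  proof
    assume "A.e = 0"
    then have "x = 0" if "x \<in> A" for x using A.e_left[OF that] by simp
    then show False using nz A.zero by blast
  qed
  then obtain p where p: "minimal_projection A p"
    using minimal_projection_below[OF A A.e_projection] by blast
  have Pp: "P (corner p A)"
    by (rule P.corner_property[OF A PA]) (use p in \<open>simp add: minimal_projection_def\<close>)
  \<comment> \<open>The supremum of the empty family.\<close>
  have 0: "0 \<in> property_projections P N"
    by (rule P.finite_sup[OF N, of "{}"]) (auto simp: is_proj_sup_def proj_le_def projections_def N.zero)
  \<comment> \<open>\<open>proj_less\<close> is well-founded downwards, so a maximal projection is
    found as one with minimal complement.\<close>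
  define Q where "Q = (\<lambda>q. N.e - q) ` property_projections P N"
  have "N.e - 0 \<in> Q" using 0 unfolding Q_def by blast
  then obtain m where m: "m \<in> Q" "\<And>r. (r, m) \<in> proj_less \<Longrightarrow> r \<notin> Q"
    using wfE_min[OF wf_proj_less[OF fin], of _ Q] by blast
  then obtain q where q: "q \<in> property_projections P N" "m = N.e - q" by (auto simp: Q_def)
  have qpr: "q \<in> projections N" and qN: "q \<in> N" "q \<odot> q = q" "adj q = q"
    using q by (auto simp: property_projections_def projections_def)
  have compl: "N.e - x \<in> projections N" if "x \<in> projections N" for x
    using that by (auto simp: projections_def N.diff N.e_in adj_diff N.in_bounded N.adj_e
        blinfun_compose.diff_left blinfun_compose.diff_right N.e_left N.e_right)
  have "m = 0"
  proof (rule ccontr)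
    assume "m \<noteq> 0"
    then obtain r where r: "minimal_projection N r" "proj_le r m"
      using minimal_projection_below[OF N, of m] compl[OF qpr] q by blast
    have rpr: "r \<in> projections N" "r \<noteq> 0" using r by (auto simp: minimal_projection_def)
    then have rN: "r \<in> N" "r \<odot> r = r" "adj r = r" by (auto simp: projections_def)
    have Pr: "r \<in> property_projections P N"
      using P_minimal[OF P A N p r(1) Pp] rpr by (simp add: property_projections_def)
    have qr: "q \<odot> r = 0" using r(2) q rN by (simp add: proj_le_def blinfun_compose.diff_left N.e_left)
    have rq: "r \<odot> q = 0"
    proof -
      have "adj (q \<odot> r) = r \<odot> q" using qN rN by (simp add: N.adj_comp_in)
      then show ?thesis by (simp add: qr)
    qed
    define s where "s = q + r"
    have spr: "s \<in> projections N"
      unfolding projections_def s_def using qN rN qr rq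
      by (simp add: N.add adj_add N.in_bounded blinfun_compose.add_left blinfun_compose.add_right)
    have sP: "s \<in> property_projections P N"
    proof (rule P.finite_sup[OF N, of "{q, r}"])
      show "is_proj_sup N {q, r} s"
        unfolding is_proj_sup_def using spr qN rN qr rq
        by (auto simp: proj_le_def s_def blinfun_compose.add_left blinfun_compose.add_right)
    qed (use q Pr in auto)
    have "(N.e - s, m) \<in> proj_less"
    proof -
      have "m \<odot> (N.e - s) = N.e - s"
        unfolding q(2) s_def using qN rN qr N.e_in
        by (simp add: blinfun_compose.diff_left blinfun_compose.diff_right blinfun_compose.add_right N.e_left N.e_right)
      moreover have "N.e - s \<noteq> m" using rpr by (simp add: q(2) s_def)
      ultimately show ?thesis
        using compl[OF spr] compl[OF qpr] projections_subset_bounded[OF N] q(2)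
        by (auto simp: proj_less_def proj_le_def)
    qed
    then show False using m(2) sP by (auto simp: Q_def)
  qed
  then have "q = N.e" using q by simp
  then show ?thesis using q P.unit_property[OF N] by (simp add: N.e_def)
qed

end

section \<open>The largest central projection\<close>

lemma limitin_functional_topology:
  assumes l: "l \<in> bounded_operators" and f: "\<And>x. f x \<in> bounded_operators"
    and lim: "\<And>\<phi>. \<phi> \<in> \<Phi> \<Longrightarrow> ((\<lambda>x. \<phi> (f x)) \<longlongrightarrow> \<phi> l) net" and ne: "\<Phi> \<noteq> {}"
  shows "limitin (functional_topology \<Phi>) f l net"
proof -
  have "generate_topology_on {{T \<in> bounded_operators. \<phi> T \<in> U} | \<phi> U. \<phi> \<in> \<Phi> \<and> open U} V
    \<Longrightarrow> l \<in> V \<Longrightarrow> eventually (\<lambda>x. f x \<in> V) net" for V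
  proof (induction V rule: generate_topology_on.induct)
    case (Int a b)
    then show ?case by (simp add: eventually_conj)
  next
    case (UN K)
    then obtain a where "a \<in> K" "l \<in> a" by blast
    with UN show ?case by (blast intro: eventually_mono)
  next
    case (Basis s)
    then obtain \<phi> U where s: "s = {T \<in> bounded_operators. \<phi> T \<in> U}" "\<phi> \<in> \<Phi>" "open U" by blast
    have "eventually (\<lambda>x. \<phi> (f x) \<in> U) net"
      using topological_tendstoD[OF lim[OF s(2)] s(3)] Basis s by simp
    then show ?case by (simp add: s f)
  qed simp
  then show ?thesis
    unfolding limitin_def using l topspace_functional_topology[OF ne]
    by (simp add: functional_topology_def openin_topology_generated_by_iff)
qed

text \<open>For central projections, central orthogonality thereby becomes plain
  orthogonality.\<close>

lemma (in vN_algebra) central_support_central: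
  assumes "p \<in> central_projections A"
  shows "central_support A p = p"
  unfolding central_support_def
proof (rule the_equality)
  have pp: "p \<in> projections A" using assms by (simp add: central_projections_def)
  then have "p \<odot> p = p" by (simp add: projections_def)
  then show "p \<in> central_projections A \<and> proj_le p p \<and>
    (\<forall>z'\<in>central_projections A. proj_le p z' \<longrightarrow> proj_le p z')"
    using assms by (simp add: proj_le_def)
  then show "z = p" if "z \<in> central_projections A \<and> proj_le p z \<and>
    (\<forall>z'\<in>central_projections A. proj_le p z' \<longrightarrow> proj_le z z')" for z
    using that pp by (intro proj_le_antisym) (auto simp: central_projections_def)
qed

text \<open>Complete ideality speaks of sums that are given as elements of the algebra, so the sum
  has to be produced: first weakly by Bessel's inequality, then strongly, and inside
  \<open>A\<close> by weak closedness.\<close>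

lemma (in vN_algebra) orthogonal_sum_exists:
  assumes S: "S \<subseteq> central_projections A"
    and orth: "\<And>p q. p \<in> S \<Longrightarrow> q \<in> S \<Longrightarrow> p \<noteq> q \<Longrightarrow> p \<odot> q = 0"
  shows "\<exists>r\<in>central_projections A. (\<forall>p\<in>S. r \<odot> p = p) \<and>
    (\<forall>\<xi>. ((\<lambda>p. blinfun_apply p \<xi>) has_sum blinfun_apply r \<xi>) S)"
proof -
  have pr: "p \<in> projections A" and pA: "p \<in> A" "p \<odot> p = p" "adj p = p"
    and pc: "\<And>x. x \<in> A \<Longrightarrow> p \<odot> x = x \<odot> p" if "p \<in> S" for p
    using subsetD[OF S that] by (auto simp: central_projections_def projections_def center_def)
  have pb: "p \<in> bounded_operators" if "p \<in> S" for p using pA(1)[OF that] by (rule in_bounded)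
  have ps: "cinner (p \<xi>) (q \<eta>) = (if p = q then cinner \<xi> (p \<eta>) else 0)" if "p \<in> S" "q \<in> S" for p q \<xi> \<eta>
  proof -
    have *: "cinner (p \<xi>) (q \<eta>) = cinner \<xi> ((p \<odot> q) \<eta>)"
      using projection_apply(2)[OF pr[OF that(1)]] by simp
    have "p \<odot> q = (if p = q then p else 0)" using that orth[of p q] pA(2)[of p] by auto
    then show ?thesis unfolding * by (simp add: blinfun.zero_left cinner.zero_right)
  qed
  have bessel: "(\<Sum>p\<in>J. (norm (blinfun_apply p \<xi>))\<^sup>2) \<le> (norm \<xi>)\<^sup>2" if J: "finite J" "J \<subseteq> S" for J \<xi>
    by (rule orthogonal_bessel[OF J(1)]) (use J ps in \<open>auto simp: subset_iff simp flip: projection_apply(2)[OF pr]\<close>)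
  \<comment> \<open>Extended by zero because \<open>operator_of_sum\<close> asks for linearity at
    every index, not only at those in \<open>S\<close>.\<close>
  define \<alpha> where "\<alpha> p = (if p \<in> S then blinfun_apply p else (\<lambda>_. 0))" for p
  have "\<exists>r. r \<in> bounded_operators \<and>
    (\<forall>\<xi> \<eta>. ((\<lambda>p. cinner (\<alpha> p \<xi>) (\<alpha> p \<eta>)) has_sum cinner \<xi> (blinfun_apply r \<eta>)) S)"
  proof (rule operator_of_sum[of \<alpha> \<alpha> S 1])
    show "(\<Sum>i\<in>J. (norm (\<alpha> i x))\<^sup>2) \<le> (norm x)\<^sup>2" if "finite J" "J \<subseteq> S" for J x
      using bessel[OF that, of x] that by (simp add: \<alpha>_def subset_iff cong: sum.cong)
    then show "(\<Sum>i\<in>J. (norm (\<alpha> i x))\<^sup>2) \<le> (1 * norm x)\<^sup>2" if "finite J" "J \<subseteq> S" for J x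
      using that by simp
  qed (auto simp: \<alpha>_def blinfun.add_right bounded_operatorsD[OF pb] scaleC.zero_right)
  then obtain r where r: "r \<in> bounded_operators"
    and r_sum': "\<forall>\<xi> \<eta>. ((\<lambda>p. cinner (\<alpha> p \<xi>) (\<alpha> p \<eta>)) has_sum cinner \<xi> (blinfun_apply r \<eta>)) S"
    by (elim exE conjE)
  have r_sum: "((\<lambda>p. cinner \<xi> (blinfun_apply p \<eta>)) has_sum cinner \<xi> (r \<eta>)) S" for \<xi> \<eta>
    using r_sum'[rule_format, of \<xi> \<eta>] by (rule has_sum_cong[THEN iffD1, rotated]) (simp add: \<alpha>_def ps)
  have r_unique: "r v = w" if "\<And>\<xi>. ((\<lambda>p. cinner \<xi> (blinfun_apply p v)) has_sum cinner \<xi> w) S" for v w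
    by (rule cinner_extI) (rule has_sum_unique[OF r_sum that])
  have rp: "r \<odot> p = p" if p: "p \<in> S" for p
  proof (rule blinfun_eqI)
    fix \<eta>
    have "r (p \<eta>) = p \<eta>"
    proof (rule r_unique)
      fix \<xi>
      have "q (p \<eta>) = (if q = p then p \<eta> else 0)" if "q \<in> S" for q
        using orth[OF that p] pA(2)[OF p] by (metis blinfun.zero_left blinfun_apply_blinfun_compose)
      then show "((\<lambda>q. cinner \<xi> (blinfun_apply q (p \<eta>))) has_sum cinner \<xi> (p \<eta>)) S"
        using p by (intro has_sum_finite_neutralI[of "{p}"]) (auto simp: cinner.zero_right)
    qed
    then show "(r \<odot> p) \<eta> = p \<eta>" by simp
  qed
  have adj_r: "adj r = r"
  proof (rule operator_cinner_eqI)
    fix \<xi> \<eta>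
    have "((\<lambda>p. cnj (cinner \<eta> (blinfun_apply p \<xi>))) has_sum cnj (cinner \<eta> (r \<xi>))) S"
      using r_sum by (simp only: has_sum_cnj_iff)
    moreover have "cnj (cinner \<eta> (p \<xi>)) = cinner \<xi> (p \<eta>)" if "p \<in> S" for p
      using projection_apply(2)[OF pr[OF that], of \<xi> \<eta>] cinner_commute[of "p \<xi>" \<eta>] by simp
    ultimately have "((\<lambda>p. cinner \<xi> (blinfun_apply p \<eta>)) has_sum cnj (cinner \<eta> (r \<xi>))) S"
      by (simp cong: has_sum_cong)
    then have "cnj (cinner \<eta> (r \<xi>)) = cinner \<xi> (r \<eta>)" using r_sum has_sum_unique by blast
    moreover have "cinner (r \<xi>) \<eta> = cnj (cinner \<eta> (r \<xi>))" by (rule cinner_commute)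
    ultimately show "cinner \<xi> (adj r \<eta>) = cinner \<xi> (r \<eta>)" by (simp add: cinner_adj' r)
  qed
  have pr': "p \<odot> r = p" if "p \<in> S" for p
    using adj_compose[OF r pb[OF that]] by (simp add: rp that adj_r pA)
  have rr: "r (r \<eta>) = r \<eta>" for \<eta>
  proof (rule r_unique)
    fix \<xi>
    have "p (r \<eta>) = p \<eta>" if "p \<in> S" for p using pr'[OF that] by (metis blinfun_apply_blinfun_compose)
    then show "((\<lambda>p. cinner \<xi> (blinfun_apply p (r \<eta>))) has_sum cinner \<xi> (r \<eta>)) S"
      using r_sum[of \<xi> \<eta>] by (simp cong: has_sum_cong)
  qed
  have rc: "r \<odot> x = x \<odot> r" if x: "x \<in> A" for x
  proof (rule blinfun_eqI)
    fix \<eta>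
    have "r (x \<eta>) = x (r \<eta>)"
    proof (rule r_unique)
      fix \<xi>
      have "cinner \<xi> (p (x \<eta>)) = cinner (adj x \<xi>) (p \<eta>)" if "p \<in> S" for p
      proof -
        have "p (x \<eta>) = x (p \<eta>)" using pc[OF that x] by (metis blinfun_apply_blinfun_compose)
        then show ?thesis by (simp add: cinner_adj in_bounded x)
      qed
      then have "((\<lambda>p. cinner \<xi> (blinfun_apply p (x \<eta>))) has_sum cinner (adj x \<xi>) (r \<eta>)) S"
        using r_sum[of "adj x \<xi>" \<eta>] by (simp cong: has_sum_cong)
      moreover have "cinner (adj x \<xi>) (r \<eta>) = cinner \<xi> (x (r \<eta>))" by (rule cinner_adj[OF in_bounded[OF x]])
      ultimately show "((\<lambda>p. cinner \<xi> (blinfun_apply p (x \<eta>))) has_sum cinner \<xi> (x (r \<eta>))) S" by simp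
    qed
    then show "(r \<odot> x) \<eta> = (x \<odot> r) \<eta>" by simp
  qed
  \<comment> \<open>For a finite partial sum, the squared distance from \<open>r \<xi>\<close> is
    the difference of the two diagonal matrix coefficients at \<xi>; so weak convergence implies
    strong convergence.\<close>
  have strong: "((\<lambda>p. blinfun_apply p \<xi>) has_sum r \<xi>) S" for \<xi>
  proof -
    have "((\<lambda>J. Re (cinner \<xi> (r \<xi>)) - Re (\<Sum>p\<in>J. cinner \<xi> (blinfun_apply p \<xi>))) \<longlongrightarrow> Re (cinner \<xi> (r \<xi>)) - Re (cinner \<xi> (r \<xi>)))
      (finite_subsets_at_top S)"
      using r_sum[of \<xi> \<xi>] unfolding has_sum_def by (intro tendsto_intros)
    then have lim: "((\<lambda>J. sqrt (Re (cinner \<xi> (r \<xi>)) - Re (\<Sum>p\<in>J. cinner \<xi> (blinfun_apply p \<xi>)))) \<longlongrightarrow> 0)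
      (finite_subsets_at_top S)"
      using tendsto_real_sqrt by fastforce
    have eq: "norm ((\<Sum>p\<in>J. blinfun_apply p \<xi>) - r \<xi>) = sqrt (Re (cinner \<xi> (r \<xi>)) - Re (\<Sum>p\<in>J. cinner \<xi> (blinfun_apply p \<xi>)))"
      if J: "finite J" "J \<subseteq> S" for J
    proof -
      define y where "y = (\<Sum>p\<in>J. blinfun_apply p \<xi>)"
      have rsym: "cinner (r a) b = cinner a (r b)" for a b using cinner_adj[OF r] adj_r by metis
      have ry: "r y = y"
        unfolding y_def blinfun.sum_right using J rp
        by (intro sum.cong refl) (metis blinfun_apply_blinfun_compose subsetD)
      have yy: "cinner y y = cinner \<xi> y"
      proof -
        have "cinner y y = (\<Sum>q\<in>J. \<Sum>p\<in>J. if p = q then cinner \<xi> (blinfun_apply p \<xi>) else 0)"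
          unfolding y_def cinner.sum_left cinner.sum_right
          using J ps by (intro sum.cong refl) (auto simp: subset_iff)
        then show ?thesis using J by (simp add: y_def cinner.sum_right)
      qed
      have "cinner (y - r \<xi>) (y - r \<xi>) = cinner y y - cinner y (r \<xi>) - (cinner (r \<xi>) y - cinner (r \<xi>) (r \<xi>))"
        by (simp only: cinner.diff_left cinner.diff_right) simp
      also have "cinner (r \<xi>) y = cinner \<xi> y" by (simp add: rsym ry)
      also have "cinner (r \<xi>) (r \<xi>) = cinner \<xi> (r \<xi>)" by (simp add: rsym rr)
      also have "cinner y (r \<xi>) = cinner y \<xi>" by (simp add: ry flip: rsym)
      also have "cinner y \<xi> = cnj (cinner \<xi> y)" by (rule cinner_commute)
      also have "\<dots> = cinner y y" by (simp only: yy[symmetric] cinner_self) simp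
      finally have "cinner (y - r \<xi>) (y - r \<xi>) = cinner \<xi> (r \<xi>) - cinner \<xi> y" by simp
      then have "(norm (y - r \<xi>))\<^sup>2 = Re (cinner \<xi> (r \<xi>)) - Re (cinner \<xi> y)"
        by (metis Re_complex_of_real cinner_self minus_complex.simps(1))
      then show ?thesis by (simp add: y_def cinner.sum_right real_sqrt_unique flip: Re_sum)
    qed
    have "((\<lambda>J. norm ((\<Sum>p\<in>J. blinfun_apply p \<xi>) - r \<xi>)) \<longlongrightarrow> 0) (finite_subsets_at_top S)"
      by (rule Lim_transform_eventually[OF lim])
        (auto simp: eventually_finite_subsets_at_top_weakI eq)
    then show ?thesis unfolding has_sum_def by (simp add: LIM_zero_iff tendsto_norm_zero_iff)
  qed
  have rA: "r \<in> A"
  proof (rule limitin_closedin[OF _ wot_closed])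
    \<comment> \<open>Intersecting with \<open>S\<close> makes every partial sum a bounded
      complex-linear operator, as \<open>limitin_functional_topology\<close> demands of all values;
      eventually it changes nothing.\<close>
    show "limitin weak_operator_topology (\<lambda>J. \<Sum>p\<in>J \<inter> S. p) r (finite_subsets_at_top S)"
      unfolding weak_operator_topology_def
    proof (rule limitin_functional_topology)
      show "(\<Sum>p\<in>J \<inter> S. p) \<in> bounded_operators" for J by (intro bounded_operators_sum pb) auto
      fix \<phi> :: "'h operator \<Rightarrow> complex" assume "\<phi> \<in> {\<lambda>T. cinner \<xi> (blinfun_apply T \<eta>) | \<xi> \<eta> :: 'h. True}"
      then obtain \<xi> \<eta> where \<phi>: "\<phi> = (\<lambda>T. cinner \<xi> (blinfun_apply T \<eta>))" by blast
      have "((\<lambda>J. \<Sum>p\<in>J. cinner \<xi> (blinfun_apply p \<eta>)) \<longlongrightarrow> \<phi> r) (finite_subsets_at_top S)"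
        using r_sum[of \<xi> \<eta>] by (simp add: has_sum_def \<phi>)
      then show "((\<lambda>J. \<phi> (\<Sum>p\<in>J \<inter> S. p)) \<longlongrightarrow> \<phi> r) (finite_subsets_at_top S)"
        by (rule Lim_transform_eventually)
          (auto intro!: eventually_finite_subsets_at_top_weakI simp: \<phi> blinfun.sum_left cinner.sum_right Int_absorb2)
    qed (use r in auto)
    show "\<forall>\<^sub>F J in finite_subsets_at_top S. (\<Sum>p\<in>J \<inter> S. p) \<in> A"
      by (intro always_eventually allI sum) (use pA in auto)
  qed simp
  have "r \<odot> r = r" by (rule blinfun_eqI) (simp add: rr)
  moreover have "r \<in> center A" unfolding center_def using rA rc by blast
  ultimately have "r \<in> central_projections A"
    using rA adj_r by (simp add: central_projections_def projections_def)
  then show ?thesis using rp strong by (intro bexI[of _ r] conjI ballI allI)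
qed

text \<open>Sum a maximal orthogonal family of nonzero central projections with the property. If a
  central \<open>q\<close> with the property were not below the sum \<open>r\<close>, then
  \<open>q - r \<odot> q\<close> could be added to the family.\<close>

lemma largest_central_projection_exists:
  assumes N: "von_neumann_algebra N" and P: "Z_completely_ideal P"
  shows "is_largest_in (property_projections P N \<inter> central_projections N) (largest_central_projection N P)"
proof -
  interpret vN_algebra N by unfold_locales fact
  interpret P: ideal_prop P using P by unfold_locales (simp add: Z_completely_ideal_def)
  define Z where "Z = property_projections P N \<inter> central_projections N"
  have Zpr: "p \<in> projections N" and ZA: "p \<in> N" "p \<odot> p = p" "adj p = p"
    and Zc: "\<And>x. x \<in> N \<Longrightarrow> p \<odot> x = x \<odot> p" if "p \<in> central_projections N" for p
    using that by (auto simp: central_projections_def projections_def center_def)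
  define \<A> where "\<A> = {S. S \<subseteq> Z \<and> 0 \<notin> S \<and> (\<forall>p\<in>S. \<forall>q\<in>S. p \<noteq> q \<longrightarrow> p \<odot> q = 0)}"
  have "\<exists>S\<in>\<A>. \<forall>X\<in>\<A>. S \<subseteq> X \<longrightarrow> X = S"
  proof (rule subset_Zorn_nonempty)
    show "\<A> \<noteq> {}" by (auto simp: \<A>_def)
    fix C assume C: "C \<noteq> {}" "subset.chain \<A> C"
    have CA: "C \<subseteq> \<A>" and ch: "\<forall>X\<in>C. \<forall>Y\<in>C. X \<subseteq> Y \<or> Y \<subseteq> X"
      using C(2) by (auto simp: subset_chain_def)
    have "p \<odot> q = 0" if pq: "p \<in> \<Union>C" "q \<in> \<Union>C" "p \<noteq> q" for p q
    proof -
      obtain X Y where XY: "X \<in> C" "Y \<in> C" "p \<in> X" "q \<in> Y" using pq by blast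
      then have "X \<subseteq> Y \<or> Y \<subseteq> X" using ch by blast
      then obtain U where "U \<in> C" "p \<in> U" "q \<in> U" using XY by blast
      then show ?thesis using CA pq(3) by (auto simp: \<A>_def)
    qed
    then show "\<Union>C \<in> \<A>" using CA by (auto simp: \<A>_def)
  qed
  then obtain S where SA: "S \<in> \<A>" and max: "\<forall>X\<in>\<A>. S \<subseteq> X \<longrightarrow> X = S" by (elim bexE)
  have S: "S \<subseteq> Z" "0 \<notin> S" and orth: "\<And>p q. p \<in> S \<Longrightarrow> q \<in> S \<Longrightarrow> p \<noteq> q \<Longrightarrow> p \<odot> q = 0"
    using SA by (auto simp: \<A>_def)
  have SC: "S \<subseteq> central_projections N" using S by (auto simp: Z_def)
  have "\<exists>r\<in>central_projections N. (\<forall>p\<in>S. r \<odot> p = p) \<and>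
    (\<forall>\<xi>. ((\<lambda>p. blinfun_apply p \<xi>) has_sum blinfun_apply r \<xi>) S)"
    by (rule orthogonal_sum_exists[OF SC]) (rule orth)
  then obtain r where r: "r \<in> central_projections N" "\<forall>p\<in>S. r \<odot> p = p"
    "\<forall>\<xi>. ((\<lambda>p. blinfun_apply p \<xi>) has_sum blinfun_apply r \<xi>) S"
    by (elim bexE conjE)
  have "r \<in> property_projections P N"
  proof -
    have "S \<subseteq> property_projections P N" using S by (auto simp: Z_def)
    moreover have "\<forall>p\<in>S. \<forall>q\<in>S. p \<noteq> q \<longrightarrow> central_support N p \<odot> central_support N q = 0"
      using SC orth by (auto simp: central_support_central subset_iff)
    moreover have "r \<in> N" using r ZA by blast
    ultimately show ?thesis using P N r(3) unfolding Z_completely_ideal_def by blast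
  qed
  then have rZ: "r \<in> Z" using r by (simp add: Z_def)
  have largest: "proj_le q r" if q: "q \<in> Z" for q
  proof -
    have qC: "q \<in> central_projections N" using q by (simp add: Z_def)
    note q' = ZA[OF qC] and r' = ZA[OF r(1)]
    define t where "t = q - r \<odot> q"
    have qr: "q \<odot> r = r \<odot> q" by (rule Zc[OF qC r'(1)])
    have rq2: "(r \<odot> q) \<odot> (r \<odot> q) = r \<odot> q" "q \<odot> (r \<odot> q) = r \<odot> q" "(r \<odot> q) \<odot> q = r \<odot> q"
    proof -
      show 1: "(r \<odot> q) \<odot> q = r \<odot> q" by (simp add: blinfun_compose_assoc q')
      have "q \<odot> (r \<odot> q) = (q \<odot> r) \<odot> q" by (simp only: blinfun_compose_assoc)
      then show 2: "q \<odot> (r \<odot> q) = r \<odot> q" by (simp only: qr 1)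
      have "(r \<odot> q) \<odot> (r \<odot> q) = r \<odot> (q \<odot> (r \<odot> q))" by (simp only: blinfun_compose_assoc)
      also have "\<dots> = (r \<odot> r) \<odot> q" by (simp only: 2 blinfun_compose_assoc)
      finally show "(r \<odot> q) \<odot> (r \<odot> q) = r \<odot> q" by (simp only: r')
    qed
    have tN: "t \<in> N" by (simp add: t_def diff comp q' r')
    have tt: "t \<odot> t = t" unfolding t_def by (simp add: blinfun_compose.diff_left blinfun_compose.diff_right rq2 q')
    have "adj (r \<odot> q) = r \<odot> q" using q' r' qr by (simp add: adj_comp_in)
    then have "adj t = t" unfolding t_def using q' r' by (simp add: adj_diff in_bounded comp)
    then have tpr: "t \<in> projections N" using tN tt by (simp add: projections_def)
    have "t \<odot> x = x \<odot> t" if x: "x \<in> N" for x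
    proof -
      have "(r \<odot> q) \<odot> x = x \<odot> (r \<odot> q)"
      proof -
        have "(r \<odot> q) \<odot> x = r \<odot> (x \<odot> q)" by (simp only: blinfun_compose_assoc Zc[OF qC x])
        also have "\<dots> = (r \<odot> x) \<odot> q" by (simp only: blinfun_compose_assoc)
        also have "\<dots> = x \<odot> (r \<odot> q)" by (simp only: Zc[OF r(1) x] blinfun_compose_assoc)
        finally show ?thesis .
      qed
      then show ?thesis unfolding t_def by (simp add: blinfun_compose.diff_left blinfun_compose.diff_right Zc[OF qC x])
    qed
    then have tC: "t \<in> central_projections N" using tpr tN by (simp add: central_projections_def center_def)
    have "proj_le t q" unfolding proj_le_def t_def by (simp add: blinfun_compose.diff_right rq2 q')
    then have "t \<in> property_projections P N"
      using P.down[OF N, of q t] q tpr by (auto simp: Z_def)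
    then have tZ: "t \<in> Z" using tC by (simp add: Z_def)
    have tp: "t \<odot> p = 0" "p \<odot> t = 0" if p: "p \<in> S" for p
    proof -
      have pN: "p \<in> N" using p SC ZA by blast
      have "t \<odot> p = q \<odot> p - r \<odot> (q \<odot> p)" by (simp add: t_def blinfun_compose.diff_left blinfun_compose_assoc)
      also have "r \<odot> (q \<odot> p) = (q \<odot> r) \<odot> p" by (simp only: qr blinfun_compose_assoc)
      also have "\<dots> = q \<odot> (r \<odot> p)" by (simp only: blinfun_compose_assoc)
      finally show "t \<odot> p = 0" by (simp add: bspec[OF r(2) p])
      then show "p \<odot> t = 0" using Zc[OF tC pN] by simp
    qed
    have "t = 0"
    proof (rule ccontr)
      assume "t \<noteq> 0"
      then have "insert t S \<in> \<A>" using S tZ tp orth by (auto simp: \<A>_def)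
      then have "t \<in> S" using max by blast
      then show False using tp tt \<open>t \<noteq> 0\<close> by auto
    qed
    then show ?thesis by (simp add: proj_le_def t_def)
  qed
  have "is_largest_in Z r" using rZ largest by (simp add: is_largest_in_def)
  moreover have "z = r" if "is_largest_in Z z" for z
    using that rZ largest Zpr unfolding is_largest_in_def
    by (intro proj_le_antisym) (auto simp: Z_def)
  ultimately show ?thesis
    unfolding largest_central_projection_def Z_def by (rule theI)
qed

theorem theorem1p7:
  fixes M N :: "'h::complex_hilbert_space operator set"
    and E :: "'h operator \<Rightarrow> 'h operator"
    and P :: "'h operator set \<Rightarrow> bool"
  assumes "strongly_PP_expectation E M N"
    and "Z_completely_ideal P"
    and "descends_strongly_PP P"
  shows "largest_central_projection N P + negation_projection N P = unit_of M
       \<and> largest_central_projection M P + negation_projection M P = unit_of M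
       \<and> largest_central_projection N P = largest_central_projection M P
       \<and> negation_projection N P = negation_projection M P"
proof -
  have vM: "von_neumann_algebra M" and vN: "von_neumann_algebra N" and unit: "unit_of N = unit_of M"
    using assms(1) by (auto simp: strongly_PP_expectation_def PP_expectation_def
        conditional_expectation_def wstar_subalgebra_def)
  have NM: "N \<subseteq> M"
    using assms(1) by (auto simp: strongly_PP_expectation_def PP_expectation_def
        conditional_expectation_def wstar_subalgebra_def)
  interpret M: vN_algebra M by unfold_locales (rule vM)
  interpret N: vN_algebra N by unfold_locales (rule vN)
  interpret P: ideal_prop P using assms(2) by unfold_locales (simp add: Z_completely_ideal_def)
  define zM where "zM = largest_central_projection M P"
  define zN where "zN = largest_central_projection N P"
  have zM: "zM \<in> central_projections M" "P (corner zM M)"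
    and zM_max: "\<And>p. p \<in> central_projections M \<Longrightarrow> P (corner p M) \<Longrightarrow> zM \<odot> p = p"
    using largest_central_projection_exists[OF vM assms(2)]
    by (auto simp: zM_def is_largest_in_def property_projections_def central_projections_def proj_le_def)
  have zN: "zN \<in> central_projections N" "P (corner zN N)"
    and zN_max: "\<And>p. p \<in> central_projections N \<Longrightarrow> P (corner p N) \<Longrightarrow> zN \<odot> p = p"
    using largest_central_projection_exists[OF vN assms(2)]
    by (auto simp: zN_def is_largest_in_def property_projections_def central_projections_def proj_le_def)
  have zM': "zM \<in> projections M" "zM \<in> M" "adj zM = zM"
    and zN': "zN \<in> projections N" "zN \<in> N" "adj zN = zN"
    using zM zN by (auto simp: central_projections_def projections_def)
  have "zN = zM"
  proof (cases "\<exists>B0::'h set. infinite B0 \<and> orthonormal B0")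
    case True
    then obtain S :: "nat \<Rightarrow> 'h operator" where S: "isometries S" using isometries_exist by blast
    obtain s where s: "s \<in> central_projections N" "P (corner s N)" "s \<odot> zM = zM"
      by (rule property_projection_down[OF S assms(1) P.ideal_prop_axioms assms(3) zM])
    obtain c where c: "c \<in> central_projections M" "P (corner c M)" "c \<odot> zN = zN"
      by (rule property_projection_up[OF S assms(1) P.ideal_prop_axioms assms(3) zN])
    \<comment> \<open>\<open>s\<close> lies above \<open>zM\<close> and, by maximality, below
      \<open>zN\<close>; symmetrically for \<open>c\<close>.\<close>
    have "zN \<odot> zM = (zN \<odot> s) \<odot> zM" by (simp only: blinfun_compose_assoc s(3))
    then have 1: "zN \<odot> zM = zM" by (simp add: zN_max[OF s(1,2)] s(3))
    have "zM \<odot> zN = (zM \<odot> c) \<odot> zN" by (simp only: blinfun_compose_assoc c(3))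
    then have 2: "zM \<odot> zN = zN" by (simp add: zM_max[OF c(1,2)] c(3))
    have "adj (zM \<odot> zN) = zN \<odot> zM"
      using zM' zN' by (simp add: adj_compose M.in_bounded N.in_bounded)
    then show ?thesis using 1 2 zN' by simp
  next
    case False
    interpret F: finite_dim "TYPE('h)" by unfold_locales (use False in blast)
    \<comment> \<open>A single nonzero algebra with the property gives it to \<open>M\<close> and
      \<open>N\<close> themselves, so both largest projections are the common unit. If there is
      none, both are zero.\<close>
    have full: "zN = zM" if A: "von_neumann_algebra A" "P A" "A \<noteq> {0}" for A :: "'h operator set"
    proof -
      have "P M" "P N" using F.P_all[OF P.ideal_prop_axioms A] vM vN by blast+
      then have "zM \<odot> M.e = M.e" "zN \<odot> N.e = N.e"
        using zM_max[OF M.e_central] zN_max[OF N.e_central] by (simp_all add: M.corner_e N.corner_e)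
      then have "zM = M.e" "zN = N.e" using M.e_right[OF zM'(2)] N.e_right[OF zN'(2)] by simp_all
      then show ?thesis using unit by (simp add: M.e_def N.e_def)
    qed
    show ?thesis
    proof (rule ccontr)
      assume neq: "zN \<noteq> zM"
      then have "zN \<noteq> 0 \<or> zM \<noteq> 0" by auto
      moreover have "zM = 0" 
      proof (rule ccontr)
        assume "zM \<noteq> 0"
        moreover have "zM \<in> corner zM M" using zM' by (simp add: M.corner_eq[OF zM'(1)] projections_def)
        ultimately show False using full[OF M.corner_vN(1)[OF zM'(1)] zM(2)] neq by auto
      qed
      moreover have "zN = 0" 
      proof (rule ccontr)
        assume "zN \<noteq> 0"
        moreover have "zN \<in> corner zN N" using zN' by (simp add: N.corner_eq[OF zN'(1)] projections_def)
        ultimately show False using full[OF N.corner_vN(1)[OF zN'(1)] zN(2)] neq by auto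
      qed
      ultimately show False by simp
    qed
  qed
  then show ?thesis
    by (simp add: negation_projection_def unit flip: zM_def zN_def)
qed

end
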